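(* Let $p$ be a prime, $S$ a finite $p$-group and $\mathcal{F}$ a fusion system over $S$. Let $(\mathcal{L},\Delta,S)$ be a locality over $\mathcal{F}$, and let $\mathcal{T}$ be a transporter system associated to $\mathcal{F}$. Then the following hold. (a) $\mathcal{T}(\mathcal{L},\Delta)$ is a linking system if and only if $(\mathcal{L},\Delta,S)$ is a linking locality. (b) If $(\mathcal{L},\Delta,S)$ is of objective characteristic $p$, then $\Delta\subseteq \mathcal{F}^s$ and, for any $P\in\Delta\cap\mathcal{F}^f$, $N_{\mathcal{L}}(P)$ is a model for $N_{\mathcal{F}}(P)$. Similarly, if $\mathcal{T}$ is of objective characteristic $p$ then $\mathrm{ob}(\mathcal{T})\subseteq \mathcal{F}^s$ and, for any $P\in\mathrm{ob}(\mathcal{T})\cap\mathcal{F}^f$, the group $\mathrm{Aut}_{\mathcal{T}}(P)$ is isomorphic to a model for $N_{\mathcal{F}}(P)$. (c) Assume $\Delta\subseteq \mathcal{F}^q$. Then $C_{\mathcal{L}}(P)=C_S(P)O_{p'}(C_{\mathcal{L}}(P))$ for every $P\in\Delta\cap\mathcal{F}^f$. As a consequence, $(\mathcal{L},\Delta,S)$ is of objective characteristic $p$ if and only if $C_{\mathcal{L}}(P)$ is a $p$-group for every $P\in\Delta$. If $\mathrm{ob}(\mathcal{T})\subseteq \mathcal{F}^q$, then $\mathcal{T}$ is a linking system if and only if it is a linking system in the sense of Oliver. In particular, every linking system in the sense of Oliver is a linking system. (d) If $\Delta\subseteq \mathcal{F}^c$, then $(\mathcal{L},\Delta,S)$ is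 of objective characteristic $p$ if and only if $(\mathcal{L},\Delta,S)$ is a $\Delta$-linking system in the sense of Chermak, i.e. if and only if $C_{\mathcal{L}}(P)\leq P$ for every $P\in\Delta$. If $\Delta=\mathcal{F}^c$, then $(\mathcal{L},\Delta,S)$ is a linking locality if and only if $(\mathcal{L},\Delta,S)$ is a centric linking system in the sense of Chermak. If $\mathrm{ob}(\mathcal{T})=\mathcal{F}^c$, then $\mathcal{T}$ is a linking system if and only if it is a centric linking system in the sense of Broto–Levi–Oliver.
   Context: Maps are written on the right and composed left to right. $\mathcal{F}$ is not assumed to be saturated. Fusion systems. $P^{\mathcal{F}}$ is the set of $\mathcal{F}$-conjugates of $P\leq S$. $P$ is fully normalized [fully centralized] if $|N_S(P)|\geq |N_S(Q)|$ [$|C_S(P)|\geq|C_S(Q)|$] for all $Q\in P^{\mathcal{F}}$; $\mathcal{F}^f$ is the set of fully normalized subgroups. $P$ is centric if $C_S(Q)\leq Q$ for all $Q\in P^{\mathcal{F}}$, and radical if $O_p(\mathrm{Aut}_{\mathcal{F}}(P))=\mathrm{Inn}(P)$; $\mathcal{F}^c$, $\mathcal{F}^{cr}$ are the sets of centric, respectively centric radical, subgroups. $N_{\mathcal{F}}(P)$ [resp. $C_{\mathcal{F}}(P)$] is the fusion system over $N_S(P)$ [resp. $C_S(P)$] whose morphisms $A\to B$ are those $\varphi\in\mathrm{Hom}_{\mathcal{F}}(A,B)$ which extend to some $\hat\varphi\in \mathrm{Hom}_{\mathcal{F}}(AP,BP)$ with $P\hat\varphi=P$ [resp. $\hat\varphi|_P=\mathrm{id}_P$].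 $R\unlhd S$ is normal in $\mathcal{F}$ if $N_{\mathcal{F}}(R)=\mathcal{F}$; $O_p(\mathcal{F})$ is the largest normal subgroup. $Q\leq S$ is subcentric ($Q\in\mathcal{F}^s$) if, for every fully normalized $P\in Q^{\mathcal{F}}$, $O_p(N_{\mathcal{F}}(P))$ is centric in $\mathcal{F}$. $Q$ is quasicentric ($Q\in\mathcal{F}^q$) if, for every fully centralized $P\in Q^{\mathcal{F}}$, $C_{\mathcal{F}}(P)=\mathcal{F}_{C_S(P)}(C_S(P))$, where $\mathcal{F}_S(G)$ denotes the fusion system over $S$ of $G$-conjugation. A finite group $G$ is of characteristic $p$ if $C_G(O_p(G))\leq O_p(G)$. A model for a fusion system $\mathcal{F}$ over $S$ is a finite group $G$ of characteristic $p$ with $S\in\mathrm{Syl}_p(G)$ and $\mathcal{F}_S(G)=\mathcal{F}$. Partial groups. Let $\mathbf{W}(\mathcal{L})$ be the set of words in a set $\mathcal{L}$, $\circ$ concatenation, $\emptyset$ the empty word. A partial group is a non-empty set $\mathcal{L}$ with $\mathbf{D}\subseteq \mathbf{W}(\mathcal{L})$, a map $\Pi\colon\mathbf{D}\to\mathcal{L}$ and an involutory bijection $f\mapsto f^{-1}$ of $\mathcal L$ such that: all words of length one are in $\mathbf{D}$, and $u\circ v\in\mathbf{D}$ implies $u,v\in\mathbf{D}$; $\Pi((f))=f$; if $u\circ v\circ w\in\mathbf{D}$ then $u\circ(\Pi(v))\circ w\in\mathbf{D}$ and $\Pi(u\circ v\circ w)=\Pi(u\circ(\Pi(v))\circ w)$;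 if $w=(f_1,\dots,f_n)\in\mathbf{D}$ then, with $w^{-1}=(f_n^{-1},\dots,f_1^{-1})$, $w^{-1}\circ w\in\mathbf{D}$ and $\Pi(w^{-1}\circ w)=\mathbf{1}:=\Pi(\emptyset)$. For $g\in\mathcal{L}$, $\mathbf{D}(g)=\{x: (g^{-1},x,g)\in\mathbf{D}\}$ and $x^g=\Pi(g^{-1},x,g)$ for $x\in\mathbf{D}(g)$; for $X\subseteq\mathbf{D}(g)$, $X^g=\{x^g:x\in X\}$. $N_{\mathcal{L}}(X)=\{g: X\subseteq\mathbf{D}(g),\,X^g=X\}$, $C_{\mathcal{L}}(X)=\{g: X\subseteq\mathbf{D}(g),\,x^g=x\ \forall x\in X\}$. A partial subgroup is a subset closed under inversion and under $\Pi$ on $\mathbf{D}$-words; it is a subgroup if all its words lie in $\mathbf{D}$ (it is then a group), and a $p$-subgroup if moreover it is a finite $p$-group. Localities. $(\mathcal{L},\Delta,S)$ is a locality if $\mathcal{L}$ is a finite partial group, $S$ is a maximal $p$-subgroup of $\mathcal{L}$, $\Delta$ is a non-empty set of subgroups of $S$ closed under overgroups in $S$ and under $\mathcal{L}$-conjugation (if $P\in\Delta$, $g\in\mathcal L$, $P\subseteq\mathbf{D}(g)$ and $P^g\subseteq S$ then $P^g\in\Delta$), and $\mathbf{D}$ is the set of words $(f_1,\dots,f_n)$ for which there are $P_0,\dots,P_n\in\Delta$ with $P_{i-1}\subseteq\mathbf{D}(f_i)$ and $P_{i-1}^{f_i}=P_i$ for all $i$. For $P\in\Delta$, $N_{\mathcal{L}}(P)$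 is a finite group, with subgroup $C_{\mathcal L}(P)$. $\mathcal{F}_S(\mathcal{L})$ is the fusion system over $S$ generated by conjugation maps by elements of $\mathcal{L}$ between subgroups of $S$. The locality is over $\mathcal{F}$ if $\mathcal{F}=\mathcal{F}_S(\mathcal{L})$. It is of objective characteristic $p$ if $N_{\mathcal{L}}(P)$ is of characteristic $p$ for all $P\in\Delta$, and a linking locality if moreover $\mathcal{F}_S(\mathcal{L})^{cr}\subseteq\Delta$. A locality $(\mathcal L,\mathcal F^c,S)$ over $\mathcal F$ is a centric linking system in the sense of Chermak if $C_{\mathcal L}(P)\leq P$ for all $P\in\mathcal F^c$. Transporter systems. For a set $\Delta$ of subgroups of $S$, $\mathcal{T}_\Delta(S)$ is the category with object set $\Delta$ and morphisms $P\to Q$ the elements $g\in S$ with $P^g\leq Q$. A transporter system associated to $\mathcal{F}$ is a non-empty finite category $\mathcal{T}$ with $\mathrm{ob}(\mathcal{T})$ a set of subgroups of $S$ closed under $\mathcal{F}$-conjugation and overgroups in $S$, together with functors $\mathcal{T}_{\mathrm{ob}(\mathcal{T})}(S)\xrightarrow{\varepsilon}\mathcal{T}\xrightarrow{\rho}\mathcal{F}$ such that: $\varepsilon$ is the identity and $\rho$ the inclusion on objects; setting $E(P)=\ker(\rho_{P,P}\colon \mathrm{Aut}_{\mathcal{T}}(P)\to\mathrm{Aut}_{\mathcal{F}}(P))$, for all $P,Q$ the group $E(P)$ acts freely on $\mathrm{Hom}_{\mathcal{T}}(P,Q)$ by precomposition with $\rho_{P,Q}$ the orbit map, and $E(Q)$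 acts freely on $\mathrm{Hom}_{\mathcal{T}}(P,Q)$ by postcomposition; $\varepsilon_{P,Q}$ is injective and $\varepsilon$ followed by $\rho$ sends $g$ to the conjugation map $c_g$; for $\varphi\in\mathrm{Hom}_{\mathcal{T}}(P,Q)$ and $g\in P$, first $\varepsilon_{P,P}(g)$ then $\varphi$ equals first $\varphi$ then $\varepsilon_{Q,Q}(g(\rho(\varphi)))$; $\varepsilon_{S,S}(S)\in\mathrm{Syl}_p(\mathrm{Aut}_{\mathcal{T}}(S))$; and if $\varphi\in\mathrm{Hom}_{\mathcal{T}}(P,Q)$ is an isomorphism, $P\unlhd\bar P\leq S$, $Q\unlhd\bar Q\leq S$ and conjugation by $\varphi$ carries $\varepsilon_{P,P}(\bar P)$ into $\varepsilon_{Q,Q}(\bar Q)$, then there is $\bar\varphi\in\mathrm{Hom}_{\mathcal{T}}(\bar P,\bar Q)$ such that first $\varepsilon_{P,\bar P}(1)$ then $\bar\varphi$ equals first $\varphi$ then $\varepsilon_{Q,\bar Q}(1)$. $\mathcal{T}$ is of objective characteristic $p$ if $\mathrm{Aut}_{\mathcal{T}}(P)$ is of characteristic $p$ for all $P\in\mathrm{ob}(\mathcal{T})$, and a linking system if moreover $\mathcal{F}^{cr}\subseteq\mathrm{ob}(\mathcal{T})$. A transporter system is a linking system in the sense of Oliver if and only if $\mathcal{F}^{cr}\subseteq\mathrm{ob}(\mathcal{T})$ and $E(P)$ is a $p$-group for every object $P$; the objects of such a linking system are known to be quasicentric (Oliver). It is a centric linking system in the sense of Broto–Levi–Oliver if and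 only if $\mathrm{ob}(\mathcal{T})=\mathcal{F}^c$ and $E(P)=Z(\varepsilon_{P,P}(P))$ for every object $P$. $\mathcal{T}(\mathcal{L},\Delta)$ is the transporter system associated to $\mathcal{F}_S(\mathcal{L})$ with object set $\Delta$, whose morphisms $P\to Q$ are triples $(f,P,Q)$ with $f\in\mathcal{L}$, $P\subseteq\mathbf{D}(f)$, $P^f\leq Q$, composition being given by the product in $\mathcal{L}$, with $\varepsilon$ given by inclusion on morphism sets and $\rho$ sending $(f,P,Q)$ to $c_f|_P$. *)

theory Defs
  imports "HOL-Algebra.Algebra"
begin

text \<open>Conjugation and all morphisms act from the right: \<open>x\<close> conjugated by \<open>g\<close> is
  \<open>g\<inverse> x g\<close>, and composites are read from left to right.\<close>


section \<open>Finite groups\<close>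

definition conj_by :: "'a monoid \<Rightarrow> 'a \<Rightarrow> 'a \<Rightarrow> 'a" where
  "conj_by G g x = inv\<^bsub>G\<^esub> g \<otimes>\<^bsub>G\<^esub> x \<otimes>\<^bsub>G\<^esub> g"

definition conj_map :: "'a monoid \<Rightarrow> 'a \<Rightarrow> 'a set \<Rightarrow> 'a \<Rightarrow> 'a" where
  "conj_map G g P = (\<lambda>x\<in>P. conj_by G g x)"

definition subgrp :: "'a monoid \<Rightarrow> 'a set \<Rightarrow> 'a monoid" where
  "subgrp G H = G\<lparr>carrier := H\<rparr>"

definition centralizer :: "'a monoid \<Rightarrow> 'a set \<Rightarrow> 'a set" where
  "centralizer G Y = {g \<in> carrier G. \<forall>x\<in>Y. g \<otimes>\<^bsub>G\<^esub> x = x \<otimes>\<^bsub>G\<^esub> g}"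

definition center :: "'a monoid \<Rightarrow> 'a set" where
  "center G = centralizer G (carrier G)"

definition finite_p_group :: "nat \<Rightarrow> 'a monoid \<Rightarrow> bool" where
  "finite_p_group p G \<longleftrightarrow> group G \<and> finite (carrier G) \<and> (\<exists>n. order G = p ^ n)"

definition sylow_subgroup :: "nat \<Rightarrow> 'a monoid \<Rightarrow> 'a set \<Rightarrow> bool" where
  "sylow_subgroup p G H \<longleftrightarrow>
     group G \<and> finite (carrier G) \<and> subgroup H G \<and> card H = p ^ multiplicity p (order G)"

text \<open>\<open>GREATEST\<close> refers to the inclusion order on sets: these are the largest normal
  \<open>p\<close>-subgroup and the largest normal subgroup of order prime to \<open>p\<close>.\<close>

definition O_p :: "nat \<Rightarrow> 'a monoid \<Rightarrow> 'a set" where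
  "O_p p G = (GREATEST N. N \<lhd> G \<and> finite_p_group p (subgrp G N))"

definition O_p' :: "nat \<Rightarrow> 'a monoid \<Rightarrow> 'a set" where
  "O_p' p G = (GREATEST N. N \<lhd> G \<and> coprime p (card N))"

definition characteristic_p :: "nat \<Rightarrow> 'a monoid \<Rightarrow> bool" where
  "characteristic_p p G \<longleftrightarrow>
     group G \<and> finite (carrier G) \<and> centralizer G (O_p p G) \<subseteq> O_p p G"


section \<open>Fusion systems\<close>

text \<open>A fusion system is given by its morphism sets: \<open>F P Q\<close> consists of functions that are
  extensional on \<open>P\<close>, and it is empty unless \<open>P\<close> and \<open>Q\<close> are subgroups of \<open>S\<close>. Hence two
  fusion systems over \<open>S\<close> coincide iff they are equal as functions. Composing
  \<open>\<phi> \<in> F P Q\<close> with the inclusion of \<open>Q\<close> into an overgroup does not change the function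
  \<open>\<phi>\<close>; the last axiom below therefore says that \<open>\<phi>\<close> is an isomorphism of \<open>F\<close> onto its
  image followed by an inclusion.\<close>

type_synonym 'a fusion = "'a set \<Rightarrow> 'a set \<Rightarrow> ('a \<Rightarrow> 'a) set"

locale fusion_system =
  fixes S :: "'a monoid" and F :: "'a fusion"
  assumes objects: "\<And>P Q. F P Q \<noteq> {} \<Longrightarrow> subgroup P S \<and> subgroup Q S"
    and conj_in: "\<And>P Q g. \<lbrakk>subgroup P S; subgroup Q S; g \<in> carrier S; conj_by S g ` P \<subseteq> Q\<rbrakk>
      \<Longrightarrow> conj_map S g P \<in> F P Q"
    and mono_homs: "\<And>P Q. F P Q \<subseteq> mon (subgrp S P) (subgrp S Q) \<inter> extensional P"
    and comp_in: "\<And>P Q R \<phi> \<psi>. \<lbrakk>\<phi> \<in> F P Q; \<psi> \<in> F Q R\<rbrakk> \<Longrightarrow> compose P \<psi> \<phi> \<in> F P R"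
    and iso_onto_image: "\<And>P Q \<phi>. \<phi> \<in> F P Q
      \<Longrightarrow> \<phi> \<in> F P (\<phi> ` P) \<and> restrict (inv_into P \<phi>) (\<phi> ` P) \<in> F (\<phi> ` P) P"

definition fusion_of_group :: "'a monoid \<Rightarrow> 'a monoid \<Rightarrow> 'a fusion" where
  "fusion_of_group S G = (\<lambda>P Q. if subgroup P S \<and> subgroup Q S
     then {conj_map G g P | g. g \<in> carrier G \<and> conj_by G g ` P \<subseteq> Q} else {})"

definition conjugates :: "'a monoid \<Rightarrow> 'a fusion \<Rightarrow> 'a set \<Rightarrow> 'a set set" where
  "conjugates S F P = {\<phi> ` P | \<phi>. \<phi> \<in> F P (carrier S)}"

definition fully_normalized :: "'a monoid \<Rightarrow> 'a fusion \<Rightarrow> 'a set set" where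
  "fully_normalized S F = {P. subgroup P S \<and>
     (\<forall>Q\<in>conjugates S F P. card (normalizer S Q) \<le> card (normalizer S P))}"

definition fully_centralized :: "'a monoid \<Rightarrow> 'a fusion \<Rightarrow> 'a set set" where
  "fully_centralized S F = {P. subgroup P S \<and>
     (\<forall>Q\<in>conjugates S F P. card (centralizer S Q) \<le> card (centralizer S P))}"

definition Aut_F :: "'a fusion \<Rightarrow> 'a set \<Rightarrow> ('a \<Rightarrow> 'a) monoid" where
  "Aut_F F P = \<lparr>carrier = F P P, Group.monoid.mult = (\<lambda>\<phi> \<psi>. compose P \<psi> \<phi>), one = (\<lambda>x\<in>P. x)\<rparr>"

definition Inn :: "'a monoid \<Rightarrow> 'a set \<Rightarrow> ('a \<Rightarrow> 'a) set" where
  "Inn S P = (\<lambda>g. conj_map S g P) ` P"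

definition centric :: "'a monoid \<Rightarrow> 'a fusion \<Rightarrow> 'a set set" where
  "centric S F = {P. subgroup P S \<and> (\<forall>Q\<in>conjugates S F P. centralizer S Q \<subseteq> Q)}"

definition radical :: "nat \<Rightarrow> 'a monoid \<Rightarrow> 'a fusion \<Rightarrow> 'a set set" where
  "radical p S F = {P. subgroup P S \<and> O_p p (Aut_F F P) = Inn S P}"

definition centric_radical :: "nat \<Rightarrow> 'a monoid \<Rightarrow> 'a fusion \<Rightarrow> 'a set set" where
  "centric_radical p S F = centric S F \<inter> radical p S F"

text \<open>\<open>normalizer_fusion S F P\<close> and \<open>centralizer_fusion S F P\<close> are fusion systems over
  \<open>subgrp S (normalizer S P)\<close> and \<open>subgrp S (centralizer S P)\<close>.\<close>

definition normalizer_fusion :: "'a monoid \<Rightarrow> 'a fusion \<Rightarrow> 'a set \<Rightarrow> 'a fusion" where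
  "normalizer_fusion S F P = (\<lambda>A B.
     if A \<subseteq> normalizer S P \<and> B \<subseteq> normalizer S P
     then {\<phi> \<in> F A B. \<exists>\<psi> \<in> F (A <#>\<^bsub>S\<^esub> P) (B <#>\<^bsub>S\<^esub> P). (\<forall>x\<in>A. \<psi> x = \<phi> x) \<and> \<psi> ` P = P}
     else {})"

definition centralizer_fusion :: "'a monoid \<Rightarrow> 'a fusion \<Rightarrow> 'a set \<Rightarrow> 'a fusion" where
  "centralizer_fusion S F P = (\<lambda>A B.
     if A \<subseteq> centralizer S P \<and> B \<subseteq> centralizer S P
     then {\<phi> \<in> F A B. \<exists>\<psi> \<in> F (A <#>\<^bsub>S\<^esub> P) (B <#>\<^bsub>S\<^esub> P). (\<forall>x\<in>A. \<psi> x = \<phi> x) \<and> (\<forall>x\<in>P. \<psi> x = x)}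
     else {})"

definition normal_in_fusion :: "'a monoid \<Rightarrow> 'a fusion \<Rightarrow> 'a set \<Rightarrow> bool" where
  "normal_in_fusion S F R \<longleftrightarrow> R \<lhd> S \<and> normalizer_fusion S F R = F"

definition fusion_core :: "'a monoid \<Rightarrow> 'a fusion \<Rightarrow> 'a set" where
  "fusion_core S F = (GREATEST R. normal_in_fusion S F R)"

definition subcentric :: "'a monoid \<Rightarrow> 'a fusion \<Rightarrow> 'a set set" where
  "subcentric S F = {Q. subgroup Q S \<and>
     (\<forall>P \<in> conjugates S F Q \<inter> fully_normalized S F.
        fusion_core (subgrp S (normalizer S P)) (normalizer_fusion S F P) \<in> centric S F)}"

definition quasicentric :: "'a monoid \<Rightarrow> 'a fusion \<Rightarrow> 'a set set" where
  "quasicentric S F = {Q. subgroup Q S \<and>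
     (\<forall>P \<in> conjugates S F Q \<inter> fully_centralized S F.
        centralizer_fusion S F P =
          fusion_of_group (subgrp S (centralizer S P)) (subgrp S (centralizer S P)))}"

text \<open>\<open>S\<close> and \<open>G\<close> are separate records on the same type, so that \<open>S\<close> is a subgroup of \<open>G\<close>
  has to include that the multiplications agree on \<open>S\<close>.\<close>

definition model :: "nat \<Rightarrow> 'a monoid \<Rightarrow> 'a fusion \<Rightarrow> 'a monoid \<Rightarrow> bool" where
  "model p S F G \<longleftrightarrow> characteristic_p p G \<and>
     sylow_subgroup p G (carrier S) \<and>
     (\<forall>x\<in>carrier S. \<forall>y\<in>carrier S. x \<otimes>\<^bsub>S\<^esub> y = x \<otimes>\<^bsub>G\<^esub> y) \<and>
     fusion_of_group S G = F"

text \<open>A model for a fusion system over \<open>S\<close> contains \<open>S\<close>, and the type \<open>'a\<close> of the elements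
  of \<open>S\<close> may be too small to accommodate it. To say that a group with elements of type \<open>'m\<close>
  is isomorphic to a model we place \<open>S\<close> and its fusion system in \<open>'a + 'm\<close>, along \<open>Inl\<close>.\<close>

definition Inl_group :: "'a monoid \<Rightarrow> ('a + 'm) monoid" where
  "Inl_group S = \<lparr>carrier = Inl ` carrier S,
     Group.monoid.mult = (\<lambda>x y. Inl (projl x \<otimes>\<^bsub>S\<^esub> projl y)), one = Inl \<one>\<^bsub>S\<^esub>\<rparr>"

definition Inl_fusion :: "'a fusion \<Rightarrow> ('a + 'm) fusion" where
  "Inl_fusion F = (\<lambda>P Q. if P \<subseteq> range Inl \<and> Q \<subseteq> range Inl
     then (\<lambda>\<phi>. \<lambda>x\<in>P. Inl (\<phi> (projl x))) ` F (projl ` P) (projl ` Q) else {})"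

definition isomorphic_to_model :: "nat \<Rightarrow> 'a monoid \<Rightarrow> 'a fusion \<Rightarrow> 'm monoid \<Rightarrow> bool" where
  "isomorphic_to_model p S F H \<longleftrightarrow>
     (\<exists>G :: ('a + 'm) monoid. model p (Inl_group S) (Inl_fusion F) G \<and> H \<cong> G)"


section \<open>Partial groups\<close>

record 'a pgrp =
  pcarrier :: "'a set"
  pdom :: "'a list set"
  pprod :: "'a list \<Rightarrow> 'a"
  pinv :: "'a \<Rightarrow> 'a"

locale partial_group =
  fixes L :: "'a pgrp"
  assumes nonempty: "pcarrier L \<noteq> {}"
    and dom_words: "pdom L \<subseteq> lists (pcarrier L)"
    and prod_closed: "\<And>w. w \<in> pdom L \<Longrightarrow> pprod L w \<in> pcarrier L"
    and inv_closed: "\<And>f. f \<in> pcarrier L \<Longrightarrow> pinv L f \<in> pcarrier L"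
    and inv_inv: "\<And>f. f \<in> pcarrier L \<Longrightarrow> pinv L (pinv L f) = f"
    and dom_singleton: "\<And>f. f \<in> pcarrier L \<Longrightarrow> [f] \<in> pdom L"
    and dom_append: "\<And>u v. u @ v \<in> pdom L \<Longrightarrow> u \<in> pdom L \<and> v \<in> pdom L"
    and prod_singleton: "\<And>f. f \<in> pcarrier L \<Longrightarrow> pprod L [f] = f"
    and prod_append: "\<And>u v w. u @ v @ w \<in> pdom L \<Longrightarrow>
      u @ [pprod L v] @ w \<in> pdom L \<and> pprod L (u @ v @ w) = pprod L (u @ [pprod L v] @ w)"
    and prod_inv: "\<And>w. w \<in> pdom L \<Longrightarrow>
      rev (map (pinv L) w) @ w \<in> pdom L \<and> pprod L (rev (map (pinv L) w) @ w) = pprod L []"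

definition conj_dom :: "'a pgrp \<Rightarrow> 'a \<Rightarrow> 'a set" where
  "conj_dom L g = {x \<in> pcarrier L. [pinv L g, x, g] \<in> pdom L}"

definition pconj :: "'a pgrp \<Rightarrow> 'a \<Rightarrow> 'a \<Rightarrow> 'a" where
  "pconj L g x = pprod L [pinv L g, x, g]"

definition pnormalizer :: "'a pgrp \<Rightarrow> 'a set \<Rightarrow> 'a set" where
  "pnormalizer L Y = {g \<in> pcarrier L. Y \<subseteq> conj_dom L g \<and> pconj L g ` Y = Y}"

definition pcentralizer :: "'a pgrp \<Rightarrow> 'a set \<Rightarrow> 'a set" where
  "pcentralizer L Y = {g \<in> pcarrier L. Y \<subseteq> conj_dom L g \<and> (\<forall>x\<in>Y. pconj L g x = x)}"

definition partial_subgroup :: "'a pgrp \<Rightarrow> 'a set \<Rightarrow> bool" where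
  "partial_subgroup L H \<longleftrightarrow> H \<subseteq> pcarrier L \<and> (\<forall>f\<in>H. pinv L f \<in> H) \<and>
     (\<forall>w \<in> lists H \<inter> pdom L. pprod L w \<in> H)"

definition pgrp_subgroup :: "'a pgrp \<Rightarrow> 'a set \<Rightarrow> bool" where
  "pgrp_subgroup L H \<longleftrightarrow> partial_subgroup L H \<and> lists H \<subseteq> pdom L"

definition induced_group :: "'a pgrp \<Rightarrow> 'a set \<Rightarrow> 'a monoid" where
  "induced_group L H = \<lparr>carrier = H, Group.monoid.mult = (\<lambda>x y. pprod L [x, y]), one = pprod L []\<rparr>"

definition pgrp_p_subgroup :: "nat \<Rightarrow> 'a pgrp \<Rightarrow> 'a set \<Rightarrow> bool" where
  "pgrp_p_subgroup p L H \<longleftrightarrow> pgrp_subgroup L H \<and> finite_p_group p (induced_group L H)"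


section \<open>Localities\<close>

text \<open>As \<open>S\<close> is a group in its own right, the locale requires that its multiplication is the
  one induced by \<open>L\<close>.\<close>

locale locality = partial_group L
  for p :: nat and L :: "'a pgrp" and \<Delta> :: "'a set set" and S :: "'a monoid" +
  assumes finite_pcarrier: "finite (pcarrier L)"
    and S_group: "group S"
    and S_p_subgroup: "pgrp_p_subgroup p L (carrier S)"
    and S_mult: "\<And>x y. \<lbrakk>x \<in> carrier S; y \<in> carrier S\<rbrakk> \<Longrightarrow> x \<otimes>\<^bsub>S\<^esub> y = pprod L [x, y]"
    and S_maximal: "\<And>H. \<lbrakk>pgrp_p_subgroup p L H; carrier S \<subseteq> H\<rbrakk> \<Longrightarrow> H = carrier S"
    and Delta_nonempty: "\<Delta> \<noteq> {}"
    and Delta_subgroups: "\<And>P. P \<in> \<Delta> \<Longrightarrow> subgroup P S"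
    and Delta_overgroups: "\<And>P Q. \<lbrakk>P \<in> \<Delta>; subgroup Q S; P \<subseteq> Q\<rbrakk> \<Longrightarrow> Q \<in> \<Delta>"
    and Delta_conj: "\<And>P g. \<lbrakk>P \<in> \<Delta>; g \<in> pcarrier L; P \<subseteq> conj_dom L g; pconj L g ` P \<subseteq> carrier S\<rbrakk>
      \<Longrightarrow> pconj L g ` P \<in> \<Delta>"
    and dom_Delta: "pdom L = {w \<in> lists (pcarrier L).
      \<exists>P :: nat \<Rightarrow> 'a set. (\<forall>i\<le>length w. P i \<in> \<Delta>) \<and>
        (\<forall>i<length w. P i \<subseteq> conj_dom L (w ! i) \<and> pconj L (w ! i) ` P i = P (Suc i))}"

text \<open>The smallest fusion system over \<open>S\<close> containing all conjugation maps by elements of \<open>L\<close>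
  between subgroups of \<open>S\<close>.\<close>

definition fusion_of_locality :: "'a pgrp \<Rightarrow> 'a monoid \<Rightarrow> 'a fusion" where
  "fusion_of_locality L S = (\<lambda>P Q. \<Inter>{E P Q | E. fusion_system S E \<and>
     (\<forall>A B f. subgroup A S \<longrightarrow> subgroup B S \<longrightarrow> f \<in> pcarrier L \<longrightarrow> A \<subseteq> conj_dom L f \<longrightarrow>
        pconj L f ` A \<subseteq> B \<longrightarrow> (\<lambda>x\<in>A. pconj L f x) \<in> E A B)})"

definition locality_over ::
  "nat \<Rightarrow> 'a fusion \<Rightarrow> 'a pgrp \<Rightarrow> 'a set set \<Rightarrow> 'a monoid \<Rightarrow> bool" where
  "locality_over p F L \<Delta> S \<longleftrightarrow> locality p L \<Delta> S \<and> F = fusion_of_locality L S"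

definition locality_objective_char :: "nat \<Rightarrow> 'a pgrp \<Rightarrow> 'a set set \<Rightarrow> 'a monoid \<Rightarrow> bool" where
  "locality_objective_char p L \<Delta> S \<longleftrightarrow> locality p L \<Delta> S \<and>
     (\<forall>P\<in>\<Delta>. characteristic_p p (induced_group L (pnormalizer L P)))"

definition linking_locality :: "nat \<Rightarrow> 'a pgrp \<Rightarrow> 'a set set \<Rightarrow> 'a monoid \<Rightarrow> bool" where
  "linking_locality p L \<Delta> S \<longleftrightarrow> locality_objective_char p L \<Delta> S \<and>
     centric_radical p S (fusion_of_locality L S) \<subseteq> \<Delta>"

definition Chermak_linking_system :: "nat \<Rightarrow> 'a pgrp \<Rightarrow> 'a set set \<Rightarrow> 'a monoid \<Rightarrow> bool" where
  "Chermak_linking_system p L \<Delta> S \<longleftrightarrow> locality p L \<Delta> S \<and> (\<forall>P\<in>\<Delta>. pcentralizer L P \<subseteq> P)"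

definition Chermak_centric_linking_system ::
  "nat \<Rightarrow> 'a fusion \<Rightarrow> 'a pgrp \<Rightarrow> 'a set set \<Rightarrow> 'a monoid \<Rightarrow> bool" where
  "Chermak_centric_linking_system p F L \<Delta> S \<longleftrightarrow> locality_over p F L \<Delta> S \<and>
     \<Delta> = centric S F \<and> (\<forall>P \<in> centric S F. pcentralizer L P \<subseteq> P)"


section \<open>Transporter systems\<close>

text \<open>\<open>tcomp T \<phi> \<psi>\<close> is first \<open>\<phi>\<close>, then \<open>\<psi>\<close>. The maps \<open>eps T P Q\<close> and \<open>rho T\<close> are the two
  structure functors on morphisms.\<close>

record ('a, 'm) transporter =
  ob :: "'a set set"
  mor :: "'m set"
  src :: "'m \<Rightarrow> 'a set"
  tgt :: "'m \<Rightarrow> 'a set"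
  tid :: "'a set \<Rightarrow> 'm"
  tcomp :: "'m \<Rightarrow> 'm \<Rightarrow> 'm"
  eps :: "'a set \<Rightarrow> 'a set \<Rightarrow> 'a \<Rightarrow> 'm"
  rho :: "'m \<Rightarrow> 'a \<Rightarrow> 'a"

definition thom :: "('a, 'm) transporter \<Rightarrow> 'a set \<Rightarrow> 'a set \<Rightarrow> 'm set" where
  "thom T P Q = {\<phi> \<in> mor T. src T \<phi> = P \<and> tgt T \<phi> = Q}"

definition inverse_pair ::
  "('a, 'm) transporter \<Rightarrow> 'a set \<Rightarrow> 'a set \<Rightarrow> 'm \<Rightarrow> 'm \<Rightarrow> bool" where
  "inverse_pair T P Q \<phi> \<psi> \<longleftrightarrow> \<phi> \<in> thom T P Q \<and> \<psi> \<in> thom T Q P \<and>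
     tcomp T \<phi> \<psi> = tid T P \<and> tcomp T \<psi> \<phi> = tid T Q"

definition Aut_T :: "('a, 'm) transporter \<Rightarrow> 'a set \<Rightarrow> 'm monoid" where
  "Aut_T T P = units_of \<lparr>carrier = thom T P P, Group.monoid.mult = tcomp T, one = tid T P\<rparr>"

definition E_T :: "('a, 'm) transporter \<Rightarrow> 'a set \<Rightarrow> 'm set" where
  "E_T T P = {\<phi> \<in> carrier (Aut_T T P). rho T \<phi> = (\<lambda>x\<in>P. x)}"

definition transporter_set :: "'a monoid \<Rightarrow> 'a set \<Rightarrow> 'a set \<Rightarrow> 'a set" where
  "transporter_set S P Q = {g \<in> carrier S. conj_by S g ` P \<subseteq> Q}"

locale transporter_system = fusion_system S F
  for p :: nat and S :: "'a monoid" and F :: "'a fusion" and T :: "('a, 'm) transporter" +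
  assumes S_p_group: "finite_p_group p S"
    and ob_nonempty: "ob T \<noteq> {}"
    and ob_subgroups: "\<And>P. P \<in> ob T \<Longrightarrow> subgroup P S"
    and ob_conj: "\<And>P Q. \<lbrakk>P \<in> ob T; Q \<in> conjugates S F P\<rbrakk> \<Longrightarrow> Q \<in> ob T"
    and ob_overgroups: "\<And>P Q. \<lbrakk>P \<in> ob T; subgroup Q S; P \<subseteq> Q\<rbrakk> \<Longrightarrow> Q \<in> ob T"
    and finite_mor: "finite (mor T)"
    and src_tgt: "\<And>\<phi>. \<phi> \<in> mor T \<Longrightarrow> src T \<phi> \<in> ob T \<and> tgt T \<phi> \<in> ob T"
    and tid_in: "\<And>P. P \<in> ob T \<Longrightarrow> tid T P \<in> thom T P P"
    and tcomp_in: "\<And>P Q R \<phi> \<psi>. \<lbrakk>\<phi> \<in> thom T P Q; \<psi> \<in> thom T Q R\<rbrakk> \<Longrightarrow> tcomp T \<phi> \<psi> \<in> thom T P R"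
    and tcomp_tid: "\<And>P Q \<phi>. \<phi> \<in> thom T P Q \<Longrightarrow>
      tcomp T (tid T P) \<phi> = \<phi> \<and> tcomp T \<phi> (tid T Q) = \<phi>"
    and tcomp_assoc: "\<And>P Q R U \<phi> \<psi> \<chi>. \<lbrakk>\<phi> \<in> thom T P Q; \<psi> \<in> thom T Q R; \<chi> \<in> thom T R U\<rbrakk> \<Longrightarrow>
      tcomp T (tcomp T \<phi> \<psi>) \<chi> = tcomp T \<phi> (tcomp T \<psi> \<chi>)"
    and eps_in: "\<And>P Q g. \<lbrakk>P \<in> ob T; Q \<in> ob T; g \<in> transporter_set S P Q\<rbrakk> \<Longrightarrow> eps T P Q g \<in> thom T P Q"
    and eps_one: "\<And>P. P \<in> ob T \<Longrightarrow> eps T P P \<one>\<^bsub>S\<^esub> = tid T P"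
    and eps_mult: "\<And>P Q R g h. \<lbrakk>P \<in> ob T; Q \<in> ob T; R \<in> ob T;
        g \<in> transporter_set S P Q; h \<in> transporter_set S Q R\<rbrakk> \<Longrightarrow>
      eps T P R (g \<otimes>\<^bsub>S\<^esub> h) = tcomp T (eps T P Q g) (eps T Q R h)"
    and rho_in: "\<And>P Q \<phi>. \<phi> \<in> thom T P Q \<Longrightarrow> rho T \<phi> \<in> F P Q"
    and rho_tid: "\<And>P. P \<in> ob T \<Longrightarrow> rho T (tid T P) = (\<lambda>x\<in>P. x)"
    and rho_tcomp: "\<And>P Q R \<phi> \<psi>. \<lbrakk>\<phi> \<in> thom T P Q; \<psi> \<in> thom T Q R\<rbrakk> \<Longrightarrow>
      rho T (tcomp T \<phi> \<psi>) = compose P (rho T \<psi>) (rho T \<phi>)"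
    \<comment> \<open>\<open>rho_surj\<close> and \<open>rho_orbits\<close>: \<open>rho\<close> is the orbit map of the action by precomposition\<close>
    and E_pre_free: "\<And>P Q e \<phi>. \<lbrakk>e \<in> E_T T P; \<phi> \<in> thom T P Q; tcomp T e \<phi> = \<phi>\<rbrakk> \<Longrightarrow> e = tid T P"
    and rho_surj: "\<And>P Q. \<lbrakk>P \<in> ob T; Q \<in> ob T\<rbrakk> \<Longrightarrow> rho T ` thom T P Q = F P Q"
    and rho_orbits: "\<And>P Q \<phi> \<psi>. \<lbrakk>\<phi> \<in> thom T P Q; \<psi> \<in> thom T P Q\<rbrakk> \<Longrightarrow>
      rho T \<phi> = rho T \<psi> \<longleftrightarrow> (\<exists>e \<in> E_T T P. \<psi> = tcomp T e \<phi>)"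
    and E_post_free: "\<And>P Q e \<phi>. \<lbrakk>e \<in> E_T T Q; \<phi> \<in> thom T P Q; tcomp T \<phi> e = \<phi>\<rbrakk> \<Longrightarrow> e = tid T Q"
    and eps_inj: "\<And>P Q. \<lbrakk>P \<in> ob T; Q \<in> ob T\<rbrakk> \<Longrightarrow> inj_on (eps T P Q) (transporter_set S P Q)"
    and rho_eps: "\<And>P Q g. \<lbrakk>P \<in> ob T; Q \<in> ob T; g \<in> transporter_set S P Q\<rbrakk> \<Longrightarrow>
      rho T (eps T P Q g) = conj_map S g P"
    and eps_commute: "\<And>P Q \<phi> g. \<lbrakk>\<phi> \<in> thom T P Q; g \<in> P\<rbrakk> \<Longrightarrow>
      tcomp T (eps T P P g) \<phi> = tcomp T \<phi> (eps T Q Q (rho T \<phi> g))"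
    and eps_sylow: "sylow_subgroup p (Aut_T T (carrier S)) (eps T (carrier S) (carrier S) ` carrier S)"
    and extension: "\<And>P Q P' Q' \<phi> \<psi>.
      \<lbrakk>inverse_pair T P Q \<phi> \<psi>;
       subgroup P' S; P \<lhd> subgrp S P'; subgroup Q' S; Q \<lhd> subgrp S Q';
       \<forall>g\<in>P'. tcomp T \<psi> (tcomp T (eps T P P g) \<phi>) \<in> eps T Q Q ` Q'\<rbrakk> \<Longrightarrow>
      \<exists>\<theta> \<in> thom T P' Q'. tcomp T (eps T P P' \<one>\<^bsub>S\<^esub>) \<theta> = tcomp T \<phi> (eps T Q Q' \<one>\<^bsub>S\<^esub>)"

definition transporter_objective_char ::
  "nat \<Rightarrow> 'a monoid \<Rightarrow> 'a fusion \<Rightarrow> ('a, 'm) transporter \<Rightarrow> bool" where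
  "transporter_objective_char p S F T \<longleftrightarrow> transporter_system p S F T \<and>
     (\<forall>P \<in> ob T. characteristic_p p (Aut_T T P))"

definition linking_system ::
  "nat \<Rightarrow> 'a monoid \<Rightarrow> 'a fusion \<Rightarrow> ('a, 'm) transporter \<Rightarrow> bool" where
  "linking_system p S F T \<longleftrightarrow> transporter_objective_char p S F T \<and>
     centric_radical p S F \<subseteq> ob T"

definition Oliver_linking_system ::
  "nat \<Rightarrow> 'a monoid \<Rightarrow> 'a fusion \<Rightarrow> ('a, 'm) transporter \<Rightarrow> bool" where
  "Oliver_linking_system p S F T \<longleftrightarrow> transporter_system p S F T \<and>
     centric_radical p S F \<subseteq> ob T \<and>
     (\<forall>P \<in> ob T. finite_p_group p (subgrp (Aut_T T P) (E_T T P)))"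

definition BLO_centric_linking_system ::
  "nat \<Rightarrow> 'a monoid \<Rightarrow> 'a fusion \<Rightarrow> ('a, 'm) transporter \<Rightarrow> bool" where
  "BLO_centric_linking_system p S F T \<longleftrightarrow> transporter_system p S F T \<and>
     ob T = centric S F \<and>
     (\<forall>P \<in> ob T. E_T T P = center (subgrp (Aut_T T P) (eps T P P ` P)))"

definition transporter_of_locality ::
  "'a pgrp \<Rightarrow> 'a set set \<Rightarrow> ('a, 'a \<times> 'a set \<times> 'a set) transporter" where
  "transporter_of_locality L \<Delta> = \<lparr>
     ob = \<Delta>,
     mor = {(f, P, Q). f \<in> pcarrier L \<and> P \<in> \<Delta> \<and> Q \<in> \<Delta> \<and>
              P \<subseteq> conj_dom L f \<and> pconj L f ` P \<subseteq> Q},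
     src = (\<lambda>(f, P, Q). P),
     tgt = (\<lambda>(f, P, Q). Q),
     tid = (\<lambda>P. (pprod L [], P, P)),
     tcomp = (\<lambda>(f, P, Q) (g, Q', R). (pprod L [f, g], P, R)),
     eps = (\<lambda>P Q g. (g, P, Q)),
     rho = (\<lambda>(f, P, Q). \<lambda>x\<in>P. pconj L f x)\<rparr>"

end

theory Submission
  imports Defs
begin

text \<open>
  All of the work is done in transporter systems. A locality \<open>(L, \<Delta>, S)\<close> enters through its
  transporter system \<open>T(L, \<Delta>)\<close>: there the automorphism group of \<open>P\<close> is a copy of \<open>N\<^sub>L(P)\<close>, the
  subgroup \<open>E(P)\<close> is a copy of \<open>C\<^sub>L(P)\<close>, and the fusion system is that of the locality. Once
  \<open>transporter_system_of_locality\<close> is known, (a) compares two definitions, and the statements on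
  localities in (b), (c), (d) are those on transporter systems.

  Let \<open>T\<close> be a transporter system and \<open>P\<close> an object. Two facts carry the argument. First, if \<open>P\<close>
  is fully normalized, then \<open>N\<^sub>S(P)\<close> is a Sylow subgroup of \<open>Aut\<^sub>T(P)\<close>
  (\<open>fully_normalized_imp_sylow\<close>): the elements of a larger \<open>p\<close>-group normalizing \<open>N\<^sub>S(P)\<close> would
  extend to \<open>N\<^sub>S(P)\<close>, could by induction be conjugated into \<open>S\<close>, and would there normalize a
  conjugate of \<open>P\<close>, whose normalizer in \<open>S\<close> would be larger than that of \<open>P\<close>. Secondly, \<open>N\<^sub>F(P)\<close> is
  the fusion system that \<open>Aut\<^sub>T(P)\<close> induces on \<open>N\<^sub>S(P)\<close> (\<open>normalizer_fusion_eq\<close>), because an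
  automorphism of \<open>P\<close> that conjugates \<open>A \<le> N\<^sub>S(P)\<close> into \<open>B \<le> N\<^sub>S(P)\<close> extends to a morphism from \<open>AP\<close>
  to \<open>BP\<close>.

  For (b) these facts say that \<open>Aut\<^sub>T(P)\<close> is a model for \<open>N\<^sub>F(P)\<close> when it is of characteristic \<open>p\<close>.
  The subgroup \<open>Q\<close> of \<open>N\<^sub>S(P)\<close> that corresponds to \<open>O\<^sub>p(Aut\<^sub>T(P))\<close> is then normal in \<open>N\<^sub>F(P)\<close>; it
  is centric in \<open>F\<close> because \<open>E(Q)\<close>, restricted to \<open>P\<close>, centralizes \<open>O\<^sub>p(Aut\<^sub>T(P))\<close> and so lies in
  it (\<open>O_p_centric\<close>).

  For (c), if \<open>P\<close> is quasicentric and fully normalized, then \<open>C\<^sub>S(P)\<close> is a Sylow subgroup of \<open>E(P)\<close>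
  that controls fusion in \<open>E(P)\<close>. By Frobenius' theorem (\<open>frobenius_normal_complement\<close>, proved
  here by transfer) it has a normal complement, which is \<open>O\<^sub>p\<^sub>'(E(P))\<close>. This is a normal
  \<open>p'\<close>-subgroup of \<open>Aut\<^sub>T(P)\<close>, hence trivial if \<open>Aut\<^sub>T(P)\<close> is of characteristic \<open>p\<close>. Conversely, if
  \<open>E(P)\<close> is a \<open>p\<close>-group, then it lies in \<open>O\<^sub>p(Aut\<^sub>T(P))\<close>, and it contains the centralizer of that
  group since it is the centralizer of the image of \<open>P\<close>. Part (d) is the case where \<open>C\<^sub>S(P) \<le> P\<close>,
  as centric subgroups are quasicentric.
\<close>

section \<open>Subgroups and conjugation\<close>

lemma subgrp_simps [simp]:
  "carrier (subgrp G H) = H" "x \<otimes>\<^bsub>subgrp G H\<^esub> y = x \<otimes>\<^bsub>G\<^esub> y" "\<one>\<^bsub>subgrp G H\<^esub> = \<one>\<^bsub>G\<^esub>"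
  by (simp_all add: subgrp_def)

lemma order_subgrp [simp]: "order (subgrp G H) = card H"
  by (simp add: order_def)

lemma subgrp_subgrp [simp]: "subgrp (subgrp G H) K = subgrp G K"
  by (simp add: subgrp_def)

lemma set_mult_subgrp [simp]: "A <#>\<^bsub>subgrp G H\<^esub> B = A <#>\<^bsub>G\<^esub> B"
  by (simp add: subgrp_def)

lemma r_coset_subgrp [simp]: "A #>\<^bsub>subgrp G H\<^esub> b = A #>\<^bsub>G\<^esub> b"
  by (simp add: subgrp_def)

text \<open>The group-theoretic notions of this development take records of type \<open>'a monoid\<close>, whereas
  \<open>group\<close> allows extended records.\<close>

locale plain_group = group G for G :: "'a monoid" (structure)
begin

lemma group_subgrp: "subgroup H G \<Longrightarrow> group (subgrp G H)"
  by (simp add: subgrp_def subgroup_imp_group)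

lemma inv_subgrp: "subgroup H G \<Longrightarrow> x \<in> H \<Longrightarrow> inv\<^bsub>subgrp G H\<^esub> x = inv x"
  by (simp add: subgrp_def m_inv_consistent)

lemma conj_by_subgrp: "subgroup H G \<Longrightarrow> g \<in> H \<Longrightarrow> conj_by (subgrp G H) g x = conj_by G g x"
  by (simp add: conj_by_def inv_subgrp)

lemma subgroup_subgrp_iff: "subgroup H G \<Longrightarrow> subgroup K (subgrp G H) \<longleftrightarrow> subgroup K G \<and> K \<subseteq> H"
  unfolding subgrp_def
  using incl_subgroup[of H K] subgroup_incl[of K H] subgroup.subset[of K "G\<lparr>carrier := H\<rparr>"] by auto

lemma conj_by_closed [simp]: "g \<in> carrier G \<Longrightarrow> x \<in> carrier G \<Longrightarrow> conj_by G g x \<in> carrier G"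
  by (simp add: conj_by_def)

lemma conj_by_one [simp]: "x \<in> carrier G \<Longrightarrow> conj_by G \<one> x = x"
  by (simp add: conj_by_def)

lemma conj_by_of_one [simp]: "g \<in> carrier G \<Longrightarrow> conj_by G g \<one> = \<one>"
  by (simp add: conj_by_def)

lemma conj_by_mult: "\<lbrakk>g \<in> carrier G; x \<in> carrier G; y \<in> carrier G\<rbrakk>
    \<Longrightarrow> conj_by G g (x \<otimes> y) = conj_by G g x \<otimes> conj_by G g y"
  unfolding conj_by_def
  by (smt (verit) inv_closed inv_solve_left m_assoc m_closed)

lemma conj_by_comp: "\<lbrakk>g \<in> carrier G; h \<in> carrier G; x \<in> carrier G\<rbrakk>
    \<Longrightarrow> conj_by G (g \<otimes> h) x = conj_by G h (conj_by G g x)"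
  unfolding conj_by_def by (simp add: inv_mult_group m_assoc)

lemma conj_by_inv_cancel [simp]: "\<lbrakk>g \<in> carrier G; x \<in> carrier G\<rbrakk> \<Longrightarrow> conj_by G (inv g) (conj_by G g x) = x"
  using conj_by_comp[of g "inv g" x] by simp

lemma conj_by_inv_cancel' [simp]: "\<lbrakk>g \<in> carrier G; x \<in> carrier G\<rbrakk> \<Longrightarrow> conj_by G g (conj_by G (inv g) x) = x"
  using conj_by_comp[of "inv g" g x] by simp

lemma conj_by_inv: "\<lbrakk>g \<in> carrier G; x \<in> carrier G\<rbrakk> \<Longrightarrow> conj_by G g (inv x) = inv (conj_by G g x)"
  unfolding conj_by_def by (simp add: inv_mult_group m_assoc)

lemma conj_by_eq_iff: "\<lbrakk>g \<in> carrier G; x \<in> carrier G; y \<in> carrier G\<rbrakk>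
    \<Longrightarrow> conj_by G g x = y \<longleftrightarrow> x \<otimes> g = g \<otimes> y"
  unfolding conj_by_def by (metis inv_closed inv_solve_left m_assoc m_closed)

lemma inj_on_conj_by: "g \<in> carrier G \<Longrightarrow> inj_on (conj_by G g) (carrier G)"
  by (metis conj_by_inv_cancel inj_on_inverseI)

lemma conj_by_pow: "\<lbrakk>g \<in> carrier G; x \<in> carrier G\<rbrakk>
    \<Longrightarrow> conj_by G g (x [^] (n::nat)) = conj_by G g x [^] n"
  by (induction n) (simp_all add: conj_by_mult)

lemma card_conj_by_image: "g \<in> carrier G \<Longrightarrow> H \<subseteq> carrier G \<Longrightarrow> card (conj_by G g ` H) = card H"
  by (meson card_image inj_on_conj_by inj_on_subset)

lemma conj_by_image_comp: "\<lbrakk>g \<in> carrier G; h \<in> carrier G; H \<subseteq> carrier G\<rbrakk>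
    \<Longrightarrow> conj_by G (g \<otimes> h) ` H = conj_by G h ` conj_by G g ` H"
  by (force simp: image_image conj_by_comp intro!: image_cong)

lemma normal_iff_conj_by: "N \<lhd> G \<longleftrightarrow> subgroup N G \<and> (\<forall>g\<in>carrier G. \<forall>x\<in>N. conj_by G g x \<in> N)"
  unfolding normal_inv_iff conj_by_def by (metis inv_closed inv_inv)

lemma normalizer_eq:
  assumes "H \<subseteq> carrier G"
  shows "normalizer G H = {g \<in> carrier G. conj_by G g ` H = H}"
proof -
  have "g <# H #> inv g = conj_by G (inv g) ` H" if "g \<in> carrier G" for g
    using that by (auto simp: l_coset_def r_coset_def conj_by_def)
  moreover have "conj_by G (inv g) ` H = H \<longleftrightarrow> conj_by G g ` H = H" if "g \<in> carrier G" for g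
    using that assms conj_by_image_comp[of g "inv g" H] conj_by_image_comp[of "inv g" g H]
    by (metis conj_by_one image_cong image_ident inv_closed l_inv r_inv subsetD)
  ultimately show ?thesis
    using assms unfolding normalizer_def stabilizer_def
    by (intro Collect_cong conj_cong refl) simp
qed

lemma normalizer_eq_finite:
  assumes "H \<subseteq> carrier G" "finite H"
  shows "normalizer G H = {g \<in> carrier G. conj_by G g ` H \<subseteq> H}"
  unfolding normalizer_eq[OF assms(1)]
  using assms card_conj_by_image card_subset_eq by (metis (no_types, lifting) subset_refl)

lemma subgroup_subset_normalizer: "subgroup H G \<Longrightarrow> H \<subseteq> normalizer G H"
proof
  fix h assume H: "subgroup H G" "h \<in> H"
  then have c: "H \<subseteq> carrier G" by (simp add: subgroup.subset)
  have i: "inv h \<in> H" using H by (simp add: subgroup.m_inv_closed)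
  have "conj_by G h ` H \<subseteq> H" "conj_by G (inv h) ` H \<subseteq> H"
    using H i by (auto simp: conj_by_def subgroup.m_closed subgroup.m_inv_closed)
  moreover have "\<forall>x\<in>H. conj_by G h (conj_by G (inv h) x) = x"
    using c H by (metis conj_by_inv_cancel' subsetD)
  then have "H = conj_by G h ` conj_by G (inv h) ` H"
    by (simp add: image_image cong: image_cong_simp)
  ultimately have "conj_by G h ` H = H" by (metis image_mono subset_antisym)
  then show "h \<in> normalizer G H" using H c by (auto simp: normalizer_eq)
qed

lemma normal_in_normalizer:
  assumes "subgroup H G" "subgroup K G" "H \<subseteq> K" "K \<subseteq> normalizer G H"
  shows "H \<lhd> subgrp G K"
proof -
  interpret K: plain_group "subgrp G K" using assms group_subgrp by (simp add: plain_group_def)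
  show ?thesis
    unfolding K.normal_iff_conj_by
    using assms by (auto simp: subgroup_subgrp_iff conj_by_subgrp normalizer_eq subgroup.subset)
qed

lemma subgroup_card_dvd: "\<lbrakk>finite (carrier G); subgroup H G; subgroup K G; H \<subseteq> K\<rbrakk> \<Longrightarrow> card H dvd card K"
  using group.lagrange[OF group_subgrp, of K H] by (metis dvd_triv_right order_subgrp subgroup_subgrp_iff)

lemma finite_p_group_subgrp_iff:
  "\<lbrakk>finite (carrier G); subgroup H G\<rbrakk> \<Longrightarrow> finite_p_group p (subgrp G H) \<longleftrightarrow> (\<exists>n. card H = p ^ n)"
  using finite_subset[OF subgroup.subset, of H G] group_subgrp[of H] unfolding finite_p_group_def by simp

end

lemma p_group_subgroup:
  assumes "Factorial_Ring.prime p" "card K = p ^ n" "card H dvd card K"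
  shows "\<exists>m. card H = p ^ m"
  using assms divides_primepow_nat by auto

section \<open>Fixed points of p-groups and Sylow subgroups\<close>

lemma group_action_restrictI:
  fixes G (structure) and E :: "'x set"
  assumes "group G" "\<And>g x. \<lbrakk>g \<in> carrier G; x \<in> E\<rbrakk> \<Longrightarrow> act g x \<in> E"
    and "\<And>x. x \<in> E \<Longrightarrow> act \<one>\<^bsub>G\<^esub> x = x"
    and "\<And>g h x. \<lbrakk>g \<in> carrier G; h \<in> carrier G; x \<in> E\<rbrakk> \<Longrightarrow> act (g \<otimes>\<^bsub>G\<^esub> h) x = act g (act h x)"
  shows "group_action G E (\<lambda>g. \<lambda>x\<in>E. act g x)"
proof -
  interpret group G by fact
  have "bij_betw (\<lambda>x\<in>E. act g x) E E" if "g \<in> carrier G" for g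
  proof (rule bij_betw_byWitness[where f' = "\<lambda>x\<in>E. act (inv g) x"])
    show "\<forall>x\<in>E. (\<lambda>x\<in>E. act (inv g) x) ((\<lambda>x\<in>E. act g x) x) = x"
      using assms that by (metis inv_closed l_inv restrict_apply')
    show "\<forall>x\<in>E. (\<lambda>x\<in>E. act g x) ((\<lambda>x\<in>E. act (inv g) x) x) = x"
      using assms that by (metis inv_closed r_inv restrict_apply')
  qed (use assms that in auto)
  then have "(\<lambda>g. \<lambda>x\<in>E. act g x) \<in> hom G (BijGroup E)"
    using assms
    by (intro homI) (auto simp: BijGroup_def Bij_def compose_def fun_eq_iff intro!: restrict_ext)
  then show ?thesis
    by (simp add: group_action_def group_hom_def group_hom_axioms_def group_BijGroup is_group)
qed

text \<open>The points that are not fixed form a union of orbits, and the length of a nontrivial orbit is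
  a power of \<open>p\<close> greater than 1.\<close>

lemma card_fixed_points_mod:
  fixes Q (structure) and E :: "'x set"
  assumes p: "Factorial_Ring.prime p" and Q: "group Q" "order Q = p ^ n" and fin: "finite E"
    and closed: "\<And>g x. \<lbrakk>g \<in> carrier Q; x \<in> E\<rbrakk> \<Longrightarrow> act g x \<in> E"
    and one: "\<And>x. x \<in> E \<Longrightarrow> act \<one>\<^bsub>Q\<^esub> x = x"
    and mult: "\<And>g h x. \<lbrakk>g \<in> carrier Q; h \<in> carrier Q; x \<in> E\<rbrakk> \<Longrightarrow> act (g \<otimes>\<^bsub>Q\<^esub> h) x = act g (act h x)"
  shows "p dvd card E \<longleftrightarrow> p dvd card {x \<in> E. \<forall>g\<in>carrier Q. act g x = x}"
proof -
  interpret group Q by fact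
  define Y where "Y = {x \<in> E. \<not> (\<forall>g\<in>carrier Q. act g x = x)}"
  let ?a = "\<lambda>g. \<lambda>x\<in>Y. act g x"
  have clY: "act g x \<in> Y" if "g \<in> carrier Q" "x \<in> Y" for g x
  proof -
    have x: "x \<in> E" using that(2) Y_def by blast
    have "\<forall>h\<in>carrier Q. act h x = x" if *: "\<forall>h\<in>carrier Q. act h (act g x) = act g x"
    proof
      have "act (inv g) (act g x) = x" using x \<open>g \<in> carrier Q\<close> by (metis inv_closed l_inv mult one)
      then have gx: "act g x = x" using * \<open>g \<in> carrier Q\<close> by auto
      fix h assume "h \<in> carrier Q" then show "act h x = x" using * gx by auto
    qed
    then show ?thesis using that x closed unfolding Y_def by blast
  qed
  interpret A: group_action Q Y ?a
    by (rule group_action_restrictI) (use clY one mult Y_def Q in auto)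
  have finY: "finite Y" using fin Y_def by auto
  have "p dvd card orb" if orb: "orb \<in> orbits Q Y ?a" for orb
  proof -
    from that obtain x where x: "x \<in> Y" "orb = orbit Q ?a x" by (auto simp: orbits_def)
    have "card orb dvd p ^ n"
      using A.orbit_stabilizer_theorem[OF x(1)] x(2) Q(2) by (metis dvd_triv_left)
    then obtain k where k: "card orb = p ^ k" using p divides_primepow_nat by auto
    obtain g where g: "g \<in> carrier Q" "act g x \<noteq> x" using x(1) Y_def by auto
    have "{x, act g x} \<subseteq> orb"
      using x g A.orbit_refl[OF x(1)] unfolding orbit_def by auto
    moreover have "finite orb" using orb finY A.orbits_coverture Union_upper finite_subset by metis
    ultimately have "card orb \<noteq> 1" using g(2) by (metis card_1_singletonE insert_subset singletonD)
    then show ?thesis using k by (cases k) auto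
  qed
  then have "p dvd (\<Sum>orb\<in>orbits Q Y ?a. card orb)" by (simp add: dvd_sum)
  then have pY: "p dvd card Y" using A.disjoint_sum[OF finY, of "\<lambda>_. 1::nat"] by simp
  have "card E = card {x \<in> E. \<forall>g\<in>carrier Q. act g x = x} + card Y"
    unfolding Y_def using fin by (subst card_Un_disjoint[symmetric]) (auto intro: arg_cong[of _ _ card])
  then show ?thesis using pY by (simp add: dvd_add_left_iff)
qed

lemma sylow_exists:
  assumes "Factorial_Ring.prime p" "group G" "finite (carrier G)"
  shows "\<exists>V. sylow_subgroup p G V"
proof -
  have "order G = p ^ multiplicity p (order G) * (order G div p ^ multiplicity p (order G))"
    by (simp add: multiplicity_dvd)
  from sylow_thm[OF assms(1,2) this assms(3)] show ?thesis
    using assms unfolding sylow_subgroup_def by blast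
qed

context plain_group
begin

lemma index_not_dvd:
  assumes "Factorial_Ring.prime p" "sylow_subgroup p G V"
  shows "\<not> p dvd card (rcosets V)"
proof
  assume "p dvd card (rcosets V)"
  moreover have *: "card (rcosets V) * p ^ multiplicity p (order G) = order G"
    using assms lagrange by (metis sylow_subgroup_def)
  ultimately have "p ^ Suc (multiplicity p (order G)) dvd order G"
    by (metis mult_dvd_mono dvd_refl power_Suc)
  moreover have "order G \<noteq> 0" using assms(2) order_gt_0_iff_finite by (auto simp: sylow_subgroup_def)
  ultimately show False
    using assms(1) by (metis not_prime_unit power_dvd_iff_le_multiplicity Suc_n_not_le_n)
qed

text \<open>A \<open>p\<close>-subgroup \<open>U\<close> acts on the cosets of \<open>V\<close>. The next results come
  from this congruence: it yields fixed cosets when \<open>V\<close> has index prime to \<open>p\<close>, and it makes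
  the normalizer of \<open>U\<close> large when \<open>V = U\<close>.\<close>

lemma card_fixed_cosets_mod:
  assumes p: "Factorial_Ring.prime p" and fin: "finite (carrier G)"
    and V: "subgroup V G" and U: "subgroup U G" "card U = p ^ n"
  shows "p dvd card (rcosets V) \<longleftrightarrow> p dvd card {C \<in> rcosets V. \<forall>u\<in>U. C #> inv u = C}"
proof -
  have Uc: "U \<subseteq> carrier G" and Vc: "V \<subseteq> carrier G" using U V by (simp_all add: subgroup.subset)
  have 1: "C #> inv u \<in> rcosets V" if "u \<in> U" "C \<in> rcosets V" for u C
  proof -
    from that obtain g where "g \<in> carrier G" "C = V #> g" by (auto simp: RCOSETS_def)
    moreover have "inv u \<in> carrier G" using that Uc by auto
    ultimately show ?thesis using Vc by (simp add: coset_mult_assoc rcosetsI)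
  qed
  have 2: "C #> inv \<one> = C" if "C \<in> rcosets V" for C
    using that Vc by (auto simp: RCOSETS_def coset_mult_assoc)
  have 3: "C #> inv (u \<otimes> w) = C #> inv w #> inv u" if "u \<in> U" "w \<in> U" "C \<in> rcosets V" for u w C
  proof -
    from that obtain g where "g \<in> carrier G" "C = V #> g" by (auto simp: RCOSETS_def)
    moreover have "u \<in> carrier G" "w \<in> carrier G" using that Uc by auto
    ultimately show ?thesis using Vc by (simp add: coset_mult_assoc inv_mult_group m_assoc)
  qed
  have "finite (rcosets V)" using fin by (simp add: RCOSETS_def)
  from card_fixed_points_mod[OF p group_subgrp[OF U(1)], where E = "rcosets V"
      and act = "\<lambda>u C. C #> inv u" and n = n, OF _ this] show ?thesis
    using 1 2 3 U(2) by simp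
qed

lemma coset_fixed_iff:
  assumes "subgroup V G" "u \<in> carrier G" "g \<in> carrier G"
  shows "(V #> g) #> inv u = V #> g \<longleftrightarrow> conj_by G (inv g) u \<in> V"
proof -
  have V: "V \<subseteq> carrier G" using assms by (simp add: subgroup.subset)
  have "(V #> g) #> inv u = V #> g \<longleftrightarrow> V #> (g \<otimes> inv u) #> inv g = V"
    using assms V by (metis (no_types, lifting) coset_mult_assoc coset_mult_inv1 coset_mult_inv2 coset_mult_one inv_closed m_closed r_inv)
  also have "\<dots> \<longleftrightarrow> V #> (g \<otimes> inv u \<otimes> inv g) = V"
    using assms V by (simp add: coset_mult_assoc)
  also have "\<dots> \<longleftrightarrow> g \<otimes> inv u \<otimes> inv g \<in> V"
    using assms V by (meson coset_join1 coset_join2 inv_closed m_closed)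
  also have "g \<otimes> inv u \<otimes> inv g = inv (conj_by G (inv g) u)"
    using assms by (simp add: conj_by_def inv_mult_group m_assoc)
  finally show ?thesis
    using assms by (metis conj_by_closed inv_closed inv_inv subgroup.m_inv_closed)
qed

lemma p_subgroup_conj_into_sylow:
  assumes p: "Factorial_Ring.prime p" and V: "sylow_subgroup p G V"
    and U: "subgroup U G" "card U = p ^ n"
  shows "\<exists>g\<in>carrier G. conj_by G g ` U \<subseteq> V"
proof -
  have Vs: "subgroup V G" and fin: "finite (carrier G)" using V by (auto simp: sylow_subgroup_def)
  have Uc: "U \<subseteq> carrier G" using U by (simp add: subgroup.subset)
  have "{C \<in> rcosets V. \<forall>u\<in>U. C #> inv u = C} \<noteq> {}"
    using index_not_dvd[OF p V] card_fixed_cosets_mod[OF p fin Vs U] by (metis card.empty dvd_0_right)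
  then obtain C where C: "C \<in> rcosets V" "\<forall>u\<in>U. C #> inv u = C" by auto
  then obtain g where g: "g \<in> carrier G" "C = V #> g" by (auto simp: RCOSETS_def)
  have "conj_by G (inv g) ` U \<subseteq> V"
    using C g coset_fixed_iff[OF Vs _ g(1)] Uc by (metis image_subsetI subsetD)
  then show ?thesis using g(1) by blast
qed

lemma normal_p_subgroup_in_sylow:
  assumes p: "Factorial_Ring.prime p" and V: "sylow_subgroup p G V"
    and N: "N \<lhd> G" "card N = p ^ n"
  shows "N \<subseteq> V"
proof -
  have Ns: "subgroup N G" "finite (carrier G)" using N V by (auto simp: normal_imp_subgroup sylow_subgroup_def)
  obtain g where g: "g \<in> carrier G" "conj_by G g ` N \<subseteq> V"
    using p_subgroup_conj_into_sylow[OF p V Ns(1) N(2)] by blast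
  have "conj_by G g ` N = N"
    using N(1) g Ns unfolding normal_iff_conj_by
    by (intro card_subset_eq) (auto simp: card_conj_by_image subgroup.subset finite_subset[OF subgroup.subset])
  then show ?thesis using g by simp
qed

text \<open>Normalizers grow in \<open>p\<close>-groups, in the form needed here: the cosets of \<open>U\<close> that are fixed by \<open>U\<close>
  are those in the normalizer \<open>N\<close> of \<open>U\<close>. Their number is divisible by \<open>p\<close> if the index of \<open>U\<close>
  is, so that a Sylow subgroup of \<open>N\<close> properly contains \<open>U\<close>.\<close>

lemma p_subgroup_grows:
  assumes p: "Factorial_Ring.prime p" and fin: "finite (carrier G)"
    and U: "subgroup U G" "card U = p ^ n" and ns: "\<not> sylow_subgroup p G U"
  shows "\<exists>H m. subgroup H G \<and> card H = p ^ m \<and> U \<subset> H \<and> H \<subseteq> normalizer G U"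
proof -
  have Uc: "U \<subseteq> carrier G" using U by (simp add: subgroup.subset)
  have finU: "finite U" using Uc fin finite_subset by blast
  define N where "N = normalizer G U"
  have Ns: "subgroup N G" using Uc normalizer_imp_subgroup N_def by blast
  have UN: "U \<subseteq> N" using U N_def subgroup_subset_normalizer by blast
  interpret NG: plain_group "subgrp G N" using Ns group_subgrp by (simp add: plain_group_def)
  have UsN: "subgroup U (subgrp G N)" using Ns U UN subgroup_subgrp_iff by blast
  have ne: "order G \<noteq> 0" using fin order_gt_0_iff_finite by simp
  let ?X = "rcosets U"
  have lag: "card ?X * p ^ n = order G" using lagrange U by metis
  have "p dvd card ?X"
  proof -
    have "n \<le> multiplicity p (order G)"
      using lag p ne by (metis dvd_triv_right not_prime_unit power_dvd_iff_le_multiplicity)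
    moreover have "n \<noteq> multiplicity p (order G)"
      using ns U fin is_group by (auto simp: sylow_subgroup_def)
    ultimately have "p ^ Suc n dvd order G" by (meson multiplicity_dvd' Suc_leI le_neq_implies_less)
    then have "p ^ n * p dvd p ^ n * card ?X" using lag by (simp add: mult.commute)
    then show ?thesis using p by (simp add: prime_gt_0_nat)
  qed
  moreover note card_fixed_cosets_mod[OF p fin U(1) U]
  moreover have "{C \<in> ?X. \<forall>u\<in>U. C #> inv u = C} = rcosets\<^bsub>subgrp G N\<^esub> U"
  proof -
    have "(\<forall>u\<in>U. U #> g #> inv u = U #> g) \<longleftrightarrow> inv g \<in> N" if "g \<in> carrier G" for g
    proof -
      have "(\<forall>u\<in>U. U #> g #> inv u = U #> g) \<longleftrightarrow> (\<forall>u\<in>U. conj_by G (inv g) u \<in> U)"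
        using that coset_fixed_iff[OF U(1) _ that] Uc by (metis subsetD)
      then show ?thesis
        using that Uc finU unfolding N_def by (simp add: normalizer_eq_finite image_subset_iff)
    qed
    moreover have "inv g \<in> N \<longleftrightarrow> g \<in> N" if "g \<in> carrier G" for g
      using that Ns by (metis inv_inv subgroup.m_inv_closed)
    ultimately have iff: "(\<forall>u\<in>U. U #> g #> inv u = U #> g) \<longleftrightarrow> g \<in> N" if "g \<in> carrier G" for g
      using that by simp
    have "rcosets\<^bsub>subgrp G N\<^esub> U = (#>) U ` N" "?X = (#>) U ` carrier G"
      by (auto simp: RCOSETS_def)
    moreover have "{g \<in> carrier G. \<forall>u\<in>U. U #> g #> inv u = U #> g} = N"
      using iff subgroup.subset[OF Ns] by blast
    ultimately show ?thesis by (simp only: Compr_image_eq)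
  qed
  ultimately have "p dvd card (rcosets\<^bsub>subgrp G N\<^esub> U)" by simp
  moreover have lagN: "card (rcosets\<^bsub>subgrp G N\<^esub> U) * p ^ n = card N"
    using NG.lagrange[OF UsN] U by simp
  ultimately have "p ^ Suc n dvd card N" by (metis mult_dvd_mono dvd_refl power_Suc)
  have finN: "finite N" using fin Ns finite_subset subgroup.subset by metis
  obtain H where H: "sylow_subgroup p (subgrp G N) H"
    using sylow_exists[OF p NG.is_group] finN by auto
  have "U \<lhd> subgrp G N" using normal_in_normalizer[OF U(1) Ns UN] N_def by simp
  then have UH: "U \<subseteq> H" using NG.normal_p_subgroup_in_sylow[OF p H _ U(2)] by blast
  have N0: "card N \<noteq> 0" using finN Ns subgroup.one_closed by (metis card_0_eq emptyE)
  have "n < multiplicity p (card N)"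
    using \<open>p ^ Suc n dvd card N\<close> N0 p
    by (metis Suc_le_lessD not_prime_unit power_dvd_iff_le_multiplicity)
  moreover have cH: "card H = p ^ multiplicity p (card N)" using H by (simp add: sylow_subgroup_def)
  ultimately have "card U \<noteq> card H"
    using U(2) p by (metis less_not_refl power_inject_exp prime_gt_1_nat)
  then have "U \<subset> H" using UH by auto
  moreover have "subgroup H G" "H \<subseteq> N" using H Ns subgroup_subgrp_iff by (auto simp: sylow_subgroup_def)
  ultimately show ?thesis using cH N_def by blast
qed

lemma sylow_inter_normal:
  assumes p: "Factorial_Ring.prime p" and V: "sylow_subgroup p G V" and N: "N \<lhd> G"
  shows "sylow_subgroup p (subgrp G N) (V \<inter> N)"
proof -
  have Vs: "subgroup V G" and fin: "finite (carrier G)" and cV: "card V = p ^ multiplicity p (order G)"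
    using V by (auto simp: sylow_subgroup_def)
  have Ns: "subgroup N G" using N normal_imp_subgroup by blast
  have finN: "finite N" using fin Ns finite_subset subgroup.subset by metis
  interpret NG: plain_group "subgrp G N" using Ns group_subgrp by (simp add: plain_group_def)
  obtain U where U: "sylow_subgroup p (subgrp G N) U"
    using sylow_exists[OF p NG.is_group] finN by auto
  have Us: "subgroup U G" "U \<subseteq> N" and cU: "card U = p ^ multiplicity p (card N)"
    using U Ns subgroup_subgrp_iff by (auto simp: sylow_subgroup_def)
  obtain g where g: "g \<in> carrier G" "conj_by G g ` U \<subseteq> V"
    using p_subgroup_conj_into_sylow[OF p V Us(1) cU] by blast
  have "conj_by G g ` U \<subseteq> V \<inter> N" using g Us N normal_iff_conj_by by auto
  then have le: "card U \<le> card (V \<inter> N)"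
    using card_conj_by_image[OF g(1), of U] Us finN by (metis card_mono finite_Int subgroup.subset)
  have I: "subgroup (V \<inter> N) G" using Vs Ns subgroups_Inter_pair by blast
  have "card (V \<inter> N) dvd card V" by (rule subgroup_card_dvd[OF fin I Vs]) auto
  then obtain k where k: "card (V \<inter> N) = p ^ k" using p cV divides_primepow_nat by auto
  have "card (V \<inter> N) dvd card N" by (rule subgroup_card_dvd[OF fin I Ns]) auto
  moreover have "card N \<noteq> 0" using finN Ns subgroup.one_closed by (metis card_0_eq emptyE)
  ultimately have "k \<le> multiplicity p (card N)"
    using k p by (metis not_prime_unit power_dvd_iff_le_multiplicity)
  then have "card (V \<inter> N) \<le> card U" using k cU p by (metis power_increasing prime_ge_1_nat)
  then have "card (V \<inter> N) = p ^ multiplicity p (card N)" using le cU by simp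
  then show ?thesis
    unfolding sylow_subgroup_def using I Ns finN NG.is_group subgroup_subgrp_iff by simp
qed

text \<open>\<open>O_p\<close> is defined as a greatest element. It exists because the intersection of all conjugates of
  a Sylow subgroup contains every normal \<open>p\<close>-subgroup.\<close>

lemma O_p_greatest:
  assumes p: "Factorial_Ring.prime p" and fin: "finite (carrier G)"
  shows "O_p p G \<lhd> G" "\<exists>n. card (O_p p G) = p ^ n"
    "\<And>N n. N \<lhd> G \<Longrightarrow> card N = p ^ n \<Longrightarrow> N \<subseteq> O_p p G"
proof -
  obtain V where V: "sylow_subgroup p G V" using sylow_exists[OF p is_group fin] by blast
  have Vs: "subgroup V G" and cV: "card V = p ^ multiplicity p (order G)"
    using V by (auto simp: sylow_subgroup_def)
  define C where "C = {x \<in> carrier G. \<forall>g\<in>carrier G. conj_by G g x \<in> V}"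
  have CV: "C \<subseteq> V" unfolding C_def by (auto dest: bspec[OF _ one_closed])
  have Cs: "subgroup C G"
    by standard (auto simp: C_def conj_by_mult conj_by_inv subgroup.m_closed[OF Vs]
        subgroup.one_closed[OF Vs] subgroup.m_inv_closed[OF Vs])
  have CN: "C \<lhd> G"
    unfolding normal_iff_conj_by using Cs by (auto simp: C_def conj_by_comp[symmetric])
  have cC: "\<exists>n. card C = p ^ n"
    using subgroup_card_dvd[OF fin Cs Vs CV] cV p_group_subgroup[OF p] by blast
  have max: "N \<subseteq> C" if "N \<lhd> G" "card N = p ^ n" for N n
    using normal_p_subgroup_in_sylow[OF p V that] that(1)
    unfolding normal_iff_conj_by C_def by (auto dest: subgroup.mem_carrier)
  have "O_p p G = C"
    unfolding O_p_def
  proof (rule Greatest_equality)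
    show "C \<lhd> G \<and> finite_p_group p (subgrp G C)"
      using CN cC fin Cs by (simp add: finite_p_group_subgrp_iff)
    show "N \<le> C" if "N \<lhd> G \<and> finite_p_group p (subgrp G N)" for N
      using that max fin by (metis finite_p_group_subgrp_iff normal_imp_subgroup)
  qed
  then show "O_p p G \<lhd> G" "\<exists>n. card (O_p p G) = p ^ n"
    "\<And>N n. N \<lhd> G \<Longrightarrow> card N = p ^ n \<Longrightarrow> N \<subseteq> O_p p G"
    using CN cC max by auto
qed

section \<open>Transfer and normal p-complements\<close>

lemma mult_inv_cancel:
  "\<lbrakk>x \<in> carrier G; y \<in> carrier G\<rbrakk> \<Longrightarrow> inv x \<otimes> (x \<otimes> y) = y"
  "\<lbrakk>x \<in> carrier G; y \<in> carrier G\<rbrakk> \<Longrightarrow> x \<otimes> (inv x \<otimes> y) = y"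
  by (simp_all add: m_assoc[symmetric])

lemma rcos_eq_self_mult:
  assumes "subgroup H G" "h \<in> H" "g \<in> carrier G"
  shows "H #> (h \<otimes> g) = H #> g"
  using assms coset_mult_assoc[of H h g] coset_join2[of h H] subgroup.mem_carrier[of H G h] subgroup.subset[of H G]
  by simp

text \<open>The transfer of \<open>\<lambda>\<close> can be computed from any function \<open>f\<close> with \<open>f(hg) = \<lambda>(h) f(g)\<close>. If \<open>\<lambda>\<close>
  takes the same value on elements of \<open>H\<close> that are conjugate in \<open>G\<close>, then \<open>f\<close> can be chosen to satisfy
  \<open>f(gs) = f(g) \<lambda>(s)\<close> as well, which makes the values of the transfer on \<open>H\<close> obvious. To define \<open>f\<close>,
  write \<open>g = a r b\<close> with \<open>a, b \<in> H\<close> and \<open>r\<close> the representative of the double coset, and take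
  \<open>\<lambda>(a) \<lambda>(b)\<close>: the equation \<open>a r b = c r d\<close> says that \<open>r\<close> conjugates \<open>c\<^sup>-\<^sup>1 a\<close> to \<open>d b\<^sup>-\<^sup>1\<close>, so that
  the invariance of \<open>\<lambda>\<close> is what makes this well defined.\<close>

lemma biequivariant_extension:
  assumes H: "subgroup H G" and A: "comm_group A" and lam: "lam \<in> hom (subgrp G H) A"
    and inv: "\<And>h g. \<lbrakk>h \<in> H; g \<in> carrier G; conj_by G g h \<in> H\<rbrakk> \<Longrightarrow> lam (conj_by G g h) = lam h"
  obtains f where "\<And>g. g \<in> carrier G \<Longrightarrow> f g \<in> carrier A"
    and "\<And>h g s. \<lbrakk>h \<in> H; g \<in> carrier G; s \<in> H\<rbrakk> \<Longrightarrow> f (h \<otimes> g \<otimes> s) = lam h \<otimes>\<^bsub>A\<^esub> f g \<otimes>\<^bsub>A\<^esub> lam s"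
proof -
  interpret A: comm_group A by fact
  interpret HG: group "subgrp G H" using group_subgrp H by blast
  interpret lam: group_hom "subgrp G H" A lam
    using lam by (simp add: group_hom_def group_hom_axioms_def HG.is_group A.is_group)
  have Hc: "h \<in> carrier G" if "h \<in> H" for h using that H by (simp add: subgroup.mem_carrier)
  have lc [simp]: "lam h \<in> carrier A" if "h \<in> H" for h using that lam.hom_closed by simp
  have lm: "lam (h \<otimes> k) = lam h \<otimes>\<^bsub>A\<^esub> lam k" if "h \<in> H" "k \<in> H" for h k
    using that lam.hom_mult by simp
  have Hm: "h \<otimes> k \<in> H" if "h \<in> H" "k \<in> H" for h k using that H by (simp add: subgroup.m_closed)
  have Hi: "inv h \<in> H" if "h \<in> H" for h using that H by (simp add: subgroup.m_inv_closed)
  define D where "D g = {h \<otimes> g \<otimes> s | h s. h \<in> H \<and> s \<in> H}" for g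
  define r where "r g = (SOME x. x \<in> D g)" for g
  define f where "f g = (SOME a. \<exists>h s. h \<in> H \<and> s \<in> H \<and> g = h \<otimes> r g \<otimes> s \<and> a = lam h \<otimes>\<^bsub>A\<^esub> lam s)" for g
  have D1: "D (h \<otimes> g \<otimes> s) \<subseteq> D g" if "h \<in> H" "s \<in> H" "g \<in> carrier G" for h g s
  proof
    fix x assume "x \<in> D (h \<otimes> g \<otimes> s)"
    then obtain a b where ab: "a \<in> H" "b \<in> H" "x = a \<otimes> (h \<otimes> g \<otimes> s) \<otimes> b" by (auto simp: D_def)
    then have "x = (a \<otimes> h) \<otimes> g \<otimes> (s \<otimes> b)" using that Hc by (simp add: m_assoc)
    then show "x \<in> D g" unfolding D_def using ab that Hm by blast
  qed
  have D2: "D (h \<otimes> g \<otimes> s) = D g" if "h \<in> H" "s \<in> H" "g \<in> carrier G" for h g s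
  proof
    have "g = inv h \<otimes> (h \<otimes> g \<otimes> s) \<otimes> inv s"
      using that Hc by (simp add: m_assoc mult_inv_cancel)
    then show "D g \<subseteq> D (h \<otimes> g \<otimes> s)"
      using D1[of "inv h" "inv s" "h \<otimes> g \<otimes> s"] that Hc Hi by simp
  qed (rule D1[OF that])
  have rD: "r g \<in> D g" if "g \<in> carrier G" for g
  proof -
    have "\<one> \<otimes> g \<otimes> \<one> \<in> D g" unfolding D_def using H subgroup.one_closed by blast
    then show ?thesis unfolding r_def by (rule someI)
  qed
  have rc: "r g \<in> carrier G" if "g \<in> carrier G" for g
    using rD[OF that] that Hc by (auto simp: D_def)
  have ex: "\<exists>h s. h \<in> H \<and> s \<in> H \<and> g = h \<otimes> r g \<otimes> s" if g: "g \<in> carrier G" for g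
  proof -
    obtain a b where ab: "a \<in> H" "b \<in> H" "r g = a \<otimes> g \<otimes> b" using rD[OF g] by (auto simp: D_def)
    then have "g = inv a \<otimes> r g \<otimes> inv b" using g Hc by (simp add: m_assoc mult_inv_cancel)
    then show ?thesis using ab Hi by blast
  qed
  have well: "lam a \<otimes>\<^bsub>A\<^esub> lam b = lam c \<otimes>\<^bsub>A\<^esub> lam d"
    if "a \<in> H" "b \<in> H" "c \<in> H" "d \<in> H" "x \<in> carrier G" "a \<otimes> x \<otimes> b = c \<otimes> x \<otimes> d" for a b c d x
  proof -
    have cl: "inv c \<otimes> a \<in> H" "d \<otimes> inv b \<in> H" using that Hm Hi by auto
    have "(inv c \<otimes> a) \<otimes> x = inv c \<otimes> (a \<otimes> x \<otimes> b) \<otimes> inv b"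
      using that(1-5) Hc by (simp add: m_assoc)
    also have "\<dots> = inv c \<otimes> (c \<otimes> x \<otimes> d) \<otimes> inv b"
      by (simp only: that(6))
    also have "\<dots> = x \<otimes> (d \<otimes> inv b)"
      using that(1-5) Hc by (simp add: m_assoc mult_inv_cancel)
    finally have "conj_by G x (inv c \<otimes> a) = d \<otimes> inv b"
      using conj_by_eq_iff that Hc cl by simp
    then have "lam (inv c \<otimes> a) = lam (d \<otimes> inv b)"
      using inv[of "inv c \<otimes> a" x] cl that by simp
    then have "inv\<^bsub>A\<^esub> lam c \<otimes>\<^bsub>A\<^esub> lam a = lam d \<otimes>\<^bsub>A\<^esub> inv\<^bsub>A\<^esub> lam b"
      using that Hi lm lam.hom_inv by (simp add: inv_subgrp[OF H])
    then show ?thesis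
      using that by (metis A.inv_solve_left' A.inv_solve_right A.m_assoc A.m_closed A.inv_closed lc)
  qed
  have feq: "f g = lam h \<otimes>\<^bsub>A\<^esub> lam s" if "g \<in> carrier G" "h \<in> H" "s \<in> H" "g = h \<otimes> r g \<otimes> s" for g h s
    unfolding f_def
  proof (rule some_equality)
    show "\<exists>h' s'. h' \<in> H \<and> s' \<in> H \<and> g = h' \<otimes> r g \<otimes> s' \<and> lam h \<otimes>\<^bsub>A\<^esub> lam s = lam h' \<otimes>\<^bsub>A\<^esub> lam s'"
      using that by blast
    show "a = lam h \<otimes>\<^bsub>A\<^esub> lam s"
      if "\<exists>h' s'. h' \<in> H \<and> s' \<in> H \<and> g = h' \<otimes> r g \<otimes> s' \<and> a = lam h' \<otimes>\<^bsub>A\<^esub> lam s'" for a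
      using that well rc[OF \<open>g \<in> carrier G\<close>] \<open>h \<in> H\<close> \<open>s \<in> H\<close> \<open>g = h \<otimes> r g \<otimes> s\<close> by metis
  qed
  show thesis
  proof
    show "f g \<in> carrier A" if "g \<in> carrier G" for g
      using ex[OF that] feq[OF that] by auto
    show "f (h \<otimes> g \<otimes> s) = lam h \<otimes>\<^bsub>A\<^esub> f g \<otimes>\<^bsub>A\<^esub> lam s" if "h \<in> H" and g: "g \<in> carrier G" and "s \<in> H" for h g s
    proof -
      obtain a b where ab: "a \<in> H" "b \<in> H" "g = a \<otimes> r g \<otimes> b" using ex[OF g] by blast
      have req: "r (h \<otimes> g \<otimes> s) = r g" unfolding r_def using D2 that by simp
      have "h \<otimes> g \<otimes> s = h \<otimes> (a \<otimes> r g \<otimes> b) \<otimes> s" using ab by simp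
      also have "\<dots> = (h \<otimes> a) \<otimes> r (h \<otimes> g \<otimes> s) \<otimes> (b \<otimes> s)"
        using that ab(1,2) Hc rc unfolding req by (simp add: m_assoc)
      finally have "f (h \<otimes> g \<otimes> s) = lam (h \<otimes> a) \<otimes>\<^bsub>A\<^esub> lam (b \<otimes> s)"
        using that ab Hc Hm by (intro feq) auto
      moreover have "f g = lam a \<otimes>\<^bsub>A\<^esub> lam b" using ab that by (intro feq) auto
      ultimately show ?thesis using that ab lm by (simp add: A.m_assoc)
    qed
  qed
qed

text \<open>The transfer is \<open>v(x) = \<Prod> f(gx) / f(g)\<close>, the product being taken over representatives \<open>g\<close> of the
  cosets \<open>Hg\<close>. It is multiplicative because right multiplication by \<open>x\<close> permutes the cosets. For
  \<open>h \<in> H\<close> each factor is \<open>\<lambda>(h)\<close> by the choice of \<open>f\<close>.\<close>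

theorem transfer:
  assumes fin: "finite (carrier G)" and H: "subgroup H G" and A: "comm_group A"
    and lam: "lam \<in> hom (subgrp G H) A"
    and inv: "\<And>h g. \<lbrakk>h \<in> H; g \<in> carrier G; conj_by G g h \<in> H\<rbrakk> \<Longrightarrow> lam (conj_by G g h) = lam h"
  shows "\<exists>v \<in> hom G A. \<forall>h\<in>H. v h = lam h [^]\<^bsub>A\<^esub> card (rcosets H)"
proof -
  interpret A: comm_group A by fact
  obtain f where fc: "\<And>g. g \<in> carrier G \<Longrightarrow> f g \<in> carrier A"
    and f: "\<And>h g s. \<lbrakk>h \<in> H; g \<in> carrier G; s \<in> H\<rbrakk> \<Longrightarrow> f (h \<otimes> g \<otimes> s) = lam h \<otimes>\<^bsub>A\<^esub> f g \<otimes>\<^bsub>A\<^esub> lam s"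
    using biequivariant_extension[OF H A lam inv] by metis
  have Hc: "h \<in> carrier G" if "h \<in> H" for h using that H by (simp add: subgroup.mem_carrier)
  have lc: "lam h \<in> carrier A" if "h \<in> H" for h using that lam by (auto simp: hom_def)
  have l1: "lam \<one> = \<one>\<^bsub>A\<^esub>"
    using hom_one[OF lam group_subgrp[OF H] A.is_group] by simp
  have oneH: "\<one> \<in> H" using H subgroup.one_closed by blast
  have fl: "f (h \<otimes> g) = lam h \<otimes>\<^bsub>A\<^esub> f g" if "h \<in> H" "g \<in> carrier G" for h g
    using f[OF that oneH] that Hc fc lc l1 by simp
  have fr: "f (g \<otimes> s) = f g \<otimes>\<^bsub>A\<^esub> lam s" if "s \<in> H" "g \<in> carrier G" for s g
    using f[OF oneH that(2,1)] that Hc fc lc l1 by simp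
  define c where "c C = (SOME x. x \<in> C)" for C :: "'a set"
  have c: "c C \<in> C" "c C \<in> carrier G" "C = H #> c C" if "C \<in> rcosets H" for C
  proof -
    from that obtain g where g: "g \<in> carrier G" "C = H #> g" by (auto simp: RCOSETS_def)
    then have "g \<in> C" using rcos_self H by blast
    then show *: "c C \<in> C" unfolding c_def by (rule someI)
    then show "c C \<in> carrier G" using that H subgroup.rcosets_carrier is_group by blast
    show "C = H #> c C" using * g H repr_independence by metis
  qed
  define q where "q x C = f (c C \<otimes> x) \<otimes>\<^bsub>A\<^esub> inv\<^bsub>A\<^esub> f (c C)" for x C
  have qc: "q x C \<in> carrier A" if "x \<in> carrier G" "C \<in> rcosets H" for x C
    unfolding q_def using that c fc by simp
  have qeq: "q x C = f (g \<otimes> x) \<otimes>\<^bsub>A\<^esub> inv\<^bsub>A\<^esub> f g"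
    if x: "x \<in> carrier G" and C: "C \<in> rcosets H" and g: "g \<in> C" for x C g
  proof -
    obtain h where h: "h \<in> H" "g = h \<otimes> c C" using c[OF C] g by (auto simp: r_coset_def)
    have "f (g \<otimes> x) \<otimes>\<^bsub>A\<^esub> inv\<^bsub>A\<^esub> f g = (lam h \<otimes>\<^bsub>A\<^esub> f (c C \<otimes> x)) \<otimes>\<^bsub>A\<^esub> inv\<^bsub>A\<^esub> (lam h \<otimes>\<^bsub>A\<^esub> f (c C))"
      using h fl c[OF C] x Hc by (simp add: m_assoc)
    also have "\<dots> = q x C"
    proof -
      let ?a = "f (c C)" and ?b = "f (c C \<otimes> x)" and ?l = "lam h"
      have cl: "?a \<in> carrier A" "?b \<in> carrier A" "?l \<in> carrier A" using h lc fc c[OF C] x by auto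
      then have "(?l \<otimes>\<^bsub>A\<^esub> ?b) \<otimes>\<^bsub>A\<^esub> inv\<^bsub>A\<^esub> (?l \<otimes>\<^bsub>A\<^esub> ?a) = (?l \<otimes>\<^bsub>A\<^esub> inv\<^bsub>A\<^esub> ?l) \<otimes>\<^bsub>A\<^esub> (?b \<otimes>\<^bsub>A\<^esub> inv\<^bsub>A\<^esub> ?a)"
        by (simp only: A.inv_mult A.m_ac A.inv_closed A.m_closed)
      then show ?thesis unfolding q_def using cl by simp
    qed
    finally show ?thesis by simp
  qed
  define v where "v x = finprod A (q x) (rcosets H)" for x
  have vc: "v x \<in> carrier A" if "x \<in> carrier G" for x
    unfolding v_def using qc that by (intro A.finprod_closed) auto
  have sh: "C #> x \<in> rcosets H" if "C \<in> rcosets H" "x \<in> carrier G" for C x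
    using that H by (auto simp: RCOSETS_def coset_mult_assoc subgroup.subset)
  have shinv: "(C #> x) #> inv x = C" "(C #> inv x) #> x = C" if "C \<in> rcosets H" "x \<in> carrier G" for C x
    using that subgroup.rcosets_carrier[OF H is_group that(1)] by (simp_all add: coset_mult_assoc)
  have vm: "v (x \<otimes> y) = v x \<otimes>\<^bsub>A\<^esub> v y" if x: "x \<in> carrier G" and y: "y \<in> carrier G" for x y
  proof -
    have qm: "q (x \<otimes> y) C = q x C \<otimes>\<^bsub>A\<^esub> q y (C #> x)" if C: "C \<in> rcosets H" for C
    proof -
      have "c C \<otimes> x \<in> C #> x" using c[OF C] by (auto simp: r_coset_def)
      then have "q y (C #> x) = f (c C \<otimes> x \<otimes> y) \<otimes>\<^bsub>A\<^esub> inv\<^bsub>A\<^esub> f (c C \<otimes> x)"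
        using qeq[OF y sh[OF C x]] by blast
      moreover
      let ?a = "f (c C)" and ?b = "f (c C \<otimes> x)" and ?d = "f (c C \<otimes> x \<otimes> y)"
      have cl: "?a \<in> carrier A" "?b \<in> carrier A" "?d \<in> carrier A" using fc c[OF C] x y by auto
      then have "(?b \<otimes>\<^bsub>A\<^esub> inv\<^bsub>A\<^esub> ?a) \<otimes>\<^bsub>A\<^esub> (?d \<otimes>\<^bsub>A\<^esub> inv\<^bsub>A\<^esub> ?b) = (?b \<otimes>\<^bsub>A\<^esub> inv\<^bsub>A\<^esub> ?b) \<otimes>\<^bsub>A\<^esub> (?d \<otimes>\<^bsub>A\<^esub> inv\<^bsub>A\<^esub> ?a)"
        by (simp only: A.m_ac A.inv_closed A.m_closed)
      ultimately show ?thesis unfolding q_def using cl c[OF C] x y by (simp add: m_assoc)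
    qed
    have bij: "inj_on (\<lambda>C. C #> x) (rcosets H)" "(\<lambda>C. C #> x) ` (rcosets H) = rcosets H"
    proof -
      show "inj_on (\<lambda>C. C #> x) (rcosets H)" using shinv x by (metis inj_on_inverseI)
      show "(\<lambda>C. C #> x) ` (rcosets H) = rcosets H"
        using shinv sh x by (auto simp: image_iff) (metis inv_closed)
    qed
    have "v (x \<otimes> y) = finprod A (\<lambda>C. q x C \<otimes>\<^bsub>A\<^esub> q y (C #> x)) (rcosets H)"
      unfolding v_def using qc qm sh x y by (intro A.finprod_cong') auto
    also have "\<dots> = v x \<otimes>\<^bsub>A\<^esub> finprod A (\<lambda>C. q y (C #> x)) (rcosets H)"
      unfolding v_def using qc sh x y by (intro A.finprod_multf) auto
    also have "finprod A (\<lambda>C. q y (C #> x)) (rcosets H) = v y"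
      unfolding v_def using A.finprod_reindex[of "q y" "\<lambda>C. C #> x" "rcosets H"] bij qc y by auto
    finally show ?thesis .
  qed
  have "v h = lam h [^]\<^bsub>A\<^esub> card (rcosets H)" if h: "h \<in> H" for h
  proof -
    have "q h C = lam h" if C: "C \<in> rcosets H" for C
    proof -
      have cl: "f (c C) \<in> carrier A" "lam h \<in> carrier A" using fc c[OF C] lc h by auto
      then have "(f (c C) \<otimes>\<^bsub>A\<^esub> lam h) \<otimes>\<^bsub>A\<^esub> inv\<^bsub>A\<^esub> f (c C) = lam h \<otimes>\<^bsub>A\<^esub> (f (c C) \<otimes>\<^bsub>A\<^esub> inv\<^bsub>A\<^esub> f (c C))"
        by (simp only: A.m_ac A.inv_closed A.m_closed)
      then show ?thesis unfolding q_def using fr[OF h c(2)[OF C]] cl by simp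
    qed
    then have "v h = finprod A (\<lambda>_. lam h) (rcosets H)"
      unfolding v_def using lc h by (intro A.finprod_cong') auto
    then show ?thesis using A.finprod_const[OF lc[OF h], of "rcosets H"] by (rule trans)
  qed
  moreover have "v \<in> hom G A" using vc vm by (auto simp: hom_def)
  ultimately show ?thesis by blast
qed

text \<open>Let \<open>M\<close> be of
  maximal order among the proper \<open>S\<close>-invariant subgroups of \<open>T\<close>. The number of fixed points of \<open>S\<close>
  on \<open>T/M\<close> is divisible by \<open>p\<close>, so that there is a fixed coset other than \<open>M\<close>. The fixed cosets
  form an \<open>S\<close>-invariant subgroup, which by maximality is all of \<open>T/M\<close>.
  In other words, \<open>[T, S]\<close> is a proper subgroup of \<open>T\<close>.\<close>

lemma p_group_central_quotient:
  assumes p: "Factorial_Ring.prime p" and S: "subgroup S G" "card S = p ^ n"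
    and T: "subgroup T G" "T \<subseteq> S" "T \<noteq> {\<one>}" "\<And>s t. \<lbrakk>s \<in> S; t \<in> T\<rbrakk> \<Longrightarrow> conj_by G s t \<in> T"
  obtains M where "subgroup M G" "M \<subset> T" "\<And>s t. \<lbrakk>s \<in> S; t \<in> T\<rbrakk> \<Longrightarrow> inv t \<otimes> conj_by G s t \<in> M"
proof -
  have Sc: "s \<in> carrier G" if "s \<in> S" for s using that S by (simp add: subgroup.mem_carrier)
  have Tc: "s \<in> carrier G" if "s \<in> T" for s using that T by (simp add: subgroup.mem_carrier)
  have finS: "finite S" using S(2) p by (metis card.infinite power_not_zero prime_gt_0_nat less_irrefl)
  have finT: "finite T" using finS T(2) finite_subset by blast
  define N where "N M \<longleftrightarrow> subgroup M G \<and> M \<subset> T \<and> (\<forall>s\<in>S. \<forall>t\<in>M. conj_by G s t \<in> M)" for M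
  have "N {\<one>}" unfolding N_def
    using T subgroup.one_closed[OF T(1)] triv_subgroup Sc by auto
  moreover have "\<And>M. N M \<Longrightarrow> card M < Suc (card T)"
    unfolding N_def using finT by (meson card_mono less_imp_le psubset_imp_subset le_imp_less_Suc)
  ultimately obtain M where M: "N M" and max: "\<And>M'. N M' \<Longrightarrow> card M' \<le> card M"
    using ex_has_greatest_nat[of N "{\<one>}" card "Suc (card T)"] by blast
  have Ms: "subgroup M G" and MT: "M \<subset> T" and Mn: "\<And>s t. s \<in> S \<Longrightarrow> t \<in> M \<Longrightarrow> conj_by G s t \<in> M"
    using M by (auto simp: N_def)
  have Mc: "s \<in> carrier G" if "s \<in> M" for s using that MT Tc by blast
  have Mm: "h \<otimes> k \<in> M" if "h \<in> M" "k \<in> M" for h k using that Ms by (simp add: subgroup.m_closed)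
  have Mi: "inv h \<in> M" if "h \<in> M" for h using that Ms by (simp add: subgroup.m_inv_closed)
  have Tm: "h \<otimes> k \<in> T" if "h \<in> T" "k \<in> T" for h k using that T by (simp add: subgroup.m_closed)
  have Ti: "inv h \<in> T" if "h \<in> T" for h using that T by (simp add: subgroup.m_inv_closed)
  have Si: "inv h \<in> S" if "h \<in> S" for h using that S by (simp add: subgroup.m_inv_closed)
  define Q where "Q = {t \<in> T. \<forall>s\<in>S. inv t \<otimes> conj_by G s t \<in> M}"
  have MQ: "M \<subseteq> Q" using MT Mn Mm Mi by (auto simp: Q_def)
  have Qs: "subgroup Q G"
  proof
    show "Q \<subseteq> carrier G" using Tc by (auto simp: Q_def)
    show "\<one> \<in> Q" using MQ Ms subgroup.one_closed by blast
    show "t \<otimes> u \<in> Q" if "t \<in> Q" "u \<in> Q" for t u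
    proof -
      have tu: "t \<in> T" "u \<in> T" "u \<in> S" using that T(2) by (auto simp: Q_def)
      have "inv (t \<otimes> u) \<otimes> conj_by G s (t \<otimes> u) \<in> M" if s: "s \<in> S" for s
      proof -
        have "inv (t \<otimes> u) \<otimes> conj_by G s (t \<otimes> u)
            = conj_by G u (inv t \<otimes> conj_by G s t) \<otimes> (inv u \<otimes> conj_by G s u)"
          unfolding conj_by_def using tu Tc Sc s
          by (simp add: inv_mult_group m_assoc mult_inv_cancel)
        then show ?thesis using Mm Mn \<open>t \<in> Q\<close> \<open>u \<in> Q\<close> tu s by (auto simp: Q_def)
      qed
      then show ?thesis using tu Tm by (auto simp: Q_def)
    qed
    show "inv t \<in> Q" if "t \<in> Q" for t
    proof -
      have t: "t \<in> T" "inv t \<in> S" using that T(2) Ti by (auto simp: Q_def)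
      have "inv (inv t) \<otimes> conj_by G s (inv t) \<in> M" if s: "s \<in> S" for s
      proof -
        have "inv (inv t) \<otimes> conj_by G s (inv t) = inv (conj_by G (inv t) (inv t \<otimes> conj_by G s t))"
          unfolding conj_by_def using t Tc Sc s
          by (simp add: inv_mult_group m_assoc)
        then show ?thesis using Mi Mn \<open>t \<in> Q\<close> t s by (auto simp: Q_def)
      qed
      then show ?thesis using t Ti by (auto simp: Q_def)
    qed
  qed
  have Qn: "conj_by G s t \<in> Q" if "s \<in> S" "t \<in> Q" for s t
  proof -
    have t: "t \<in> T" using that by (auto simp: Q_def)
    have "conj_by G s t = t \<otimes> (inv t \<otimes> conj_by G s t)"
      using t that Tc Sc by (simp add: m_assoc[symmetric])
    moreover have "inv t \<otimes> conj_by G s t \<in> Q" using that MQ by (auto simp: Q_def)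
    ultimately show ?thesis using Qs that(2) by (metis subgroup.m_closed)
  qed
  interpret TG: plain_group "subgrp G T" using group_subgrp T by (simp add: plain_group_def)
  have MsT: "subgroup M (subgrp G T)" using Ms MT T subgroup_subgrp_iff by auto
  let ?X = "rcosets\<^bsub>subgrp G T\<^esub> M" and ?act = "\<lambda>s C. conj_by G (inv s) ` C"
  have X: "?X = (#>) M ` T" by (auto simp: RCOSETS_def)
  have act: "conj_by G s ` (M #> t) = M #> conj_by G s t" if "s \<in> S" "t \<in> T" for s t
  proof -
    have "conj_by G s ` (M #> t) = (\<lambda>m. conj_by G s m \<otimes> conj_by G s t) ` M"
    proof -
      have "M #> t = (\<lambda>m. m \<otimes> t) ` M" by (auto simp: r_coset_def)
      then show ?thesis using that Sc Tc Mc by (simp add: image_image conj_by_mult cong: image_cong_simp)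
    qed
    also have "\<dots> = (\<lambda>m. m \<otimes> conj_by G s t) ` conj_by G s ` M" by auto
    also have "conj_by G s ` M = M"
    proof
      show "conj_by G s ` M \<subseteq> M" using Mn that by auto
      show "M \<subseteq> conj_by G s ` M"
      proof
        fix m assume m: "m \<in> M"
        then have "m = conj_by G s (conj_by G (inv s) m)" using Sc Mc that by simp
        then show "m \<in> conj_by G s ` M" using Mn Si m that by blast
      qed
    qed
    finally show ?thesis by (auto simp: r_coset_def)
  qed
  have coseteq: "M #> x = M #> t \<longleftrightarrow> x \<otimes> inv t \<in> M" if "x \<in> T" "t \<in> T" for x t
  proof
    assume "M #> x = M #> t"
    then have "x \<in> M #> t" using rcos_self[OF Tc[OF that(1)] Ms] by simp
    then show "x \<otimes> inv t \<in> M" using that Tc Mc by (auto simp: r_coset_def m_assoc)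
  next
    assume *: "x \<otimes> inv t \<in> M"
    have "x = (x \<otimes> inv t) \<otimes> t" using that Tc by (simp add: m_assoc)
    then show "M #> x = M #> t" using rcos_eq_self_mult[OF Ms * Tc[OF that(2)]] by simp
  qed
  have "p dvd card ?X \<longleftrightarrow> p dvd card {C \<in> ?X. \<forall>s\<in>carrier (subgrp G S). ?act s C = C}"
  proof (rule card_fixed_points_mod[OF p group_subgrp[OF S(1)]])
    show "order (subgrp G S) = p ^ n" using S by simp
    show "finite ?X" using finT by (simp add: X)
    show "?act s C \<in> ?X" if "s \<in> carrier (subgrp G S)" "C \<in> ?X" for s C
      using that act Si T(4) by (auto simp: X)
    show "?act \<one>\<^bsub>subgrp G S\<^esub> C = C" if C: "C \<in> ?X" for C
    proof -
      obtain t where "t \<in> T" "C = M #> t" using C by (auto simp: X)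
      then show ?thesis using act[OF subgroup.one_closed[OF S(1)], of t] Tc by simp
    qed
    show "?act (s \<otimes>\<^bsub>subgrp G S\<^esub> r) C = ?act s (?act r C)"
      if "s \<in> carrier (subgrp G S)" "r \<in> carrier (subgrp G S)" and C: "C \<in> ?X" for s r C
    proof -
      obtain t where t: "t \<in> T" "C = M #> t" using C by (auto simp: X)
      have "C \<subseteq> carrier G" using t Tc Mc by (auto simp: r_coset_def)
      then show ?thesis
        using conj_by_image_comp[of "inv r" "inv s" C] that Sc by (simp add: inv_mult_group)
    qed
  qed
  moreover have "p dvd card ?X"
  proof -
    have lag: "card ?X * card M = card T" using TG.lagrange[OF MsT] by simp
    have "card T dvd card S"
      using group.lagrange[OF group_subgrp[OF S(1)], of T] T S subgroup_subgrp_iff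
      by (metis dvd_triv_right order_subgrp)
    then have "card ?X dvd p ^ n" using lag S(2) by (metis dvd_mult_left)
    then obtain k where k: "card ?X = p ^ k" using p divides_primepow_nat by auto
    moreover have "card ?X \<noteq> 1" using lag MT finT by (metis psubset_card_mono mult_1 less_irrefl)
    ultimately show ?thesis by (cases k) auto
  qed
  moreover have "M \<in> {C \<in> ?X. \<forall>s\<in>carrier (subgrp G S). ?act s C = C}"
  proof -
    have "M = M #> \<one>" using Mc by (simp add: subsetI)
    then show ?thesis using act[of _ \<one>] Si Sc subgroup.one_closed[OF T(1)] by (auto simp: X)
  qed
  ultimately have "{C \<in> ?X. \<forall>s\<in>carrier (subgrp G S). ?act s C = C} \<noteq> {M}"
    using p by (metis card.empty card_insert_disjoint empty_iff finite.emptyI not_prime_unit One_nat_def)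
  then obtain C where C: "C \<in> ?X" "C \<noteq> M" "\<forall>s\<in>S. ?act s C = C"
    using \<open>M \<in> {C \<in> ?X. \<forall>s\<in>carrier (subgrp G S). ?act s C = C}\<close> by auto
  then obtain t where t: "t \<in> T" "C = M #> t" by (auto simp: X)
  have tQ: "t \<in> Q"
  proof -
    have "inv t \<otimes> conj_by G s t \<in> M" if s: "s \<in> S" for s
    proof -
      have "M #> conj_by G s t = M #> t" using C(3) t act[OF s t(1)] Si[OF s] Sc[OF s] by (metis inv_inv)
      then have "conj_by G s t \<otimes> inv t \<in> M" using coseteq T(4) s t by blast
      then have "conj_by G t (conj_by G s t \<otimes> inv t) \<in> M" using Mn t T(2) by blast
      moreover have "conj_by G t (conj_by G s t \<otimes> inv t) = inv t \<otimes> conj_by G s t"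
        unfolding conj_by_def[of G t] using s t Tc Sc by (simp add: m_assoc)
      ultimately show ?thesis by simp
    qed
    then show ?thesis using t by (auto simp: Q_def)
  qed
  have "t \<notin> M"
    using C(2) t coset_join2[OF Tc Ms] by auto
  then have "card M < card Q" using tQ MQ finT by (metis (no_types, lifting) Q_def finite_subset mem_Collect_eq psubsetI psubset_card_mono subsetI)
  then have "\<not> N Q" using max by (metis not_less)
  then have "Q = T" unfolding N_def using Qs Qn by (auto simp: Q_def)
  then show thesis using that[OF Ms MT] by (auto simp: Q_def)
qed

lemma card_set_mult_inter:
  assumes H: "subgroup H G" and K: "K \<lhd> G" and HK: "H \<inter> K = {\<one>}"
  shows "card (H <#> K) = card H * card K"
proof -
  have Ks: "subgroup K G" using K normal_imp_subgroup by blast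
  have Hc: "s \<in> carrier G" if "s \<in> H" for s using that H by (simp add: subgroup.mem_carrier)
  have Kc: "s \<in> carrier G" if "s \<in> K" for s using that Ks by (simp add: subgroup.mem_carrier)
  have "H <#> K = (\<lambda>(h, k). h \<otimes> k) ` (H \<times> K)" by (auto simp: set_mult_def)
  moreover have "inj_on (\<lambda>(h, k). h \<otimes> k) (H \<times> K)"
  proof (rule inj_onI, clarsimp)
    fix h k h' k' assume a: "h \<in> H" "k \<in> K" "h' \<in> H" "k' \<in> K" "h \<otimes> k = h' \<otimes> k'"
    have "inv h' \<otimes> (h \<otimes> k) \<otimes> inv k = inv h' \<otimes> (h' \<otimes> k') \<otimes> inv k" by (simp only: a(5))
    then have e: "inv h' \<otimes> h = k' \<otimes> inv k"
      using a(1-4) Hc Kc by (simp add: m_assoc mult_inv_cancel)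
    have "inv h' \<otimes> h \<in> H \<inter> K"
      using a e H Ks by (metis IntI subgroup.m_closed subgroup.m_inv_closed)
    then have "inv h' \<otimes> h = \<one>" using HK by blast
    then show "h = h' \<and> k = k'"
      using a e Hc Kc by (metis inv_closed inv_inv inv_equality r_cancel inv_equality l_inv)
  qed
  ultimately show ?thesis by (simp add: card_image card_cartesian_product)
qed

text \<open>The complement is the subgroup \<open>K\<close> generated by all elements of order prime to \<open>p\<close>. It contains a
  Sylow \<open>q\<close>-subgroup for every prime \<open>q \<noteq> p\<close>; hence the assertion is that \<open>T = S \<inter> K\<close>, a Sylow
  subgroup of \<open>K\<close>, is trivial. Otherwise \<open>T\<close> has a proper subgroup \<open>M\<close> such that \<open>S\<close> acts trivially
  on \<open>T/M\<close>. As conjugacy in \<open>K\<close> of elements of \<open>T\<close> is induced by \<open>S\<close>, the projection from \<open>T\<close> to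
  \<open>T/M\<close> is invariant and has a transfer to \<open>K\<close>. This transfer is trivial, for it maps the
  generators of \<open>K\<close> to elements of order prime to \<open>p\<close> in a \<open>p\<close>-group. But it is not trivial on
  \<open>T\<close>, since it raises the nontrivial elements of \<open>T/M\<close> to a power prime to \<open>p\<close>.\<close>

theorem frobenius_normal_complement:
  assumes p: "Factorial_Ring.prime p" and S: "sylow_subgroup p G S"
    and control: "\<And>x g. \<lbrakk>x \<in> S; g \<in> carrier G; conj_by G g x \<in> S\<rbrakk> \<Longrightarrow> \<exists>s\<in>S. conj_by G g x = conj_by G s x"
  shows "\<exists>K. K \<lhd> G \<and> coprime p (card K) \<and> S <#> K = carrier G"
proof -
  have Ss: "subgroup S G" and fin: "finite (carrier G)" and cS: "card S = p ^ multiplicity p (order G)"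
    using S by (auto simp: sylow_subgroup_def)
  have Sc: "s \<in> carrier G" if "s \<in> S" for s using that Ss by (simp add: subgroup.mem_carrier)
  define R where "R = {x \<in> carrier G. coprime p (ord x)}"
  define K where "K = generate G R"
  have Rc: "R \<subseteq> carrier G" by (auto simp: R_def)
  have Ks: "subgroup K G" unfolding K_def using Rc by (rule generate_is_subgroup)
  have RK: "R \<subseteq> K" by (auto simp: K_def intro: generate.incl)
  have Rconj: "conj_by G g x \<in> R" if "g \<in> carrier G" "x \<in> R" for g x
  proof -
    have x: "x \<in> carrier G" "coprime p (ord x)" using that by (auto simp: R_def)
    have "conj_by G g x [^] ord x = \<one>"
      using conj_by_pow[OF that(1) x(1), of "ord x"] x that by simp
    then have "ord (conj_by G g x) dvd ord x" using x that pow_eq_id by simp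
    then have "coprime p (ord (conj_by G g x))" using coprime_divisors[OF dvd_refl _ x(2)] by blast
    then show ?thesis using x that by (simp add: R_def)
  qed
  have KN: "K \<lhd> G"
    unfolding K_def
  proof (rule normal_generateI[OF Rc])
    fix h g assume "h \<in> R" "g \<in> carrier G"
    then show "g \<otimes> h \<otimes> inv g \<in> R" using Rconj[of "inv g" h] by (simp add: conj_by_def)
  qed
  interpret KG: plain_group "subgrp G K" using group_subgrp Ks by (simp add: plain_group_def)
  define T where "T = S \<inter> K"
  have TsK: "sylow_subgroup p (subgrp G K) T" unfolding T_def by (rule sylow_inter_normal[OF p S KN])
  have TsG: "subgroup T (subgrp G K)" using TsK by (simp add: sylow_subgroup_def)
  have Ts: "subgroup T G" using TsG Ks subgroup_subgrp_iff by blast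
  have Tc: "s \<in> carrier G" if "s \<in> T" for s using that Ts by (simp add: subgroup.mem_carrier)
  have finK: "finite K" using fin Ks subgroup.subset finite_subset by metis
  have Tn: "conj_by G s t \<in> T" if "s \<in> S" "t \<in> T" for s t
  proof -
    have "conj_by G s t \<in> S"
      using that Ss by (auto simp: T_def conj_by_def subgroup.m_closed subgroup.m_inv_closed)
    then show ?thesis using that KN Sc unfolding normal_iff_conj_by T_def by auto
  qed
  have T1: "T = {\<one>}"
  proof (rule ccontr)
    assume "T \<noteq> {\<one>}"
    obtain M where M: "subgroup M G" "M \<subset> T" and MT: "\<And>s t. \<lbrakk>s \<in> S; t \<in> T\<rbrakk> \<Longrightarrow> inv t \<otimes> conj_by G s t \<in> M"
      using p_group_central_quotient[OF p Ss cS Ts _ \<open>T \<noteq> {\<one>}\<close> Tn] unfolding T_def by blast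
    interpret TG: plain_group "subgrp G T" using group_subgrp Ts by (simp add: plain_group_def)
    have MsT: "subgroup M (subgrp G T)" using M Ts subgroup_subgrp_iff by auto
    have "M \<lhd> subgrp G T"
      unfolding TG.normal_iff_conj_by
    proof (intro conjI ballI MsT)
      fix t m assume "t \<in> carrier (subgrp G T)" "m \<in> M"
      then have tm: "t \<in> T" "t \<in> S" "m \<in> T" "m \<in> M" using M by (auto simp: T_def)
      have "conj_by G t m = m \<otimes> (inv m \<otimes> conj_by G t m)"
        using tm Tc by (simp add: mult_inv_cancel)
      also have "\<dots> \<in> M" using MT tm M by (simp add: subgroup.m_closed)
      finally show "conj_by (subgrp G T) t m \<in> M" using conj_by_subgrp[OF Ts] tm by simp
    qed
    then interpret MN: normal M "subgrp G T" .
    let ?A = "subgrp G T Mod M"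
    have Agrp: "group ?A" by (rule MN.factorgroup_is_group)
    have coset_eq: "M #> x = M #> y" if "x \<in> T" "y \<in> T" "inv x \<otimes> y \<in> M" for x y
    proof -
      have "x <# M = y <# M"
      proof -
        have "y = x \<otimes> (inv x \<otimes> y)" using that Tc by (simp add: mult_inv_cancel)
        then have "y \<in> x <# M" using that by (auto simp: l_coset_def)
        then show ?thesis using l_repr_independence[OF _ Tc[OF that(1)] M(1)] by blast
      qed
      moreover have "x <#\<^bsub>subgrp G T\<^esub> M = M #>\<^bsub>subgrp G T\<^esub> x" "y <#\<^bsub>subgrp G T\<^esub> M = M #>\<^bsub>subgrp G T\<^esub> y"
        using MN.coset_eq that by auto
      ultimately show ?thesis by (simp add: l_coset_def)
    qed
    have Acomm: "comm_group ?A"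
    proof (rule group.group_comm_groupI[OF Agrp])
      fix X1 X2 assume "X1 \<in> carrier ?A" "X2 \<in> carrier ?A"
      then obtain x y where xy: "x \<in> T" "y \<in> T" "X1 = M #> x" "X2 = M #> y"
        by (auto simp: carrier_FactGroup)
      have prods: "X1 \<otimes>\<^bsub>?A\<^esub> X2 = M #> (x \<otimes> y)" "X2 \<otimes>\<^bsub>?A\<^esub> X1 = M #> (y \<otimes> x)"
        using MN.rcos_sum[of x y] MN.rcos_sum[of y x] xy by simp_all
      have "inv (y \<otimes> x) \<otimes> (x \<otimes> y) = inv x \<otimes> conj_by G y x"
        using xy Tc by (simp add: conj_by_def inv_mult_group m_assoc)
      then have "inv (y \<otimes> x) \<otimes> (x \<otimes> y) \<in> M" using MT xy by (simp add: T_def)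
      then show "X1 \<otimes>\<^bsub>?A\<^esub> X2 = X2 \<otimes>\<^bsub>?A\<^esub> X1"
        unfolding prods using coset_eq xy Ts by (metis subgroup.m_closed)
    qed
    define lam where "lam = (\<lambda>x. M #> x)"
    have lam: "lam \<in> hom (subgrp (subgrp G K) T) ?A"
      using MN.r_coset_hom_Mod by (simp add: lam_def)
    have laminv: "lam (conj_by (subgrp G K) g h) = lam h"
      if hg: "h \<in> T" "g \<in> carrier (subgrp G K)" "conj_by (subgrp G K) g h \<in> T" for h g
    proof -
      have g: "g \<in> K" "g \<in> carrier G" using that Ks by (auto dest: subgroup.mem_carrier)
      have eq: "conj_by (subgrp G K) g h = conj_by G g h" using conj_by_subgrp[OF Ks g(1)] .
      obtain s where s: "s \<in> S" "conj_by G g h = conj_by G s h"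
        using control[of h g] hg g eq by (auto simp: T_def)
      show ?thesis unfolding eq s(2) lam_def
        using coset_eq[of h "conj_by G s h"] MT[OF s(1) that(1)] that(1) Tn[OF s(1) that(1)] by simp
    qed
    obtain v where v: "v \<in> hom (subgrp G K) ?A"
      and vT: "\<And>h. h \<in> T \<Longrightarrow> v h = lam h [^]\<^bsub>?A\<^esub> card (rcosets\<^bsub>subgrp G K\<^esub> T)"
      using KG.transfer[OF _ TsG Acomm lam laminv] finK by auto
    interpret A: comm_group ?A by (rule Acomm)
    interpret v: group_hom "subgrp G K" ?A v
      using v KG.is_group Agrp by (simp add: group_hom_def group_hom_axioms_def)
    have ordA: "order ?A dvd card T"
      using TG.lagrange[OF MsT] by (simp add: order_def FactGroup_def) (metis dvd_triv_left)
    have cT: "\<exists>k. card T = p ^ k" using TsK by (auto simp: sylow_subgroup_def)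
    obtain a where a: "order ?A = p ^ a" using ordA cT p divides_primepow_nat by metis
    \<comment> \<open>The transfer vanishes on the generators of \<open>K\<close>, whereas on \<open>T\<close> it is a power of the projection.\<close>
    have trivR: "v x = \<one>\<^bsub>?A\<^esub>" if "x \<in> R" for x
    proof -
      have x: "x \<in> K" "coprime p (ord x)" using that RK by (auto simp: R_def)
      have "x [^]\<^bsub>subgrp G K\<^esub> ord x = x [^] ord x" by (simp add: subgrp_def nat_pow_consistent[symmetric])
      then have "v x [^]\<^bsub>?A\<^esub> ord x = \<one>\<^bsub>?A\<^esub>"
        using v.hom_nat_pow[of x "ord x"] v.hom_one x that by (simp add: R_def)
      then have "A.ord (v x) dvd ord x" using A.pow_eq_id x by simp
      moreover have "A.ord (v x) dvd p ^ a" using A.ord_dvd_group_order[of "v x"] a x by simp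
      moreover have "coprime (p ^ a) (ord x)" using x by simp
      ultimately have "A.ord (v x) = 1" by (meson coprime_common_divisor_nat nat_dvd_1_iff_1 coprime_common_divisor)
      then show ?thesis using A.ord_eq_1 x by simp
    qed
    have "K \<subseteq> {x \<in> K. v x = \<one>\<^bsub>?A\<^esub>}"
    proof -
      have ker: "subgroup (kernel (subgrp G K) ?A v) G"
        using v.subgroup_kernel Ks subgroup_subgrp_iff by blast
      have "R \<subseteq> kernel (subgrp G K) ?A v" using trivR RK by (auto simp: kernel_def)
      then have "K \<subseteq> kernel (subgrp G K) ?A v" unfolding K_def[symmetric]
        using generate_subgroup_incl[OF _ ker] K_def by blast
      then show ?thesis by (auto simp: kernel_def)
    qed
    then have v1: "v x = \<one>\<^bsub>?A\<^esub>" if "x \<in> K" for x using that by blast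
    obtain t where t: "t \<in> T" "t \<notin> M" using M by blast
    have lt: "lam t \<in> carrier ?A" using t by (simp add: lam_def carrier_FactGroup)
    have "lam t [^]\<^bsub>?A\<^esub> card (rcosets\<^bsub>subgrp G K\<^esub> T) = \<one>\<^bsub>?A\<^esub>"
      using vT[OF t(1)] v1 t by (simp add: T_def)
    then have "A.ord (lam t) dvd card (rcosets\<^bsub>subgrp G K\<^esub> T)" using A.pow_eq_id lt by simp
    moreover have "A.ord (lam t) dvd p ^ a" using A.ord_dvd_group_order[OF lt] a by simp
    moreover have "coprime (p ^ a) (card (rcosets\<^bsub>subgrp G K\<^esub> T))"
      using KG.index_not_dvd[OF p TsK] p by (simp add: prime_imp_coprime)
    ultimately have "A.ord (lam t) = 1" by (meson coprime_common_divisor_nat nat_dvd_1_iff_1 coprime_common_divisor)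
    then have "M #> t = M" using A.ord_eq_1 lt by (simp add: lam_def)
    then show False using t Tc rcos_self M by blast
  qed
  have copK: "coprime p (card K)"
  proof -
    have "card T = 1" by (simp add: T1)
    then have "p ^ multiplicity p (card K) = 1" using TsK by (simp add: sylow_subgroup_def)
    then have "multiplicity p (card K) = 0"
      using p by (metis nat_power_eq_Suc_0_iff One_nat_def not_prime_1)
    moreover have "card K \<noteq> 0" using finK Ks subgroup.one_closed by (metis card_0_eq emptyE)
    ultimately have "\<not> p dvd card K"
      using p by (metis not_dvd_imp_multiplicity_0 prime_multiplicity_gt_zero_iff multiplicity_eq_zero_iff not_prime_unit)
    then show ?thesis using p by (simp add: prime_imp_coprime)
  qed
  \<comment> \<open>Comparing the two sides prime by prime shows that \<open>K\<close> is large enough: for \<open>q \<noteq> p\<close> it contains a Sylow \<open>q\<close>-subgroup.\<close>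
  have "order G dvd card S * card K"
  proof (rule multiplicity_le_imp_dvd)
    show "order G \<noteq> 0" using fin order_gt_0_iff_finite by simp
    fix q :: nat assume q: "Factorial_Ring.prime q"
    have K0: "card K \<noteq> 0" using finK Ks subgroup.one_closed by (metis card_0_eq emptyE)
    have S0: "card S \<noteq> 0" using cS p by simp
    show "multiplicity q (order G) \<le> multiplicity q (card S * card K)"
    proof (cases "q = p")
      case True
      have "multiplicity p (card S) = multiplicity p (order G)"
        unfolding cS using p by (simp add: multiplicity_same_power not_prime_unit)
      then show ?thesis
        using True q S0 K0 by (simp add: prime_elem_multiplicity_mult_distrib)
    next
      case False
      obtain U where U: "sylow_subgroup q G U" using sylow_exists[OF q is_group fin] by blast
      then have Us: "subgroup U G" and cU: "card U = q ^ multiplicity q (order G)"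
        by (auto simp: sylow_subgroup_def)
      have "U \<subseteq> R"
      proof
        fix u assume u: "u \<in> U"
        have uc: "u \<in> carrier G" using u Us subgroup.mem_carrier by metis
        interpret U: group "subgrp G U" using group_subgrp Us .
        have "u [^]\<^bsub>subgrp G U\<^esub> card U = \<one>"
          using U.pow_order_eq_1[of u] u by simp
        then have "u [^] card U = \<one>" by (simp add: subgrp_def nat_pow_consistent[symmetric])
        then have "ord u dvd q ^ multiplicity q (order G)" using pow_eq_id uc cU by metis
        moreover have "coprime p (q ^ multiplicity q (order G))"
          using p q False by (simp add: primes_coprime)
        ultimately have "coprime p (ord u)" using coprime_divisors[OF dvd_refl] by blast
        then show "u \<in> R" using uc by (simp add: R_def)
      qed
      then have "card U dvd card K" using subgroup_card_dvd[OF fin Us Ks] RK by blast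
      then have "q ^ multiplicity q (order G) dvd card S * card K" using cU by simp
      then show ?thesis using q S0 K0
        by (meson mult_eq_0_iff multiplicity_geI not_prime_unit)
    qed
  qed
  moreover have cSK: "card (S <#> K) = card S * card K"
    by (rule card_set_mult_inter[OF Ss KN]) (use T1 T_def in simp)
  moreover have SKc: "S <#> K \<subseteq> carrier G" using Ss Ks subgroup.subset setmult_subset_G by blast
  moreover have "card S * card K \<noteq> 0"
    using finK Ks subgroup.one_closed cS p by (metis card_0_eq emptyE mult_eq_0_iff power_not_zero not_prime_0)
  ultimately have "order G \<le> card (S <#> K)" by (simp add: dvd_imp_le)
  then have "S <#> K = carrier G" using SKc fin by (intro card_seteq) (auto simp: order_def)
  then show ?thesis using KN copK by blast
qed

section \<open>Groups of characteristic p\<close>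

lemma ord_dvd_card_subgroup:
  assumes "subgroup H G" "x \<in> H" "finite H"
  shows "ord x dvd card H"
proof -
  interpret H: group "subgrp G H" using group_subgrp assms by blast
  have "x [^]\<^bsub>subgrp G H\<^esub> card H = \<one>"
    using H.pow_order_eq_1[of x] assms by simp
  then have "x [^] card H = \<one>" by (simp add: subgrp_def nat_pow_consistent[symmetric])
  then show ?thesis using pow_eq_id assms subgroup.mem_carrier by metis
qed

text \<open>An element of order prime to \<open>p\<close> has trivial image in \<open>G/K\<close>, a quotient of \<open>S\<close>. So a normal
  complement of a \<open>p\<close>-subgroup is determined by \<open>G\<close>, and is invariant under all automorphisms.\<close>

lemma normal_complement_eq:
  assumes p: "Factorial_Ring.prime p" and fin: "finite (carrier G)"
    and S: "subgroup S G" "card S = p ^ n" and K: "K \<lhd> G" "coprime p (card K)" "S <#> K = carrier G"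
  shows "K = {x \<in> carrier G. coprime p (ord x)}"
proof -
  interpret K: normal K G by fact
  have finK: "finite K" "finite S" using fin K.subset S subgroup.subset finite_subset by metis+
  have copK: "coprime p (ord x)" if "x \<in> K" for x
    using ord_dvd_card_subgroup[OF K.subgroup_axioms that finK(1)] K(2) coprime_divisors[OF dvd_refl] by blast
  have "x \<in> K" if x: "x \<in> carrier G" "coprime p (ord x)" for x
  proof -
    have "x \<in> S <#> K" using x K(3) by simp
    then obtain s k where sk: "s \<in> S" "k \<in> K" "x = s \<otimes> k" by (auto simp: set_mult_def)
    have sc: "s \<in> carrier G" "k \<in> carrier G" using sk S subgroup.mem_carrier K.mem_carrier by metis+
    interpret Q: group "G Mod K" by (rule K.factorgroup_is_group)
    interpret h: group_hom G "G Mod K" "\<lambda>a. K #> a"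
      using K.r_coset_hom_Mod by (simp add: group_hom_def group_hom_axioms_def Q.is_group)
    have "K #> k = K" using coset_join2[OF sc(2) K.subgroup_axioms sk(2)] .
    then have xs: "K #> x = K #> s"
      using h.hom_mult[OF sc] Q.r_one[of "K #> s"] sk sc by (simp add: carrier_FactGroup)
    have xc: "K #> x \<in> carrier (G Mod K)" "K #> s \<in> carrier (G Mod K)"
      using x sc by (auto simp: carrier_FactGroup)
    have "s [^] (p ^ n) = \<one>"
      using ord_dvd_card_subgroup[OF S(1) sk(1) finK(2)] S(2) pow_eq_id[OF sc(1)] by simp
    then have "(K #> s) [^]\<^bsub>G Mod K\<^esub> (p ^ n) = \<one>\<^bsub>G Mod K\<^esub>"
      using h.hom_nat_pow[OF sc(1), of "p ^ n"] h.hom_one by metis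
    then have "Q.ord (K #> x) dvd p ^ n" using Q.pow_eq_id xc xs by metis
    moreover have "x [^] ord x = \<one>" using x by simp
    then have "(K #> x) [^]\<^bsub>G Mod K\<^esub> (ord x) = \<one>\<^bsub>G Mod K\<^esub>"
      using h.hom_nat_pow[OF x(1), of "ord x"] h.hom_one by metis
    then have "Q.ord (K #> x) dvd ord x" using Q.pow_eq_id xc xs by metis
    moreover have "coprime (p ^ n) (ord x)" using x by simp
    ultimately have "Q.ord (K #> x) = 1" by (meson coprime_common_divisor_nat nat_dvd_1_iff_1 coprime_common_divisor)
    then have "K #> x = K" using Q.ord_eq_1 xc by simp
    then show "x \<in> K" using rcos_self[OF x(1) K.subgroup_axioms] by simp
  qed
  then show ?thesis using copK K.subset by blast
qed

text \<open>A normal subgroup of order prime to \<open>p\<close> consists of elements of order prime to \<open>p\<close>, and these all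
  lie in \<open>K\<close>.\<close>

lemma O_p'_eq_complement:
  assumes p: "Factorial_Ring.prime p" and fin: "finite (carrier G)"
    and S: "subgroup S G" "card S = p ^ n" and K: "K \<lhd> G" "coprime p (card K)" "S <#> K = carrier G"
  shows "O_p' p G = K"
  unfolding O_p'_def
proof (rule Greatest_equality)
  show "K \<lhd> G \<and> coprime p (card K)" using K by simp
  fix N assume N: "N \<lhd> G \<and> coprime p (card N)"
  then have Ns: "subgroup N G" "finite N"
    using normal_imp_subgroup fin subgroup.subset finite_subset by metis+
  have "coprime p (ord x)" if "x \<in> N" for x
    using ord_dvd_card_subgroup[OF Ns(1) that Ns(2)] N coprime_divisors[OF dvd_refl] by blast
  then show "N \<le> K"
    unfolding normal_complement_eq[OF p fin S K] using Ns subgroup.subset by blast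
qed

text \<open>\<open>K\<close> and \<open>O\<^sub>p(G)\<close> are normal and intersect trivially, so they commute; hence \<open>K\<close> lies in the
  centralizer of \<open>O\<^sub>p(G)\<close>, which is contained in \<open>O\<^sub>p(G)\<close>.\<close>

lemma characteristic_p_coprime_normal_trivial:
  assumes p: "Factorial_Ring.prime p" and G: "characteristic_p p G" and K: "K \<lhd> G" "coprime p (card K)"
  shows "K = {\<one>}"
proof -
  have fin: "finite (carrier G)" and C: "centralizer G (O_p p G) \<subseteq> O_p p G"
    using G by (auto simp: characteristic_p_def)
  note O = O_p_greatest[OF p fin]
  obtain n where n: "card (O_p p G) = p ^ n" using O(2) by blast
  have Ks: "subgroup K G" "subgroup (O_p p G) G" using K O normal_imp_subgroup by auto
  have I: "subgroup (K \<inter> O_p p G) G" using Ks subgroups_Inter_pair by blast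
  have "card (K \<inter> O_p p G) dvd card K" "card (K \<inter> O_p p G) dvd p ^ n"
    using subgroup_card_dvd[OF fin I Ks(1)] subgroup_card_dvd[OF fin I Ks(2)] n by auto
  moreover have "coprime (card K) (p ^ n)" using K(2) by (simp add: coprime_commute)
  ultimately have "card (K \<inter> O_p p G) = 1" by (meson coprime_common_divisor_nat nat_dvd_1_iff_1 coprime_common_divisor)
  then have triv: "K \<inter> O_p p G = {\<one>}"
    using I subgroup.one_closed by (metis card_1_singletonE singletonD)
  have "K \<subseteq> centralizer G (O_p p G)"
  proof
    fix k assume k: "k \<in> K"
    have "k \<otimes> x = x \<otimes> k" if "x \<in> O_p p G" for x
    proof -
      have kc: "k \<in> carrier G" "x \<in> carrier G" using k that Ks subgroup.mem_carrier by metis+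
      define c where "c = inv k \<otimes> conj_by G x k"
      have "c \<in> K" unfolding c_def
        using K(1) k kc unfolding normal_iff_conj_by by (simp add: subgroup.m_closed subgroup.m_inv_closed)
      moreover have "c = conj_by G k (inv x) \<otimes> x"
        unfolding c_def conj_by_def using kc by (simp add: m_assoc)
      then have "c \<in> O_p p G"
        using O(1) that kc unfolding normal_iff_conj_by by (simp add: subgroup.m_closed subgroup.m_inv_closed)
      ultimately have "c = \<one>" using triv by blast
      then have "conj_by G x k = k" unfolding c_def using kc
        by (metis conj_by_closed inv_closed inv_equality inv_inv)
      then show ?thesis using kc conj_by_eq_iff by simp
    qed
    then show "k \<in> centralizer G (O_p p G)" using k Ks subgroup.mem_carrier by (auto simp: centralizer_def)
  qed
  then show ?thesis using triv C by blast
qed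

text \<open>Both \<open>Q\<close> and \<open>E\<close> lie in \<open>O\<^sub>p(G)\<close>, so \<open>C\<^sub>G(O\<^sub>p(G)) \<le> C\<^sub>G(Q) \<le> E \<le> O\<^sub>p(G)\<close>. It is applied with
  \<open>Q\<close> the image of an object \<open>P\<close> and \<open>E = E(P)\<close>.\<close>

lemma characteristic_pI:
  assumes p: "Factorial_Ring.prime p" and fin: "finite (carrier G)"
    and Q: "Q \<lhd> G" "card Q = p ^ n" and E: "E \<lhd> G" "card E = p ^ m" and C: "centralizer G Q \<subseteq> E"
  shows "characteristic_p p G"
proof -
  note O = O_p_greatest[OF p fin]
  have "centralizer G (O_p p G) \<subseteq> centralizer G Q"
    using O(3)[OF Q] by (auto simp: centralizer_def)
  then show ?thesis using C O(3)[OF E] is_group fin by (auto simp: characteristic_p_def)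
qed

end

lemma iso_O_p:
  assumes p: "Factorial_Ring.prime p" and G: "plain_group G" "finite (carrier G)" and H: "plain_group H"
    and h: "h \<in> iso G H"
  shows "O_p p H = h ` O_p p G"
proof -
  interpret G: plain_group G by fact
  interpret H: plain_group H by fact
  have h1: "h ` carrier G = carrier H" "inj_on h (carrier G)" "h \<in> hom G H"
    using h by (auto simp: iso_def bij_betw_def)
  have finH: "finite (carrier H)" using h1(1) G(2) by (metis finite_imageI)
  note O = G.O_p_greatest[OF p G(2)]
  have step: "f ` N \<lhd> K \<and> card (f ` N) = card N" if "f \<in> iso J K" "group J" "group K" "N \<lhd> J"
    for f :: "'x \<Rightarrow> 'y" and J :: "'x monoid" and K :: "'y monoid" and N
  proof -
    have "N \<subseteq> carrier J" using that normal_imp_subgroup subgroup.subset by blast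
    moreover have "inj_on f (carrier J)" using that(1) by (simp add: iso_def bij_betw_def)
    ultimately have "inj_on f N" using inj_on_subset by blast
    then show ?thesis using iso_normal_subgroup[OF that] card_image by blast
  qed
  show ?thesis
    unfolding O_p_def[of p H]
  proof (rule Greatest_equality)
    have *: "h ` O_p p G \<lhd> H" "card (h ` O_p p G) = card (O_p p G)"
      using step[OF h G.is_group H.is_group O(1)] by auto
    then show "h ` O_p p G \<lhd> H \<and> finite_p_group p (subgrp H (h ` O_p p G))"
      using O(2) by (simp add: H.finite_p_group_subgrp_iff finH normal_imp_subgroup)
    fix N assume N: "N \<lhd> H \<and> finite_p_group p (subgrp H N)"
    then obtain n where n: "card N = p ^ n"
      using H.finite_p_group_subgrp_iff finH normal_imp_subgroup by blast
    let ?g = "inv_into (carrier G) h"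
    have g: "?g \<in> iso H G" using G.iso_set_sym[OF h] .
    have "?g ` N \<lhd> G" "card (?g ` N) = p ^ n" using step[OF g H.is_group G.is_group] N n by auto
    then have "?g ` N \<subseteq> O_p p G" using O(3) by blast
    then have "h ` ?g ` N \<subseteq> h ` O_p p G" by blast
    moreover have "N \<subseteq> carrier H" using N normal_imp_subgroup subgroup.subset by blast
    then have "h ` ?g ` N = N" using h1 by (simp add: image_inv_into_cancel)
    ultimately show "N \<le> h ` O_p p G" by simp
  qed
qed

lemma iso_characteristic_p:
  assumes p: "Factorial_Ring.prime p" and H: "group H" and h: "h \<in> iso G H" and G: "characteristic_p p G"
  shows "characteristic_p p H"
proof -
  have grp: "group G" "finite (carrier G)" and C: "centralizer G (O_p p G) \<subseteq> O_p p G"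
    using G by (auto simp: characteristic_p_def)
  interpret G: plain_group G using grp by (simp add: plain_group_def)
  interpret H: plain_group H using H by (simp add: plain_group_def)
  have h1: "h ` carrier G = carrier H" "inj_on h (carrier G)" "h \<in> hom G H"
    using h by (auto simp: iso_def bij_betw_def)
  have Oc: "O_p p G \<subseteq> carrier G"
    using G.O_p_greatest(1)[OF p grp(2)] normal_imp_subgroup subgroup.subset by blast
  have "centralizer H (O_p p H) \<subseteq> O_p p H"
    unfolding iso_O_p[OF p G.plain_group_axioms grp(2) H.plain_group_axioms h]
  proof
    fix y assume y: "y \<in> centralizer H (h ` O_p p G)"
    then obtain x where x: "x \<in> carrier G" "y = h x" using h1 by (auto simp: centralizer_def)
    have "x \<otimes>\<^bsub>G\<^esub> z = z \<otimes>\<^bsub>G\<^esub> x" if z: "z \<in> O_p p G" for z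
    proof -
      have zc: "z \<in> carrier G" using z Oc by blast
      have "h (x \<otimes>\<^bsub>G\<^esub> z) = h (z \<otimes>\<^bsub>G\<^esub> x)"
        using y z x zc h1(3) by (auto simp: centralizer_def hom_mult)
      then show ?thesis using h1(2) x zc by (simp add: inj_on_eq_iff)
    qed
    then have "x \<in> centralizer G (O_p p G)" using x by (auto simp: centralizer_def)
    then show "y \<in> h ` O_p p G" using C x by blast
  qed
  moreover have "finite (carrier H)" using h1 grp(2) by (metis finite_imageI)
  ultimately show ?thesis using H by (simp add: characteristic_p_def)
qed

context plain_group
begin

lemma centralizer_normal:
  assumes N: "N \<lhd> G" shows "centralizer G N \<lhd> G"
proof -
  have Ns: "subgroup N G" using N normal_imp_subgroup by blast
  have Nc: "x \<in> carrier G" if "x \<in> N" for x using that Ns subgroup.mem_carrier by metis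
  have C: "centralizer G N = {g \<in> carrier G. \<forall>x\<in>N. conj_by G x g = g}"
    unfolding centralizer_def using Nc by (auto simp: conj_by_eq_iff)
  have "subgroup (centralizer G N) G"
    unfolding C by standard (use Nc in \<open>auto simp: conj_by_mult conj_by_inv\<close>)
  moreover have "conj_by G g c \<in> centralizer G N" if g: "g \<in> carrier G" and c: "c \<in> centralizer G N" for g c
  proof -
    have cc: "c \<in> carrier G" using c by (simp add: C)
    have "conj_by G g c \<otimes> x = x \<otimes> conj_by G g c" if x: "x \<in> N" for x
    proof -
      define y where "y = conj_by G (inv g) x"
      have y: "y \<in> N" "y \<in> carrier G" unfolding y_def using N x g Nc unfolding normal_iff_conj_by by auto
      have "x = conj_by G g y" unfolding y_def using g x Nc by simp
      moreover have "c \<otimes> y = y \<otimes> c" using c y by (simp add: centralizer_def)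
      ultimately show ?thesis using conj_by_mult[OF g] cc y by metis
    qed
    then show ?thesis using g cc by (simp add: centralizer_def)
  qed
  ultimately show ?thesis unfolding normal_iff_conj_by by blast
qed

end

section \<open>Morphisms of fusion systems and of transporter systems\<close>

lemma Aut_T_mult_eq: "x \<otimes>\<^bsub>Aut_T T P\<^esub> y = tcomp T x y" "\<one>\<^bsub>Aut_T T P\<^esub> = tid T P"
  by (simp_all add: Aut_T_def units_of_def)

text \<open>Composition is written from left to right, as in \<open>tcomp\<close>. The morphism \<open>inc P Q\<close> plays the role
  of an inclusion, and \<open>el P\<close> embeds \<open>N\<^sub>S(P)\<close> into the automorphism group of \<open>P\<close>.\<close>

locale prime_transporter_system = transporter_system p S F T
  for p :: nat and S :: "'a monoid" and F :: "'a fusion" and T :: "('a, 'm) transporter" +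
  assumes prime_p: "Factorial_Ring.prime p"
begin

abbreviation cmp (infixl "\<star>" 70) where "\<phi> \<star> \<psi> \<equiv> tcomp T \<phi> \<psi>"
abbreviation inc where "inc P Q \<equiv> eps T P Q \<one>\<^bsub>S\<^esub>"
abbreviation el where "el P \<equiv> eps T P P"

sublocale S: plain_group S
  using S_p_group by (simp add: plain_group_def finite_p_group_def)

lemma finite_S: "finite (carrier S)"
  using S_p_group by (simp add: finite_p_group_def)

lemma p_group_S: "\<exists>n. card (carrier S) = p ^ n"
  using S_p_group by (simp add: finite_p_group_def order_def)

lemma card_subgroup_S: "subgroup H S \<Longrightarrow> \<exists>n. card H = p ^ n"
  using S.subgroup_card_dvd[OF finite_S _ S.subgroup_self] p_group_subgroup[OF prime_p] p_group_S
    subgroup.subset by metis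

lemma finite_subgroup_S: "subgroup H S \<Longrightarrow> finite H"
  using finite_S subgroup.subset finite_subset by metis

lemma subgroup_normalizer: "subgroup P S \<Longrightarrow> subgroup (normalizer S P) S"
  by (simp add: S.normalizer_imp_subgroup subgroup.subset)

lemma F_subgroups: "\<phi> \<in> F P Q \<Longrightarrow> subgroup P S \<and> subgroup Q S"
  using objects by blast

lemma F_hom:
  assumes "\<phi> \<in> F P Q"
  shows "\<phi> \<in> extensional P" "\<And>x. x \<in> P \<Longrightarrow> \<phi> x \<in> Q" "inj_on \<phi> P"
    "\<And>x y. \<lbrakk>x \<in> P; y \<in> P\<rbrakk> \<Longrightarrow> \<phi> (x \<otimes>\<^bsub>S\<^esub> y) = \<phi> x \<otimes>\<^bsub>S\<^esub> \<phi> y"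
  using mono_homs[of P Q] assms by (auto simp: mon_def hom_def)

lemma F_incl: "\<lbrakk>subgroup A S; subgroup B S; A \<subseteq> B\<rbrakk> \<Longrightarrow> (\<lambda>x\<in>A. x) \<in> F A B"
proof -
  assume A: "subgroup A S" "subgroup B S" "A \<subseteq> B"
  have "conj_by S \<one>\<^bsub>S\<^esub> ` A \<subseteq> B" using A subgroup.mem_carrier[OF A(1)] by auto
  then have "conj_map S \<one>\<^bsub>S\<^esub> A \<in> F A B" using conj_in A by blast
  moreover have "conj_map S \<one>\<^bsub>S\<^esub> A = (\<lambda>x\<in>A. x)"
    unfolding conj_map_def using subgroup.mem_carrier[OF A(1)] by (intro restrict_ext) simp
  ultimately show ?thesis by simp
qed

lemma F_restrict:
  assumes "\<phi> \<in> F P Q" "subgroup A S" "A \<subseteq> P" "subgroup B S" "\<phi> ` A \<subseteq> B"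
  shows "restrict \<phi> A \<in> F A B"
proof -
  have "compose A \<phi> (\<lambda>x\<in>A. x) \<in> F A Q"
    using comp_in[OF F_incl[OF assms(2) _ assms(3)] assms(1)] F_subgroups[OF assms(1)] by blast
  moreover have "compose A \<phi> (\<lambda>x\<in>A. x) = restrict \<phi> A"
    by (auto simp: compose_def)
  ultimately have *: "restrict \<phi> A \<in> F A Q" by simp
  then have i: "restrict \<phi> A \<in> F A (\<phi> ` A)"
    using iso_onto_image by fastforce
  then have "compose A (\<lambda>x\<in>\<phi> ` A. x) (restrict \<phi> A) \<in> F A B"
    using comp_in[OF i F_incl[OF _ assms(4,5)]] F_subgroups[OF i] by blast
  moreover have "compose A (\<lambda>x\<in>\<phi> ` A. x) (restrict \<phi> A) = restrict \<phi> A"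
    by (auto simp: compose_def)
  ultimately show ?thesis by simp
qed

lemma F_image: "\<phi> \<in> F P Q \<Longrightarrow> subgroup (\<phi> ` P) S \<and> \<phi> \<in> F P (\<phi> ` P)"
  using iso_onto_image F_subgroups by blast

lemma conjugates_self: "subgroup P S \<Longrightarrow> P \<in> conjugates S F P"
  using F_incl[OF _ S.subgroup_self subgroup.subset, of P] unfolding conjugates_def
  by (force intro!: exI[of _ "\<lambda>x\<in>P. x"])

lemma conjugates_subgroup: "Q \<in> conjugates S F P \<Longrightarrow> subgroup P S \<and> subgroup Q S"
  using F_image F_subgroups unfolding conjugates_def by blast

lemma conjugates_card: "Q \<in> conjugates S F P \<Longrightarrow> card Q = card P"
  using F_hom(3) card_image unfolding conjugates_def by blast

lemma conjugatesE:
  assumes "Q \<in> conjugates S F P"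
  obtains \<phi> where "\<phi> \<in> F P Q" "\<phi> ` P = Q"
  using assms F_image unfolding conjugates_def by blast

lemma conjugatesI: "\<phi> \<in> F P Q \<Longrightarrow> \<phi> ` P \<in> conjugates S F P"
proof -
  assume "\<phi> \<in> F P Q"
  then have i: "\<phi> \<in> F P (\<phi> ` P)" "subgroup (\<phi> ` P) S" "subgroup P S" using F_image F_subgroups by auto
  have "restrict \<phi> P \<in> F P (carrier S)"
    using F_restrict[OF i(1,3) subset_refl S.subgroup_self] i(2) subgroup.subset by blast
  then show ?thesis unfolding conjugates_def by (force intro!: exI[of _ "restrict \<phi> P"])
qed

lemma conjugates_sym: "Q \<in> conjugates S F P \<Longrightarrow> P \<in> conjugates S F Q"
proof -
  assume "Q \<in> conjugates S F P"
  then obtain \<phi> where f: "\<phi> \<in> F P Q" "\<phi> ` P = Q" by (rule conjugatesE)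
  have "restrict (inv_into P \<phi>) (\<phi> ` P) \<in> F (\<phi> ` P) P" using iso_onto_image f by blast
  from conjugatesI[OF this] show ?thesis
    using f(2) inv_into_image_cancel[OF F_hom(3)[OF f(1)] subset_refl] by simp
qed

lemma conjugates_trans: "\<lbrakk>Q \<in> conjugates S F P; R \<in> conjugates S F Q\<rbrakk> \<Longrightarrow> R \<in> conjugates S F P"
proof -
  assume "Q \<in> conjugates S F P" "R \<in> conjugates S F Q"
  then obtain \<phi> \<psi> where f: "\<phi> \<in> F P Q" "\<phi> ` P = Q" "\<psi> \<in> F Q R" "\<psi> ` Q = R" by (meson conjugatesE)
  from conjugatesI[OF comp_in[OF f(1,3)]] show ?thesis using f by (simp add: compose_def image_comp[symmetric] image_image) (metis image_image)
qed

lemma exists_fully_normalized: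
  assumes "subgroup P S"
  obtains Q where "Q \<in> conjugates S F P" "Q \<in> fully_normalized S F"
proof -
  have "card (normalizer S Q) < Suc (card (carrier S))" if "Q \<in> conjugates S F P" for Q
    using that conjugates_subgroup subgroup_normalizer finite_S subgroup.subset
    by (metis card_mono less_Suc_eq_le)
  then obtain Q where Q: "Q \<in> conjugates S F P"
      "\<And>R. R \<in> conjugates S F P \<Longrightarrow> card (normalizer S R) \<le> card (normalizer S Q)"
    using ex_has_greatest_nat[of "\<lambda>Q. Q \<in> conjugates S F P" P "\<lambda>Q. card (normalizer S Q)" "Suc (card (carrier S))"]
      conjugates_self[OF assms] by blast
  then have "Q \<in> fully_normalized S F"
    unfolding fully_normalized_def using conjugates_subgroup conjugates_trans by blast
  then show thesis using that Q by blast
qed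

lemma thomD: "\<phi> \<in> thom T P Q \<Longrightarrow> P \<in> ob T \<and> Q \<in> ob T"
  using src_tgt by (auto simp: thom_def)

lemma transporter_set_self: "P \<in> ob T \<Longrightarrow> transporter_set S P P = normalizer S P"
  using ob_subgroups[of P] S.normalizer_eq_finite[of P] finite_subgroup_S
  by (auto simp: transporter_set_def subgroup.subset)

lemma one_transporter: "\<lbrakk>P \<in> ob T; P \<subseteq> Q\<rbrakk> \<Longrightarrow> \<one>\<^bsub>S\<^esub> \<in> transporter_set S P Q"
  using ob_subgroups[of P] by (auto simp: transporter_set_def subgroup.mem_carrier)

lemma inc_in: "\<lbrakk>P \<in> ob T; Q \<in> ob T; P \<subseteq> Q\<rbrakk> \<Longrightarrow> inc P Q \<in> thom T P Q"
  using eps_in one_transporter by blast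

lemma rho_inc: "\<lbrakk>P \<in> ob T; Q \<in> ob T; P \<subseteq> Q; x \<in> P\<rbrakk> \<Longrightarrow> rho T (inc P Q) x = x"
  using rho_eps[of P Q "\<one>\<^bsub>S\<^esub>"] one_transporter ob_subgroups[of P]
  by (simp add: conj_map_def subgroup.mem_carrier)

lemma el_in: "\<lbrakk>P \<in> ob T; g \<in> normalizer S P\<rbrakk> \<Longrightarrow> el P g \<in> thom T P P"
  using eps_in transporter_set_self by blast

lemma normalizer_carrier: "P \<in> ob T \<Longrightarrow> g \<in> normalizer S P \<Longrightarrow> g \<in> carrier S"
  using subgroup.mem_carrier[OF subgroup_normalizer[OF ob_subgroups]] by blast

lemma mem_normalizer: "P \<in> ob T \<Longrightarrow> g \<in> P \<Longrightarrow> g \<in> normalizer S P"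
  using S.subgroup_subset_normalizer ob_subgroups by blast

lemma rho_el: "\<lbrakk>P \<in> ob T; g \<in> normalizer S P; x \<in> P\<rbrakk> \<Longrightarrow> rho T (el P g) x = conj_by S g x"
  using rho_eps[of P P g] transporter_set_self by (simp add: conj_map_def)

lemma el_mult: "\<lbrakk>P \<in> ob T; g \<in> normalizer S P; h \<in> normalizer S P\<rbrakk> \<Longrightarrow> el P (g \<otimes>\<^bsub>S\<^esub> h) = el P g \<star> el P h"
  using eps_mult transporter_set_self by blast

lemma el_inj: "\<lbrakk>P \<in> ob T; g \<in> normalizer S P; h \<in> normalizer S P; el P g = el P h\<rbrakk> \<Longrightarrow> g = h"
  using eps_inj[of P P] transporter_set_self by (auto dest: inj_onD)

lemma el_inc:
  assumes "P \<in> ob T" "Q \<in> ob T" "P \<subseteq> Q" "g \<in> normalizer S P" "g \<in> normalizer S Q"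
  shows "el P g \<star> inc P Q = inc P Q \<star> el Q g" "el P g \<star> inc P Q = eps T P Q g"
proof -
  have g: "g \<in> carrier S" using assms normalizer_carrier by blast
  have "eps T P Q (g \<otimes>\<^bsub>S\<^esub> \<one>\<^bsub>S\<^esub>) = el P g \<star> inc P Q"
    using assms one_transporter transporter_set_self by (intro eps_mult) auto
  moreover have "eps T P Q (\<one>\<^bsub>S\<^esub> \<otimes>\<^bsub>S\<^esub> g) = inc P Q \<star> el Q g"
    using assms one_transporter transporter_set_self by (intro eps_mult) auto
  ultimately show "el P g \<star> inc P Q = inc P Q \<star> el Q g" "el P g \<star> inc P Q = eps T P Q g" using g by simp_all
qed

lemma rho_comp: "\<lbrakk>\<phi> \<in> thom T P Q; \<psi> \<in> thom T Q R; x \<in> P\<rbrakk> \<Longrightarrow> rho T (\<phi> \<star> \<psi>) x = rho T \<psi> (rho T \<phi> x)"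
  by (simp add: rho_tcomp compose_def)

lemma rho_mem: "\<lbrakk>\<phi> \<in> thom T P Q; x \<in> P\<rbrakk> \<Longrightarrow> rho T \<phi> x \<in> Q"
  using rho_in F_hom(2) by blast

lemma rho_inj: "\<phi> \<in> thom T P Q \<Longrightarrow> inj_on (rho T \<phi>) P"
  using rho_in F_hom(3) by blast

lemma rho_eqI: "\<lbrakk>\<phi> \<in> thom T P Q; \<psi> \<in> thom T P R; \<And>x. x \<in> P \<Longrightarrow> rho T \<phi> x = rho T \<psi> x\<rbrakk> \<Longrightarrow> rho T \<phi> = rho T \<psi>"
  using F_hom(1)[OF rho_in[of \<phi> P Q]] F_hom(1)[OF rho_in[of \<psi> P R]] by (intro extensionalityI)

lemma E_T_in: "e \<in> E_T T P \<Longrightarrow> e \<in> thom T P P"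
  by (simp add: E_T_def Aut_T_def units_of_def Units_def)

lemma E_T_rho: "\<lbrakk>e \<in> E_T T P; x \<in> P\<rbrakk> \<Longrightarrow> rho T e x = x"
  by (simp add: E_T_def)

text \<open>By definition \<open>E(P)\<close> consists of invertible morphisms. Invertibility is automatic: by
  \<open>rho_orbits\<close>, a morphism that acts as the identity differs from the identity by an element of \<open>E(P)\<close>.\<close>

lemma E_TI:
  assumes "e \<in> thom T P P" "\<And>x. x \<in> P \<Longrightarrow> rho T e x = x"
  shows "e \<in> E_T T P"
proof -
  have P: "P \<in> ob T" using assms thomD by blast
  have "rho T e = rho T (tid T P)"
    using rho_eqI[OF assms(1) tid_in[OF P]] assms P by (simp add: rho_tid)
  then obtain e' where "e' \<in> E_T T P" "tid T P = e' \<star> e"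
    using rho_orbits[OF assms(1) tid_in[OF P]] by metis
  moreover have "rho T (tid T P) = rho T e" using \<open>rho T e = rho T (tid T P)\<close> by simp
  then obtain e'' where "e'' \<in> E_T T P" "e = e'' \<star> tid T P"
    using rho_orbits[OF tid_in[OF P] assms(1)] by metis
  ultimately show ?thesis using E_T_in tcomp_tid by metis
qed

text \<open>Morphisms of a fusion system are injective, so \<open>\<alpha>\<close> and \<open>\<beta>\<close> act in the same way and \<open>\<beta> = e \<alpha>\<close> with
  \<open>e \<in> E(R)\<close>; this \<open>e\<close> fixes \<open>\<alpha> \<phi>\<close>, and the action of \<open>E(R)\<close> is free.\<close>

lemma tcomp_mono:
  assumes "\<alpha> \<in> thom T R P" "\<beta> \<in> thom T R P" "\<phi> \<in> thom T P Q" "\<alpha> \<star> \<phi> = \<beta> \<star> \<phi>"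
  shows "\<alpha> = \<beta>"
proof -
  have "rho T \<alpha> = rho T \<beta>"
  proof (rule rho_eqI[OF assms(1,2)])
    fix x assume x: "x \<in> R"
    have "rho T \<phi> (rho T \<alpha> x) = rho T \<phi> (rho T \<beta> x)"
      using rho_comp[OF assms(1,3) x] rho_comp[OF assms(2,3) x] assms(4) by simp
    then show "rho T \<alpha> x = rho T \<beta> x"
      using rho_inj[OF assms(3)] rho_mem[OF assms(1) x] rho_mem[OF assms(2) x] by (auto dest: inj_onD)
  qed
  then obtain e where e: "e \<in> E_T T R" "\<beta> = e \<star> \<alpha>" using rho_orbits[OF assms(1,2)] by blast
  have "e \<star> (\<alpha> \<star> \<phi>) = \<alpha> \<star> \<phi>" using e assms tcomp_assoc[OF E_T_in[OF e(1)] assms(1,3)] by simp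
  then have "e = tid T R" using E_pre_free[OF e(1) tcomp_in[OF assms(1,3)]] by blast
  then show ?thesis using e tcomp_tid[OF assms(1)] by simp
qed

lemma E_T_inverse:
  assumes "e \<in> E_T T P" obtains e' where "e' \<in> thom T P P" "e \<star> e' = tid T P" "e' \<star> e = tid T P"
  using assms by (auto simp: E_T_def Aut_T_def units_of_def Units_def)

text \<open>The restriction of the underlying homomorphism lifts to some morphism, which is then corrected by
  an element of \<open>E(A)\<close>.\<close>

lemma restrict_morphism:
  assumes f: "\<phi> \<in> thom T P Q" and A: "A \<in> ob T" "A \<subseteq> P" and B: "B \<in> ob T" "B \<subseteq> Q" "rho T \<phi> ` A \<subseteq> B"
  obtains \<psi> where "\<psi> \<in> thom T A B" "\<psi> \<star> inc B Q = inc A P \<star> \<phi>" "\<And>x. x \<in> A \<Longrightarrow> rho T \<psi> x = rho T \<phi> x"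
proof -
  have PQ: "P \<in> ob T" "Q \<in> ob T" using f thomD by auto
  have iA: "inc A P \<in> thom T A P" and iB: "inc B Q \<in> thom T B Q" using inc_in A B PQ by auto
  have "restrict (rho T \<phi>) A \<in> F A B"
    using F_restrict[OF rho_in[OF f]] A B ob_subgroups by blast
  then obtain \<psi>' where psi': "\<psi>' \<in> thom T A B" "rho T \<psi>' = restrict (rho T \<phi>) A"
    using rho_surj[OF A(1) B(1)] by (metis imageE)
  have r: "rho T (\<psi>' \<star> inc B Q) = rho T (inc A P \<star> \<phi>)"
  proof (rule rho_eqI[OF tcomp_in[OF psi'(1) iB] tcomp_in[OF iA f]])
    fix x assume x: "x \<in> A"
    then show "rho T (\<psi>' \<star> inc B Q) x = rho T (inc A P \<star> \<phi>) x"
      using rho_comp[OF psi'(1) iB x] rho_comp[OF iA f x] psi' A B PQ rho_inc by auto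
  qed
  obtain e where e: "e \<in> E_T T A" "inc A P \<star> \<phi> = e \<star> (\<psi>' \<star> inc B Q)"
    using rho_orbits[OF tcomp_in[OF psi'(1) iB] tcomp_in[OF iA f]] r by blast
  show thesis
  proof
    show i: "e \<star> \<psi>' \<in> thom T A B" using tcomp_in[OF E_T_in[OF e(1)] psi'(1)] .
    show eq: "(e \<star> \<psi>') \<star> inc B Q = inc A P \<star> \<phi>"
      using e tcomp_assoc[OF E_T_in[OF e(1)] psi'(1) iB] by simp
    show "rho T (e \<star> \<psi>') x = rho T \<phi> x" if "x \<in> A" for x
      using rho_comp[OF E_T_in[OF e(1)] psi'(1) that] E_T_rho[OF e(1) that] psi' that by simp
  qed
qed

text \<open>Lift the inverse homomorphism to a morphism \<open>\<psi>\<close>. Both composites with \<open>\<phi>\<close> act as the identity, so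
  they are invertible, and \<open>\<phi>\<close> has inverses on both sides.\<close>

lemma iso_morphism:
  assumes f: "\<phi> \<in> thom T P Q" and onto: "rho T \<phi> ` P = Q"
  obtains \<psi> where "inverse_pair T P Q \<phi> \<psi>"
proof -
  have PQ: "P \<in> ob T" "Q \<in> ob T" using f thomD by auto
  have "restrict (inv_into P (rho T \<phi>)) Q \<in> F Q P"
    using iso_onto_image[OF rho_in[OF f]] onto by simp
  then obtain \<psi> where psi: "\<psi> \<in> thom T Q P" "rho T \<psi> = restrict (inv_into P (rho T \<phi>)) Q"
    using rho_surj[OF PQ(2,1)] by (metis imageE)
  have "\<phi> \<star> \<psi> \<in> E_T T P"
    using rho_comp[OF f psi(1)] psi(2) rho_mem[OF f] rho_inj[OF f] by (intro E_TI tcomp_in[OF f psi(1)]) simp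
  then obtain a where a: "a \<in> thom T P P" "\<phi> \<star> \<psi> \<star> a = tid T P" by (rule E_T_inverse)
  have "\<psi> \<star> \<phi> \<in> E_T T Q"
    using rho_comp[OF psi(1) f] psi(2) onto by (intro E_TI tcomp_in[OF psi(1) f]) (simp add: f_inv_into_f)
  then obtain b where b: "b \<in> thom T Q Q" "b \<star> (\<psi> \<star> \<phi>) = tid T Q" by (rule E_T_inverse)
  have pa: "\<psi> \<star> a \<in> thom T Q P" and bp: "b \<star> \<psi> \<in> thom T Q P" using tcomp_in a b psi by blast+
  have 1: "\<phi> \<star> (\<psi> \<star> a) = tid T P" using tcomp_assoc[OF f psi(1) a(1)] a by simp
  have 2: "(b \<star> \<psi>) \<star> \<phi> = tid T Q" using tcomp_assoc[OF b(1) psi(1) f] b by simp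
  have "b \<star> \<psi> = (b \<star> \<psi>) \<star> (\<phi> \<star> (\<psi> \<star> a))" using 1 tcomp_tid[OF bp] by simp
  also have "\<dots> = \<psi> \<star> a" using tcomp_assoc[OF bp f pa] 2 tcomp_tid[OF pa] by simp
  finally have "(\<psi> \<star> a) \<star> \<phi> = tid T Q" using 2 by simp
  then show thesis using that 1 f pa by (auto simp: inverse_pair_def)
qed

lemma endo_iso:
  assumes f: "\<phi> \<in> thom T P P" obtains \<psi> where "inverse_pair T P P \<phi> \<psi>"
proof -
  have fin: "finite P" using f thomD ob_subgroups finite_subgroup_S by blast
  have "rho T \<phi> ` P \<subseteq> P" using rho_mem[OF f] by blast
  then have "rho T \<phi> ` P = P" using rho_inj[OF f] fin by (simp add: endo_inj_surj)
  then show thesis using iso_morphism[OF f] that by blast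
qed

lemma Aut_T_carrier: "P \<in> ob T \<Longrightarrow> carrier (Aut_T T P) = thom T P P"
proof -
  have "\<exists>y\<in>thom T P P. y \<star> x = tid T P \<and> x \<star> y = tid T P" if "x \<in> thom T P P" for x
    using endo_iso[OF that] by (metis inverse_pair_def)
  then show ?thesis by (auto simp: Aut_T_def units_of_def Units_def)
qed

declare Aut_T_mult_eq [simp]

lemma group_Aut_T: "P \<in> ob T \<Longrightarrow> group (Aut_T T P)"
  unfolding Aut_T_def
  by (intro monoid.units_group monoidI) (auto intro: tcomp_in tid_in tcomp_assoc simp: tcomp_tid)

lemma plain_group_Aut_T: "P \<in> ob T \<Longrightarrow> plain_group (Aut_T T P)"
  by (simp add: plain_group_def group_Aut_T)

lemma finite_Aut_T: "P \<in> ob T \<Longrightarrow> finite (carrier (Aut_T T P))"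
  using finite_mor by (simp add: Aut_T_carrier thom_def)

lemma inverse_pair_Aut:
  assumes "P \<in> ob T" "g \<in> thom T P P" shows "inverse_pair T P P g (inv\<^bsub>Aut_T T P\<^esub> g)"
proof -
  interpret A: group "Aut_T T P" using group_Aut_T assms by blast
  show ?thesis
    using A.r_inv[of g] A.l_inv[of g] A.inv_closed[of g] assms by (simp add: inverse_pair_def Aut_T_carrier)
qed

lemma conj_by_Aut_iff:
  assumes "P \<in> ob T" "g \<in> thom T P P" "x \<in> thom T P P" "y \<in> thom T P P"
  shows "conj_by (Aut_T T P) g x = y \<longleftrightarrow> x \<star> g = g \<star> y"
  using plain_group.conj_by_eq_iff[OF plain_group_Aut_T[OF assms(1)], of g x y] assms by (simp add: Aut_T_carrier)

text \<open>On the image of \<open>P\<close>, conjugation in \<open>Aut\<^sub>T(P)\<close> is given by the underlying homomorphisms. This is the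
  reason why \<open>E(P)\<close> is the centralizer of that image.\<close>

lemma conj_by_Aut_el:
  assumes "g \<in> thom T P P" "x \<in> P"
  shows "conj_by (Aut_T T P) g (el P x) = el P (rho T g x)"
proof -
  have P: "P \<in> ob T" using assms thomD by blast
  show ?thesis
    using conj_by_Aut_iff[OF P assms(1) el_in[OF P] el_in[OF P]] eps_commute[OF assms]
      mem_normalizer[OF P] assms rho_mem[OF assms] by blast
qed

lemma el_hom: "P \<in> ob T \<Longrightarrow> el P \<in> hom (subgrp S (normalizer S P)) (Aut_T T P)"
  by (auto simp: hom_def Aut_T_carrier el_in el_mult)

lemma el_group_hom: "P \<in> ob T \<Longrightarrow> group_hom (subgrp S (normalizer S P)) (Aut_T T P) (el P)"
  using el_hom group_Aut_T S.group_subgrp[OF subgroup_normalizer[OF ob_subgroups]]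
  by (simp add: group_hom_def group_hom_axioms_def)

lemma el_image_subgroup:
  assumes "P \<in> ob T" "subgroup A S" "A \<subseteq> normalizer S P"
  shows "subgroup (el P ` A) (Aut_T T P)"
  using group_hom.subgroup_img_is_subgroup[OF el_group_hom[OF assms(1)], of A]
    S.subgroup_subgrp_iff[OF subgroup_normalizer[OF ob_subgroups[OF assms(1)]]] assms by blast

lemma card_el_image: "\<lbrakk>P \<in> ob T; A \<subseteq> normalizer S P\<rbrakk> \<Longrightarrow> card (el P ` A) = card A"
  by (intro card_image inj_onI) (meson el_inj subsetD)

lemma el_image_normal: "P \<in> ob T \<Longrightarrow> el P ` P \<lhd> Aut_T T P"
  unfolding plain_group.normal_iff_conj_by[OF plain_group_Aut_T]
  using el_image_subgroup[OF _ ob_subgroups S.subgroup_subset_normalizer[OF ob_subgroups]]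
  by (auto simp: Aut_T_carrier conj_by_Aut_el rho_mem)

lemma E_T_eq: "P \<in> ob T \<Longrightarrow> E_T T P = {g \<in> thom T P P. \<forall>x\<in>P. rho T g x = x}"
  using E_TI E_T_in E_T_rho by blast

lemma E_T_eq_centralizer: "P \<in> ob T \<Longrightarrow> E_T T P = centralizer (Aut_T T P) (el P ` P)"
proof -
  assume P: "P \<in> ob T"
  have "(\<forall>x\<in>P. rho T g x = x) \<longleftrightarrow> (\<forall>x\<in>P. g \<star> el P x = el P x \<star> g)" if g: "g \<in> thom T P P" for g
  proof -
    have "rho T g x = x \<longleftrightarrow> g \<star> el P x = el P x \<star> g" if "x \<in> P" for x
      using conj_by_Aut_el[OF g that] conj_by_Aut_iff[OF P g el_in[OF P] el_in[OF P], of x x]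
        mem_normalizer[OF P] that el_inj[OF P, of "rho T g x" x] rho_mem[OF g that] by metis
    then show ?thesis by blast
  qed
  then show ?thesis using P by (auto simp: E_T_eq centralizer_def Aut_T_carrier)
qed

lemma E_T_normal: "P \<in> ob T \<Longrightarrow> E_T T P \<lhd> Aut_T T P"
  using plain_group.centralizer_normal[OF plain_group_Aut_T el_image_normal] E_T_eq_centralizer by metis

lemma centralizer_subset_normalizer: "subgroup P S \<Longrightarrow> centralizer S P \<subseteq> normalizer S P"
  unfolding S.normalizer_eq[OF subgroup.subset]
  by (auto simp: centralizer_def S.conj_by_eq_iff subgroup.mem_carrier image_iff)
     (metis S.conj_by_eq_iff subgroup.mem_carrier)+

lemma el_in_E_T_iff:
  assumes "P \<in> ob T" "g \<in> normalizer S P" shows "el P g \<in> E_T T P \<longleftrightarrow> g \<in> centralizer S P"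
proof -
  have g: "g \<in> carrier S" using assms normalizer_carrier by blast
  have "conj_by S g x = x \<longleftrightarrow> g \<otimes>\<^bsub>S\<^esub> x = x \<otimes>\<^bsub>S\<^esub> g" if "x \<in> P" for x
    using S.conj_by_eq_iff[OF g, of x x] subgroup.mem_carrier[OF ob_subgroups[OF assms(1)] that] by auto
  then show ?thesis using assms g by (auto simp: E_T_eq el_in rho_el centralizer_def)
qed

text \<open>Invariance under isomorphism: statements about \<open>Aut\<^sub>T(P)\<close>, \<open>E(P)\<close> and the image of \<open>P\<close> need only be
  proved for one \<open>P\<close> in each conjugacy class, for instance a fully normalized one.\<close>

lemma conj_iso:
  assumes "inverse_pair T P Q \<alpha> \<beta>"
  shows "(\<lambda>g. \<beta> \<star> g \<star> \<alpha>) \<in> iso (Aut_T T P) (Aut_T T Q)"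
    "(\<lambda>g. \<beta> \<star> g \<star> \<alpha>) ` E_T T P = E_T T Q"
    "\<And>x. x \<in> P \<Longrightarrow> \<beta> \<star> el P x \<star> \<alpha> = el Q (rho T \<alpha> x)"
    "rho T \<alpha> ` P = Q"
proof -
  have a: "\<alpha> \<in> thom T P Q" and b: "\<beta> \<in> thom T Q P" and ab: "\<alpha> \<star> \<beta> = tid T P" "\<beta> \<star> \<alpha> = tid T Q"
    using assms by (auto simp: inverse_pair_def)
  have PQ: "P \<in> ob T" "Q \<in> ob T" using a thomD by auto
  let ?f = "\<lambda>g. \<beta> \<star> g \<star> \<alpha>" and ?h = "\<lambda>g. \<alpha> \<star> g \<star> \<beta>"
  have fc: "?f g \<in> thom T Q Q" if "g \<in> thom T P P" for g using that a b tcomp_in by blast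
  have hc: "?h g \<in> thom T P P" if "g \<in> thom T Q Q" for g using that a b tcomp_in by blast
  have hf: "?h (?f g) = g" if g: "g \<in> thom T P P" for g
  proof -
    have "\<alpha> \<star> (\<beta> \<star> g \<star> \<alpha>) = g \<star> \<alpha>"
      using tcomp_assoc[OF b g a] tcomp_assoc[OF a b tcomp_in[OF g a]] ab tcomp_tid[OF tcomp_in[OF g a]] by simp
    then show ?thesis using tcomp_assoc[OF g a b] ab tcomp_tid[OF g] by simp
  qed
  have fh: "?f (?h g) = g" if g: "g \<in> thom T Q Q" for g
  proof -
    have "\<beta> \<star> (\<alpha> \<star> g \<star> \<beta>) = g \<star> \<beta>"
      using tcomp_assoc[OF a g b] tcomp_assoc[OF b a tcomp_in[OF g b]] ab tcomp_tid[OF tcomp_in[OF g b]] by simp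
    then show ?thesis using tcomp_assoc[OF g b a] ab tcomp_tid[OF g] by simp
  qed
  have fm: "?f (g \<star> h) = ?f g \<star> ?f h" if g: "g \<in> thom T P P" and h: "h \<in> thom T P P" for g h
  proof -
    have bg: "\<beta> \<star> g \<in> thom T Q P" using g b tcomp_in by blast
    have ha: "h \<star> \<alpha> \<in> thom T P Q" using h a tcomp_in by blast
    have "?f g \<star> ?f h = (\<beta> \<star> g) \<star> (\<alpha> \<star> (\<beta> \<star> (h \<star> \<alpha>)))"
      using tcomp_assoc[OF bg a fc[OF h]] tcomp_assoc[OF b h a] by simp
    also have "\<alpha> \<star> (\<beta> \<star> (h \<star> \<alpha>)) = h \<star> \<alpha>"
      using tcomp_assoc[OF a b ha] ab tcomp_tid[OF ha] by simp
    also have "(\<beta> \<star> g) \<star> (h \<star> \<alpha>) = ?f (g \<star> h)"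
      using tcomp_assoc[OF bg h a] tcomp_assoc[OF b g h] by simp
    finally show ?thesis by simp
  qed
  have bij: "bij_betw ?f (thom T P P) (thom T Q Q)"
    by (rule bij_betw_byWitness[where f' = ?h]) (use fc hc hf fh in auto)
  show "?f \<in> iso (Aut_T T P) (Aut_T T Q)"
    using bij fm fc PQ by (auto simp: iso_def hom_def Aut_T_carrier)
  have rb: "rho T \<alpha> (rho T \<beta> y) = y" if "y \<in> Q" for y
    using rho_comp[OF b a that] ab rho_tid[OF PQ(2)] that by simp
  have ra: "rho T \<beta> (rho T \<alpha> y) = y" if "y \<in> P" for y
    using rho_comp[OF a b that] ab rho_tid[OF PQ(1)] that by simp
  show onto: "rho T \<alpha> ` P = Q"
    using rb rho_mem[OF a] rho_mem[OF b] by (metis image_iff image_subsetI subsetI subset_antisym)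
  have Ef: "?f e \<in> E_T T Q" if "e \<in> E_T T P" for e
  proof (rule E_TI)
    have e: "e \<in> thom T P P" using that E_T_in by blast
    show "?f e \<in> thom T Q Q" using fc e by blast
    show "rho T (?f e) y = y" if "y \<in> Q" for y
      using rho_comp[OF tcomp_in[OF b e] a that] rho_comp[OF b e that] rho_mem[OF b that]
        E_T_rho[OF \<open>e \<in> E_T T P\<close> rho_mem[OF b that]] rb[OF that] by simp
  qed
  moreover have "?h e \<in> E_T T P" if "e \<in> E_T T Q" for e
  proof (rule E_TI)
    have e: "e \<in> thom T Q Q" using that E_T_in by blast
    show "?h e \<in> thom T P P" using hc e by blast
    show "rho T (?h e) y = y" if "y \<in> P" for y
      using rho_comp[OF tcomp_in[OF a e] b that] rho_comp[OF a e that] rho_mem[OF a that]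
        E_T_rho[OF \<open>e \<in> E_T T Q\<close> rho_mem[OF a that]] ra[OF that] by simp
  qed
  ultimately show "?f ` E_T T P = E_T T Q"
    using fh E_T_in by (auto intro!: image_eqI[of _ ?f])
  show "\<beta> \<star> el P x \<star> \<alpha> = el Q (rho T \<alpha> x)" if x: "x \<in> P" for x
  proof -
    have "el P x \<in> thom T P P" "el Q (rho T \<alpha> x) \<in> thom T Q Q"
      using el_in mem_normalizer PQ x rho_mem[OF a x] by auto
    then show ?thesis
      using eps_commute[OF a x] tcomp_assoc[OF b _ a, of "el P x"] tcomp_assoc[OF b a, of "el Q (rho T \<alpha> x)"] ab tcomp_tid
      by metis
  qed
qed

lemma conjugate_iso:
  assumes "P \<in> ob T" "Q \<in> conjugates S F P"
  obtains \<alpha> \<beta> where "inverse_pair T P Q \<alpha> \<beta>"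
proof -
  obtain \<phi> where f: "\<phi> \<in> F P Q" "\<phi> ` P = Q" using assms(2) by (rule conjugatesE)
  have Q: "Q \<in> ob T" using ob_conj assms by blast
  obtain \<alpha> where a: "\<alpha> \<in> thom T P Q" "rho T \<alpha> = \<phi>" using f rho_surj[OF assms(1) Q] by (metis imageE)
  show thesis using iso_morphism[OF a(1)] a f that by blast
qed

section \<open>Sylow subgroups of automorphism groups\<close>

lemma normalizer_in_ob: "P \<in> ob T \<Longrightarrow> normalizer S P \<in> ob T"
  using ob_overgroups subgroup_normalizer ob_subgroups S.subgroup_subset_normalizer by blast

text \<open>Extensions of automorphisms from \<open>P\<close> to a subgroup \<open>R\<close> normalizing \<open>P\<close> are unique, which comes
  down to the case of the identity: for \<open>g \<in> R\<close>, the restrictions to \<open>P\<close> of \<open>g\<close> and of its image under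
  \<open>\<delta>\<close> agree, so that \<open>\<delta>\<close> acts trivially on \<open>R\<close>, and \<open>E(R)\<close> acts freely on the morphisms from \<open>P\<close> to \<open>R\<close>.\<close>

lemma inc_fixed_imp_tid:
  assumes P: "P \<in> ob T" and R: "R \<in> ob T" "P \<subseteq> R" "R \<subseteq> normalizer S P"
    and d: "\<delta> \<in> thom T R R" "inc P R \<star> \<delta> = inc P R"
  shows "\<delta> = tid T R"
proof -
  have i: "inc P R \<in> thom T P R" using inc_in P R by blast
  have "\<delta> \<in> E_T T R"
  proof (rule E_TI[OF d(1)])
    fix g assume g: "g \<in> R"
    define h where "h = rho T \<delta> g"
    have h: "h \<in> R" unfolding h_def using rho_mem d g by blast
    have gN: "g \<in> normalizer S P" "g \<in> normalizer S R" "h \<in> normalizer S P" "h \<in> normalizer S R"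
      using g h R mem_normalizer by auto
    have e: "el P g \<in> thom T P P" "el R g \<in> thom T R R" "el R h \<in> thom T R R" using el_in P R gN by auto
    have "eps T P R g = el P g \<star> (inc P R \<star> \<delta>)" using el_inc(2)[OF P R(1,2)] gN d by simp
    also have "\<dots> = (el P g \<star> inc P R) \<star> \<delta>" using tcomp_assoc[OF e(1) i d(1)] by simp
    also have "\<dots> = inc P R \<star> (el R g \<star> \<delta>)" using el_inc(1)[OF P R(1,2)] gN tcomp_assoc[OF i e(2) d(1)] by simp
    also have "\<dots> = (inc P R \<star> \<delta>) \<star> el R h" using eps_commute[OF d(1) g] tcomp_assoc[OF i d(1) e(3)] h_def by simp
    also have "\<dots> = eps T P R h" using d el_inc[OF P R(1,2)] gN by simp
    finally have "eps T P R g = eps T P R h" .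
    moreover have "g \<in> transporter_set S P R" "h \<in> transporter_set S P R"
      using gN R(2) transporter_set_self[OF P] by (auto simp: transporter_set_def)
    ultimately show "rho T \<delta> g = g" using eps_inj[OF P R(1)] h_def by (auto dest: inj_onD)
  qed
  then show ?thesis using E_post_free i d by blast
qed

lemma extension_unique:
  assumes P: "P \<in> ob T" and R: "R \<in> ob T" "P \<subseteq> R" "R \<subseteq> normalizer S P"
    and d: "\<theta> \<in> thom T R R" "\<theta>' \<in> thom T R R" "inc P R \<star> \<theta> = inc P R \<star> \<theta>'"
  shows "\<theta> = \<theta>'"
proof -
  obtain \<psi> where psi: "inverse_pair T R R \<theta>' \<psi>" using endo_iso[OF d(2)] .
  have p: "\<psi> \<in> thom T R R" "\<theta>' \<star> \<psi> = tid T R" "\<psi> \<star> \<theta>' = tid T R" using psi by (auto simp: inverse_pair_def)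
  have i: "inc P R \<in> thom T P R" using inc_in P R by blast
  have "inc P R \<star> (\<theta> \<star> \<psi>) = inc P R \<star> (\<theta>' \<star> \<psi>)"
    using tcomp_assoc[OF i d(1) p(1)] tcomp_assoc[OF i d(2) p(1)] d by simp
  then have "inc P R \<star> (\<theta> \<star> \<psi>) = inc P R" using p tcomp_tid[OF i] by simp
  then have "\<theta> \<star> \<psi> = tid T R" using inc_fixed_imp_tid[OF P R tcomp_in[OF d(1) p(1)]] by blast
  then have "(\<theta> \<star> \<psi>) \<star> \<theta>' = \<theta>'" using tcomp_tid[OF d(2)] by simp
  then show ?thesis using tcomp_assoc[OF d(1) p(1) d(2)] p tcomp_tid[OF d(1)] by simp
qed

text \<open>Induction on the index of \<open>P\<close> in \<open>S\<close>; the case \<open>P = S\<close> is an axiom. Let \<open>R = N\<^sub>S(P)\<close> and suppose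
  that its image is properly contained in a \<open>p\<close>-group \<open>H\<close> that normalizes it. By the extension axiom
  the elements of \<open>H\<close> extend uniquely to \<open>R\<close>, so that they form a \<open>p\<close>-subgroup of \<open>Aut\<^sub>T(R)\<close>. As
  \<open>R\<close> is larger than \<open>P\<close>, induction applies to a fully normalized conjugate \<open>R'\<close> of \<open>R\<close>: some
  isomorphism \<open>\<chi>\<close> from \<open>R\<close> to \<open>R'\<close> conjugates the extension of \<open>H\<close> into \<open>N\<^sub>S(R')\<close>. All of it
  normalizes \<open>P\<chi>\<close>, whose normalizer is therefore larger than that of \<open>P\<close>.\<close>

lemma fully_normalized_imp_sylow:
  assumes "P \<in> ob T" "P \<in> fully_normalized S F"
  shows "sylow_subgroup p (Aut_T T P) (el P ` normalizer S P)"
  using assms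
proof (induction "card (carrier S) - card P" arbitrary: P rule: less_induct)
  case less
  note P = less.prems(1) and fn = less.prems(2)
  have Ps: "subgroup P S" using P ob_subgroups by blast
  show ?case
  proof (cases "P = carrier S")
    case True
    have "normalizer S (carrier S) = carrier S"
      using S.subgroup_subset_normalizer[OF S.subgroup_self] subgroup_normalizer[OF S.subgroup_self] subgroup.subset
      by blast
    then show ?thesis using True eps_sylow by simp
  next
    case False
    define R where "R = normalizer S P"
    define N where "N = el P ` R"
    have Rs: "subgroup R S" and Rob: "R \<in> ob T" and PR: "P \<subseteq> R"
      using R_def subgroup_normalizer Ps normalizer_in_ob P S.subgroup_subset_normalizer by auto
    interpret A: plain_group "Aut_T T P" by (rule plain_group_Aut_T[OF P])
    have finA: "finite (carrier (Aut_T T P))" by (rule finite_Aut_T[OF P])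
    have Ns: "subgroup N (Aut_T T P)" unfolding N_def using el_image_subgroup[OF P Rs] R_def by blast
    have cN: "card N = card R" unfolding N_def using card_el_image[OF P] R_def by blast
    obtain r where r: "card R = p ^ r" using card_subgroup_S[OF Rs] by blast
    have cPS: "card P < card (carrier S)"
      using False Ps finite_S subgroup.subset by (metis psubsetI psubset_card_mono)
    have cPR: "card P < card R"
    proof -
      obtain k where k: "card P = p ^ k" using card_subgroup_S[OF Ps] by blast
      obtain m where m: "card (carrier S) = p ^ m" using p_group_S by blast
      have "multiplicity p (p ^ m) = m" using prime_p by (simp add: multiplicity_same_power not_prime_unit)
      then have "\<not> sylow_subgroup p S P" using cPS m by (auto simp: sylow_subgroup_def order_def)
      then obtain H where H: "subgroup H S" "P \<subset> H" "H \<subseteq> normalizer S P"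
        using S.p_subgroup_grows[OF prime_p finite_S Ps k] by blast
      then have "P \<subset> R" unfolding R_def by blast
      then show ?thesis using finite_subgroup_S[OF Rs] psubset_card_mono by blast
    qed
    have iPR: "inc P R \<in> thom T P R" using inc_in[OF P Rob PR] .
    show ?thesis
    proof (rule ccontr)
      assume "\<not> sylow_subgroup p (Aut_T T P) (el P ` normalizer S P)"
      then have "\<not> sylow_subgroup p (Aut_T T P) N" unfolding N_def R_def .
      then obtain H m where H: "subgroup H (Aut_T T P)" "card H = p ^ m" "N \<subset> H" "H \<subseteq> normalizer (Aut_T T P) N"
        using A.p_subgroup_grows[OF prime_p finA Ns trans[OF cN r]] by blast
      have Ht: "h \<in> thom T P P" if "h \<in> H" for h
        using subgroup.mem_carrier[OF H(1) that] Aut_T_carrier[OF P] by simp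
      have ext: "\<exists>\<theta>\<in>thom T R R. inc P R \<star> \<theta> = h \<star> inc P R" if h: "h \<in> H" for h
      proof -
        have "P \<lhd> subgrp S R" using S.normal_in_normalizer[OF Ps Rs PR] R_def by blast
        moreover have "tcomp T (inv\<^bsub>Aut_T T P\<^esub> h) (tcomp T (el P g) h) \<in> el P ` R" if g: "g \<in> R" for g
        proof -
          have "conj_by (Aut_T T P) h (el P g) \<in> N"
            using h H(4) g A.normalizer_eq[OF subgroup.subset[OF Ns]] unfolding N_def by blast
          moreover have "inv\<^bsub>Aut_T T P\<^esub> h \<in> thom T P P"
            using inverse_pair_Aut[OF P Ht[OF h]] by (simp add: inverse_pair_def)
          ultimately show ?thesis unfolding N_def conj_by_def
            using tcomp_assoc[OF _ el_in[OF P] Ht[OF h]] g R_def by simp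
        qed
        ultimately show ?thesis
          using extension[OF inverse_pair_Aut[OF P Ht[OF h]] Rs _ Rs] by blast
      qed
      \<comment> \<open>The group of the extensions of elements of \<open>H\<close> to \<open>R\<close>.\<close>
      define H' where "H' = {\<theta> \<in> thom T R R. \<exists>h\<in>H. inc P R \<star> \<theta> = h \<star> inc P R}"
      interpret AR: plain_group "Aut_T T R" by (rule plain_group_Aut_T[OF Rob])
      have H's: "subgroup H' (Aut_T T R)"
      proof
        show "H' \<subseteq> carrier (Aut_T T R)" by (auto simp: H'_def Aut_T_carrier[OF Rob])
        show "\<one>\<^bsub>Aut_T T R\<^esub> \<in> H'"
          using subgroup.one_closed[OF H(1)] tcomp_tid[OF iPR] tid_in[OF Rob] by (auto simp: H'_def intro!: bexI[of _ "tid T P"])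
        show "x \<otimes>\<^bsub>Aut_T T R\<^esub> y \<in> H'" if "x \<in> H'" "y \<in> H'" for x y
        proof -
          from that obtain h k where hk: "x \<in> thom T R R" "y \<in> thom T R R" "h \<in> H" "k \<in> H"
            "inc P R \<star> x = h \<star> inc P R" "inc P R \<star> y = k \<star> inc P R" by (auto simp: H'_def)
          have "inc P R \<star> (x \<star> y) = (h \<star> k) \<star> inc P R"
            using hk tcomp_assoc[OF iPR hk(1,2)] tcomp_assoc[OF Ht[OF hk(3)] iPR hk(2)]
              tcomp_assoc[OF Ht[OF hk(3)] Ht[OF hk(4)] iPR] by simp
          moreover have "h \<star> k \<in> H" using subgroup.m_closed[OF H(1) hk(3,4)] by simp
          ultimately show ?thesis using tcomp_in hk by (auto simp: H'_def)
        qed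
        show "inv\<^bsub>Aut_T T R\<^esub> x \<in> H'" if "x \<in> H'" for x
        proof -
          from that obtain h where h: "x \<in> thom T R R" "h \<in> H" "inc P R \<star> x = h \<star> inc P R" by (auto simp: H'_def)
          let ?x = "inv\<^bsub>Aut_T T R\<^esub> x" and ?h = "inv\<^bsub>Aut_T T P\<^esub> h"
          have x': "?x \<in> thom T R R" "x \<star> ?x = tid T R" using inverse_pair_Aut[OF Rob h(1)] by (auto simp: inverse_pair_def)
          have h': "?h \<in> thom T P P" "?h \<star> h = tid T P" "?h \<in> H"
            using inverse_pair_Aut[OF P Ht[OF h(2)]] subgroup.m_inv_closed[OF H(1) h(2)] by (auto simp: inverse_pair_def)
          have "(?h \<star> (h \<star> inc P R)) \<star> ?x = ?h \<star> ((inc P R \<star> x) \<star> ?x)"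
            using h(3) tcomp_assoc[OF h'(1) tcomp_in[OF iPR h(1)] x'(1)] by simp
          then have "inc P R \<star> ?x = ?h \<star> inc P R"
            using tcomp_assoc[OF h'(1) Ht[OF h(2)] iPR] tcomp_assoc[OF iPR h(1) x'(1)] h' x' tcomp_tid[OF iPR] by simp
          then show ?thesis using x' h' by (auto simp: H'_def)
        qed
      qed
      define ex where "ex h = (SOME \<theta>. \<theta> \<in> thom T R R \<and> inc P R \<star> \<theta> = h \<star> inc P R)" for h
      have exP: "ex h \<in> thom T R R" "inc P R \<star> ex h = h \<star> inc P R" if "h \<in> H" for h
        using someI_ex[of "\<lambda>\<theta>. \<theta> \<in> thom T R R \<and> inc P R \<star> \<theta> = h \<star> inc P R"] ext[OF that] unfolding ex_def by auto
      have "inj_on ex H"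
        using exP tcomp_mono[OF Ht Ht iPR] by (intro inj_onI) metis
      moreover have "ex ` H = H'"
      proof
        show "ex ` H \<subseteq> H'" using exP by (auto simp: H'_def)
        show "H' \<subseteq> ex ` H"
        proof
          fix \<theta> assume "\<theta> \<in> H'"
          then obtain h where h: "\<theta> \<in> thom T R R" "h \<in> H" "inc P R \<star> \<theta> = h \<star> inc P R" by (auto simp: H'_def)
          then have "\<theta> = ex h" using extension_unique[OF P Rob PR _ h(1) exP(1)] exP(2) R_def by auto
          then show "\<theta> \<in> ex ` H" using h by blast
        qed
      qed
      ultimately have cH': "card H' = p ^ m" using H(2) card_image by metis
      obtain R' where R': "R' \<in> conjugates S F R" "R' \<in> fully_normalized S F"
        using exists_fully_normalized[OF Rs] .
      have R'ob: "R' \<in> ob T" using ob_conj[OF Rob R'(1)] .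
      have "sylow_subgroup p (Aut_T T R') (el R' ` normalizer S R')"
        using less.hyps[OF _ R'ob R'(2)] conjugates_card[OF R'(1)] cPR cPS by linarith
      obtain \<alpha> \<beta> where ab: "inverse_pair T R R' \<alpha> \<beta>" using conjugate_iso[OF Rob R'(1)] .
      interpret AR': plain_group "Aut_T T R'" by (rule plain_group_Aut_T[OF R'ob])
      interpret c: group_hom "Aut_T T R" "Aut_T T R'" "\<lambda>g. \<beta> \<star> g \<star> \<alpha>"
        using conj_iso(1)[OF ab] by (simp add: group_hom_def group_hom_axioms_def iso_def AR.is_group AR'.is_group)
      have a: "\<alpha> \<in> thom T R R'" "\<beta> \<in> thom T R' R" "\<alpha> \<star> \<beta> = tid T R" "\<beta> \<star> \<alpha> = tid T R'"
        using ab by (auto simp: inverse_pair_def)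
      have "subgroup ((\<lambda>g. \<beta> \<star> g \<star> \<alpha>) ` H') (Aut_T T R')" using c.subgroup_img_is_subgroup[OF H's] .
      moreover have "card ((\<lambda>g. \<beta> \<star> g \<star> \<alpha>) ` H') = p ^ m"
        using cH' conj_iso(1)[OF ab] subgroup.subset[OF H's] card_image inj_on_subset
        by (metis (no_types, lifting) bij_betw_def iso_iff)
      ultimately obtain \<gamma> where g: "\<gamma> \<in> carrier (Aut_T T R')"
          "conj_by (Aut_T T R') \<gamma> ` (\<lambda>g. \<beta> \<star> g \<star> \<alpha>) ` H' \<subseteq> el R' ` normalizer S R'"
        using AR'.p_subgroup_conj_into_sylow[OF prime_p] \<open>sylow_subgroup p (Aut_T T R') _\<close> by blast
      have gt: "\<gamma> \<in> thom T R' R'" using g(1) Aut_T_carrier[OF R'ob] by blast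
      let ?\<chi> = "\<alpha> \<star> \<gamma>"
      have chi: "?\<chi> \<in> thom T R R'" using tcomp_in a gt by blast
      \<comment> \<open>The element of \<open>N\<^sub>S(R')\<close> that corresponds to \<open>\<theta>\<close> under conjugation by \<open>\<chi>\<close>.\<close>
      define n where "n \<theta> = (SOME x. x \<in> normalizer S R' \<and> \<theta> \<star> ?\<chi> = ?\<chi> \<star> el R' x)" for \<theta>
      have nP: "n \<theta> \<in> normalizer S R'" "\<theta> \<star> ?\<chi> = ?\<chi> \<star> el R' (n \<theta>)" if th: "\<theta> \<in> H'" for \<theta>
      proof -
        have t: "\<theta> \<in> thom T R R" using th by (auto simp: H'_def)
        obtain x where x: "x \<in> normalizer S R'" "conj_by (Aut_T T R') \<gamma> (\<beta> \<star> \<theta> \<star> \<alpha>) = el R' x"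
          using g(2) th by blast
        have bt: "\<beta> \<star> \<theta> \<in> thom T R' R" "\<beta> \<star> \<theta> \<star> \<alpha> \<in> thom T R' R'" using tcomp_in a t by blast+
        have e: "el R' x \<in> thom T R' R'" using el_in[OF R'ob x(1)] .
        have "(\<beta> \<star> \<theta> \<star> \<alpha>) \<star> \<gamma> = \<gamma> \<star> el R' x"
          using x(2) conj_by_Aut_iff[OF R'ob gt bt(2) e] by blast
        then have "\<alpha> \<star> ((\<beta> \<star> \<theta> \<star> \<alpha>) \<star> \<gamma>) = ?\<chi> \<star> el R' x"
          using tcomp_assoc[OF a(1) gt e] by simp
        moreover have "\<alpha> \<star> ((\<beta> \<star> \<theta> \<star> \<alpha>) \<star> \<gamma>) = \<theta> \<star> ?\<chi>"
          using tcomp_assoc[OF bt(1) a(1) gt] tcomp_assoc[OF a(2) t chi] tcomp_assoc[OF a(1,2) tcomp_in[OF t chi]]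
            a(3) tcomp_tid[OF tcomp_in[OF t chi]] by simp
        ultimately have "\<exists>x. x \<in> normalizer S R' \<and> \<theta> \<star> ?\<chi> = ?\<chi> \<star> el R' x" using x(1) by metis
        from someI_ex[OF this] show "n \<theta> \<in> normalizer S R'" "\<theta> \<star> ?\<chi> = ?\<chi> \<star> el R' (n \<theta>)"
          unfolding n_def by auto
      qed
      define P' where "P' = rho T ?\<chi> ` P"
      have rr: "restrict (rho T ?\<chi>) P \<in> F P R'"
        using F_restrict[OF rho_in[OF chi] Ps PR ob_subgroups[OF R'ob]] rho_mem[OF chi] PR by blast
      have P'c: "P' \<in> conjugates S F P"
        using conjugatesI[OF rr] by (simp add: P'_def)
      have P'ob: "P' \<in> ob T" using ob_conj[OF P P'c] .
      have "n ` H' \<subseteq> normalizer S P'"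
      proof
        fix x assume "x \<in> n ` H'"
        then obtain \<theta> where th: "\<theta> \<in> H'" "x = n \<theta>" by blast
        then obtain h where h: "\<theta> \<in> thom T R R" "h \<in> H" "inc P R \<star> \<theta> = h \<star> inc P R" by (auto simp: H'_def)
        have xN: "x \<in> normalizer S R'" using nP th by simp
        have e: "el R' x \<in> thom T R' R'" using el_in[OF R'ob xN] .
        have "conj_by S x z \<in> P'" if "z \<in> P'" for z
        proof -
          from that obtain y where y: "y \<in> P" "z = rho T ?\<chi> y" by (auto simp: P'_def)
          have yR: "y \<in> R" using y PR by blast
          have "rho T \<theta> y = rho T (inc P R \<star> \<theta>) y"
            using rho_comp[OF iPR h(1) y(1)] rho_inc[OF P Rob PR y(1)] by simp
          also have "\<dots> = rho T h y"
            using h(3) rho_comp[OF Ht[OF h(2)] iPR y(1)] rho_inc[OF P Rob PR rho_mem[OF Ht[OF h(2)] y(1)]] by simp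
          finally have tP: "rho T \<theta> y \<in> P" using rho_mem[OF Ht[OF h(2)] y(1)] by simp
          have "conj_by S x z = rho T (el R' x) z"
            using rho_el[OF R'ob xN] y rho_mem[OF chi yR] by simp
          also have "\<dots> = rho T (?\<chi> \<star> el R' x) y" using rho_comp[OF chi e yR] y by simp
          also have "\<dots> = rho T (\<theta> \<star> ?\<chi>) y" using nP(2)[OF th(1)] th by simp
          also have "\<dots> = rho T ?\<chi> (rho T \<theta> y)" using rho_comp[OF h(1) chi yR] .
          finally show ?thesis using tP by (simp add: P'_def)
        qed
        then show "x \<in> normalizer S P'"
          using S.normalizer_eq_finite[of P'] ob_subgroups[OF P'ob] finite_subgroup_S normalizer_carrier[OF R'ob xN]
          by (auto simp: subgroup.subset)
      qed
      moreover have "inj_on n H'"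
      proof (rule inj_onI)
        fix x y assume xy: "x \<in> H'" "y \<in> H'" "n x = n y"
        then have "x \<in> thom T R R" "y \<in> thom T R R" "x \<star> ?\<chi> = y \<star> ?\<chi>" using nP by (auto simp: H'_def)
        then show "x = y" using tcomp_mono[OF _ _ chi] by blast
      qed
      ultimately have "card H' \<le> card (normalizer S P')"
        using finite_subgroup_S[OF subgroup_normalizer[OF ob_subgroups[OF P'ob]]] card_inj_on_le by blast
      also have "\<dots> \<le> card R" using fn P'c unfolding fully_normalized_def R_def by blast
      also have "\<dots> < card H" using H(3) cN finA H(1) subgroup.subset by (metis finite_subset psubset_card_mono)
      finally show False using cH' H(2) by simp
    qed
  qed
qed

section \<open>The fusion system of a normalizer\<close>

lemma subgroup_set_mult_normalizing:
  assumes "subgroup P S" "subgroup A S" "A \<subseteq> normalizer S P"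
  shows "subgroup (A <#>\<^bsub>S\<^esub> P) S" "A \<subseteq> A <#>\<^bsub>S\<^esub> P" "P \<subseteq> A <#>\<^bsub>S\<^esub> P" "A <#>\<^bsub>S\<^esub> P \<subseteq> normalizer S P"
proof -
  let ?N = "normalizer S P"
  have Ns: "subgroup ?N S" using subgroup_normalizer assms by blast
  interpret N: plain_group "subgrp S ?N" using S.group_subgrp[OF Ns] by (simp add: plain_group_def)
  have PN: "P \<subseteq> ?N" using S.subgroup_subset_normalizer assms by blast
  have "P \<lhd> subgrp S ?N" using S.normal_in_normalizer[OF assms(1) Ns PN subset_refl] .
  moreover have "subgroup A (subgrp S ?N)" using S.subgroup_subgrp_iff[OF Ns] assms by blast
  ultimately have "subgroup (A <#>\<^bsub>subgrp S ?N\<^esub> P) (subgrp S ?N)"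
    using N.mult_norm_subgroup by (metis N.commut_normal)
  then show "subgroup (A <#>\<^bsub>S\<^esub> P) S" "A <#>\<^bsub>S\<^esub> P \<subseteq> ?N" using S.subgroup_subgrp_iff[OF Ns] by auto
  show "A \<subseteq> A <#>\<^bsub>S\<^esub> P" "P \<subseteq> A <#>\<^bsub>S\<^esub> P"
    using assms subgroup.one_closed[OF assms(1)] subgroup.one_closed[OF assms(2)]
    by (force simp: set_mult_def dest: subgroup.mem_carrier)+
qed

text \<open>Suppose that \<open>\<gamma>\<close> conjugates \<open>a\<close> to \<open>f a\<close> for all \<open>a \<in> A\<close>. Then it conjugates \<open>AP\<close> into \<open>BP\<close>, and
  the extension axiom provides an extension \<open>\<theta>\<close> of \<open>\<gamma>\<close>. Restricting \<open>a \<theta> = \<theta> (a\<theta>)\<close> to \<open>P\<close> shows that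
  \<open>\<theta>\<close> maps \<open>a\<close> to \<open>f a\<close>.\<close>

lemma el_commute_extend:
  assumes P: "P \<in> ob T" and A: "subgroup A S" "A \<subseteq> normalizer S P" and B: "subgroup B S" "B \<subseteq> normalizer S P"
    and g: "\<gamma> \<in> thom T P P" and f: "\<And>a. a \<in> A \<Longrightarrow> f a \<in> B \<and> el P a \<star> \<gamma> = \<gamma> \<star> el P (f a)"
  shows "\<exists>\<psi> \<in> F (A <#>\<^bsub>S\<^esub> P) (B <#>\<^bsub>S\<^esub> P). (\<forall>a\<in>A. \<psi> a = f a) \<and> (\<forall>x\<in>P. \<psi> x = rho T \<gamma> x)"
proof -
  let ?A = "A <#>\<^bsub>S\<^esub> P" and ?B = "B <#>\<^bsub>S\<^esub> P"
  have Ps: "subgroup P S" using ob_subgroups P by blast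
  note As = subgroup_set_mult_normalizing[OF Ps A] and Bs = subgroup_set_mult_normalizing[OF Ps B]
  have Aob: "?A \<in> ob T" and Bob: "?B \<in> ob T" using ob_overgroups[OF P] As Bs by auto
  obtain \<gamma>' where gg: "inverse_pair T P P \<gamma> \<gamma>'" using endo_iso[OF g] .
  have g': "\<gamma>' \<in> thom T P P" "\<gamma>' \<star> \<gamma> = tid T P" using gg by (auto simp: inverse_pair_def)
  have PN: "x \<in> normalizer S P" if "x \<in> P" for x using that mem_normalizer[OF P] by blast
  have "\<forall>y\<in>?A. tcomp T \<gamma>' (tcomp T (el P y) \<gamma>) \<in> el P ` ?B"
  proof
    fix y assume "y \<in> ?A"
    then obtain a x where y: "a \<in> A" "x \<in> P" "y = a \<otimes>\<^bsub>S\<^esub> x" by (auto simp: set_mult_def)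
    have N: "a \<in> normalizer S P" "x \<in> normalizer S P" "f a \<in> normalizer S P" "rho T \<gamma> x \<in> normalizer S P"
      using y A B f PN rho_mem[OF g] by auto
    note e = el_in[OF P N(1)] el_in[OF P N(2)] el_in[OF P N(3)] el_in[OF P N(4)]
    have "el P y \<star> \<gamma> = el P a \<star> (\<gamma> \<star> el P (rho T \<gamma> x))"
      using y el_mult[OF P N(1,2)] tcomp_assoc[OF e(1,2) g] eps_commute[OF g y(2)] by simp
    also have "\<dots> = \<gamma> \<star> (el P (f a) \<star> el P (rho T \<gamma> x))"
      using tcomp_assoc[OF e(1) g e(4)] tcomp_assoc[OF g e(3,4)] f[OF y(1)] by simp
    also have "\<dots> = \<gamma> \<star> el P (f a \<otimes>\<^bsub>S\<^esub> rho T \<gamma> x)" using el_mult[OF P N(3,4)] by simp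
    finally have "\<gamma>' \<star> (el P y \<star> \<gamma>) = (\<gamma>' \<star> \<gamma>) \<star> el P (f a \<otimes>\<^bsub>S\<^esub> rho T \<gamma> x)"
      using tcomp_assoc[OF g'(1) g el_in[OF P]] subgroup.m_closed[OF subgroup_normalizer[OF Ps] N(3,4)] by simp
    then have "\<gamma>' \<star> (el P y \<star> \<gamma>) = el P (f a \<otimes>\<^bsub>S\<^esub> rho T \<gamma> x)"
      using g' tcomp_tid[OF el_in[OF P subgroup.m_closed[OF subgroup_normalizer[OF Ps] N(3,4)]]] by simp
    moreover have "f a \<otimes>\<^bsub>S\<^esub> rho T \<gamma> x \<in> ?B" using f[OF y(1)] rho_mem[OF g y(2)] by (auto simp: set_mult_def)
    ultimately show "tcomp T \<gamma>' (tcomp T (el P y) \<gamma>) \<in> el P ` ?B" by simp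
  qed
  then obtain \<theta> where th: "\<theta> \<in> thom T ?A ?B" "inc P ?A \<star> \<theta> = \<gamma> \<star> inc P ?B"
    using extension[OF gg As(1) S.normal_in_normalizer[OF Ps As(1,3,4)] Bs(1) S.normal_in_normalizer[OF Ps Bs(1,3,4)]]
    by blast
  have iA: "inc P ?A \<in> thom T P ?A" and iB: "inc P ?B \<in> thom T P ?B" using inc_in P Aob Bob As Bs by auto
  have onP: "rho T \<theta> x = rho T \<gamma> x" if x: "x \<in> P" for x
    using rho_comp[OF iA th(1) x] rho_comp[OF g iB x] th(2) rho_inc[OF P Aob As(3) x]
      rho_inc[OF P Bob Bs(3) rho_mem[OF g x]] by simp
  have onA: "rho T \<theta> a = f a" if a: "a \<in> A" for a
  proof -
    have aA: "a \<in> ?A" using a As by blast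
    define b where "b = rho T \<theta> a"
    have bB: "b \<in> ?B" unfolding b_def using rho_mem[OF th(1) aA] .
    have N: "a \<in> normalizer S P" "b \<in> normalizer S P" "f a \<in> normalizer S P" using a bB A B Bs f by auto
    have Na: "a \<in> normalizer S ?A" "b \<in> normalizer S ?B" using aA bB mem_normalizer Aob Bob by auto
    note e = el_in[OF P N(1)] el_in[OF P N(2)] el_in[OF P N(3)] el_in[OF Aob Na(1)] el_in[OF Bob Na(2)]
    have "\<gamma> \<star> (el P (f a) \<star> inc P ?B) = el P a \<star> (inc P ?A \<star> \<theta>)"
      using tcomp_assoc[OF g e(3) iB] tcomp_assoc[OF e(1) g iB] f[OF a] th(2) by simp
    also have "\<dots> = inc P ?A \<star> (el ?A a \<star> \<theta>)"
      using tcomp_assoc[OF e(1) iA th(1)] tcomp_assoc[OF iA e(4) th(1)] el_inc(1)[OF P Aob As(3) N(1) Na(1)] by simp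
    also have "\<dots> = (inc P ?A \<star> \<theta>) \<star> el ?B b"
      using eps_commute[OF th(1) aA] tcomp_assoc[OF iA th(1) e(5)] by (simp add: b_def)
    also have "\<dots> = \<gamma> \<star> (el P b \<star> inc P ?B)"
      using th(2) tcomp_assoc[OF g iB e(5)] el_inc(1)[OF P Bob Bs(3) N(2) Na(2)] by simp
    finally have "(\<gamma>' \<star> \<gamma>) \<star> (el P (f a) \<star> inc P ?B) = (\<gamma>' \<star> \<gamma>) \<star> (el P b \<star> inc P ?B)"
      using tcomp_assoc[OF g'(1) g tcomp_in[OF e(3) iB]] tcomp_assoc[OF g'(1) g tcomp_in[OF e(2) iB]] by simp
    then have "el P (f a) \<star> inc P ?B = el P b \<star> inc P ?B"
      using g' tcomp_tid[OF tcomp_in[OF e(3) iB]] tcomp_tid[OF tcomp_in[OF e(2) iB]] by simp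
    then have "el P (f a) = el P b" using tcomp_mono[OF e(3) e(2) iB] by blast
    then show ?thesis using el_inj[OF P N(3) N(2)] b_def by simp
  qed
  show ?thesis using rho_in[OF th(1)] onA onP by blast
qed

text \<open>One direction is the preceding lemma. For the other one, a morphism from \<open>AP\<close> to \<open>BP\<close> that leaves
  \<open>P\<close> invariant restricts to an element of \<open>Aut\<^sub>T(P)\<close>.\<close>

lemma normalizer_fusion_eq:
  assumes P: "P \<in> ob T"
  shows "normalizer_fusion S F P A B =
    (if subgroup A S \<and> subgroup B S \<and> A \<subseteq> normalizer S P \<and> B \<subseteq> normalizer S P
     then {f \<in> extensional A. \<exists>\<gamma>\<in>thom T P P. \<forall>a\<in>A. f a \<in> B \<and> el P a \<star> \<gamma> = \<gamma> \<star> el P (f a)} else {})"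
    (is "_ = ?R")
proof (cases "subgroup A S \<and> subgroup B S \<and> A \<subseteq> normalizer S P \<and> B \<subseteq> normalizer S P")
  case False
  then show ?thesis unfolding normalizer_fusion_def using F_subgroups by auto
next
  case True
  then have A: "subgroup A S" "A \<subseteq> normalizer S P" and B: "subgroup B S" "B \<subseteq> normalizer S P" by auto
  have Ps: "subgroup P S" using ob_subgroups P by blast
  note As = subgroup_set_mult_normalizing[OF Ps A] and Bs = subgroup_set_mult_normalizing[OF Ps B]
  let ?A = "A <#>\<^bsub>S\<^esub> P" and ?B = "B <#>\<^bsub>S\<^esub> P"
  have Aob: "?A \<in> ob T" and Bob: "?B \<in> ob T" using ob_overgroups[OF P] As Bs by auto
  have iA: "inc P ?A \<in> thom T P ?A" and iB: "inc P ?B \<in> thom T P ?B" using inc_in P Aob Bob As Bs by auto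
  show ?thesis
  proof (intro equalityI subsetI)
    fix f assume "f \<in> normalizer_fusion S F P A B"
    then obtain \<psi> where f: "f \<in> F A B" and psi: "\<psi> \<in> F ?A ?B" "\<forall>x\<in>A. \<psi> x = f x" "\<psi> ` P = P"
      by (auto simp: normalizer_fusion_def split: if_splits)
    obtain \<theta> where th: "\<theta> \<in> thom T ?A ?B" "rho T \<theta> = \<psi>" using rho_surj[OF Aob Bob] psi by (metis imageE)
    have sub: "rho T \<theta> ` P \<subseteq> P" using psi th by simp
    obtain \<gamma> where g: "\<gamma> \<in> thom T P P" "\<gamma> \<star> inc P ?B = inc P ?A \<star> \<theta>"
      using restrict_morphism[OF th(1) P As(3) P Bs(3) sub] by metis
    have "f a \<in> B \<and> el P a \<star> \<gamma> = \<gamma> \<star> el P (f a)" if a: "a \<in> A" for a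
    proof
      show fa: "f a \<in> B" using F_hom(2)[OF f a] .
      have N: "a \<in> normalizer S P" "f a \<in> normalizer S P" using a fa A B by auto
      have Na: "a \<in> normalizer S ?A" "f a \<in> normalizer S ?B" using a fa As Bs mem_normalizer Aob Bob by blast+
      note e = el_in[OF P N(1)] el_in[OF P N(2)] el_in[OF Aob Na(1)] el_in[OF Bob Na(2)]
      have rf: "rho T \<theta> a = f a" using psi th a by auto
      have "(el P a \<star> \<gamma>) \<star> inc P ?B = el P a \<star> (inc P ?A \<star> \<theta>)" using tcomp_assoc[OF e(1) g(1) iB] g(2) by simp
      also have "\<dots> = inc P ?A \<star> (el ?A a \<star> \<theta>)"
        using tcomp_assoc[OF e(1) iA th(1)] tcomp_assoc[OF iA e(3) th(1)] el_inc(1)[OF P Aob As(3) N(1) Na(1)] by simp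
      also have "\<dots> = (inc P ?A \<star> \<theta>) \<star> el ?B (f a)"
        using eps_commute[OF th(1), of a] a As(2) tcomp_assoc[OF iA th(1) e(4)] rf by auto
      also have "\<dots> = (\<gamma> \<star> el P (f a)) \<star> inc P ?B"
        using g(2) tcomp_assoc[OF g(1) iB e(4)] tcomp_assoc[OF g(1) e(2) iB] el_inc(1)[OF P Bob Bs(3) N(2) Na(2)] by simp
      finally show "el P a \<star> \<gamma> = \<gamma> \<star> el P (f a)"
        using tcomp_mono[OF tcomp_in[OF e(1) g(1)] tcomp_in[OF g(1) e(2)] iB] by blast
    qed
    then show "f \<in> ?R" using True g(1) F_hom(1)[OF f] by auto
  next
    fix f assume "f \<in> ?R"
    then obtain \<gamma> where fe: "f \<in> extensional A" and g: "\<gamma> \<in> thom T P P"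
      and f: "\<And>a. a \<in> A \<Longrightarrow> f a \<in> B \<and> el P a \<star> \<gamma> = \<gamma> \<star> el P (f a)" using True by auto
    obtain \<psi> where psi: "\<psi> \<in> F ?A ?B" "\<forall>a\<in>A. \<psi> a = f a" "\<forall>x\<in>P. \<psi> x = rho T \<gamma> x"
      using el_commute_extend[OF P A B g f] by blast
    have "restrict \<psi> A \<in> F A B"
      by (rule F_restrict[OF psi(1) A(1) As(2) B(1)]) (use psi(2) f in auto)
    moreover have "restrict \<psi> A = f" using psi(2) fe by (intro extensionalityI[of _ A]) auto
    moreover have "\<exists>\<psi> \<in> F ?A ?B. (\<forall>x\<in>A. \<psi> x = f x) \<and> \<psi> ` P = P"
    proof -
      obtain \<gamma>' where "inverse_pair T P P \<gamma> \<gamma>'" using endo_iso[OF g] .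
      then have "rho T \<gamma> ` P = P" by (rule conj_iso(4))
      then have "\<psi> ` P = P" using psi(3) by (simp cong: image_cong_simp)
      then show ?thesis using psi by blast
    qed
    ultimately show "f \<in> normalizer_fusion S F P A B"
      unfolding normalizer_fusion_def using True by simp
  qed
qed

end

section \<open>Objective characteristic p and subcentric subgroups\<close>

lemma (in plain_group) subset_set_mult:
  assumes "U \<subseteq> carrier G" "V \<subseteq> carrier G"
  shows "\<one> \<in> V \<Longrightarrow> U \<subseteq> U <#> V" "\<one> \<in> U \<Longrightarrow> V \<subseteq> U <#> V"
proof -
  show "U \<subseteq> U <#> V" if "\<one> \<in> V"
  proof
    fix u assume "u \<in> U"
    then have "u = u \<otimes> \<one>" using assms by auto
    then show "u \<in> U <#> V" using \<open>u \<in> U\<close> that unfolding set_mult_def by blast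
  qed
  show "V \<subseteq> U <#> V" if "\<one> \<in> U"
  proof
    fix v assume "v \<in> V"
    then have "v = \<one> \<otimes> v" using assms by auto
    then show "v \<in> U <#> V" using \<open>v \<in> V\<close> that unfolding set_mult_def by blast
  qed
qed

text \<open>Extend a morphism first to the product with \<open>Q\<close>, then to the product with \<open>R\<close>.\<close>

lemma (in plain_group) normal_in_fusion_mult:
  assumes E: "\<And>A B \<phi>. \<phi> \<in> E A B \<Longrightarrow> subgroup A G \<and> subgroup B G \<and>
      (\<forall>x\<in>A. \<forall>y\<in>A. \<phi> (x \<otimes> y) = \<phi> x \<otimes> \<phi> y)"
    and Q: "normal_in_fusion G E Q" and R: "normal_in_fusion G E R"
  shows "normal_in_fusion G E (Q <#> R)"
proof -
  have QN: "Q \<lhd> G" and RN: "R \<lhd> G" using Q R by (auto simp: normal_in_fusion_def)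
  have Qs: "subgroup Q G" and Rs: "subgroup R G" using QN RN normal_imp_subgroup by auto
  note Qc = subgroup.subset[OF Qs] and Rc = subgroup.subset[OF Rs]
  have ext: "\<exists>\<psi>\<in>E (A <#> U) (B <#> U). (\<forall>x\<in>A. \<psi> x = \<phi> x) \<and> \<psi> ` U = U"
    if U: "normal_in_fusion G E U" and f: "\<phi> \<in> E A B" for U A B \<phi>
  proof -
    have "\<phi> \<in> normalizer_fusion G E U A B" using U f by (simp add: normal_in_fusion_def)
    then show ?thesis by (auto simp: normalizer_fusion_def split: if_splits)
  qed
  have N: "Q <#> R \<lhd> G"
  proof -
    have "subgroup (Q <#> R) G" using mult_norm_subgroup[OF QN Rs] commut_normal[OF Qs RN] by simp
    moreover have "conj_by G g x \<in> Q <#> R" if "g \<in> carrier G" "x \<in> Q <#> R" for g x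
    proof -
      from that obtain q r where "q \<in> Q" "r \<in> R" "x = q \<otimes> r" by (auto simp: set_mult_def)
      then show ?thesis
        using that conj_by_mult[of g q r] QN RN Qc Rc unfolding normal_iff_conj_by set_mult_def by blast
    qed
    ultimately show ?thesis unfolding normal_iff_conj_by by blast
  qed
  have NG: "normalizer G (Q <#> R) = carrier G"
  proof -
    have "subgroup (Q <#> R) G" using N normal_imp_subgroup by blast
    note c = subgroup.subset[OF this]
    have sub: "conj_by G g ` (Q <#> R) \<subseteq> Q <#> R" if "g \<in> carrier G" for g
      using N that unfolding normal_iff_conj_by by blast
    have "conj_by G g ` (Q <#> R) = Q <#> R" if g: "g \<in> carrier G" for g
    proof -
      have "Q <#> R = conj_by G g ` conj_by G (inv g) ` (Q <#> R)"
        using conj_by_image_comp[of "inv g" g] g c by (simp add: subset_iff cong: image_cong_simp)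
      then show ?thesis using sub[OF g] sub[OF inv_closed[OF g]] by blast
    qed
    then show ?thesis unfolding normalizer_eq[OF c] by blast
  qed
  have "normalizer_fusion G E (Q <#> R) A B = E A B" for A B
  proof (intro equalityI subsetI)
    fix \<phi> assume "\<phi> \<in> normalizer_fusion G E (Q <#> R) A B"
    then show "\<phi> \<in> E A B" by (auto simp: normalizer_fusion_def split: if_splits)
  next
    fix \<phi> assume f: "\<phi> \<in> E A B"
    then have A: "subgroup A G" and B: "subgroup B G" using E by auto
    note Ac = subgroup.subset[OF A] and Bc = subgroup.subset[OF B]
    obtain \<psi>1 where 1: "\<psi>1 \<in> E (A <#> Q) (B <#> Q)" "\<forall>x\<in>A. \<psi>1 x = \<phi> x" "\<psi>1 ` Q = Q"
      using ext[OF Q f] by blast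
    obtain \<psi> where 2: "\<psi> \<in> E (A <#> Q <#> R) (B <#> Q <#> R)" "\<forall>x\<in>A <#> Q. \<psi> x = \<psi>1 x" "\<psi> ` R = R"
      using ext[OF R 1(1)] by blast
    have sets: "A <#> Q <#> R = A <#> (Q <#> R)" "B <#> Q <#> R = B <#> (Q <#> R)"
      using set_mult_assoc Ac Bc Qc Rc by auto
    have AQ: "A \<subseteq> A <#> Q" "Q \<subseteq> A <#> Q"
      using subset_set_mult[OF Ac Qc] subgroup.one_closed[OF A] subgroup.one_closed[OF Qs] by auto
    have QR: "Q \<subseteq> A <#> Q <#> R" "R \<subseteq> A <#> Q <#> R"
    proof -
      have "\<one> \<in> A <#> Q" using AQ subgroup.one_closed[OF A] by blast
      moreover have "A <#> Q \<subseteq> carrier G" using Ac Qc setmult_subset_G by blast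
      ultimately show "R \<subseteq> A <#> Q <#> R" using subset_set_mult(2)[OF _ Rc] by blast
      have "A <#> Q \<subseteq> A <#> Q <#> R"
        using subset_set_mult(1)[OF \<open>A <#> Q \<subseteq> carrier G\<close> Rc] subgroup.one_closed[OF Rs] by blast
      then show "Q \<subseteq> A <#> Q <#> R" using AQ by blast
    qed
    have "\<psi> ` Q = Q" using 1(3) 2(2) AQ(2) by (metis (no_types, lifting) image_cong subsetD)
    have im: "\<psi> ` (Q <#> R) = \<psi> ` Q <#> \<psi> ` R"
    proof -
      have "\<psi> (q \<otimes> r) = \<psi> q \<otimes> \<psi> r" if "q \<in> Q" "r \<in> R" for q r
        using E[OF 2(1)] QR that by blast
      then show ?thesis unfolding set_mult_def by (auto simp: image_iff) metis+
    qed
    have "\<psi> \<in> E (A <#> (Q <#> R)) (B <#> (Q <#> R))" "\<forall>x\<in>A. \<psi> x = \<phi> x" "\<psi> ` (Q <#> R) = Q <#> R"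
      using 2 1 sets AQ im \<open>\<psi> ` Q = Q\<close> by auto
    then show "\<phi> \<in> normalizer_fusion G E (Q <#> R) A B"
      unfolding normalizer_fusion_def using f NG Ac Bc by auto
  qed
  then show ?thesis using N by (auto simp: normal_in_fusion_def fun_eq_iff)
qed

text \<open>As products of normal subgroups are normal, one of maximal order contains all the others.\<close>

lemma (in plain_group) fusion_core_greatest:
  assumes fin: "finite (carrier G)"
    and E: "\<And>A B \<phi>. \<phi> \<in> E A B \<Longrightarrow> subgroup A G \<and> subgroup B G \<and>
      (\<forall>x\<in>A. \<forall>y\<in>A. \<phi> (x \<otimes> y) = \<phi> x \<otimes> \<phi> y)"
    and Q: "normal_in_fusion G E Q"
  shows "normal_in_fusion G E (fusion_core G E)" "Q \<subseteq> fusion_core G E"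
proof -
  have sub: "subgroup R G" if "normal_in_fusion G E R" for R
    using that normal_imp_subgroup by (auto simp: normal_in_fusion_def)
  have "card R < Suc (order G)" if "normal_in_fusion G E R" for R
    using subgroup.subset[OF sub[OF that]] fin by (simp add: order_def card_mono less_Suc_eq_le)
  then obtain M where M: "normal_in_fusion G E M" and max: "\<And>R. normal_in_fusion G E R \<Longrightarrow> card R \<le> card M"
    using ex_has_greatest_nat[of "normal_in_fusion G E" Q card "Suc (order G)"] Q by blast
  have le: "R \<subseteq> M" if R: "normal_in_fusion G E R" for R
  proof -
    have MR: "normal_in_fusion G E (M <#> R)" using normal_in_fusion_mult[OF E M R] by blast
    have s: "M \<subseteq> M <#> R" "R \<subseteq> M <#> R"
      using subset_set_mult[OF subgroup.subset[OF sub[OF M]] subgroup.subset[OF sub[OF R]]]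
        subgroup.one_closed[OF sub[OF R]] subgroup.one_closed[OF sub[OF M]] by auto
    have "finite (M <#> R)" using fin subgroup.subset[OF sub[OF MR]] finite_subset by blast
    then have "M = M <#> R" using card_seteq[OF _ s(1)] max[OF MR] by blast
    then show ?thesis using s by simp
  qed
  have "fusion_core G E = M" unfolding fusion_core_def
    by (rule Greatest_equality[of "normal_in_fusion G E"]) (use M le in auto)
  then show "normal_in_fusion G E (fusion_core G E)" "Q \<subseteq> fusion_core G E" using M le[OF Q] by auto
qed

context prime_transporter_system
begin

text \<open>The condition \<open>E(P) \<le> P\<close> is stronger than \<open>C\<^sub>S(P) \<le> P\<close> and, unlike the latter, is invariant under
  conjugation in \<open>F\<close>. Hence it implies that \<open>P\<close> is centric.\<close>

lemma E_T_in_el_conj: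
  assumes "P \<in> ob T" "Q \<in> conjugates S F P" "E_T T P \<subseteq> el P ` P"
  shows "E_T T Q \<subseteq> el Q ` Q"
proof -
  obtain \<alpha> \<beta> where ab: "inverse_pair T P Q \<alpha> \<beta>" using conjugate_iso[OF assms(1,2)] .
  have "E_T T Q \<subseteq> (\<lambda>g. \<beta> \<star> g \<star> \<alpha>) ` el P ` P" using conj_iso(2)[OF ab] assms(3) by blast
  also have "\<dots> \<subseteq> el Q ` Q" using conj_iso(3,4)[OF ab] by auto
  finally show ?thesis .
qed

lemma centralizer_subset_of_E_T:
  assumes "P \<in> ob T" "E_T T P \<subseteq> el P ` P" shows "centralizer S P \<subseteq> P"
proof
  fix c assume c: "c \<in> centralizer S P"
  have cN: "c \<in> normalizer S P" using c centralizer_subset_normalizer[OF ob_subgroups[OF assms(1)]] by blast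
  then have "el P c \<in> E_T T P" using el_in_E_T_iff[OF assms(1)] c by blast
  then obtain z where "z \<in> P" "el P c = el P z" using assms(2) by blast
  then show "c \<in> P" using el_inj[OF assms(1) cN mem_normalizer[OF assms(1)]] by metis
qed

lemma centricI:
  assumes "P \<in> ob T" "E_T T P \<subseteq> el P ` P" shows "P \<in> centric S F"
  unfolding centric_def
  using centralizer_subset_of_E_T[OF ob_conj[OF assms(1)] E_T_in_el_conj[OF assms(1) _ assms(2)]] ob_subgroups assms(1)
  by blast

lemma centric_overgroup:
  assumes "P \<in> centric S F" "subgroup Q S" "P \<subseteq> Q" shows "Q \<in> centric S F"
proof -
  have Ps: "subgroup P S" using assms by (auto simp: centric_def)
  have "centralizer S R \<subseteq> R" if "R \<in> conjugates S F Q" for R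
  proof -
    obtain \<phi> where f: "\<phi> \<in> F Q R" "\<phi> ` Q = R" using \<open>R \<in> conjugates S F Q\<close> by (rule conjugatesE)
    have "restrict \<phi> P \<in> F P R"
      using F_restrict[OF f(1) Ps assms(3)] f(2) assms(3) F_subgroups[OF f(1)] by blast
    then have "\<phi> ` P \<in> conjugates S F P" using conjugatesI by fastforce
    then have "centralizer S (\<phi> ` P) \<subseteq> \<phi> ` P" using assms(1) by (auto simp: centric_def)
    moreover have "\<phi> ` P \<subseteq> R" using f assms(3) by blast
    moreover have "centralizer S R \<subseteq> centralizer S (\<phi> ` P)" using \<open>\<phi> ` P \<subseteq> R\<close> by (auto simp: centralizer_def)
    ultimately show ?thesis by blast
  qed
  then show ?thesis using assms by (auto simp: centric_def)
qed

lemma normalizer_fusion_hom: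
  assumes P: "P \<in> ob T" and f: "\<phi> \<in> normalizer_fusion S F P A B"
  shows "subgroup A (subgrp S (normalizer S P)) \<and> subgroup B (subgrp S (normalizer S P)) \<and>
      (\<forall>x\<in>A. \<forall>y\<in>A. \<phi> (x \<otimes>\<^bsub>S\<^esub> y) = \<phi> x \<otimes>\<^bsub>S\<^esub> \<phi> y)"
proof -
  have f': "\<phi> \<in> F A B" "A \<subseteq> normalizer S P" "B \<subseteq> normalizer S P"
    using f by (auto simp: normalizer_fusion_def split: if_splits)
  show ?thesis
    using F_hom(4)[OF f'(1)] F_subgroups[OF f'(1)] f'(2,3)
      S.subgroup_subgrp_iff[OF subgroup_normalizer[OF ob_subgroups[OF P]]] by blast
qed

text \<open>Since \<open>N\<^sub>S(P)\<close> is a Sylow subgroup of \<open>Aut\<^sub>T(P)\<close>, it contains \<open>O\<^sub>p(Aut\<^sub>T(P))\<close>.\<close>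

lemma O_p_Aut_T:
  assumes P: "P \<in> ob T" and fn: "P \<in> fully_normalized S F"
  obtains Q where "subgroup Q S" "P \<subseteq> Q" "Q \<subseteq> normalizer S P" "el P ` Q = O_p p (Aut_T T P)"
proof -
  interpret A: plain_group "Aut_T T P" by (rule plain_group_Aut_T[OF P])
  interpret e: group_hom "subgrp S (normalizer S P)" "Aut_T T P" "el P" by (rule el_group_hom[OF P])
  have Ps: "subgroup P S" using P ob_subgroups by blast
  note O = A.O_p_greatest[OF prime_p finite_Aut_T[OF P]]
  obtain n where n: "card (O_p p (Aut_T T P)) = p ^ n" using O(2) by blast
  have OS: "O_p p (Aut_T T P) \<subseteq> el P ` normalizer S P"
    using A.normal_p_subgroup_in_sylow[OF prime_p fully_normalized_imp_sylow[OF P fn] O(1) n] .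
  define Q where "Q = {g \<in> normalizer S P. el P g \<in> O_p p (Aut_T T P)}"
  have im: "el P ` Q = O_p p (Aut_T T P)" using OS by (auto simp: Q_def)
  have Os: "subgroup (O_p p (Aut_T T P)) (Aut_T T P)" using O(1) normal_imp_subgroup by blast
  have Ns: "subgroup (normalizer S P) S" using subgroup_normalizer[OF Ps] .
  have "subgroup Q (subgrp S (normalizer S P))"
  proof
    show "\<one>\<^bsub>subgrp S (normalizer S P)\<^esub> \<in> Q" "\<And>x y. x \<in> Q \<Longrightarrow> y \<in> Q \<Longrightarrow> x \<otimes>\<^bsub>subgrp S (normalizer S P)\<^esub> y \<in> Q"
      using subgroup.one_closed[OF Os] subgroup.m_closed[OF Os] subgroup.m_closed[OF Ns] subgroup.one_closed[OF Ns]
        e.hom_one by (auto simp: Q_def el_mult[OF P])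
    show "inv\<^bsub>subgrp S (normalizer S P)\<^esub> x \<in> Q" if "x \<in> Q" for x
      using that e.hom_inv[of x] subgroup.m_inv_closed[OF Os] e.G.inv_closed[of x] by (auto simp: Q_def)
  qed (auto simp: Q_def)
  then have Qs: "subgroup Q S" "Q \<subseteq> normalizer S P" using S.subgroup_subgrp_iff[OF Ns] by auto
  obtain k where "card (el P ` P) = p ^ k"
    using card_el_image[OF P] card_subgroup_S[OF Ps] S.subgroup_subset_normalizer[OF Ps] by metis
  then have "el P ` P \<subseteq> O_p p (Aut_T T P)" using O(3)[OF el_image_normal[OF P]] by blast
  then have "P \<subseteq> Q" using mem_normalizer[OF P] by (auto simp: Q_def)
  then show thesis using that Qs im by blast
qed

text \<open>An element of \<open>E(Q)\<close> restricts to an element of \<open>Aut\<^sub>T(P)\<close> that centralizes \<open>Q\<close>. As \<open>Aut\<^sub>T(P)\<close> is of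
  characteristic \<open>p\<close>, the restriction lies in \<open>Q\<close>, and by uniqueness of extensions so does the given
  element.\<close>

lemma O_p_centric:
  assumes P: "P \<in> ob T" and ch: "characteristic_p p (Aut_T T P)"
    and Q: "subgroup Q S" "P \<subseteq> Q" "Q \<subseteq> normalizer S P" "el P ` Q = O_p p (Aut_T T P)"
  shows "Q \<in> centric S F"
proof -
  have Qob: "Q \<in> ob T" using ob_overgroups[OF P Q(1,2)] .
  have i: "inc P Q \<in> thom T P Q" using inc_in[OF P Qob Q(2)] .
  have "E_T T Q \<subseteq> el Q ` Q"
  proof
    fix d assume d: "d \<in> E_T T Q"
    have dt: "d \<in> thom T Q Q" using d E_T_in by blast
    obtain c where c: "c \<in> thom T P P" "c \<star> inc P Q = inc P Q \<star> d"
      using restrict_morphism[OF dt P Q(2) P Q(2)] E_T_rho[OF d] Q(2) by (metis image_subsetI subsetD)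
    have "c \<in> centralizer (Aut_T T P) (O_p p (Aut_T T P))"
    proof -
      have "c \<star> el P g = el P g \<star> c" if g: "g \<in> Q" for g
      proof -
        have gN: "g \<in> normalizer S P" "g \<in> normalizer S Q" using g Q mem_normalizer[OF Qob] by auto
        note e = el_in[OF P gN(1)] el_in[OF Qob gN(2)]
        have "(el P g \<star> c) \<star> inc P Q = el P g \<star> (inc P Q \<star> d)" using tcomp_assoc[OF e(1) c(1) i] c(2) by simp
        also have "\<dots> = inc P Q \<star> (el Q g \<star> d)"
          using tcomp_assoc[OF e(1) i dt] tcomp_assoc[OF i e(2) dt] el_inc(1)[OF P Qob Q(2) gN] by simp
        also have "\<dots> = (inc P Q \<star> d) \<star> el Q g"
          using eps_commute[OF dt g] E_T_rho[OF d g] tcomp_assoc[OF i dt e(2)] by simp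
        also have "\<dots> = (c \<star> el P g) \<star> inc P Q"
          using c tcomp_assoc[OF c(1) i e(2)] tcomp_assoc[OF c(1) e(1) i] el_inc(1)[OF P Qob Q(2) gN] by simp
        finally show ?thesis using tcomp_mono[OF tcomp_in[OF e(1) c(1)] tcomp_in[OF c(1) e(1)] i] by simp
      qed
      then show ?thesis using c(1) by (auto simp: centralizer_def Aut_T_carrier[OF P] Q(4)[symmetric])
    qed
    then have "c \<in> el P ` Q" using ch Q(4) by (auto simp: characteristic_p_def)
    then obtain z where z: "z \<in> Q" "c = el P z" by blast
    have zN: "z \<in> normalizer S P" "z \<in> normalizer S Q" using z Q mem_normalizer[OF Qob] by auto
    have ez: "el Q z \<in> thom T Q Q" using el_in[OF Qob zN(2)] .
    have "inc P Q \<star> d = inc P Q \<star> el Q z"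
      using c z el_inc(1)[OF P Qob Q(2) zN] by simp
    then have "d = el Q z" using extension_unique[OF P Qob Q(2,3) dt ez] by blast
    then show "d \<in> el Q ` Q" using z by blast
  qed
  then show ?thesis using centricI[OF Qob] by blast
qed

text \<open>A morphism of \<open>N\<^sub>F(P)\<close> is conjugation by some \<open>\<gamma> \<in> Aut\<^sub>T(P)\<close>. Conjugation by \<open>\<gamma>\<close> leaves
  \<open>O\<^sub>p(Aut\<^sub>T(P))\<close> invariant, so it also defines the required extension to the product with \<open>Q\<close>.\<close>

lemma O_p_normal_in_normalizer_fusion:
  assumes P: "P \<in> ob T"
    and Q: "subgroup Q S" "P \<subseteq> Q" "Q \<subseteq> normalizer S P" "el P ` Q = O_p p (Aut_T T P)"
  shows "normal_in_fusion (subgrp S (normalizer S P)) (normalizer_fusion S F P) Q"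
proof -
  let ?N = "normalizer S P"
  have Ps: "subgroup P S" using P ob_subgroups by blast
  have Ns: "subgroup ?N S" using subgroup_normalizer[OF Ps] .
  interpret N: plain_group "subgrp S ?N" using S.group_subgrp[OF Ns] by (simp add: plain_group_def)
  interpret A: plain_group "Aut_T T P" by (rule plain_group_Aut_T[OF P])
  have ON: "O_p p (Aut_T T P) \<lhd> Aut_T T P" using A.O_p_greatest(1)[OF prime_p finite_Aut_T[OF P]] .
  have QsN: "subgroup Q (subgrp S ?N)" using Q S.subgroup_subgrp_iff[OF Ns] by blast
  have move: "\<exists>q'\<in>Q. el P q \<star> \<gamma> = \<gamma> \<star> el P q'" if q: "q \<in> Q" and g: "\<gamma> \<in> thom T P P" for q \<gamma>
  proof -
    have "el P q \<in> O_p p (Aut_T T P)" using q Q(4) by blast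
    then have "conj_by (Aut_T T P) \<gamma> (el P q) \<in> el P ` Q"
      using ON g Q(4) unfolding A.normal_iff_conj_by by (auto simp: Aut_T_carrier[OF P])
    then obtain q' where "q' \<in> Q" "conj_by (Aut_T T P) \<gamma> (el P q) = el P q'" by blast
    then show ?thesis
      using conj_by_Aut_iff[OF P g el_in[OF P] el_in[OF P], of q q'] Q(3) q by blast
  qed
  have uniq: "y = z" if "x \<in> ?N" "y \<in> ?N" "z \<in> ?N" "\<gamma> \<in> thom T P P"
      "el P x \<star> \<gamma> = \<gamma> \<star> el P y" "el P x \<star> \<gamma> = \<gamma> \<star> el P z" for x y z \<gamma>
  proof -
    have "conj_by (Aut_T T P) \<gamma> (el P x) = el P y" "conj_by (Aut_T T P) \<gamma> (el P x) = el P z"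
      using that conj_by_Aut_iff[OF P that(4) el_in[OF P] el_in[OF P]] by auto
    then show ?thesis using el_inj[OF P that(2,3)] by simp
  qed
  have QN: "Q \<lhd> subgrp S ?N"
    unfolding N.normal_iff_conj_by
  proof (intro conjI ballI QsN)
    fix g q assume g: "g \<in> carrier (subgrp S ?N)" and q: "q \<in> Q"
    have gN: "g \<in> ?N" "q \<in> ?N" using g q Q by auto
    have gc: "g \<in> carrier S" "q \<in> carrier S" using gN normalizer_carrier[OF P] by auto
    obtain q' where q': "q' \<in> Q" "el P q \<star> el P g = el P g \<star> el P q'" using move[OF q el_in[OF P gN(1)]] by blast
    have "el P (q \<otimes>\<^bsub>S\<^esub> g) = el P (g \<otimes>\<^bsub>S\<^esub> q')" using q' el_mult[OF P] gN Q(3) by (metis subsetD)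
    then have "q \<otimes>\<^bsub>S\<^esub> g = g \<otimes>\<^bsub>S\<^esub> q'"
      using el_inj[OF P subgroup.m_closed[OF Ns gN(2,1)] subgroup.m_closed[OF Ns gN(1)]] q' Q(3) by blast
    then have "conj_by S g q = q'"
      using S.conj_by_eq_iff[OF gc, of q'] q' Q(3) normalizer_carrier[OF P] by blast
    then show "conj_by (subgrp S ?N) g q \<in> Q" using S.conj_by_subgrp[OF Ns gN(1)] q' by simp
  qed
  have NN: "normalizer (subgrp S ?N) Q = ?N"
  proof -
    have QcN: "Q \<subseteq> carrier (subgrp S ?N)" using Q by simp
    show ?thesis
      unfolding N.normalizer_eq_finite[OF QcN finite_subgroup_S[OF Q(1)]]
      using QN unfolding N.normal_iff_conj_by by auto
  qed
  let ?E = "normalizer_fusion S F P"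
  have "normalizer_fusion (subgrp S ?N) ?E Q A B = ?E A B" for A B
  proof (intro equalityI subsetI)
    fix \<phi> assume "\<phi> \<in> normalizer_fusion (subgrp S ?N) ?E Q A B"
    then show "\<phi> \<in> ?E A B" by (auto simp: normalizer_fusion_def split: if_splits)
  next
    fix \<phi> assume f: "\<phi> \<in> ?E A B"
    then have sub: "subgroup A S" "subgroup B S" "A \<subseteq> ?N" "B \<subseteq> ?N"
      and fe: "\<phi> \<in> extensional A" and ex: "\<exists>\<gamma>\<in>thom T P P. \<forall>a\<in>A. \<phi> a \<in> B \<and> el P a \<star> \<gamma> = \<gamma> \<star> el P (\<phi> a)"
      unfolding normalizer_fusion_eq[OF P] by (auto split: if_splits)
    obtain \<gamma> where g: "\<gamma> \<in> thom T P P" and g2: "\<forall>a\<in>A. \<phi> a \<in> B \<and> el P a \<star> \<gamma> = \<gamma> \<star> el P (\<phi> a)"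
      using ex by blast
    have AQ: "subgroup (U <#>\<^bsub>S\<^esub> Q) S" "U \<subseteq> U <#>\<^bsub>S\<^esub> Q" "Q \<subseteq> U <#>\<^bsub>S\<^esub> Q" "U <#>\<^bsub>S\<^esub> Q \<subseteq> ?N"
      if U: "subgroup U S" "U \<subseteq> ?N" for U
    proof -
      have UN: "subgroup U (subgrp S ?N)" using U S.subgroup_subgrp_iff[OF Ns] by blast
      have "subgroup (U <#>\<^bsub>subgrp S ?N\<^esub> Q) (subgrp S ?N)"
        using N.mult_norm_subgroup[OF QN UN] N.commut_normal[OF UN QN] by metis
      then show "subgroup (U <#>\<^bsub>S\<^esub> Q) S" "U <#>\<^bsub>S\<^esub> Q \<subseteq> ?N" using S.subgroup_subgrp_iff[OF Ns] by auto
      show "U \<subseteq> U <#>\<^bsub>S\<^esub> Q" "Q \<subseteq> U <#>\<^bsub>S\<^esub> Q"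
        using S.subset_set_mult[OF subgroup.subset[OF U(1)] subgroup.subset[OF Q(1)]]
          subgroup.one_closed[OF U(1)] subgroup.one_closed[OF Q(1)] by auto
    qed
    note As = AQ[OF sub(1,3)] and Bs = AQ[OF sub(2,4)]
    have ex: "\<exists>y. y \<in> B <#>\<^bsub>S\<^esub> Q \<and> el P x \<star> \<gamma> = \<gamma> \<star> el P y" if "x \<in> A <#>\<^bsub>S\<^esub> Q" for x
    proof -
      from that obtain a q where x: "a \<in> A" "q \<in> Q" "x = a \<otimes>\<^bsub>S\<^esub> q" by (auto simp: set_mult_def)
      obtain q' where q': "q' \<in> Q" "el P q \<star> \<gamma> = \<gamma> \<star> el P q'" using move[OF x(2) g] by blast
      have N: "a \<in> ?N" "q \<in> ?N" "\<phi> a \<in> ?N" "q' \<in> ?N" using x q' g2 sub Q(3) by auto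
      note e = el_in[OF P N(1)] el_in[OF P N(2)] el_in[OF P N(3)] el_in[OF P N(4)]
      have "el P x \<star> \<gamma> = el P a \<star> (\<gamma> \<star> el P q')" using x el_mult[OF P N(1,2)] tcomp_assoc[OF e(1,2) g] q' by simp
      also have "\<dots> = \<gamma> \<star> el P (\<phi> a \<otimes>\<^bsub>S\<^esub> q')"
        using el_mult[OF P N(3,4)] tcomp_assoc[OF e(1) g e(4)] tcomp_assoc[OF g e(3,4)] g2 x by simp
      finally show ?thesis using g2 x(1) q'(1) by (auto simp: set_mult_def)
    qed
    define \<psi> where "\<psi> = (\<lambda>x\<in>A <#>\<^bsub>S\<^esub> Q. SOME y. y \<in> B <#>\<^bsub>S\<^esub> Q \<and> el P x \<star> \<gamma> = \<gamma> \<star> el P y)"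
    have psi: "\<psi> x \<in> B <#>\<^bsub>S\<^esub> Q \<and> el P x \<star> \<gamma> = \<gamma> \<star> el P (\<psi> x)" if "x \<in> A <#>\<^bsub>S\<^esub> Q" for x
      using someI_ex[OF ex[OF that]] that by (simp add: \<psi>_def)
    have "\<psi> \<in> extensional (A <#>\<^bsub>S\<^esub> Q)" by (simp add: \<psi>_def)
    moreover have "\<exists>\<gamma>\<in>thom T P P. \<forall>a\<in>A <#>\<^bsub>S\<^esub> Q. \<psi> a \<in> B <#>\<^bsub>S\<^esub> Q \<and> el P a \<star> \<gamma> = \<gamma> \<star> el P (\<psi> a)"
      using g psi by blast
    ultimately have psiE: "\<psi> \<in> ?E (A <#>\<^bsub>S\<^esub> Q) (B <#>\<^bsub>S\<^esub> Q)"
      unfolding normalizer_fusion_eq[OF P] using As Bs by simp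
    have on: "\<psi> a = \<phi> a" if "a \<in> A" for a
      using uniq[of a "\<psi> a" "\<phi> a", OF _ _ _ g] psi[of a] g2 that As(2) Bs(4) sub by blast
    have "\<psi> q \<in> Q" if q: "q \<in> Q" for q
    proof -
      obtain q' where q': "q' \<in> Q" "el P q \<star> \<gamma> = \<gamma> \<star> el P q'" using move[OF q g] by blast
      have "\<psi> q = q'" using uniq[of q "\<psi> q" q', OF _ _ _ g] psi[of q] q q' As(3) Bs(4) Q(3) by blast
      then show ?thesis using q' by simp
    qed
    moreover have "inj_on \<psi> Q"
    proof -
      have "\<psi> \<in> F (A <#>\<^bsub>S\<^esub> Q) (B <#>\<^bsub>S\<^esub> Q)" using psiE by (auto simp: normalizer_fusion_def split: if_splits)
      then show ?thesis using F_hom(3) As(3) inj_on_subset by blast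
    qed
    ultimately have "\<psi> ` Q = Q" using finite_subgroup_S[OF Q(1)] by (intro endo_inj_surj) auto
    then have "\<exists>\<psi>\<in>?E (A <#>\<^bsub>S\<^esub> Q) (B <#>\<^bsub>S\<^esub> Q). (\<forall>x\<in>A. \<psi> x = \<phi> x) \<and> \<psi> ` Q = Q"
      using psiE on by blast
    then show "\<phi> \<in> normalizer_fusion (subgrp S ?N) ?E Q A B"
      unfolding normalizer_fusion_def[of "subgrp S ?N"] using f sub NN by simp
  qed
  then show ?thesis using QN by (auto simp: normal_in_fusion_def fun_eq_iff)
qed

theorem objective_char_subcentric:
  assumes ch: "\<And>P. P \<in> ob T \<Longrightarrow> characteristic_p p (Aut_T T P)"
  shows "ob T \<subseteq> subcentric S F"
proof
  fix P0 assume P0: "P0 \<in> ob T"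
  have "fusion_core (subgrp S (normalizer S P)) (normalizer_fusion S F P) \<in> centric S F"
    if "P \<in> conjugates S F P0 \<inter> fully_normalized S F" for P
  proof -
    have P: "P \<in> ob T" "P \<in> fully_normalized S F" using that ob_conj P0 by auto
    obtain Q where Q: "subgroup Q S" "P \<subseteq> Q" "Q \<subseteq> normalizer S P" "el P ` Q = O_p p (Aut_T T P)"
      using O_p_Aut_T[OF P] .
    have Ns: "subgroup (normalizer S P) S" using subgroup_normalizer[OF ob_subgroups[OF P(1)]] .
    interpret N: plain_group "subgrp S (normalizer S P)" using S.group_subgrp[OF Ns] by (simp add: plain_group_def)
    have fin: "finite (carrier (subgrp S (normalizer S P)))" using finite_subgroup_S[OF Ns] by simp
    have hom: "subgroup A (subgrp S (normalizer S P)) \<and> subgroup B (subgrp S (normalizer S P)) \<and>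
      (\<forall>x\<in>A. \<forall>y\<in>A. \<phi> (x \<otimes>\<^bsub>subgrp S (normalizer S P)\<^esub> y) = \<phi> x \<otimes>\<^bsub>subgrp S (normalizer S P)\<^esub> \<phi> y)"
      if "\<phi> \<in> normalizer_fusion S F P A B" for A B \<phi>
      using normalizer_fusion_hom[OF P(1) that] by simp
    note core = N.fusion_core_greatest[OF fin hom O_p_normal_in_normalizer_fusion[OF P(1) Q]]
    have "subgroup (fusion_core (subgrp S (normalizer S P)) (normalizer_fusion S F P)) S"
      using core(1) normal_imp_subgroup S.subgroup_subgrp_iff[OF Ns] unfolding normal_in_fusion_def by blast
    then show ?thesis
      using centric_overgroup[OF O_p_centric[OF P(1) ch[OF P(1)] Q] _ core(2)] by blast
  qed
  then show "P0 \<in> subcentric S F" using ob_subgroups[OF P0] by (auto simp: subcentric_def)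
qed

section \<open>Quasicentric and centric objects\<close>

lemma sylow_E_T:
  assumes P: "P \<in> ob T" and fn: "P \<in> fully_normalized S F"
  shows "sylow_subgroup p (subgrp (Aut_T T P) (E_T T P)) (el P ` centralizer S P)"
proof -
  interpret A: plain_group "Aut_T T P" by (rule plain_group_Aut_T[OF P])
  have "el P ` normalizer S P \<inter> E_T T P = el P ` centralizer S P"
    using el_in_E_T_iff[OF P] centralizer_subset_normalizer[OF ob_subgroups[OF P]] by blast
  then show ?thesis
    using A.sylow_inter_normal[OF prime_p fully_normalized_imp_sylow[OF P fn] E_T_normal[OF P]] by simp
qed

lemma subgroup_centralizer:
  assumes "P \<subseteq> carrier S" shows "subgroup (centralizer S P) S"
proof -
  have C: "centralizer S P = {g \<in> carrier S. \<forall>x\<in>P. conj_by S x g = g}"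
    unfolding centralizer_def using assms by (auto simp: S.conj_by_eq_iff subset_iff)
  show ?thesis
    unfolding C by standard (use assms in \<open>auto simp: S.conj_by_mult S.conj_by_inv subset_iff\<close>)
qed

lemma card_E_T_conj: "\<lbrakk>P \<in> ob T; Q \<in> conjugates S F P\<rbrakk> \<Longrightarrow> card (E_T T Q) = card (E_T T P)"
proof -
  assume a: "P \<in> ob T" "Q \<in> conjugates S F P"
  obtain \<alpha> \<beta> where ab: "inverse_pair T P Q \<alpha> \<beta>" using conjugate_iso[OF a] .
  have "inj_on (\<lambda>g. \<beta> \<star> g \<star> \<alpha>) (thom T P P)"
    using conj_iso(1)[OF ab] Aut_T_carrier[OF a(1)] by (auto simp: iso_def bij_betw_def)
  then have "inj_on (\<lambda>g. \<beta> \<star> g \<star> \<alpha>) (E_T T P)" using E_T_in inj_on_subset by blast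
  then show ?thesis using conj_iso(2)[OF ab] card_image by metis
qed

text \<open>If \<open>Q\<close> is conjugate to \<open>P\<close>, then \<open>C\<^sub>S(Q)\<close> is isomorphic to a \<open>p\<close>-subgroup of \<open>E(Q)\<close>, and \<open>E(Q)\<close>
  has the same order as \<open>E(P)\<close>, of which \<open>C\<^sub>S(P)\<close> is a Sylow subgroup.\<close>

lemma fully_normalized_imp_centralized:
  assumes P: "P \<in> ob T" and fn: "P \<in> fully_normalized S F"
  shows "P \<in> fully_centralized S F"
proof -
  have "card (centralizer S Q) \<le> card (centralizer S P)" if Q: "Q \<in> conjugates S F P" for Q
  proof -
    have Qob: "Q \<in> ob T" using ob_conj[OF P Q] .
    have Qs: "subgroup Q S" and Ps: "subgroup P S" using Qob P ob_subgroups by auto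
    interpret B: plain_group "Aut_T T Q" by (rule plain_group_Aut_T[OF Qob])
    have Cs: "subgroup (centralizer S Q) S" using subgroup_centralizer Qs subgroup.subset by blast
    note CN = centralizer_subset_normalizer[OF Qs] centralizer_subset_normalizer[OF Ps]
    have Es: "subgroup (E_T T Q) (Aut_T T Q)" using E_T_normal[OF Qob] normal_imp_subgroup by blast
    have E0: "card (E_T T Q) \<noteq> 0"
      using subgroup.one_closed[OF Es] finite_subset[OF subgroup.subset[OF Es] finite_Aut_T[OF Qob]] by auto
    obtain n where n: "card (centralizer S Q) = p ^ n" using card_subgroup_S[OF Cs] by blast
    have "el Q ` centralizer S Q \<subseteq> E_T T Q" using el_in_E_T_iff[OF Qob] CN(1) by blast
    then have "card (el Q ` centralizer S Q) dvd card (E_T T Q)"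
      using B.subgroup_card_dvd[OF finite_Aut_T[OF Qob] el_image_subgroup[OF Qob Cs CN(1)] Es] by blast
    then have "p ^ n dvd card (E_T T Q)" using card_el_image[OF Qob CN(1)] n by simp
    then have "n \<le> multiplicity p (card (E_T T Q))"
      using E0 prime_p by (metis not_prime_unit power_dvd_iff_le_multiplicity)
    moreover have "card (centralizer S P) = p ^ multiplicity p (card (E_T T P))"
      using sylow_E_T[OF P fn] card_el_image[OF P CN(2)] by (simp add: sylow_subgroup_def)
    ultimately show ?thesis
      using n card_E_T_conj[OF P Q] prime_p by (metis power_increasing prime_ge_1_nat)
  qed
  then show ?thesis using ob_subgroups[OF P] by (simp add: fully_centralized_def)
qed

lemma group_E_T: "P \<in> ob T \<Longrightarrow> plain_group (subgrp (Aut_T T P) (E_T T P))"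
  using plain_group.group_subgrp[OF plain_group_Aut_T normal_imp_subgroup[OF E_T_normal]]
  by (simp add: plain_group_def)

text \<open>Conjugation by \<open>\<gamma> \<in> E(P)\<close> on the cyclic group generated by \<open>x\<close> extends to a morphism that is the
  identity on \<open>P\<close>, so it belongs to \<open>C\<^sub>F(P)\<close>. If \<open>P\<close> is quasicentric it is therefore conjugation by an
  element of \<open>C\<^sub>S(P)\<close>.\<close>

lemma quasicentric_control:
  assumes P: "P \<in> ob T" and fn: "P \<in> fully_normalized S F" and q: "P \<in> quasicentric S F"
    and x: "x \<in> centralizer S P" "y \<in> centralizer S P" and g: "\<gamma> \<in> E_T T P" "el P x \<star> \<gamma> = \<gamma> \<star> el P y"
  shows "\<exists>s\<in>centralizer S P. y = conj_by S s x"
proof -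
  let ?C = "centralizer S P"
  have Ps: "subgroup P S" using ob_subgroups[OF P] .
  have Cs: "subgroup ?C S" using subgroup_centralizer Ps subgroup.subset by blast
  note CN = centralizer_subset_normalizer[OF Ps]
  have xc: "x \<in> carrier S" using x Cs subgroup.mem_carrier by metis
  define A where "A = generate S {x}"
  have As: "subgroup A S" unfolding A_def using xc by (intro S.generate_is_subgroup) auto
  have xA: "x \<in> A" unfolding A_def by (simp add: generate.incl)
  have AC: "A \<subseteq> ?C" unfolding A_def using S.generate_subgroup_incl[OF _ Cs] x by blast
  have gt: "\<gamma> \<in> thom T P P" using g E_T_in by blast
  interpret Au: plain_group "Aut_T T P" by (rule plain_group_Aut_T[OF P])
  \<comment> \<open>The hypothesis is about the generator \<open>x\<close> of \<open>A\<close> only; since the elements that \<open>\<gamma>\<close> conjugates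
    into the image of \<open>C\<^sub>S(P)\<close> form a subgroup, \<open>\<gamma>\<close> moves all of \<open>A\<close> into it.\<close>
  define B where "B = {z \<in> ?C. \<exists>w\<in>?C. el P z \<star> \<gamma> = \<gamma> \<star> el P w}"
  have el1: "el P \<one>\<^bsub>S\<^esub> = tid T P" using eps_one[OF P] .
  have cj: "el P z \<star> \<gamma> = \<gamma> \<star> el P w \<longleftrightarrow> conj_by (Aut_T T P) \<gamma> (el P z) = el P w" if "z \<in> ?C" "w \<in> ?C" for z w
    using conj_by_Aut_iff[OF P gt el_in[OF P] el_in[OF P]] that CN by blast
  interpret eh: group_hom "subgrp S (normalizer S P)" "Aut_T T P" "el P" by (rule el_group_hom[OF P])
  have Ns: "subgroup (normalizer S P) S" using subgroup_normalizer[OF Ps] .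
  have Bs: "subgroup B S"
  proof
    show "B \<subseteq> carrier S" using subgroup.subset[OF Cs] by (auto simp: B_def)
    show "\<one>\<^bsub>S\<^esub> \<in> B" using subgroup.one_closed[OF Cs] el1 tcomp_tid[OF gt] by (auto simp: B_def intro!: bexI[of _ "\<one>\<^bsub>S\<^esub>"])
    show "z \<otimes>\<^bsub>S\<^esub> z' \<in> B" if "z \<in> B" "z' \<in> B" for z z'
    proof -
      from that obtain w w' where w: "z \<in> ?C" "z' \<in> ?C" "w \<in> ?C" "w' \<in> ?C"
        "conj_by (Aut_T T P) \<gamma> (el P z) = el P w" "conj_by (Aut_T T P) \<gamma> (el P z') = el P w'"
        using cj by (auto simp: B_def)
      have "conj_by (Aut_T T P) \<gamma> (el P (z \<otimes>\<^bsub>S\<^esub> z')) = el P (w \<otimes>\<^bsub>S\<^esub> w')"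
        using w Au.conj_by_mult[of \<gamma> "el P z" "el P z'"] el_mult[OF P, of z z'] el_mult[OF P, of w w'] CN gt el_in[OF P]
        by (auto simp: Aut_T_carrier[OF P] subset_iff)
      then show ?thesis using w cj subgroup.m_closed[OF Cs] by (auto simp: B_def)
    qed
    show "inv\<^bsub>S\<^esub> z \<in> B" if "z \<in> B" for z
    proof -
      from that obtain w where w: "z \<in> ?C" "w \<in> ?C" "conj_by (Aut_T T P) \<gamma> (el P z) = el P w"
        using cj by (auto simp: B_def)
      have hi: "el P (inv\<^bsub>S\<^esub> v) = inv\<^bsub>Aut_T T P\<^esub> el P v" if "v \<in> ?C" for v
        using eh.hom_inv[of v] S.inv_subgrp[OF Ns, of v] that CN by auto
      have "conj_by (Aut_T T P) \<gamma> (el P (inv\<^bsub>S\<^esub> z)) = el P (inv\<^bsub>S\<^esub> w)"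
        using w Au.conj_by_inv[of \<gamma> "el P z"] hi CN gt el_in[OF P]
        by (auto simp: Aut_T_carrier[OF P] subset_iff)
      then show ?thesis using w cj subgroup.m_inv_closed[OF Cs] by (auto simp: B_def)
    qed
  qed
  have "x \<in> B" using x g by (auto simp: B_def)
  then have AB: "A \<subseteq> B" unfolding A_def using S.generate_subgroup_incl[OF _ Bs] by blast
  define f where "f = (\<lambda>a\<in>A. SOME w. w \<in> ?C \<and> el P a \<star> \<gamma> = \<gamma> \<star> el P w)"
  have f: "f a \<in> ?C \<and> el P a \<star> \<gamma> = \<gamma> \<star> el P (f a)" if "a \<in> A" for a
  proof -
    have "\<exists>w. w \<in> ?C \<and> el P a \<star> \<gamma> = \<gamma> \<star> el P w" using that AB by (auto simp: B_def)
    from someI_ex[OF this] show ?thesis using that by (simp add: f_def)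
  qed
  have AN: "A \<subseteq> normalizer S P" using AC CN by blast
  obtain \<psi> where psi: "\<psi> \<in> F (A <#>\<^bsub>S\<^esub> P) (?C <#>\<^bsub>S\<^esub> P)" "\<forall>a\<in>A. \<psi> a = f a" "\<forall>z\<in>P. \<psi> z = rho T \<gamma> z"
    using el_commute_extend[OF P As AN Cs CN gt f] by blast
  note As' = subgroup_set_mult_normalizing[OF Ps As AN]
  have "restrict \<psi> A \<in> F A ?C"
    by (rule F_restrict[OF psi(1) As As'(2) Cs]) (use psi(2) f in auto)
  moreover have "restrict \<psi> A = f" using psi(2) by (intro extensionalityI[of _ A]) (auto simp: f_def)
  moreover have "\<exists>\<psi> \<in> F (A <#>\<^bsub>S\<^esub> P) (?C <#>\<^bsub>S\<^esub> P). (\<forall>a\<in>A. \<psi> a = f a) \<and> (\<forall>z\<in>P. \<psi> z = z)"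
    using psi E_T_rho[OF g(1)] by auto
  ultimately have "f \<in> centralizer_fusion S F P A ?C"
    using AC by (simp add: centralizer_fusion_def)
  moreover have "centralizer_fusion S F P = fusion_of_group (subgrp S ?C) (subgrp S ?C)"
    using q fully_normalized_imp_centralized[OF P fn] conjugates_self[OF Ps] unfolding quasicentric_def by blast
  ultimately obtain s where s: "s \<in> ?C" "f = conj_map (subgrp S ?C) s A"
    by (auto simp: fusion_of_group_def split: if_splits)
  have "f x = conj_by S s x" using s xA S.conj_by_subgrp[OF Cs s(1)] by (simp add: conj_map_def)
  moreover have "f x = y"
  proof -
    have "conj_by (Aut_T T P) \<gamma> (el P x) = el P (f x)" using f[OF xA] cj x by blast
    moreover have "conj_by (Aut_T T P) \<gamma> (el P x) = el P y" using g(2) cj x by blast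
    ultimately show ?thesis using el_inj[OF P, of "f x" y] f[OF xA] x CN by auto
  qed
  ultimately show ?thesis using s(1) by blast
qed

theorem quasicentric_complement:
  assumes P: "P \<in> ob T" and fn: "P \<in> fully_normalized S F" and q: "P \<in> quasicentric S F"
  shows "\<exists>K. K \<lhd> subgrp (Aut_T T P) (E_T T P) \<and> coprime p (card K) \<and>
    el P ` centralizer S P <#>\<^bsub>subgrp (Aut_T T P) (E_T T P)\<^esub> K = E_T T P"
proof -
  let ?E = "subgrp (Aut_T T P) (E_T T P)"
  interpret A: plain_group "Aut_T T P" by (rule plain_group_Aut_T[OF P])
  interpret E: plain_group ?E by (rule group_E_T[OF P])
  have Es: "subgroup (E_T T P) (Aut_T T P)" using E_T_normal[OF P] normal_imp_subgroup by blast
  note CN = centralizer_subset_normalizer[OF ob_subgroups[OF P]]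
  have "\<exists>s\<in>el P ` centralizer S P. conj_by ?E \<gamma> u = conj_by ?E s u"
    if u: "u \<in> el P ` centralizer S P" and g: "\<gamma> \<in> carrier ?E" and w: "conj_by ?E \<gamma> u \<in> el P ` centralizer S P" for u \<gamma>
  proof -
    have gE: "\<gamma> \<in> E_T T P" "\<gamma> \<in> thom T P P" using g E_T_in by auto
    obtain x where x: "x \<in> centralizer S P" "u = el P x" using u by blast
    obtain y where y: "y \<in> centralizer S P" "conj_by ?E \<gamma> u = el P y" using w by blast
    have N: "x \<in> normalizer S P" "y \<in> normalizer S P" using x y CN by auto
    have "el P x \<star> \<gamma> = \<gamma> \<star> el P y"
      using y(2) x(2) A.conj_by_subgrp[OF Es gE(1)] conj_by_Aut_iff[OF P gE(2) el_in[OF P N(1)] el_in[OF P N(2)]] by simp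
    then obtain s where s: "s \<in> centralizer S P" "y = conj_by S s x"
      using quasicentric_control[OF P fn q x(1) y(1) gE(1)] by blast
    have sN: "s \<in> normalizer S P" and sE: "el P s \<in> E_T T P"
      using s CN el_in_E_T_iff[OF P] by auto
    have sc: "s \<in> carrier S" "x \<in> carrier S" "y \<in> carrier S" using sN N normalizer_carrier[OF P] by auto
    have "x \<otimes>\<^bsub>S\<^esub> s = s \<otimes>\<^bsub>S\<^esub> y" using s(2) S.conj_by_eq_iff[OF sc] by simp
    then have "el P x \<star> el P s = el P s \<star> el P y" using el_mult[OF P] N sN by metis
    then have "conj_by ?E (el P s) u = el P y"
      using x(2) A.conj_by_subgrp[OF Es sE] conj_by_Aut_iff[OF P el_in[OF P sN] el_in[OF P N(1)] el_in[OF P N(2)]] by simp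
    then have "conj_by ?E \<gamma> u = conj_by ?E (el P s) u" using y(2) by simp
    then show ?thesis using s(1) by blast
  qed
  then show ?thesis
    using E.frobenius_normal_complement[OF prime_p sylow_E_T[OF P fn]] by simp
qed

lemma E_T_p_group_imp_char_p:
  assumes P: "P \<in> ob T" and E: "card (E_T T P) = p ^ n"
  shows "characteristic_p p (Aut_T T P)"
proof -
  interpret A: plain_group "Aut_T T P" by (rule plain_group_Aut_T[OF P])
  obtain k where "card (el P ` P) = p ^ k"
    using card_el_image[OF P] card_subgroup_S[OF ob_subgroups[OF P]] S.subgroup_subset_normalizer[OF ob_subgroups[OF P]] by metis
  then show ?thesis
    using A.characteristic_pI[OF prime_p finite_Aut_T[OF P] el_image_normal[OF P] _ E_T_normal[OF P] E]
      E_T_eq_centralizer[OF P] by simp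
qed

text \<open>The normal complement \<open>K\<close> consists of the elements of \<open>E(P)\<close> of order prime to \<open>p\<close>. So it is normal in
  \<open>Aut\<^sub>T(P)\<close> and not only in \<open>E(P)\<close>, and it is trivial because \<open>Aut\<^sub>T(P)\<close> is of characteristic \<open>p\<close>.\<close>

lemma char_p_quasicentric_E_T:
  assumes P: "P \<in> ob T" and fn: "P \<in> fully_normalized S F" and q: "P \<in> quasicentric S F"
    and ch: "characteristic_p p (Aut_T T P)"
  shows "E_T T P = el P ` centralizer S P"
proof -
  let ?E = "subgrp (Aut_T T P) (E_T T P)"
  interpret A: plain_group "Aut_T T P" by (rule plain_group_Aut_T[OF P])
  interpret E: plain_group ?E by (rule group_E_T[OF P])
  have EN: "E_T T P \<lhd> Aut_T T P" using E_T_normal[OF P] .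
  have Es: "subgroup (E_T T P) (Aut_T T P)" using EN normal_imp_subgroup by blast
  have finE: "finite (carrier ?E)" using finite_subset[OF subgroup.subset[OF Es] finite_Aut_T[OF P]] by simp
  obtain K where K: "K \<lhd> ?E" "coprime p (card K)" "el P ` centralizer S P <#>\<^bsub>?E\<^esub> K = carrier ?E"
    using quasicentric_complement[OF P fn q] by auto
  have CsE: "subgroup (el P ` centralizer S P) ?E" "card (el P ` centralizer S P) = p ^ multiplicity p (order ?E)"
    using sylow_E_T[OF P fn] by (auto simp: sylow_subgroup_def)
  have Keq: "K = {x \<in> carrier ?E. coprime p (E.ord x)}"
    using E.normal_complement_eq[OF prime_p finE CsE K] .
  have "x [^]\<^bsub>?E\<^esub> n = x [^]\<^bsub>Aut_T T P\<^esub> n" for x and n :: nat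
    by (simp add: subgrp_def A.nat_pow_consistent[symmetric])
  then have ordeq: "E.ord x = A.ord x" for x
    by (simp add: E.ord_def A.ord_def)
  have KN: "K \<lhd> Aut_T T P"
    unfolding A.normal_iff_conj_by
  proof (intro conjI ballI)
    show "subgroup K (Aut_T T P)" using K(1) normal_imp_subgroup A.subgroup_subgrp_iff[OF Es] by blast
    fix g x assume g: "g \<in> carrier (Aut_T T P)" and x: "x \<in> K"
    have xE: "x \<in> E_T T P" "coprime p (A.ord x)" using x Keq ordeq by auto
    have xA: "x \<in> carrier (Aut_T T P)" using xE Es subgroup.mem_carrier by metis
    have "conj_by (Aut_T T P) g x [^]\<^bsub>Aut_T T P\<^esub> A.ord x = \<one>\<^bsub>Aut_T T P\<^esub>"
      using A.conj_by_pow[OF g xA, of "A.ord x"] A.pow_ord_eq_1[OF xA] A.conj_by_of_one[OF g] by metis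
    then have "A.ord (conj_by (Aut_T T P) g x) dvd A.ord x" using A.pow_eq_id A.conj_by_closed[OF g xA] by blast
    then have "coprime p (A.ord (conj_by (Aut_T T P) g x))" using coprime_divisors[OF dvd_refl _ xE(2)] by blast
    moreover have "conj_by (Aut_T T P) g x \<in> E_T T P" using EN g xE unfolding A.normal_iff_conj_by by blast
    ultimately show "conj_by (Aut_T T P) g x \<in> K" using Keq ordeq by simp
  qed
  have "K = {\<one>\<^bsub>Aut_T T P\<^esub>}" using A.characteristic_p_coprime_normal_trivial[OF prime_p ch KN K(2)] .
  moreover have "el P ` centralizer S P \<subseteq> carrier (Aut_T T P)"
    using subgroup.subset[OF CsE(1)] subgroup.subset[OF Es] by auto
  ultimately have "el P ` centralizer S P <#>\<^bsub>?E\<^esub> K = el P ` centralizer S P"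
    using A.r_one by (auto simp: set_mult_def image_iff subset_iff simp del: Aut_T_mult_eq)
  then show ?thesis using K(3) by simp
qed

lemma finite_p_group_E_T_iff:
  "P \<in> ob T \<Longrightarrow> finite_p_group p (subgrp (Aut_T T P) (E_T T P)) \<longleftrightarrow> (\<exists>n. card (E_T T P) = p ^ n)"
  using plain_group.finite_p_group_subgrp_iff[OF plain_group_Aut_T finite_Aut_T normal_imp_subgroup[OF E_T_normal]] .

theorem objective_char_iff_quasicentric:
  assumes q: "ob T \<subseteq> quasicentric S F"
  shows "(\<forall>P\<in>ob T. characteristic_p p (Aut_T T P)) \<longleftrightarrow>
    (\<forall>P\<in>ob T. finite_p_group p (subgrp (Aut_T T P) (E_T T P)))"
proof
  assume ch: "\<forall>P\<in>ob T. characteristic_p p (Aut_T T P)"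
  show "\<forall>P\<in>ob T. finite_p_group p (subgrp (Aut_T T P) (E_T T P))"
  proof
    fix P assume P: "P \<in> ob T"
    obtain Q where Q: "Q \<in> conjugates S F P" "Q \<in> fully_normalized S F"
      using exists_fully_normalized[OF ob_subgroups[OF P]] .
    have Qob: "Q \<in> ob T" using ob_conj[OF P Q(1)] .
    have "E_T T Q = el Q ` centralizer S Q" using char_p_quasicentric_E_T[OF Qob Q(2)] q ch Qob by blast
    then have "\<exists>n. card (E_T T Q) = p ^ n" using sylow_E_T[OF Qob Q(2)] by (auto simp: sylow_subgroup_def)
    then show "finite_p_group p (subgrp (Aut_T T P) (E_T T P))"
      using finite_p_group_E_T_iff[OF P] card_E_T_conj[OF P Q(1)] by simp
  qed
qed (use finite_p_group_E_T_iff E_T_p_group_imp_char_p in blast)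

text \<open>If \<open>C\<^sub>S(P) \<le> P\<close>, then morphisms that extend to the identity on \<open>P\<close> are inclusions of subgroups of
  \<open>C\<^sub>S(P)\<close>, and conjugation in the abelian group \<open>C\<^sub>S(P)\<close> yields nothing else.\<close>

lemma centric_imp_quasicentric: "centric S F \<subseteq> quasicentric S F"
proof
  fix Q assume Q: "Q \<in> centric S F"
  have "centralizer_fusion S F P = fusion_of_group (subgrp S (centralizer S P)) (subgrp S (centralizer S P))"
    if P: "P \<in> conjugates S F Q" for P
  proof (intro ext)
    fix A B
    let ?C = "centralizer S P"
    have Ps: "subgroup P S" using conjugates_subgroup[OF P] by blast
    have CP: "?C \<subseteq> P" using Q P by (auto simp: centric_def)
    have Cs: "subgroup ?C S" using subgroup_centralizer Ps subgroup.subset by blast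
    have triv: "conj_by (subgrp S ?C) s x = x" if "s \<in> ?C" "x \<in> ?C" for s x
    proof -
      have "x \<in> P" using that(2) CP by blast
      then have "x \<otimes>\<^bsub>S\<^esub> s = s \<otimes>\<^bsub>S\<^esub> x" using that(1) by (simp add: centralizer_def)
      then show ?thesis
        using S.conj_by_subgrp[OF Cs that(1)] S.conj_by_eq_iff[of s x x]
          subgroup.mem_carrier[OF Cs that(1)] subgroup.mem_carrier[OF Cs that(2)] by simp
    qed
    show "centralizer_fusion S F P A B = fusion_of_group (subgrp S ?C) (subgrp S ?C) A B"
    proof (cases "subgroup A S \<and> subgroup B S \<and> A \<subseteq> ?C \<and> B \<subseteq> ?C")
      case False
      then show ?thesis
        using S.subgroup_subgrp_iff[OF Cs] F_subgroups by (auto simp: centralizer_fusion_def fusion_of_group_def)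
    next
      case True
      have AP: "U <#>\<^bsub>S\<^esub> P = P" if U: "subgroup U S" "U \<subseteq> P" for U
      proof
        show "U <#>\<^bsub>S\<^esub> P \<subseteq> P" using U subgroup.m_closed[OF Ps] by (auto simp: set_mult_def)
        show "P \<subseteq> U <#>\<^bsub>S\<^esub> P"
          using S.subset_set_mult(2)[OF subgroup.subset[OF U(1)] subgroup.subset[OF Ps]] subgroup.one_closed[OF U(1)] by blast
      qed
      have AP': "A <#>\<^bsub>S\<^esub> P = P" "B <#>\<^bsub>S\<^esub> P = P" using AP True CP by auto
      have 1: "centralizer_fusion S F P A B = (if A \<subseteq> B then {\<lambda>x\<in>A. x} else {})"
      proof (intro equalityI subsetI)
        fix f assume "f \<in> centralizer_fusion S F P A B"
        then obtain \<psi> where f: "f \<in> F A B" "\<forall>x\<in>A. \<psi> x = f x" "\<forall>x\<in>P. \<psi> x = x"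
          by (auto simp: centralizer_fusion_def split: if_splits)
        have fx: "f x = x" if "x \<in> A" for x using f that True CP by (metis subsetD)
        then have "A \<subseteq> B" using F_hom(2)[OF f(1)] by auto
        moreover have "f = (\<lambda>x\<in>A. x)" using F_hom(1)[OF f(1)] fx by (intro extensionalityI[of _ A]) auto
        ultimately show "f \<in> (if A \<subseteq> B then {\<lambda>x\<in>A. x} else {})" by simp
      next
        fix f assume "f \<in> (if A \<subseteq> B then {\<lambda>x\<in>A. x} else {})"
        then have f: "A \<subseteq> B" "f = (\<lambda>x\<in>A. x)" by (auto split: if_splits)
        have "f \<in> F A B" using f F_incl True by simp
        moreover have "(\<lambda>x\<in>P. x) \<in> F P P" using F_incl Ps by simp
        then have "\<exists>\<psi>\<in>F P P. (\<forall>x\<in>A. \<psi> x = f x) \<and> (\<forall>x\<in>P. \<psi> x = x)"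
          using f True CP by (intro bexI[of _ "\<lambda>x\<in>P. x"]) auto
        ultimately show "f \<in> centralizer_fusion S F P A B" using True AP' by (simp add: centralizer_fusion_def)
      qed
      have cm: "conj_map (subgrp S ?C) s A = (\<lambda>x\<in>A. x)" "conj_by (subgrp S ?C) s ` A = A" if "s \<in> ?C" for s
      proof -
        have "\<forall>x\<in>A. conj_by (subgrp S ?C) s x = x" using triv[OF that] True by blast
        then show "conj_map (subgrp S ?C) s A = (\<lambda>x\<in>A. x)" "conj_by (subgrp S ?C) s ` A = A"
          by (auto simp: conj_map_def intro: restrict_ext)
      qed
      have "\<one>\<^bsub>S\<^esub> \<in> ?C" using subgroup.one_closed[OF Cs] .
      then have "{conj_map (subgrp S ?C) g A |g. g \<in> carrier (subgrp S ?C) \<and> conj_by (subgrp S ?C) g ` A \<subseteq> B}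
          = (if A \<subseteq> B then {\<lambda>x\<in>A. x} else {})"
        using cm by (auto intro!: exI[of _ "\<one>\<^bsub>S\<^esub>"])
      then show ?thesis using 1 True S.subgroup_subgrp_iff[OF Cs] by (simp add: fusion_of_group_def)
    qed
  qed
  then show "Q \<in> quasicentric S F" using Q by (auto simp: quasicentric_def centric_def)
qed

text \<open>For a fully normalized object \<open>E(P)\<close> is the image of \<open>C\<^sub>S(P)\<close>, which lies in \<open>P\<close>; the condition
  \<open>E(P) \<le> P\<close> then passes to all conjugates.\<close>

theorem objective_char_iff_centric:
  assumes c: "ob T \<subseteq> centric S F"
  shows "(\<forall>P\<in>ob T. characteristic_p p (Aut_T T P)) \<longleftrightarrow> (\<forall>P\<in>ob T. E_T T P \<subseteq> el P ` P)"
proof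
  assume ch: "\<forall>P\<in>ob T. characteristic_p p (Aut_T T P)"
  show "\<forall>P\<in>ob T. E_T T P \<subseteq> el P ` P"
  proof
    fix P assume P: "P \<in> ob T"
    obtain Q where Q: "Q \<in> conjugates S F P" "Q \<in> fully_normalized S F"
      using exists_fully_normalized[OF ob_subgroups[OF P]] .
    have Qob: "Q \<in> ob T" using ob_conj[OF P Q(1)] .
    have "E_T T Q = el Q ` centralizer S Q"
      using char_p_quasicentric_E_T[OF Qob Q(2)] c centric_imp_quasicentric ch Qob by blast
    moreover have "centralizer S Q \<subseteq> Q" using c P Q(1) by (auto simp: centric_def)
    ultimately have "E_T T Q \<subseteq> el Q ` Q" by blast
    then show "E_T T P \<subseteq> el P ` P" using E_T_in_el_conj[OF Qob conjugates_sym[OF Q(1)]] by blast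
  qed
next
  assume E: "\<forall>P\<in>ob T. E_T T P \<subseteq> el P ` P"
  show "\<forall>P\<in>ob T. characteristic_p p (Aut_T T P)"
  proof
    fix P assume P: "P \<in> ob T"
    interpret A: plain_group "Aut_T T P" by (rule plain_group_Aut_T[OF P])
    have Ps: "subgroup P S" "P \<subseteq> normalizer S P" using ob_subgroups[OF P] S.subgroup_subset_normalizer by auto
    have "card (E_T T P) dvd card (el P ` P)"
      using A.subgroup_card_dvd[OF finite_Aut_T[OF P] normal_imp_subgroup[OF E_T_normal[OF P]] el_image_subgroup[OF P Ps]]
        E P by blast
    moreover obtain k where "card (el P ` P) = p ^ k" using card_el_image[OF P Ps(2)] card_subgroup_S[OF Ps(1)] by metis
    ultimately obtain n where "card (E_T T P) = p ^ n" using p_group_subgroup[OF prime_p] by metis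
    then show "characteristic_p p (Aut_T T P)" using E_T_p_group_imp_char_p[OF P] by blast
  qed
qed

lemma E_T_eq_center_iff:
  assumes P: "P \<in> ob T"
  shows "E_T T P = center (subgrp (Aut_T T P) (el P ` P)) \<longleftrightarrow> E_T T P \<subseteq> el P ` P"
proof -
  have "center (subgrp (Aut_T T P) (el P ` P)) = E_T T P \<inter> el P ` P"
    unfolding E_T_eq_centralizer[OF P] center_def centralizer_def
    using subgroup.subset[OF normal_imp_subgroup[OF el_image_normal[OF P]]] by auto
  then show ?thesis by blast
qed

end

section \<open>Models\<close>

lemma group_transport:
  assumes A: "group A" and bij: "bij_betw h (carrier A) (carrier B)"
    and mult: "\<And>x y. \<lbrakk>x \<in> carrier A; y \<in> carrier A\<rbrakk> \<Longrightarrow> h (x \<otimes>\<^bsub>A\<^esub> y) = h x \<otimes>\<^bsub>B\<^esub> h y"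
    and one: "h \<one>\<^bsub>A\<^esub> = \<one>\<^bsub>B\<^esub>"
  shows "group B" "h \<in> iso A B"
proof -
  interpret A: group A by fact
  have im: "h ` carrier A = carrier B" using bij by (simp add: bij_betw_def)
  have mem: "h x \<in> carrier B" if "x \<in> carrier A" for x using that im by blast
  have ex: "\<exists>x\<in>carrier A. y = h x" if "y \<in> carrier B" for y using that im by blast
  show "group B"
  proof (rule groupI)
    show "x \<otimes>\<^bsub>B\<^esub> y \<in> carrier B" if "x \<in> carrier B" "y \<in> carrier B" for x y
      using ex[OF that(1)] ex[OF that(2)] mem mult by (metis A.m_closed)
    show "\<one>\<^bsub>B\<^esub> \<in> carrier B" using mem[OF A.one_closed] one by simp
    show "x \<otimes>\<^bsub>B\<^esub> y \<otimes>\<^bsub>B\<^esub> z = x \<otimes>\<^bsub>B\<^esub> (y \<otimes>\<^bsub>B\<^esub> z)"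
      if x: "x \<in> carrier B" and y: "y \<in> carrier B" and z: "z \<in> carrier B" for x y z
    proof -
      obtain a b c where abc: "a \<in> carrier A" "b \<in> carrier A" "c \<in> carrier A" "x = h a" "y = h b" "z = h c"
        using ex[OF x] ex[OF y] ex[OF z] by blast
      have "h (a \<otimes>\<^bsub>A\<^esub> b \<otimes>\<^bsub>A\<^esub> c) = h (a \<otimes>\<^bsub>A\<^esub> (b \<otimes>\<^bsub>A\<^esub> c))" using abc A.m_assoc by simp
      then show ?thesis using abc mult by simp
    qed
    show "\<one>\<^bsub>B\<^esub> \<otimes>\<^bsub>B\<^esub> x = x" if "x \<in> carrier B" for x
      using ex[OF that] mult[OF A.one_closed] one A.l_one by metis
    show "\<exists>y\<in>carrier B. y \<otimes>\<^bsub>B\<^esub> x = \<one>\<^bsub>B\<^esub>" if x: "x \<in> carrier B" for x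
    proof -
      obtain a where a: "a \<in> carrier A" "x = h a" using ex[OF x] by blast
      have "h (inv\<^bsub>A\<^esub> a) \<otimes>\<^bsub>B\<^esub> x = \<one>\<^bsub>B\<^esub>" using mult[of "inv\<^bsub>A\<^esub> a" a] a one by simp
      then show ?thesis using mem[of "inv\<^bsub>A\<^esub> a"] a by auto
    qed
  qed
  show "h \<in> iso A B" using bij mult mem by (auto simp: iso_def hom_def)
qed

text \<open>\<open>N\<close> is embedded into \<open>A\<close> by \<open>e\<close>, and \<open>h\<close> replaces \<open>A\<close> by an isomorphic group that literally contains
  \<open>N\<close>. The last hypothesis has the form provided by the description of \<open>N\<^sub>F(P)\<close>.\<close>

lemma modelI_iso:
  assumes p: "Factorial_Ring.prime p" and A: "characteristic_p p A" and G: "group G" and h: "h \<in> iso A G"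
    and N: "group N" and eN: "e ` carrier N \<subseteq> carrier A" and syl: "sylow_subgroup p A (e ` carrier N)"
    and em: "\<And>x y. \<lbrakk>x \<in> carrier N; y \<in> carrier N\<rbrakk> \<Longrightarrow> e (x \<otimes>\<^bsub>N\<^esub> y) = e x \<otimes>\<^bsub>A\<^esub> e y"
    and he: "\<And>x. x \<in> carrier N \<Longrightarrow> h (e x) = x"
    and F: "\<And>P Q. F P Q = (if subgroup P N \<and> subgroup Q N
        then {f \<in> extensional P. \<exists>\<gamma>\<in>carrier A. \<forall>a\<in>P. f a \<in> Q \<and> e a \<otimes>\<^bsub>A\<^esub> \<gamma> = \<gamma> \<otimes>\<^bsub>A\<^esub> e (f a)} else {})"
  shows "model p N F G"
proof -
  interpret A: plain_group A using A by (simp add: characteristic_p_def plain_group_def)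
  interpret G: plain_group G using G by (simp add: plain_group_def)
  interpret N: group N by fact
  have hb: "h ` carrier A = carrier G" "inj_on h (carrier A)" "h \<in> hom A G"
    using h by (auto simp: iso_def bij_betw_def)
  interpret h: group_hom A G h using hb by (simp add: group_hom_def group_hom_axioms_def A.is_group G.is_group)
  have em': "e x \<in> carrier A" if "x \<in> carrier N" for x using that eN by blast
  have NG: "x \<in> carrier G" if "x \<in> carrier N" for x using he[OF that] h.hom_closed[OF em'[OF that]] by simp
  have im: "h ` e ` carrier N = carrier N" using he by (simp add: image_image cong: image_cong_simp)
  have mm: "x \<otimes>\<^bsub>N\<^esub> y = x \<otimes>\<^bsub>G\<^esub> y" if "x \<in> carrier N" "y \<in> carrier N" for x y
  proof -
    have "h (e (x \<otimes>\<^bsub>N\<^esub> y)) = h (e x) \<otimes>\<^bsub>G\<^esub> h (e y)"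
      using em[OF that] em'[OF that(1)] em'[OF that(2)] h.hom_mult by simp
    then show ?thesis using he that by simp
  qed
  have finG: "finite (carrier G)" using A hb(1) by (metis characteristic_p_def finite_imageI)
  have "subgroup (h ` e ` carrier N) G"
    using h.subgroup_img_is_subgroup syl by (simp add: sylow_subgroup_def)
  moreover have "card (h ` e ` carrier N) = card (e ` carrier N)"
    using inj_on_subset[OF hb(2) eN] by (rule card_image)
  moreover have "order G = order A" unfolding order_def using hb card_image by metis
  ultimately have sG: "sylow_subgroup p G (carrier N)"
    using syl finG G.is_group unfolding im sylow_subgroup_def by simp
  have "fusion_of_group N G P Q = F P Q" for P Q
  proof (cases "subgroup P N \<and> subgroup Q N")
    case True
    have PN: "x \<in> carrier N" if "x \<in> P" for x using that True subgroup.mem_carrier by metis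
    have QN: "x \<in> carrier N" if "x \<in> Q" for x using that True subgroup.mem_carrier by metis
    have key: "conj_by G (h \<gamma>) a = b \<longleftrightarrow> e a \<otimes>\<^bsub>A\<^esub> \<gamma> = \<gamma> \<otimes>\<^bsub>A\<^esub> e b"
      if "\<gamma> \<in> carrier A" "a \<in> carrier N" "b \<in> carrier N" for \<gamma> a b
    proof -
      have "conj_by G (h \<gamma>) a = b \<longleftrightarrow> h (e a) \<otimes>\<^bsub>G\<^esub> h \<gamma> = h \<gamma> \<otimes>\<^bsub>G\<^esub> h (e b)"
        using G.conj_by_eq_iff[of "h \<gamma>" a b] that NG he by simp
      also have "\<dots> \<longleftrightarrow> h (e a \<otimes>\<^bsub>A\<^esub> \<gamma>) = h (\<gamma> \<otimes>\<^bsub>A\<^esub> e b)" using that em' by simp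
      also have "\<dots> \<longleftrightarrow> e a \<otimes>\<^bsub>A\<^esub> \<gamma> = \<gamma> \<otimes>\<^bsub>A\<^esub> e b"
        by (rule inj_on_eq_iff[OF hb(2)]) (use that em' in auto)
      finally show ?thesis .
    qed
    have "{conj_map G g P |g. g \<in> carrier G \<and> conj_by G g ` P \<subseteq> Q}
        = {f \<in> extensional P. \<exists>\<gamma>\<in>carrier A. \<forall>a\<in>P. f a \<in> Q \<and> e a \<otimes>\<^bsub>A\<^esub> \<gamma> = \<gamma> \<otimes>\<^bsub>A\<^esub> e (f a)}"
      (is "?L = ?R")
    proof (intro equalityI subsetI)
      fix f assume "f \<in> ?L"
      then obtain g where g: "f = conj_map G g P" "g \<in> carrier G" "conj_by G g ` P \<subseteq> Q" by blast
      then obtain \<gamma> where c: "\<gamma> \<in> carrier A" "g = h \<gamma>" using hb(1) by blast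
      have "f a \<in> Q \<and> e a \<otimes>\<^bsub>A\<^esub> \<gamma> = \<gamma> \<otimes>\<^bsub>A\<^esub> e (f a)" if a: "a \<in> P" for a
      proof -
        have fa: "f a = conj_by G (h \<gamma>) a" using g(1) c a by (simp add: conj_map_def)
        then have "f a \<in> Q" using g(3) c a by blast
        then show ?thesis using key[OF c(1) PN[OF a] QN, of "f a"] fa by simp
      qed
      then show "f \<in> ?R" using c(1) g(1) by (auto simp: conj_map_def)
    next
      fix f assume "f \<in> ?R"
      then obtain \<gamma> where f: "f \<in> extensional P" "\<gamma> \<in> carrier A"
        "\<And>a. a \<in> P \<Longrightarrow> f a \<in> Q \<and> e a \<otimes>\<^bsub>A\<^esub> \<gamma> = \<gamma> \<otimes>\<^bsub>A\<^esub> e (f a)" by blast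
      have eq: "conj_by G (h \<gamma>) a = f a" if "a \<in> P" for a
        using key[OF f(2) PN[OF that] QN, of "f a"] f(3)[OF that] by simp
      have "f = conj_map G (h \<gamma>) P"
        using f(1) eq by (intro extensionalityI[of _ P]) (auto simp: conj_map_def)
      moreover have "conj_by G (h \<gamma>) ` P \<subseteq> Q" using eq f(3) by auto
      ultimately show "f \<in> ?L" using f(2) hb(1) by blast
    qed
    then show ?thesis using True by (simp add: F fusion_of_group_def)
  next
    case False
    then show ?thesis unfolding F fusion_of_group_def by (simp only: if_False)
  qed
  then show ?thesis
    using iso_characteristic_p[OF p G h A] sG mm by (simp add: model_def fun_eq_iff)
qed

lemma Inl_group_simps [simp]:
  "carrier (Inl_group N) = Inl ` carrier N" "\<one>\<^bsub>Inl_group N\<^esub> = Inl \<one>\<^bsub>N\<^esub>"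
  "x \<otimes>\<^bsub>Inl_group N\<^esub> y = Inl (projl x \<otimes>\<^bsub>N\<^esub> projl y)"
  by (simp_all add: Inl_group_def)

lemma group_Inl_group: "group N \<Longrightarrow> group (Inl_group N)"
  by (rule group_transport(1)[where h = Inl]) (auto simp: bij_betw_def)

lemma subgroup_Inl_group_iff:
  assumes N: "group N"
  shows "subgroup P (Inl_group N) \<longleftrightarrow> P \<subseteq> range Inl \<and> subgroup (projl ` P) N"
proof -
  interpret N: group N by fact
  interpret I: group "Inl_group N" using group_Inl_group[OF N] .
  have "Inl \<in> hom N (Inl_group N)" by (rule homI) auto
  then interpret i: group_hom N "Inl_group N" Inl
    by (simp add: group_hom_def group_hom_axioms_def N.is_group I.is_group)
  have "projl \<in> hom (Inl_group N) N" by (rule homI) auto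
  then interpret j: group_hom "Inl_group N" N projl
    by (simp add: group_hom_def group_hom_axioms_def N.is_group I.is_group)
  show ?thesis
  proof
    assume "subgroup P (Inl_group N)"
    then show "P \<subseteq> range Inl \<and> subgroup (projl ` P) N"
      using j.subgroup_img_is_subgroup subgroup.subset[of P "Inl_group N"] by auto
  next
    assume P: "P \<subseteq> range Inl \<and> subgroup (projl ` P) N"
    then have "Inl ` projl ` P = P" by force
    then show "subgroup P (Inl_group N)" using i.subgroup_img_is_subgroup[of "projl ` P"] P by metis
  qed
qed

text \<open>The model is the copy of \<open>A\<close> in which the elements of the image of \<open>e\<close> are replaced by their preimages,
  the left summand keeping these apart from the remaining elements.\<close>

lemma isomorphic_to_modelI:
  fixes N :: "'a monoid" and A :: "'m monoid"
  assumes p: "Factorial_Ring.prime p" and A: "characteristic_p p A"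
    and N: "group N" and eN: "e ` carrier N \<subseteq> carrier A" and syl: "sylow_subgroup p A (e ` carrier N)"
    and inj: "inj_on e (carrier N)"
    and em: "\<And>x y. \<lbrakk>x \<in> carrier N; y \<in> carrier N\<rbrakk> \<Longrightarrow> e (x \<otimes>\<^bsub>N\<^esub> y) = e x \<otimes>\<^bsub>A\<^esub> e y"
    and F: "\<And>P Q. F P Q = (if subgroup P N \<and> subgroup Q N
        then {f \<in> extensional P. \<exists>\<gamma>\<in>carrier A. \<forall>a\<in>P. f a \<in> Q \<and> e a \<otimes>\<^bsub>A\<^esub> \<gamma> = \<gamma> \<otimes>\<^bsub>A\<^esub> e (f a)} else {})"
  shows "isomorphic_to_model p N F A"
proof -
  have Ag: "group A" using A by (simp add: characteristic_p_def)
  define h :: "'m \<Rightarrow> 'a + 'm" where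
    "h \<gamma> = (if \<gamma> \<in> e ` carrier N then Inl (inv_into (carrier N) e \<gamma>) else Inr \<gamma>)" for \<gamma>
  have hinj: "inj_on h (carrier A)"
    using inv_into_injective[of "carrier N" e] by (intro inj_onI) (simp add: h_def split: if_splits)
  have he: "h (e x) = Inl x" if "x \<in> carrier N" for x using that inj by (simp add: h_def)
  let ?g = "inv_into (carrier A) h"
  define G :: "('a + 'm) monoid" where
    "G = \<lparr>carrier = h ` carrier A, Group.monoid.mult = (\<lambda>x y. h (?g x \<otimes>\<^bsub>A\<^esub> ?g y)), one = h \<one>\<^bsub>A\<^esub>\<rparr>"
  have G: "group G" "h \<in> iso A G"
  proof -
    have "bij_betw h (carrier A) (carrier G)" using hinj by (simp add: G_def bij_betw_def)
    moreover have "h (x \<otimes>\<^bsub>A\<^esub> y) = h x \<otimes>\<^bsub>G\<^esub> h y" if "x \<in> carrier A" "y \<in> carrier A" for x y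
      using that hinj by (simp add: G_def)
    moreover have "h \<one>\<^bsub>A\<^esub> = \<one>\<^bsub>G\<^esub>" by (simp add: G_def)
    ultimately show "group G" "h \<in> iso A G" using group_transport[OF Ag, of h G] by auto
  qed
  have "model p (Inl_group N) (Inl_fusion F) G"
  proof (rule modelI_iso[OF p A G group_Inl_group[OF N], where e = "\<lambda>x. e (projl x)"])
    have im: "(\<lambda>x. e (projl x)) ` carrier (Inl_group N) = e ` carrier N" by (simp add: image_image)
    show "(\<lambda>x. e (projl x)) ` carrier (Inl_group N) \<subseteq> carrier A" using eN unfolding im .
    show "sylow_subgroup p A ((\<lambda>x. e (projl x)) ` carrier (Inl_group N))" using syl unfolding im .
    show "e (projl (x \<otimes>\<^bsub>Inl_group N\<^esub> y)) = e (projl x) \<otimes>\<^bsub>A\<^esub> e (projl y)"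
      if "x \<in> carrier (Inl_group N)" "y \<in> carrier (Inl_group N)" for x y using that em by auto
    show "h (e (projl x)) = x" if "x \<in> carrier (Inl_group N)" for x using that he by auto
    fix P Q :: "('a + 'm) set"
    show "Inl_fusion F P Q = (if subgroup P (Inl_group N) \<and> subgroup Q (Inl_group N)
      then {f \<in> extensional P. \<exists>\<gamma>\<in>carrier A. \<forall>a\<in>P. f a \<in> Q \<and>
        e (projl a) \<otimes>\<^bsub>A\<^esub> \<gamma> = \<gamma> \<otimes>\<^bsub>A\<^esub> e (projl (f a))} else {})" (is "_ = ?R")
    proof (cases "subgroup P (Inl_group N) \<and> subgroup Q (Inl_group N)")
      case False
      then show ?thesis unfolding subgroup_Inl_group_iff[OF N] by (auto simp: Inl_fusion_def F)
    next
      case True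
      then have P: "P \<subseteq> range Inl" "subgroup (projl ` P) N" and Q: "Q \<subseteq> range Inl" "subgroup (projl ` Q) N"
        unfolding subgroup_Inl_group_iff[OF N] by auto
      have Pi: "Inl (projl x) = x" if "x \<in> P" for x using that P by auto
      have Qi: "Inl (projl x) = x" if "x \<in> Q" for x using that Q by auto
      show ?thesis
      proof (intro equalityI subsetI)
        fix f assume "f \<in> Inl_fusion F P Q"
        then obtain \<phi> where f: "\<phi> \<in> F (projl ` P) (projl ` Q)" "f = (\<lambda>x\<in>P. Inl (\<phi> (projl x)))"
          by (auto simp: Inl_fusion_def P Q)
        then obtain \<gamma> where c: "\<gamma> \<in> carrier A"
          "\<And>a. a \<in> P \<Longrightarrow> \<phi> (projl a) \<in> projl ` Q \<and> e (projl a) \<otimes>\<^bsub>A\<^esub> \<gamma> = \<gamma> \<otimes>\<^bsub>A\<^esub> e (\<phi> (projl a))"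
          by (auto simp: F P Q)
        have "f a \<in> Q" if "a \<in> P" for a using c(2)[OF that] Qi f(2) that by auto
        then have "f \<in> extensional P \<and> (\<exists>\<gamma>\<in>carrier A. \<forall>a\<in>P. f a \<in> Q \<and>
            e (projl a) \<otimes>\<^bsub>A\<^esub> \<gamma> = \<gamma> \<otimes>\<^bsub>A\<^esub> e (projl (f a)))"
          using c f(2) by (intro conjI bexI[of _ \<gamma>]) auto
        then show "f \<in> ?R" using True by simp
      next
        fix f assume "f \<in> ?R"
        then obtain \<gamma> where f: "f \<in> extensional P" and c: "\<gamma> \<in> carrier A"
          "\<And>a. a \<in> P \<Longrightarrow> f a \<in> Q \<and> e (projl a) \<otimes>\<^bsub>A\<^esub> \<gamma> = \<gamma> \<otimes>\<^bsub>A\<^esub> e (projl (f a))"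
          using True by auto
        define \<phi> where "\<phi> = (\<lambda>y\<in>projl ` P. projl (f (Inl y)))"
        have ph: "\<phi> (projl a) = projl (f a)" if "a \<in> P" for a using that Pi by (auto simp: \<phi>_def)
        have "\<exists>\<gamma>\<in>carrier A. \<forall>y\<in>projl ` P. \<phi> y \<in> projl ` Q \<and> e y \<otimes>\<^bsub>A\<^esub> \<gamma> = \<gamma> \<otimes>\<^bsub>A\<^esub> e (\<phi> y)"
          using c ph by (intro bexI[of _ \<gamma>]) auto
        then have "\<phi> \<in> F (projl ` P) (projl ` Q)" using P Q by (simp add: F \<phi>_def)
        moreover have "f = (\<lambda>x\<in>P. Inl (\<phi> (projl x)))"
          using f ph c(2) Qi by (intro extensionalityI[of _ P]) auto
        ultimately show "f \<in> Inl_fusion F P Q" using P Q by (auto simp: Inl_fusion_def)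
      qed
    qed
  qed
  moreover have "A \<cong> G" using G(2) by (auto simp: is_iso_def)
  ultimately show ?thesis unfolding isomorphic_to_model_def by blast
qed

context prime_transporter_system
begin

lemma normalizer_fusion_eq_Aut:
  assumes P: "P \<in> ob T"
  shows "normalizer_fusion S F P A B =
    (if subgroup A (subgrp S (normalizer S P)) \<and> subgroup B (subgrp S (normalizer S P))
     then {f \<in> extensional A. \<exists>\<gamma>\<in>carrier (Aut_T T P). \<forall>a\<in>A. f a \<in> B \<and>
        el P a \<otimes>\<^bsub>Aut_T T P\<^esub> \<gamma> = \<gamma> \<otimes>\<^bsub>Aut_T T P\<^esub> el P (f a)} else {})"
  unfolding normalizer_fusion_eq[OF P] S.subgroup_subgrp_iff[OF subgroup_normalizer[OF ob_subgroups[OF P]]]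
  by (auto simp: Aut_T_carrier[OF P])

theorem Aut_T_isomorphic_to_model:
  assumes P: "P \<in> ob T" and fn: "P \<in> fully_normalized S F" and ch: "characteristic_p p (Aut_T T P)"
  shows "isomorphic_to_model p (subgrp S (normalizer S P)) (normalizer_fusion S F P) (Aut_T T P)"
proof (rule isomorphic_to_modelI[OF prime_p ch _ _ _ _ _ normalizer_fusion_eq_Aut[OF P]])
  show "group (subgrp S (normalizer S P))" by (rule S.group_subgrp[OF subgroup_normalizer[OF ob_subgroups[OF P]]])
  show "el P ` carrier (subgrp S (normalizer S P)) \<subseteq> carrier (Aut_T T P)"
    using el_in[OF P] by (auto simp: Aut_T_carrier[OF P])
  show "sylow_subgroup p (Aut_T T P) (el P ` carrier (subgrp S (normalizer S P)))"
    using fully_normalized_imp_sylow[OF P fn] by simp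
  show "inj_on (el P) (carrier (subgrp S (normalizer S P)))" using el_inj[OF P] by (auto intro: inj_onI)
qed (simp add: el_mult[OF P])

theorem Aut_T_model:
  assumes P: "P \<in> ob T" and fn: "P \<in> fully_normalized S F" and ch: "characteristic_p p (Aut_T T P)"
    and G: "group G" "h \<in> iso (Aut_T T P) G" and he: "\<And>x. x \<in> normalizer S P \<Longrightarrow> h (el P x) = x"
  shows "model p (subgrp S (normalizer S P)) (normalizer_fusion S F P) G"
proof (rule modelI_iso[OF prime_p ch G _ _ _ _ _ normalizer_fusion_eq_Aut[OF P]])
  show "group (subgrp S (normalizer S P))" by (rule S.group_subgrp[OF subgroup_normalizer[OF ob_subgroups[OF P]]])
  show "el P ` carrier (subgrp S (normalizer S P)) \<subseteq> carrier (Aut_T T P)"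
    using el_in[OF P] by (auto simp: Aut_T_carrier[OF P])
  show "sylow_subgroup p (Aut_T T P) (el P ` carrier (subgrp S (normalizer S P)))"
    using fully_normalized_imp_sylow[OF P fn] by simp
qed (use he in \<open>simp_all add: el_mult[OF P]\<close>)

end

section \<open>Partial groups\<close>

context partial_group
begin

abbreviation winv where "winv w \<equiv> rev (map (pinv L) w)"
abbreviation pone where "pone \<equiv> pprod L []"

lemma nil_dom: "[] \<in> pdom L"
  using nonempty dom_singleton dom_append[of "[]"] by fastforce

lemma set_dom: "w \<in> pdom L \<Longrightarrow> set w \<subseteq> pcarrier L"
  using dom_words by blast

lemma winv_winv: "w \<in> pdom L \<Longrightarrow> winv (winv w) = w"
  using set_dom[of w] inv_inv by (simp add: rev_map[symmetric] map_idI subset_iff)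

lemma dom_middle: "u @ v @ w \<in> pdom L \<Longrightarrow> v \<in> pdom L"
  using dom_append by blast

lemma winv_dom: "w \<in> pdom L \<Longrightarrow> winv w \<in> pdom L"
  using prod_inv dom_append by blast

lemma dom_mult_winv: "w \<in> pdom L \<Longrightarrow> w @ winv w \<in> pdom L \<and> pprod L (w @ winv w) = pone"
  using prod_inv[OF winv_dom] winv_winv by simp

lemma insert_pone: "u @ w \<in> pdom L \<Longrightarrow> u @ [pone] @ w \<in> pdom L \<and> pprod L (u @ [pone] @ w) = pprod L (u @ w)"
  using prod_append[of u "[]" w] by simp

lemma append_winv:
  assumes "u @ v \<in> pdom L"
  shows "u @ v @ winv v \<in> pdom L" "pprod L (u @ v @ winv v) = pprod L u"
proof -
  have "(u @ v) @ winv (u @ v) \<in> pdom L" using dom_mult_winv[OF assms] by blast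
  then have "(u @ v @ winv v) @ winv u \<in> pdom L" by simp
  then show d: "u @ v @ winv v \<in> pdom L" using dom_append by blast
  have v: "v \<in> pdom L" and u: "u \<in> pdom L" using assms dom_append by blast+
  have "pprod L (u @ v @ winv v) = pprod L (u @ [pone])"
    using prod_append[of u "v @ winv v" "[]"] d dom_mult_winv[OF v] by simp
  then show "pprod L (u @ v @ winv v) = pprod L u" using insert_pone[of u "[]"] u by simp
qed

lemma winv_append:
  assumes "u @ v \<in> pdom L"
  shows "winv u @ u @ v \<in> pdom L" "pprod L (winv u @ u @ v) = pprod L v"
proof -
  have "winv (u @ v) @ (u @ v) \<in> pdom L" using prod_inv[OF assms] by blast
  then have "winv v @ (winv u @ u @ v) \<in> pdom L" by simp
  then show d: "winv u @ u @ v \<in> pdom L" using dom_append by blast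
  have v: "v \<in> pdom L" and u: "u \<in> pdom L" using assms dom_append by blast+
  have "pprod L (winv u @ u @ v) = pprod L ([pone] @ v)"
    using prod_append[of "[]" "winv u @ u" v] d prod_inv[OF u] by simp
  then show "pprod L (winv u @ u @ v) = pprod L v" using insert_pone[of "[]" v] v by simp
qed

lemma prod_winv:
  assumes w: "w \<in> pdom L" shows "pinv L (pprod L w) = pprod L (winv w)"
proof -
  let ?a = "pprod L w" and ?b = "pprod L (winv w)"
  have "w @ winv w \<in> pdom L" "pprod L (w @ winv w) = pone" using dom_mult_winv[OF w] by auto
  then have "[?a] @ winv w \<in> pdom L" "pprod L ([?a] @ winv w) = pone"
    using prod_append[of "[]" w "winv w"] by auto
  then have ab: "[?a, ?b] \<in> pdom L" "pprod L [?a, ?b] = pone"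
    using prod_append[of "[?a]" "winv w" "[]"] by auto
  have 1: "[pinv L ?a, ?a, ?b] \<in> pdom L" "pprod L [pinv L ?a, ?a, ?b] = ?b"
    using winv_append[of "[?a]" "[?b]"] ab prod_singleton[OF prod_closed[OF winv_dom[OF w]]] by auto
  have "pprod L [pinv L ?a, ?a, ?b] = pprod L ([pinv L ?a] @ [pone])"
    using prod_append[of "[pinv L ?a]" "[?a, ?b]" "[]"] 1 ab by simp
  also have "\<dots> = pinv L ?a"
    using insert_pone[of "[pinv L ?a]" "[]"] dom_singleton inv_closed prod_closed[OF w] prod_singleton by simp
  finally show ?thesis using 1 by simp
qed

text \<open>From \<open>(f\<^sup>-\<^sup>1, x, f)\<close> the axioms produce the word \<open>(f, f\<^sup>-\<^sup>1, x, f, f\<^sup>-\<^sup>1)\<close>, by cancellation against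
  inverses on either side. Evaluating it and its subwords in two ways gives all of the claims.\<close>

lemma conj_inverse:
  assumes f: "f \<in> pcarrier L" and x: "x \<in> conj_dom L f"
  shows "pconj L f x \<in> conj_dom L (pinv L f)" "pconj L (pinv L f) (pconj L f x) = x"
    "pconj L f x \<in> pcarrier L" "[f, pconj L f x] \<in> pdom L" "[x, f] \<in> pdom L"
    "pprod L [f, pconj L f x] = pprod L [x, f]"
proof -
  have w: "[pinv L f, x, f] \<in> pdom L" and xc: "x \<in> pcarrier L" using x by (auto simp: conj_dom_def)
  show c: "pconj L f x \<in> pcarrier L" unfolding pconj_def using prod_closed[OF w] .
  have 1: "[f, pinv L f, x, f] \<in> pdom L"
    using winv_append(1)[of "[pinv L f]" "[x, f]"] w inv_inv[OF f] by simp
  have 2: "[f, pinv L f, x, f, pinv L f] \<in> pdom L"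
    using append_winv(1)[of "[f, pinv L f, x]" "[f]"] 1 by simp
  have 3: "[f, pconj L f x, pinv L f] \<in> pdom L"
    "pprod L [f, pconj L f x, pinv L f] = pprod L [f, pinv L f, x, f, pinv L f]"
    using prod_append[of "[f]" "[pinv L f, x, f]" "[pinv L f]"] 2 by (simp_all add: pconj_def)
  show "pconj L f x \<in> conj_dom L (pinv L f)" using 3 c inv_inv[OF f] by (simp add: conj_dom_def)
  have 4: "[x, f, pinv L f] \<in> pdom L" using dom_middle[of "[f, pinv L f]" "[x, f, pinv L f]" "[]"] 2 by simp
  have "pprod L [f, pinv L f, x, f, pinv L f] = pprod L [x, f, pinv L f]"
    using winv_append(2)[of "[pinv L f]" "[x, f, pinv L f]"] inv_inv[OF f]
      dom_middle[of "[f]" "[pinv L f, x, f, pinv L f]" "[]"] 2 by simp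
  also have "\<dots> = x" using append_winv(2)[of "[x]" "[f]"] dom_middle[of "[]" "[x, f]" "[pinv L f]"] 4 prod_singleton[OF xc] by simp
  finally show "pconj L (pinv L f) (pconj L f x) = x" using 3 inv_inv[OF f] by (simp add: pconj_def)
  show "[f, pconj L f x] \<in> pdom L" using dom_middle[of "[]" "[f, pconj L f x]" "[pinv L f]"] 3 by simp
  show "[x, f] \<in> pdom L" using dom_middle[of "[]" "[x, f]" "[pinv L f]"] 4 by simp
  have "pprod L [f, pinv L f, x, f] = pprod L [f, pconj L f x]"
    using prod_append[of "[f]" "[pinv L f, x, f]" "[]"] 1 by (simp add: pconj_def)
  moreover have "pprod L [f, pinv L f, x, f] = pprod L [x, f]"
    using winv_append(2)[of "[pinv L f]" "[x, f]"] w inv_inv[OF f] by simp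
  ultimately show "pprod L [f, pconj L f x] = pprod L [x, f]" by simp
qed

lemma inj_on_pconj: "f \<in> pcarrier L \<Longrightarrow> inj_on (pconj L f) (conj_dom L f)"
  by (metis conj_inverse(2) inj_onI)

end

section \<open>Conjugation in a locality\<close>

text \<open>Membership in the domain of a locality, with the intermediate objects computed from the first one.\<close>

fun chain :: "'a pgrp \<Rightarrow> 'a set set \<Rightarrow> 'a set \<Rightarrow> 'a list \<Rightarrow> bool" where
  "chain L \<Delta> P [] \<longleftrightarrow> P \<in> \<Delta>"
| "chain L \<Delta> P (f # w) \<longleftrightarrow> P \<in> \<Delta> \<and> f \<in> pcarrier L \<and> P \<subseteq> conj_dom L f \<and> chain L \<Delta> (pconj L f ` P) w"

locale prime_locality = locality p L \<Delta> S
  for p :: nat and L :: "'a pgrp" and \<Delta> :: "'a set set" and S :: "'a monoid" +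
  assumes prime_p: "Factorial_Ring.prime p"
    and S_p_group: "finite_p_group p S"
    and F_system: "fusion_system S (fusion_of_locality L S)"
begin

sublocale S: plain_group S
  using S_group by (simp add: plain_group_def)

abbreviation "T \<equiv> transporter_of_locality L \<Delta>"

lemma finite_S: "finite (carrier S)"
  using S_p_group by (simp add: finite_p_group_def)

lemma Delta_carrier: "P \<in> \<Delta> \<Longrightarrow> P \<subseteq> carrier S"
  using Delta_subgroups subgroup.subset by blast

lemma chain_dom: "chain L \<Delta> P w \<Longrightarrow> w \<in> pdom L"
proof -
  have key: "w \<in> lists (pcarrier L) \<and> (\<exists>Q :: nat \<Rightarrow> 'a set. Q 0 = P \<and> (\<forall>i\<le>length w. Q i \<in> \<Delta>) \<and>
      (\<forall>i<length w. Q i \<subseteq> conj_dom L (w ! i) \<and> pconj L (w ! i) ` Q i = Q (Suc i)))"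
    if "chain L \<Delta> P w" for P
    using that
  proof (induction w arbitrary: P)
    case Nil
    then show ?case by (auto intro!: exI[of _ "\<lambda>_. P"])
  next
    case (Cons f w)
    then obtain Q :: "nat \<Rightarrow> 'a set" where Q: "Q 0 = pconj L f ` P" "\<forall>i\<le>length w. Q i \<in> \<Delta>"
      "\<forall>i<length w. Q i \<subseteq> conj_dom L (w ! i) \<and> pconj L (w ! i) ` Q i = Q (Suc i)" "w \<in> lists (pcarrier L)"
      by (metis chain.simps(2))
    have "(case_nat P Q i \<in> \<Delta>)" if "i \<le> length (f # w)" for i
      using that Q Cons.prems by (cases i) auto
    moreover have "case_nat P Q i \<subseteq> conj_dom L ((f # w) ! i) \<and> pconj L ((f # w) ! i) ` case_nat P Q i = case_nat P Q (Suc i)"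
      if "i < length (f # w)" for i
      using that Q Cons.prems by (cases i) auto
    ultimately show ?case using Q Cons.prems by (intro conjI exI[of _ "case_nat P Q"]) auto
  qed
  assume "chain L \<Delta> P w"
  from key[OF this] obtain Q :: "nat \<Rightarrow> 'a set" where "w \<in> lists (pcarrier L)"
    "\<forall>i\<le>length w. Q i \<in> \<Delta>"
    "\<forall>i<length w. Q i \<subseteq> conj_dom L (w ! i) \<and> pconj L (w ! i) ` Q i = Q (Suc i)" by blast
  then show "w \<in> pdom L" unfolding dom_Delta by (intro CollectI conjI exI[of _ Q])
qed

lemma dom_chain: "w \<in> pdom L \<Longrightarrow> \<exists>P. chain L \<Delta> P w"
proof -
  have key: "chain L \<Delta> (Q 0) w" if "w \<in> lists (pcarrier L)" "\<forall>i\<le>length w. Q i \<in> \<Delta>"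
      "\<forall>i<length w. Q i \<subseteq> conj_dom L (w ! i) \<and> pconj L (w ! i) ` Q i = Q (Suc i)" for Q :: "nat \<Rightarrow> 'a set"
    using that
  proof (induction w arbitrary: Q rule: list.induct)
    case (Cons f w)
    have "Q (Suc i) \<subseteq> conj_dom L (w ! i) \<and> pconj L (w ! i) ` Q (Suc i) = Q (Suc (Suc i))" if "i < length w" for i
      using spec[OF Cons.prems(3), of "Suc i"] that by simp
    then have "chain L \<Delta> (Q (Suc 0)) w" using Cons.prems Cons.IH[of "\<lambda>i. Q (Suc i)"] by simp
    moreover have "pconj L f ` Q 0 = Q (Suc 0)" "Q 0 \<subseteq> conj_dom L f" "Q 0 \<in> \<Delta>" using Cons.prems by fastforce+
    ultimately show ?case using Cons.prems by simp
  qed auto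
  assume "w \<in> pdom L"
  then obtain Q :: "nat \<Rightarrow> 'a set" where "w \<in> lists (pcarrier L)"
    "\<forall>i\<le>length w. Q i \<in> \<Delta>"
    "\<forall>i<length w. Q i \<subseteq> conj_dom L (w ! i) \<and> pconj L (w ! i) ` Q i = Q (Suc i)"
    unfolding dom_Delta by blast
  from key[OF this] show "\<exists>P. chain L \<Delta> P w" by blast
qed

lemma S_words: "lists (carrier S) \<subseteq> pdom L"
  using S_p_subgroup by (simp add: pgrp_p_subgroup_def pgrp_subgroup_def)

lemma S_carrier: "x \<in> carrier S \<Longrightarrow> x \<in> pcarrier L"
  using S_p_subgroup by (auto simp: pgrp_p_subgroup_def pgrp_subgroup_def partial_subgroup_def)

lemma S_one: "\<one>\<^bsub>S\<^esub> = pone"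
proof -
  have m: "pone \<in> carrier S"
    using S_p_subgroup nil_dom by (auto simp: pgrp_p_subgroup_def pgrp_subgroup_def partial_subgroup_def)
  have "pone \<otimes>\<^bsub>S\<^esub> pone = pone"
    using S_mult[OF m m] insert_pone[of "[pone]" "[]"] insert_pone[of "[]" "[]"] nil_dom by simp
  then show ?thesis using S.l_cancel_one[OF m m] by simp
qed

lemma S_inv: "x \<in> carrier S \<Longrightarrow> inv\<^bsub>S\<^esub> x = pinv L x"
proof -
  assume x: "x \<in> carrier S"
  have i: "pinv L x \<in> carrier S"
    using S_p_subgroup x by (auto simp: pgrp_p_subgroup_def pgrp_subgroup_def partial_subgroup_def)
  have "pinv L x \<otimes>\<^bsub>S\<^esub> x = \<one>\<^bsub>S\<^esub>"
    using S_mult[OF i x] prod_inv[of "[x]"] dom_singleton[OF S_carrier[OF x]] S_one by simp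
  then show ?thesis using S.inv_equality x i by blast
qed

lemma pinv_S: "x \<in> carrier S \<Longrightarrow> pinv L x \<in> carrier S"
  using S_inv S.inv_closed by metis

lemma S_conj:
  assumes "g \<in> carrier S" "x \<in> carrier S"
  shows "x \<in> conj_dom L g" "pconj L g x = conj_by S g x"
proof -
  have d: "[pinv L g, x, g] \<in> pdom L" using S_words assms pinv_S[OF assms(1)] by auto
  then show "x \<in> conj_dom L g" using S_carrier assms by (simp add: conj_dom_def)
  have "pprod L ([pinv L g, x] @ [g]) = pprod L [pprod L [pinv L g, x], g]"
    using prod_append[of "[]" "[pinv L g, x]" "[g]"] d by simp
  moreover have "pprod L [pinv L g, x] = inv\<^bsub>S\<^esub> g \<otimes>\<^bsub>S\<^esub> x"
    using S_mult[OF pinv_S[OF assms(1)] assms(2)] S_inv[OF assms(1)] by simp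
  ultimately show "pconj L g x = conj_by S g x"
    using S_mult[of "inv\<^bsub>S\<^esub> g \<otimes>\<^bsub>S\<^esub> x" g] assms by (simp add: pconj_def conj_by_def)
qed

lemma S_conj_self: "\<lbrakk>subgroup P S; x \<in> P\<rbrakk> \<Longrightarrow> P \<subseteq> conj_dom L x \<and> pconj L x ` P = P"
proof -
  assume P: "subgroup P S" and x: "x \<in> P"
  have c: "y \<in> carrier S" if "y \<in> P" for y using that P subgroup.mem_carrier by metis
  have "conj_by S x ` P = P"
    using S.subgroup_subset_normalizer[OF P] x S.normalizer_eq[OF subgroup.subset[OF P]] by blast
  then show ?thesis using S_conj[OF c[OF x] c] by (auto cong: image_cong_simp)
qed

text \<open>Conjugation by \<open>f\<close> is defined on the object \<open>P\<close> and has its image in \<open>S\<close>; the image is then an object.\<close>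

definition carries :: "'a \<Rightarrow> 'a set \<Rightarrow> bool" where
  "carries f P \<longleftrightarrow> f \<in> pcarrier L \<and> P \<in> \<Delta> \<and> P \<subseteq> conj_dom L f \<and> pconj L f ` P \<subseteq> carrier S"

lemma carries_image: "carries f P \<Longrightarrow> pconj L f ` P \<in> \<Delta>"
  using Delta_conj by (simp add: carries_def)

lemma chain_carries_iff: "chain L \<Delta> P (f # w) \<longleftrightarrow> carries f P \<and> chain L \<Delta> (pconj L f ` P) w"
proof -
  have "chain L \<Delta> Q w \<Longrightarrow> Q \<in> \<Delta>" for Q by (cases w) auto
  then show ?thesis using Delta_carrier by (auto simp: carries_def)
qed

lemma carries_S: "\<lbrakk>P \<in> \<Delta>; g \<in> carrier S\<rbrakk> \<Longrightarrow> carries g P"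
proof -
  assume P: "P \<in> \<Delta>" and g: "g \<in> carrier S"
  have "x \<in> conj_dom L g \<and> pconj L g x \<in> carrier S" if "x \<in> P" for x
  proof -
    have x: "x \<in> carrier S" using that Delta_carrier[OF P] by blast
    show ?thesis using S_conj[OF g x] S.conj_by_closed[OF g x] by simp
  qed
  then show "carries g P" using P S_carrier[OF g] by (auto simp: carries_def)
qed

lemma carries_self: "\<lbrakk>P \<in> \<Delta>; g \<in> P\<rbrakk> \<Longrightarrow> carries g P \<and> pconj L g ` P = P"
  using carries_S[OF _ subsetD[OF Delta_carrier]] S_conj_self[OF Delta_subgroups] by simp

lemma inv_image: "\<lbrakk>f \<in> pcarrier L; P \<subseteq> conj_dom L f\<rbrakk> \<Longrightarrow> pconj L (pinv L f) ` pconj L f ` P = P"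
  using conj_inverse(2) by (force simp: image_image subset_iff)

lemma carries_inv: "carries f P \<Longrightarrow> carries (pinv L f) (pconj L f ` P)"
  unfolding carries_def using conj_inverse(1) inv_image Delta_conj inv_closed Delta_carrier
  by (auto simp: subset_iff)

lemma carries_subset: "\<lbrakk>carries f P; Q \<in> \<Delta>; Q \<subseteq> P\<rbrakk> \<Longrightarrow> carries f Q"
  unfolding carries_def by blast

lemma carries_comp:
  assumes f: "carries f P" and g: "carries g (pconj L f ` P)"
  shows "[f, g] \<in> pdom L" "carries (pprod L [f, g]) P"
    "\<And>x. x \<in> P \<Longrightarrow> pconj L (pprod L [f, g]) x = pconj L g (pconj L f x)"
proof -
  have fc: "f \<in> pcarrier L" "g \<in> pcarrier L" using f g by (auto simp: carries_def)
  have P: "P \<in> \<Delta>" using f by (simp add: carries_def)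
  show d: "[f, g] \<in> pdom L" using chain_dom[of P] f g carries_image[OF g] by (simp add: chain_carries_iff del: chain.simps(2))
  have pi: "pinv L (pprod L [f, g]) = pprod L [pinv L g, pinv L f]" using prod_winv[OF d] by simp
  have conv: "[pinv L (pprod L [f, g]), x, pprod L [f, g]] \<in> pdom L \<and>
      pprod L [pinv L (pprod L [f, g]), x, pprod L [f, g]] = pconj L g (pconj L f x)" if x: "x \<in> P" for x
  proof -
    have "chain L \<Delta> (pconj L g ` pconj L f ` P) [pinv L g, pinv L f, x, f, g]"
      using f g carries_inv[OF f] carries_inv[OF g] carries_self[OF P x] carries_image[OF g]
        inv_image[OF fc(2)] inv_image[OF fc(1)]
      by (simp add: chain_carries_iff carries_def del: chain.simps(2))
    then have w: "[pinv L g, pinv L f, x, f, g] \<in> pdom L" by (rule chain_dom)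
    have 1: "[pinv L g, pconj L f x, g] \<in> pdom L \<and> pprod L [pinv L g, pinv L f, x, f, g] = pprod L [pinv L g, pconj L f x, g]"
      using prod_append[of "[pinv L g]" "[pinv L f, x, f]" "[g]"] w by (simp add: pconj_def)
    have 2: "[pprod L [pinv L g, pinv L f], x, f, g] \<in> pdom L \<and>
        pprod L [pinv L g, pinv L f, x, f, g] = pprod L [pprod L [pinv L g, pinv L f], x, f, g]"
      using prod_append[of "[]" "[pinv L g, pinv L f]" "[x, f, g]"] w by simp
    have "[pprod L [pinv L g, pinv L f], x, pprod L [f, g]] \<in> pdom L \<and>
        pprod L [pprod L [pinv L g, pinv L f], x, f, g] = pprod L [pprod L [pinv L g, pinv L f], x, pprod L [f, g]]"
      using prod_append[of "[pprod L [pinv L g, pinv L f], x]" "[f, g]" "[]"] 2 by simp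
    then show ?thesis using 1 2 pi by (simp add: pconj_def)
  qed
  show eq: "pconj L (pprod L [f, g]) x = pconj L g (pconj L f x)" if "x \<in> P" for x
    using conv[OF that] by (simp add: pconj_def)
  have "pconj L (pprod L [f, g]) ` P \<subseteq> carrier S" using eq g by (auto simp: carries_def)
  then show "carries (pprod L [f, g]) P"
    using conv prod_closed[OF d] P Delta_carrier[OF P] S_carrier by (auto simp: carries_def conj_dom_def)
qed

lemma carries_one: "P \<in> \<Delta> \<Longrightarrow> carries pone P \<and> (\<forall>x\<in>P. pconj L pone x = x)"
proof -
  assume P: "P \<in> \<Delta>"
  have 1: "pone \<in> carrier S" using S_one S.one_closed by metis
  have "pconj L pone x = x" if "x \<in> P" for x
    using S_conj(2)[OF 1] that Delta_carrier[OF P] S.conj_by_one S_one by (metis subsetD)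
  then show ?thesis using carries_S[OF P 1] by blast
qed

lemma carries_exists: "f \<in> pcarrier L \<Longrightarrow> \<exists>P. carries f P"
  using dom_chain[OF dom_singleton] by (simp add: chain_carries_iff del: chain.simps(2)) blast

text \<open>If \<open>f\<close> conjugates \<open>a \<in> S\<close> to \<open>b \<in> S\<close>, then \<open>f = a\<^sup>-\<^sup>1 f b\<close>. Hence \<open>f\<close> is defined not only on \<open>P\<close> but on
  the conjugate \<open>P\<^sup>a\<close> as well.\<close>

lemma carries_conj:
  assumes f: "carries f P" and a: "a \<in> carrier S" "a \<in> conj_dom L f" "pconj L f a \<in> carrier S"
  shows "carries f (pconj L a ` P)" "pconj L f ` pconj L a ` P = pconj L (pconj L f a) ` pconj L f ` P"
proof -
  let ?b = "pconj L f a" and ?Q = "pconj L a ` P"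
  have fc: "f \<in> pcarrier L" using f by (simp add: carries_def)
  have P: "P \<in> \<Delta>" using f by (simp add: carries_def)
  have aP: "carries a P" using carries_S[OF P a(1)] .
  have Q: "?Q \<in> \<Delta>" using carries_image[OF aP] .
  have bk: "pconj L (pinv L a) ` ?Q = P" using inv_image[OF S_carrier[OF a(1)]] aP by (simp add: carries_def)
  have 1: "carries (pinv L a) ?Q" using carries_inv[OF aP] .
  have 2: "carries f (pconj L (pinv L a) ` ?Q)" using bk f by simp
  note c1 = carries_comp[OF 1 2]
  have im1: "pconj L (pprod L [pinv L a, f]) ` ?Q = pconj L f ` P"
    using c1(3) bk by (simp add: image_image[symmetric] cong: image_cong_simp)
  have bP: "carries ?b (pconj L f ` P)" using carries_S[OF carries_image[OF f] a(3)] .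
  have 3: "carries ?b (pconj L (pprod L [pinv L a, f]) ` ?Q)" using bP im1 by simp
  note c2 = carries_comp[OF c1(2) 3]
  have "chain L \<Delta> ?Q [pinv L a, f, ?b]"
    using 1 f bP bk carries_image[OF bP] by (simp add: chain_carries_iff del: chain.simps(2))
  then have w: "[pinv L a, f, ?b] \<in> pdom L" by (rule chain_dom)
  have "pprod L [pprod L [pinv L a, f], ?b] = pprod L [pinv L a, f, ?b]"
    using prod_append[of "[]" "[pinv L a, f]" "[?b]"] w by simp
  also have "\<dots> = pprod L [pinv L a, pprod L [f, ?b]]"
    using prod_append[of "[pinv L a]" "[f, ?b]" "[]"] w by simp
  also have "\<dots> = pprod L [pinv L a, pprod L [a, f]]" using conj_inverse(6)[OF fc a(2)] by simp
  also have "\<dots> = pprod L [pinv L a, a, f]"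
    using prod_append[of "[pinv L a]" "[a, f]" "[]"] winv_append(1)[of "[a]" "[f]"] conj_inverse(5)[OF fc a(2)] by simp
  also have "\<dots> = f" using winv_append(2)[of "[a]" "[f]"] conj_inverse(5)[OF fc a(2)] prod_singleton[OF fc] by simp
  finally have feq: "pprod L [pprod L [pinv L a, f], ?b] = f" .
  show "carries f ?Q" using c2(2) feq by simp
  have "pconj L f ` ?Q = pconj L ?b ` pconj L (pprod L [pinv L a, f]) ` ?Q"
    using c2(3) unfolding feq by (simp add: image_image cong: image_cong_simp)
  then show "pconj L f ` ?Q = pconj L ?b ` pconj L f ` P" using im1 by simp
qed

text \<open>The elements \<open>a\<close> and \<open>c\<close> need not lie in a common object on which \<open>f\<close> is known to be defined. By the preceding
  lemma, the word \<open>(f\<^sup>-\<^sup>1, a, f, f\<^sup>-\<^sup>1, c, f)\<close> nevertheless lies in the domain: starting from the image of an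
  object \<open>P\<close> under \<open>f\<close> it passes through \<open>P\<close>, \<open>P\<^sup>a\<close> and \<open>P\<^sup>a\<^sup>c\<close>.\<close>

lemma pconj_mult:
  assumes f: "f \<in> pcarrier L" and a: "a \<in> carrier S" "a \<in> conj_dom L f" "pconj L f a \<in> carrier S"
    and c: "c \<in> carrier S" "c \<in> conj_dom L f" "pconj L f c \<in> carrier S"
  shows "pconj L f (a \<otimes>\<^bsub>S\<^esub> c) = pconj L f a \<otimes>\<^bsub>S\<^esub> pconj L f c"
proof -
  obtain P where P: "carries f P" using carries_exists[OF f] by blast
  let ?Q = "pconj L a ` P"
  have PD: "P \<in> \<Delta>" "P \<subseteq> conj_dom L f" using P by (auto simp: carries_def)
  have Q: "carries f ?Q" using carries_conj(1)[OF P a] .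
  have QD: "?Q \<in> \<Delta>" "?Q \<subseteq> conj_dom L f" using Q by (auto simp: carries_def)
  have R: "carries f (pconj L c ` ?Q)" using carries_conj(1)[OF Q c] .
  have "chain L \<Delta> (pconj L f ` P) [pinv L f, a, f, pinv L f, c, f]"
    using carries_inv[OF P] carries_inv[OF Q] P Q R carries_S[OF PD(1) a(1)] carries_S[OF QD(1) c(1)]
      inv_image[OF f PD(2)] inv_image[OF f QD(2)] carries_image[OF R]
    by (simp add: chain_carries_iff del: chain.simps(2))
  then have w: "[pinv L f, a, f, pinv L f, c, f] \<in> pdom L" by (rule chain_dom)
  have 1: "[pconj L f a, pinv L f, c, f] \<in> pdom L"
    "pprod L [pinv L f, a, f, pinv L f, c, f] = pprod L [pconj L f a, pinv L f, c, f]"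
    using prod_append[of "[]" "[pinv L f, a, f]" "[pinv L f, c, f]"] w by (auto simp: pconj_def)
  have 2: "pprod L [pconj L f a, pinv L f, c, f] = pprod L [pconj L f a, pconj L f c]"
    using prod_append[of "[pconj L f a]" "[pinv L f, c, f]" "[]"] 1 by (auto simp: pconj_def)
  have ff: "pprod L [f, pinv L f] = pone" using dom_mult_winv[OF dom_singleton[OF f]] by simp
  have 3: "[pinv L f, a, pone, c, f] \<in> pdom L"
    "pprod L [pinv L f, a, f, pinv L f, c, f] = pprod L [pinv L f, a, pone, c, f]"
    using prod_append[of "[pinv L f, a]" "[f, pinv L f]" "[c, f]"] w ff by auto
  have ac: "pprod L [a, pone, c] = pprod L [a, c]"
    using insert_pone[of "[a]" "[c]"] subsetD[OF S_words, of "[a, c]"] a(1) c(1) by simp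
  have "pprod L [pinv L f, a, pone, c, f] = pprod L [pinv L f, pprod L [a, pone, c], f]"
    using prod_append[of "[pinv L f]" "[a, pone, c]" "[f]"] 3 by auto
  then have "pprod L [pinv L f, a, pone, c, f] = pconj L f (a \<otimes>\<^bsub>S\<^esub> c)"
    unfolding ac using S_mult a c by (simp add: pconj_def)
  then show ?thesis using 1 2 3 S_mult a c by simp
qed

lemma not_Delta_image:
  assumes f: "f \<in> pcarrier L" and A: "A \<subseteq> conj_dom L f" "A \<subseteq> carrier S" and D: "pconj L f ` A \<in> \<Delta>"
  shows "A \<in> \<Delta>"
proof -
  have "pconj L f ` A \<subseteq> conj_dom L (pinv L f)" using conj_inverse(1)[OF f] A by blast
  then have "pconj L (pinv L f) ` pconj L f ` A \<in> \<Delta>"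
    using Delta_conj[OF D inv_closed[OF f]] inv_image[OF f A(1)] A(2) by simp
  then show ?thesis using inv_image[OF f A(1)] by simp
qed

section \<open>The fusion system of a locality\<close>

text \<open>An upper bound for the fusion system of the locality: on objects only conjugation maps, and
  elsewhere all injective homomorphisms whose image is not an object. Because of the condition on the
  image, an object can only be reached from objects, so that inverses and composites stay in the
  family.\<close>

definition conj_or_small :: "'a fusion" where
  "conj_or_small P Q = {\<phi>. subgroup P S \<and> subgroup Q S \<and> \<phi> \<in> extensional P \<and> \<phi> ` P \<subseteq> Q \<and> inj_on \<phi> P \<and>
     (\<forall>x\<in>P. \<forall>y\<in>P. \<phi> (x \<otimes>\<^bsub>S\<^esub> y) = \<phi> x \<otimes>\<^bsub>S\<^esub> \<phi> y) \<and>
     (if P \<in> \<Delta> then \<exists>f. carries f P \<and> (\<forall>x\<in>P. \<phi> x = pconj L f x) else \<phi> ` P \<notin> \<Delta>)}"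

lemma conj_or_smallI:
  assumes A: "subgroup A S" "subgroup B S" and f: "f \<in> pcarrier L" "A \<subseteq> conj_dom L f" "pconj L f ` A \<subseteq> B"
  shows "(\<lambda>x\<in>A. pconj L f x) \<in> conj_or_small A B"
proof -
  note Ac = subgroup.subset[OF A(1)] and Bc = subgroup.subset[OF A(2)]
  have "pconj L f (x \<otimes>\<^bsub>S\<^esub> y) = pconj L f x \<otimes>\<^bsub>S\<^esub> pconj L f y" if "x \<in> A" "y \<in> A" for x y
    using pconj_mult[OF f(1)] that f Ac Bc by blast
  moreover have "inj_on (pconj L f) A" using inj_on_pconj[OF f(1)] f(2) inj_on_subset by blast
  moreover have "A \<in> \<Delta> \<Longrightarrow> carries f A" using f Bc by (auto simp: carries_def)
  moreover have "A \<notin> \<Delta> \<Longrightarrow> pconj L f ` A \<notin> \<Delta>" using not_Delta_image[OF f(1,2) Ac] by blast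
  ultimately show ?thesis
    unfolding conj_or_small_def using A f subgroup.m_closed[OF A(1)]
    by (auto simp: inj_on_def)
qed

lemma fusion_system_conj_or_small: "fusion_system S conj_or_small"
proof
  show "subgroup P S \<and> subgroup Q S" if "conj_or_small P Q \<noteq> {}" for P Q
    using that by (auto simp: conj_or_small_def)
  show "conj_map S g P \<in> conj_or_small P Q"
    if "subgroup P S" "subgroup Q S" "g \<in> carrier S" "conj_by S g ` P \<subseteq> Q" for P Q g
  proof -
    have e: "\<forall>x\<in>P. x \<in> conj_dom L g \<and> pconj L g x = conj_by S g x"
      using S_conj that subgroup.mem_carrier by metis
    then have "conj_map S g P = (\<lambda>x\<in>P. pconj L g x)" unfolding conj_map_def by (intro restrict_ext) simp
    moreover have "pconj L g ` P \<subseteq> Q" "P \<subseteq> conj_dom L g" using e that(4) by (auto simp: image_subset_iff)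
    ultimately show ?thesis using conj_or_smallI[OF that(1,2) S_carrier[OF that(3)]] by simp
  qed
  show "conj_or_small P Q \<subseteq> mon (subgrp S P) (subgrp S Q) \<inter> extensional P" for P Q
    by (auto simp: conj_or_small_def mon_def hom_def)
  show "compose P \<psi> \<phi> \<in> conj_or_small P R" if f: "\<phi> \<in> conj_or_small P Q" and g: "\<psi> \<in> conj_or_small Q R" for P Q R \<phi> \<psi>
  proof -
    have f': "subgroup P S" "subgroup Q S" "\<phi> ` P \<subseteq> Q" "inj_on \<phi> P" "\<forall>x\<in>P. \<forall>y\<in>P. \<phi> (x \<otimes>\<^bsub>S\<^esub> y) = \<phi> x \<otimes>\<^bsub>S\<^esub> \<phi> y"
      and g': "subgroup R S" "\<psi> ` Q \<subseteq> R" "inj_on \<psi> Q" "\<forall>x\<in>Q. \<forall>y\<in>Q. \<psi> (x \<otimes>\<^bsub>S\<^esub> y) = \<psi> x \<otimes>\<^bsub>S\<^esub> \<psi> y"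
      using f g by (auto simp: conj_or_small_def)
    have im: "compose P \<psi> \<phi> ` P = \<psi> ` \<phi> ` P" by (simp add: compose_def image_image cong: image_cong_simp)
    have inj: "inj_on (compose P \<psi> \<phi>) P"
      using f'(3,4) g'(3) by (auto simp: inj_on_def compose_def image_subset_iff)
    have hom: "\<forall>x\<in>P. \<forall>y\<in>P. compose P \<psi> \<phi> (x \<otimes>\<^bsub>S\<^esub> y) = compose P \<psi> \<phi> x \<otimes>\<^bsub>S\<^esub> compose P \<psi> \<phi> y"
      using f' g' subgroup.m_closed[OF f'(1)] by (auto simp: compose_def image_subset_iff)
    have "if P \<in> \<Delta> then \<exists>h. carries h P \<and> (\<forall>x\<in>P. compose P \<psi> \<phi> x = pconj L h x) else compose P \<psi> \<phi> ` P \<notin> \<Delta>"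
    proof (cases "P \<in> \<Delta>")
      case True
      then obtain u where u: "carries u P" "\<forall>x\<in>P. \<phi> x = pconj L u x" using f by (auto simp: conj_or_small_def)
      have uP: "pconj L u ` P \<subseteq> Q" using u f'(3) by (auto simp: image_subset_iff)
      have "Q \<in> \<Delta>" using Delta_overgroups[OF carries_image[OF u(1)] f'(2) uP] .
      then obtain v where v: "carries v Q" "\<forall>x\<in>Q. \<psi> x = pconj L v x" using g by (auto simp: conj_or_small_def)
      have "carries v (pconj L u ` P)" using carries_subset[OF v(1) carries_image[OF u(1)] uP] .
      note c = carries_comp[OF u(1) this]
      have "\<forall>x\<in>P. compose P \<psi> \<phi> x = pconj L (pprod L [u, v]) x"
        using c(3) u(2) v(2) uP by (auto simp: compose_def image_subset_iff)
      then show ?thesis using True c(2) by auto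
    next
      case False
      then have nf: "\<phi> ` P \<notin> \<Delta>" using f by (auto simp: conj_or_small_def)
      have "\<psi> ` \<phi> ` P \<notin> \<Delta>"
      proof (cases "Q \<in> \<Delta>")
        case True
        then obtain v where v: "carries v Q" "\<forall>x\<in>Q. \<psi> x = pconj L v x" using g by (auto simp: conj_or_small_def)
        have "\<psi> ` \<phi> ` P = pconj L v ` \<phi> ` P" using v(2) f'(3) by (intro image_cong) auto
        moreover have "pconj L v ` \<phi> ` P \<notin> \<Delta>"
        proof
          assume "pconj L v ` \<phi> ` P \<in> \<Delta>"
          moreover have "\<phi> ` P \<subseteq> conj_dom L v" "\<phi> ` P \<subseteq> carrier S" "v \<in> pcarrier L"
            using v(1) f'(3) subgroup.subset[OF f'(2)] by (auto simp: carries_def)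
          ultimately show False using not_Delta_image nf by blast
        qed
        ultimately show ?thesis by simp
      next
        case False
        then have "\<psi> ` Q \<notin> \<Delta>" using g by (auto simp: conj_or_small_def)
        moreover have "subgroup (\<psi> ` Q) S"
        proof -
          have "\<psi> \<in> hom (subgrp S Q) S" using g'(2,4) subgroup.subset[OF g'(1)] by (auto simp: hom_def)
          then interpret h: group_hom "subgrp S Q" S \<psi>
            using S.group_subgrp[OF f'(2)] by (simp add: group_hom_def group_hom_axioms_def S.is_group)
          show ?thesis using h.subgroup_img_is_subgroup[OF h.subgroup_self] by simp
        qed
        ultimately show ?thesis using Delta_overgroups f'(3) by (metis image_mono)
      qed
      then show ?thesis using False im by simp
    qed
    moreover have "compose P \<psi> \<phi> ` P \<subseteq> R" using im f'(3) g'(2) by blast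
    ultimately show ?thesis unfolding conj_or_small_def using f'(1) g'(1) inj hom by simp
  qed
  show "\<phi> \<in> conj_or_small P (\<phi> ` P) \<and> restrict (inv_into P \<phi>) (\<phi> ` P) \<in> conj_or_small (\<phi> ` P) P"
    if f: "\<phi> \<in> conj_or_small P Q" for P Q \<phi>
  proof -
    have f': "subgroup P S" "subgroup Q S" "\<phi> ` P \<subseteq> Q" "inj_on \<phi> P" "\<forall>x\<in>P. \<forall>y\<in>P. \<phi> (x \<otimes>\<^bsub>S\<^esub> y) = \<phi> x \<otimes>\<^bsub>S\<^esub> \<phi> y"
      using f by (auto simp: conj_or_small_def)
    let ?i = "restrict (inv_into P \<phi>) (\<phi> ` P)"
    have ix: "?i (\<phi> x) = x" if "x \<in> P" for x using that f'(4) by simp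
    have im: "subgroup (\<phi> ` P) S"
    proof -
      have "\<phi> \<in> hom (subgrp S P) S" using f'(3,5) subgroup.subset[OF f'(2)] by (auto simp: hom_def)
      then interpret h: group_hom "subgrp S P" S \<phi>
        using S.group_subgrp[OF f'(1)] by (simp add: group_hom_def group_hom_axioms_def S.is_group)
      show ?thesis using h.subgroup_img_is_subgroup[OF h.subgroup_self] by simp
    qed
    have ii: "?i ` \<phi> ` P = P" using ix by (auto simp: image_image simp del: restrict_apply)
    have hom: "\<forall>x\<in>\<phi> ` P. \<forall>y\<in>\<phi> ` P. ?i (x \<otimes>\<^bsub>S\<^esub> y) = ?i x \<otimes>\<^bsub>S\<^esub> ?i y"
    proof (intro ballI, elim imageE)
      fix x y a b assume "x = \<phi> a" "a \<in> P" "y = \<phi> b" "b \<in> P"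
      then show "?i (x \<otimes>\<^bsub>S\<^esub> y) = ?i x \<otimes>\<^bsub>S\<^esub> ?i y"
        using ix[of "a \<otimes>\<^bsub>S\<^esub> b"] ix f'(5) subgroup.m_closed[OF f'(1)] by metis
    qed
    have inj: "inj_on ?i (\<phi> ` P)" using ix by (intro inj_onI) (metis imageE)
    have "if \<phi> ` P \<in> \<Delta> then \<exists>h. carries h (\<phi> ` P) \<and> (\<forall>x\<in>\<phi> ` P. ?i x = pconj L h x) else ?i ` \<phi> ` P \<notin> \<Delta>"
    proof (cases "P \<in> \<Delta>")
      case True
      then obtain u where u: "carries u P" "\<forall>x\<in>P. \<phi> x = pconj L u x" using f by (auto simp: conj_or_small_def)
      have eq: "\<phi> ` P = pconj L u ` P" using u(2) by (intro image_cong) auto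
      have "?i y = pconj L (pinv L u) y" if y: "y \<in> \<phi> ` P" for y
      proof -
        obtain a where a: "a \<in> P" "y = \<phi> a" using y by blast
        have "pconj L (pinv L u) (pconj L u a) = a" using conj_inverse(2) u(1) a by (auto simp: carries_def)
        then show ?thesis using a u(2) ix by simp
      qed
      then show ?thesis using carries_inv[OF u(1)] carries_image[OF u(1)] unfolding eq by auto
    next
      case False
      then have "\<phi> ` P \<notin> \<Delta>" using f by (auto simp: conj_or_small_def)
      then show ?thesis using ii False by simp
    qed
    then have "?i \<in> conj_or_small (\<phi> ` P) P"
      unfolding conj_or_small_def using im f'(1) inj hom ii by simp
    moreover have "\<phi> \<in> conj_or_small P (\<phi> ` P)" using f im by (auto simp: conj_or_small_def)
    ultimately show ?thesis by blast
  qed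
qed

text \<open>On objects the generated fusion system contains nothing but conjugation maps, although its
  definition allows composites of arbitrary length.\<close>

lemma fusion_Delta:
  assumes P: "P \<in> \<Delta>"
  shows "fusion_of_locality L S P Q =
    (if subgroup Q S then {\<lambda>x\<in>P. pconj L f x | f. carries f P \<and> pconj L f ` P \<subseteq> Q} else {})"
proof (intro equalityI subsetI)
  fix \<phi> assume "\<phi> \<in> fusion_of_locality L S P Q"
  moreover have "conj_or_small P Q \<in> {E P Q | E. fusion_system S E \<and>
     (\<forall>A B f. subgroup A S \<longrightarrow> subgroup B S \<longrightarrow> f \<in> pcarrier L \<longrightarrow> A \<subseteq> conj_dom L f \<longrightarrow>
        pconj L f ` A \<subseteq> B \<longrightarrow> (\<lambda>x\<in>A. pconj L f x) \<in> E A B)}"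
    using fusion_system_conj_or_small conj_or_smallI by (intro CollectI exI[of _ conj_or_small]) simp
  ultimately have "\<phi> \<in> conj_or_small P Q"
    unfolding fusion_of_locality_def by (rule InterD)
  then obtain f where f: "subgroup Q S" "\<phi> \<in> extensional P" "\<phi> ` P \<subseteq> Q" "carries f P" "\<forall>x\<in>P. \<phi> x = pconj L f x"
    using P by (auto simp: conj_or_small_def)
  have "\<phi> = (\<lambda>x\<in>P. pconj L f x)" using f by (intro extensionalityI[of _ P]) auto
  moreover have "pconj L f ` P \<subseteq> Q" using f by auto
  ultimately show "\<phi> \<in> (if subgroup Q S then {\<lambda>x\<in>P. pconj L f x | f. carries f P \<and> pconj L f ` P \<subseteq> Q} else {})"
    using f by auto
next
  fix \<phi> assume "\<phi> \<in> (if subgroup Q S then {\<lambda>x\<in>P. pconj L f x | f. carries f P \<and> pconj L f ` P \<subseteq> Q} else {})"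
  then obtain f where f: "subgroup Q S" "\<phi> = (\<lambda>x\<in>P. pconj L f x)" "carries f P" "pconj L f ` P \<subseteq> Q"
    by (auto split: if_splits)
  then have "f \<in> pcarrier L" "P \<subseteq> conj_dom L f" by (auto simp: carries_def)
  then show "\<phi> \<in> fusion_of_locality L S P Q"
    unfolding fusion_of_locality_def using f Delta_subgroups[OF P] by (intro InterI) auto
qed

end

section \<open>The transporter system of a locality\<close>

lemma induced_group_simps [simp]:
  "carrier (induced_group L H) = H" "x \<otimes>\<^bsub>induced_group L H\<^esub> y = pprod L [x, y]"
  "\<one>\<^bsub>induced_group L H\<^esub> = pprod L []"
  by (simp_all add: induced_group_def)

lemma transporter_of_locality_simps [simp]:
  "ob (transporter_of_locality L \<Delta>) = \<Delta>"
  "tid (transporter_of_locality L \<Delta>) P = (pprod L [], P, P)"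
  "tcomp (transporter_of_locality L \<Delta>) (f, P, Q) (g, Q', R) = (pprod L [f, g], P, R)"
  "eps (transporter_of_locality L \<Delta>) P Q f = (f, P, Q)"
  "rho (transporter_of_locality L \<Delta>) (f, P, Q) = (\<lambda>x\<in>P. pconj L f x)"
  "src (transporter_of_locality L \<Delta>) (f, P, Q) = P"
  "tgt (transporter_of_locality L \<Delta>) (f, P, Q) = Q"
  by (simp_all add: transporter_of_locality_def)

context prime_locality
begin

lemma thom_T_iff: "\<phi> \<in> thom T P Q \<longleftrightarrow> (\<exists>f. \<phi> = (f, P, Q) \<and> carries f P \<and> Q \<in> \<Delta> \<and> pconj L f ` P \<subseteq> Q)"
  using Delta_carrier[of Q] unfolding thom_def carries_def transporter_of_locality_def by auto

lemma thomE:
  assumes "\<phi> \<in> thom T P Q"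
  obtains f where "\<phi> = (f, P, Q)" "carries f P" "P \<in> \<Delta>" "Q \<in> \<Delta>" "pconj L f ` P \<subseteq> Q" "f \<in> pcarrier L"
  using assms unfolding thom_T_iff carries_def by blast

lemma thomI: "\<lbrakk>carries f P; Q \<in> \<Delta>; pconj L f ` P \<subseteq> Q\<rbrakk> \<Longrightarrow> (f, P, Q) \<in> thom T P Q"
  unfolding thom_T_iff by blast

lemma carries_comp_le:
  assumes f: "carries f P" "pconj L f ` P \<subseteq> Q" and g: "carries g Q"
  shows "[f, g] \<in> pdom L" "carries (pprod L [f, g]) P"
    "\<And>x. x \<in> P \<Longrightarrow> pconj L (pprod L [f, g]) x = pconj L g (pconj L f x)"
    "pconj L g ` Q \<subseteq> R \<Longrightarrow> pconj L (pprod L [f, g]) ` P \<subseteq> R"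
proof -
  have "carries g (pconj L f ` P)" using carries_subset[OF g carries_image[OF f(1)] f(2)] .
  note c = carries_comp[OF f(1) this]
  show "[f, g] \<in> pdom L" "carries (pprod L [f, g]) P" by (rule c)+
  show eq: "\<And>x. x \<in> P \<Longrightarrow> pconj L (pprod L [f, g]) x = pconj L g (pconj L f x)" by (rule c)
  show "pconj L (pprod L [f, g]) ` P \<subseteq> R" if "pconj L g ` Q \<subseteq> R"
    using eq f(2) that by (auto simp: image_subset_iff)
qed

lemma T_tcomp_in: "\<lbrakk>\<phi> \<in> thom T P Q; \<psi> \<in> thom T Q R\<rbrakk> \<Longrightarrow> tcomp T \<phi> \<psi> \<in> thom T P R"
proof -
  assume "\<phi> \<in> thom T P Q" "\<psi> \<in> thom T Q R"
  then obtain f g where f: "\<phi> = (f, P, Q)" "carries f P" "pconj L f ` P \<subseteq> Q"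
    and g: "\<psi> = (g, Q, R)" "carries g Q" "R \<in> \<Delta>" "pconj L g ` Q \<subseteq> R" by (meson thomE)
  then show ?thesis
    using thomI[OF carries_comp_le(2)[OF f(2,3) g(2)] g(3) carries_comp_le(4)[OF f(2,3) g(2,4)]] by simp
qed

lemma T_tid_in: "P \<in> \<Delta> \<Longrightarrow> tid T P \<in> thom T P P"
  using carries_one[of P] by (auto intro!: thomI)

lemma prod_pone: "f \<in> pcarrier L \<Longrightarrow> pprod L [pone, f] = f \<and> pprod L [f, pone] = f"
  using insert_pone[of "[]" "[f]"] insert_pone[of "[f]" "[]"] dom_singleton prod_singleton by simp

lemma T_tcomp_tid: "\<phi> \<in> thom T P Q \<Longrightarrow> tcomp T (tid T P) \<phi> = \<phi> \<and> tcomp T \<phi> (tid T Q) = \<phi>"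
  by (elim thomE) (simp add: prod_pone)

lemma T_tcomp_assoc:
  assumes "\<phi> \<in> thom T P Q" "\<psi> \<in> thom T Q R" "\<chi> \<in> thom T R U"
  shows "tcomp T (tcomp T \<phi> \<psi>) \<chi> = tcomp T \<phi> (tcomp T \<psi> \<chi>)"
proof -
  obtain f g h where f: "\<phi> = (f, P, Q)" "carries f P" "pconj L f ` P \<subseteq> Q"
    and g: "\<psi> = (g, Q, R)" "carries g Q" "R \<in> \<Delta>" "pconj L g ` Q \<subseteq> R"
    and h: "\<chi> = (h, R, U)" "carries h R" using assms by (meson thomE)
  have g': "carries g (pconj L f ` P)" using carries_subset[OF g(2) carries_image[OF f(2)] f(3)] .
  have "pconj L g ` pconj L f ` P \<subseteq> R" using f(3) g(4) by blast
  then have h': "carries h (pconj L g ` pconj L f ` P)" using carries_subset[OF h(2) carries_image[OF g']] by blast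
  have "chain L \<Delta> P [f, g, h]"
    using f(2) g' h' carries_image[OF h'] by (simp add: chain_carries_iff del: chain.simps(2))
  then have w: "[f, g, h] \<in> pdom L" by (rule chain_dom)
  have "pprod L [pprod L [f, g], h] = pprod L [f, pprod L [g, h]]"
    using prod_append[of "[]" "[f, g]" "[h]"] prod_append[of "[f]" "[g, h]" "[]"] w by simp
  then show ?thesis using f g h by simp
qed

lemma group_Aut_T_loc: "P \<in> \<Delta> \<Longrightarrow> group (Aut_T T P)"
  unfolding Aut_T_def
  by (intro monoid.units_group monoidI)
    (auto intro: T_tcomp_in T_tid_in[simplified] T_tcomp_assoc simp: T_tcomp_tid[simplified])

lemma carries_endo_image: "\<lbrakk>carries f P; pconj L f ` P \<subseteq> P\<rbrakk> \<Longrightarrow> pconj L f ` P = P"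
proof -
  assume f: "carries f P" "pconj L f ` P \<subseteq> P"
  have "finite P" using f finite_S Delta_carrier finite_subset by (metis carries_def)
  moreover have "inj_on (pconj L f) P" using inj_on_pconj inj_on_subset f(1) unfolding carries_def by blast
  ultimately show ?thesis using f(2) endo_inj_surj by blast
qed

lemma thom_T_self: "P \<in> \<Delta> \<Longrightarrow> thom T P P = (\<lambda>f. (f, P, P)) ` pnormalizer L P"
proof -
  assume P: "P \<in> \<Delta>"
  have "carries f P \<and> pconj L f ` P \<subseteq> P \<longleftrightarrow> f \<in> pnormalizer L P" for f
    using carries_endo_image[of f P] P Delta_carrier[OF P] by (auto simp: carries_def pnormalizer_def)
  then show ?thesis using P by (auto simp: thom_T_iff)
qed

lemma prod_inverse_unique: "\<lbrakk>[f, g] \<in> pdom L; pprod L [f, g] = pone\<rbrakk> \<Longrightarrow> g = pinv L f"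
proof -
  assume d: "[f, g] \<in> pdom L" and e: "pprod L [f, g] = pone"
  have fg: "f \<in> pcarrier L" "g \<in> pcarrier L" using set_dom[OF d] by auto
  have 1: "[pinv L f, f, g] \<in> pdom L" "pprod L [pinv L f, f, g] = g"
    using winv_append[of "[f]" "[g]"] d prod_singleton[OF fg(2)] by auto
  have "pprod L [pinv L f, f, g] = pprod L [pinv L f, pone]"
    using prod_append[of "[pinv L f]" "[f, g]" "[]"] 1 e by simp
  then show ?thesis using 1 prod_pone[OF inv_closed[OF fg(1)]] by simp
qed

lemma thom_T_inverse:
  assumes P: "P \<in> \<Delta>" and f: "f \<in> pnormalizer L P"
  shows "inverse_pair T P P (f, P, P) (pinv L f, P, P)"
proof -
  have a: "carries f P" "pconj L f ` P = P" "f \<in> pcarrier L"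
    using P f Delta_carrier by (auto simp: carries_def pnormalizer_def)
  have i: "carries (pinv L f) P" using carries_inv[OF a(1)] a(2) by simp
  have "pconj L (pinv L f) ` P = P" using inv_image[OF a(3), of P] a(1,2) by (simp add: carries_def)
  then show ?thesis
    using a i P thomI dom_mult_winv[OF dom_singleton[OF a(3)]] prod_inv[OF dom_singleton[OF a(3)]]
    by (simp add: inverse_pair_def)
qed

lemma Aut_T_loc_carrier: "P \<in> \<Delta> \<Longrightarrow> carrier (Aut_T T P) = (\<lambda>f. (f, P, P)) ` pnormalizer L P"
proof -
  assume P: "P \<in> \<Delta>"
  have ex: "\<exists>y\<in>thom T P P. tcomp T y x = tid T P \<and> tcomp T x y = tid T P" if x: "x \<in> thom T P P" for x
  proof -
    obtain f where f: "f \<in> pnormalizer L P" "x = (f, P, P)" using x thom_T_self[OF P] by auto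
    show ?thesis using thom_T_inverse[OF P f(1)] f(2) unfolding inverse_pair_def by blast
  qed
  have "carrier (Aut_T T P) =
      {x \<in> thom T P P. \<exists>y\<in>thom T P P. tcomp T y x = tid T P \<and> tcomp T x y = tid T P}"
    by (simp add: Aut_T_def units_of_def Units_def del: transporter_of_locality_simps)
  also have "\<dots> = thom T P P" using ex by blast
  finally show ?thesis using thom_T_self[OF P] by simp
qed

lemma E_T_loc: "P \<in> \<Delta> \<Longrightarrow> E_T T P = (\<lambda>f. (f, P, P)) ` pcentralizer L P"
proof -
  assume P: "P \<in> \<Delta>"
  have "pcentralizer L P = {f \<in> pnormalizer L P. \<forall>x\<in>P. pconj L f x = x}"
    by (auto simp: pcentralizer_def pnormalizer_def cong: image_cong_simp)
  moreover have "rho T (f, P, P) = (\<lambda>x\<in>P. x) \<longleftrightarrow> (\<forall>x\<in>P. pconj L f x = x)" for f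
    by (auto simp: restrict_def fun_eq_iff)
  ultimately show ?thesis unfolding E_T_def Aut_T_loc_carrier[OF P] by auto
qed

lemma carrier_in_Delta: "carrier S \<in> \<Delta>"
  using Delta_nonempty Delta_overgroups[OF _ S.subgroup_self] Delta_carrier by blast

lemma finite_mor_T: "finite (mor T)"
proof (rule finite_subset)
  show "mor T \<subseteq> pcarrier L \<times> Pow (carrier S) \<times> Pow (carrier S)"
    using Delta_carrier by (auto simp: transporter_of_locality_def)
  show "finite (pcarrier L \<times> Pow (carrier S) \<times> Pow (carrier S))"
    using finite_pcarrier finite_S by simp
qed

text \<open>If \<open>S\<close> were not a Sylow subgroup of \<open>N\<^sub>L(S)\<close>, then it would be properly contained in a \<open>p\<close>-subgroup of
  that group, contrary to its maximality among the \<open>p\<close>-subgroups of \<open>L\<close>.\<close>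

lemma eps_S_sylow: "sylow_subgroup p (Aut_T T (carrier S)) (eps T (carrier S) (carrier S) ` carrier S)"
proof (rule ccontr)
  let ?S = "carrier S"
  let ?A = "Aut_T T ?S" and ?U = "(\<lambda>g. (g, ?S, ?S)) ` ?S"
  note SD = carrier_in_Delta
  assume "\<not> sylow_subgroup p ?A (eps T ?S ?S ` ?S)"
  then have ns: "\<not> sylow_subgroup p ?A ?U" by simp
  interpret A: plain_group ?A using group_Aut_T_loc[OF SD] by (simp add: plain_group_def)
  have cA: "carrier ?A \<subseteq> thom T ?S ?S" using Aut_T_loc_carrier[OF SD] thom_T_self[OF SD] by simp
  have finA: "finite (carrier ?A)" using finite_mor_T finite_subset[OF cA] by (simp add: thom_def)
  have normS: "g \<in> pnormalizer L ?S" if "g \<in> ?S" for g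
    using carries_self[OF SD that] by (auto simp: pnormalizer_def carries_def)
  have "(\<lambda>g. (g, ?S, ?S)) \<in> hom S ?A"
    using normS by (auto simp: hom_def Aut_T_loc_carrier[OF SD] Aut_T_mult_eq S_mult)
  then interpret h: group_hom S ?A "\<lambda>g. (g, ?S, ?S)"
    by (simp add: group_hom_def group_hom_axioms_def S.is_group A.is_group)
  have Us: "subgroup ?U ?A" using h.subgroup_img_is_subgroup[OF S.subgroup_self] .
  have cU: "card ?U = card ?S" by (intro card_image inj_onI) simp
  obtain n where n: "card ?S = p ^ n" using S_p_group by (auto simp: finite_p_group_def order_def)
  obtain H m where H: "subgroup H ?A" "card H = p ^ m" "?U \<subset> H"
    using A.p_subgroup_grows[OF prime_p finA Us trans[OF cU n] ns] by blast
  define K where "K = fst ` H"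
  have HA: "x \<in> carrier ?A" if "x \<in> H" for x using subgroup.mem_carrier[OF H(1) that] .
  have Hform: "x = (fst x, ?S, ?S)" "fst x \<in> pnormalizer L ?S" if "x \<in> H" for x
    using HA[OF that] unfolding Aut_T_loc_carrier[OF SD] by auto
  have KH: "f \<in> K \<longleftrightarrow> (f, ?S, ?S) \<in> H" for f
  proof
    assume "f \<in> K"
    then obtain x where x: "x \<in> H" "f = fst x" by (auto simp: K_def)
    then show "(f, ?S, ?S) \<in> H" using Hform(1)[OF x(1)] by simp
  next
    assume "(f, ?S, ?S) \<in> H"
    then show "f \<in> K" unfolding K_def by (rule rev_image_eqI) simp
  qed
  have Kn: "f \<in> pnormalizer L ?S" if "f \<in> K" for f using that Hform(2) by (auto simp: K_def)
  have Ka: "carries f ?S" "pconj L f ` ?S = ?S" if "f \<in> K" for f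
    using Kn[OF that] SD by (auto simp: carries_def pnormalizer_def)
  have Kw: "chain L \<Delta> ?S w" if "set w \<subseteq> K" for w
    using that by (induction w) (use Ka SD in \<open>auto simp: chain_carries_iff simp del: chain.simps(2)\<close>)
  have Kdom: "w \<in> pdom L" if "set w \<subseteq> K" for w using Kw[OF that] chain_dom by blast
  have Km: "pprod L [f, g] \<in> K" if "f \<in> K" "g \<in> K" for f g
    using subgroup.m_closed[OF H(1), of "(f, ?S, ?S)" "(g, ?S, ?S)"] that by (simp add: KH Aut_T_mult_eq)
  have K1: "pone \<in> K" using subgroup.one_closed[OF H(1)] by (simp add: KH Aut_T_mult_eq)
  have Kp: "pprod L w \<in> K" if "set w \<subseteq> K" for w
    using that
  proof (induction w)
    case (Cons f w)
    have "pprod L (f # w) = pprod L [f, pprod L w]"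
      using prod_append[of "[f]" w "[]"] Kdom[OF Cons.prems] by simp
    then show ?case using Cons Km by simp
  qed (use K1 in simp)
  have Ki: "pinv L f \<in> K" if "f \<in> K" for f
  proof -
    have fH: "(f, ?S, ?S) \<in> H" using that KH by simp
    have "inv\<^bsub>?A\<^esub> (f, ?S, ?S) \<in> H" using subgroup.m_inv_closed[OF H(1) fH] .
    then obtain g where g: "inv\<^bsub>?A\<^esub> (f, ?S, ?S) = (g, ?S, ?S)" "g \<in> K" using Hform(1) KH by metis
    have "(f, ?S, ?S) \<otimes>\<^bsub>?A\<^esub> (g, ?S, ?S) = \<one>\<^bsub>?A\<^esub>" using A.r_inv[OF HA[OF fH]] g(1) by simp
    then have "pprod L [f, g] = pone" by (simp add: Aut_T_mult_eq)
    then have "g = pinv L f" using prod_inverse_unique Kdom[of "[f, g]"] that g(2) by simp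
    then show ?thesis using g(2) by simp
  qed
  have Kc: "K \<subseteq> pcarrier L" using Kn by (auto simp: pnormalizer_def)
  have sub: "pgrp_subgroup L K"
    unfolding pgrp_subgroup_def partial_subgroup_def using Kc Ki Kp Kdom by (auto simp: lists_eq_set)
  have bij: "bij_betw fst (carrier (subgrp ?A H)) (carrier (induced_group L K))"
    using Hform(1) by (auto simp: bij_betw_def K_def inj_on_def) (metis fst_conv)+
  have "group (induced_group L K)"
  proof (rule group_transport(1)[OF A.group_subgrp[OF H(1)] bij])
    show "fst (x \<otimes>\<^bsub>subgrp ?A H\<^esub> y) = fst x \<otimes>\<^bsub>induced_group L K\<^esub> fst y"
      if "x \<in> carrier (subgrp ?A H)" "y \<in> carrier (subgrp ?A H)" for x y
      using that Hform(1)[of x] Hform(1)[of y] transporter_of_locality_simps(3)[of L \<Delta> "fst x" ?S ?S "fst y" ?S ?S]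
      by (simp add: Aut_T_mult_eq)
  qed (simp add: Aut_T_mult_eq)
  moreover have "card K = card H" using bij_betw_same_card[OF bij] by simp
  moreover have "finite K" using Kc finite_pcarrier finite_subset by blast
  ultimately have "pgrp_p_subgroup p L K"
    unfolding pgrp_p_subgroup_def finite_p_group_def using sub H(2) by (auto simp: order_def)
  moreover have "?S \<subseteq> K" using H(3) KH by blast
  ultimately have "K = ?S" using S_maximal by blast
  then have "card H = card ?U" using \<open>card K = card H\<close> cU by simp
  moreover have "finite H" using finA HA by (meson finite_subset subsetI)
  ultimately show False using H(3) by (metis psubset_card_mono less_irrefl)
qed

text \<open>As \<open>h \<in> P'\<close> normalizes \<open>P\<close>, the word \<open>(f\<^sup>-\<^sup>1, h, f)\<close> lies in the domain: it leads from \<open>Q\<close> through \<open>P\<close>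
  and \<open>P\<close> to \<open>Q\<close>. By hypothesis its product is in \<open>Q'\<close>, so \<open>f\<close> itself conjugates \<open>P'\<close> into \<open>Q'\<close>.\<close>

lemma T_extension:
  assumes inv: "inverse_pair T P Q \<phi> \<psi>"
    and P': "subgroup P' S" "P \<lhd> subgrp S P'" and Q': "subgroup Q' S" "Q \<lhd> subgrp S Q'"
    and conj: "\<forall>g\<in>P'. tcomp T \<psi> (tcomp T (eps T P P g) \<phi>) \<in> eps T Q Q ` Q'"
  shows "\<exists>\<theta> \<in> thom T P' Q'. tcomp T (eps T P P' \<one>\<^bsub>S\<^esub>) \<theta> = tcomp T \<phi> (eps T Q Q' \<one>\<^bsub>S\<^esub>)"
proof -
  have ph: "\<phi> \<in> thom T P Q" "\<psi> \<in> thom T Q P" using inv by (auto simp: inverse_pair_def)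
  obtain f where f: "\<phi> = (f, P, Q)" "carries f P" "P \<in> \<Delta>" "Q \<in> \<Delta>" "pconj L f ` P \<subseteq> Q" "f \<in> pcarrier L"
    using ph(1) by (rule thomE)
  obtain g where g: "\<psi> = (g, Q, P)" "carries g Q" "pconj L g ` Q \<subseteq> P" using ph(2) by (rule thomE)
  have c: "[f, g] \<in> pdom L" using carries_comp_le(1)[OF f(2,5) g(2)] .
  have "pprod L [f, g] = pone" using inv f g by (simp add: inverse_pair_def)
  then have gf: "g = pinv L f" using prod_inverse_unique[OF c] by blast
  have sub: "P \<subseteq> P'" "Q \<subseteq> Q'"
    using P' Q' normal_imp_subgroup subgroup.subset by (metis subgrp_simps(1))+
  have P'D: "P' \<in> \<Delta>" and Q'D: "Q' \<in> \<Delta>" using Delta_overgroups f P' Q' sub by auto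
  have mem: "h \<in> conj_dom L f \<and> pconj L f h \<in> Q'" if h: "h \<in> P'" for h
  proof -
    have hS: "h \<in> carrier S" using h P' subgroup.mem_carrier by metis
    interpret P': plain_group "subgrp S P'" using S.group_subgrp[OF P'(1)] by (simp add: plain_group_def)
    have hP: "pconj L h ` P \<subseteq> P"
      using P'(2) h S_conj(2)[OF hS] subgroup.mem_carrier[OF Delta_subgroups[OF f(3)]] S.conj_by_subgrp[OF P'(1) h]
      unfolding P'.normal_iff_conj_by by auto
    have ah: "carries h P" using carries_S[OF f(3) hS] .
    have gi: "carries g Q" "carries h (pconj L g ` Q)" using g(2) carries_subset[OF ah carries_image[OF g(2)] g(3)] by auto
    have "pconj L h ` pconj L g ` Q \<subseteq> P" using hP g(3) by blast
    then have fi: "carries f (pconj L h ` pconj L g ` Q)" using carries_subset[OF f(2) carries_image[OF gi(2)]] by blast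
    have "chain L \<Delta> Q [g, h, f]"
      using gi fi carries_image[OF fi] by (simp add: chain_carries_iff del: chain.simps(2))
    then have w: "[g, h, f] \<in> pdom L" by (rule chain_dom)
    have "pprod L [g, h, f] = pprod L [g, pprod L [h, f]]"
      using prod_append[of "[g]" "[h, f]" "[]"] w by simp
    moreover have "tcomp T \<psi> (tcomp T (eps T P P h) \<phi>) = (pprod L [g, pprod L [h, f]], Q, Q)" using f g by simp
    ultimately have "pprod L [g, h, f] \<in> Q'" using bspec[OF conj h] by auto
    then show ?thesis using w S_carrier[OF hS] unfolding gf by (simp add: conj_dom_def pconj_def)
  qed
  have "carries f P'" using mem f(6) P'D subgroup.mem_carrier[OF Q'(1)] by (auto simp: carries_def)
  then have "(f, P', Q') \<in> thom T P' Q'" using mem Q'D by (intro thomI) auto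
  moreover have "tcomp T (eps T P P' \<one>\<^bsub>S\<^esub>) (f, P', Q') = tcomp T \<phi> (eps T Q Q' \<one>\<^bsub>S\<^esub>)"
    using f prod_pone[OF f(6)] by (simp add: S_one)
  ultimately show ?thesis by blast
qed

lemma transporter_set_carries:
  assumes "P \<in> \<Delta>" "Q \<in> \<Delta>" "g \<in> transporter_set S P Q"
  shows "carries g P" "pconj L g ` P \<subseteq> Q" "g \<in> carrier S" "\<And>x. x \<in> P \<Longrightarrow> pconj L g x = conj_by S g x"
proof -
  show g: "g \<in> carrier S" using assms by (simp add: transporter_set_def)
  show "carries g P" using carries_S[OF assms(1) g] .
  show e: "pconj L g x = conj_by S g x" if "x \<in> P" for x
    using S_conj(2)[OF g] subsetD[OF Delta_carrier[OF assms(1)] that] by blast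
  show "pconj L g ` P \<subseteq> Q" using e assms(3) by (auto simp: transporter_set_def image_subset_iff)
qed

theorem transporter_system_of_locality: "transporter_system p S (fusion_of_locality L S) T"
proof (intro transporter_system.intro F_system transporter_system_axioms.intro)
  show "finite_p_group p S" by (rule S_p_group)
  show "ob T \<noteq> {}" using Delta_nonempty by simp
  show "subgroup P S" if "P \<in> ob T" for P using that Delta_subgroups by simp
  show "Q \<in> ob T" if "P \<in> ob T" "Q \<in> conjugates S (fusion_of_locality L S) P" for P Q
  proof -
    note prems = that
    from that have P: "P \<in> \<Delta>" by simp
    obtain f where "carries f P" "Q = (\<lambda>x\<in>P. pconj L f x) ` P"
      using prems(2) unfolding conjugates_def fusion_Delta[OF P] by (auto split: if_splits)
    then show ?thesis using carries_image by simp
  qed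
  show "Q \<in> ob T" if "P \<in> ob T" "subgroup Q S" "P \<subseteq> Q" for P Q using that Delta_overgroups by simp
  show "finite (mor T)" by (rule finite_mor_T)
  show "src T \<phi> \<in> ob T \<and> tgt T \<phi> \<in> ob T" if "\<phi> \<in> mor T" for \<phi>
    using that by (auto simp: transporter_of_locality_def)
  show "tid T P \<in> thom T P P" if "P \<in> ob T" for P using that T_tid_in by simp
  show "tcomp T \<phi> \<psi> \<in> thom T P R" if "\<phi> \<in> thom T P Q" "\<psi> \<in> thom T Q R" for P Q R \<phi> \<psi>
    using that by (rule T_tcomp_in)
  show "tcomp T (tid T P) \<phi> = \<phi> \<and> tcomp T \<phi> (tid T Q) = \<phi>" if "\<phi> \<in> thom T P Q" for P Q \<phi>
    using that by (rule T_tcomp_tid)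
  show "tcomp T (tcomp T \<phi> \<psi>) \<chi> = tcomp T \<phi> (tcomp T \<psi> \<chi>)"
    if "\<phi> \<in> thom T P Q" "\<psi> \<in> thom T Q R" "\<chi> \<in> thom T R U" for P Q R U \<phi> \<psi> \<chi>
    using that by (rule T_tcomp_assoc)
  show "eps T P Q g \<in> thom T P Q" if "P \<in> ob T" "Q \<in> ob T" "g \<in> transporter_set S P Q" for P Q g
    using that transporter_set_carries[of P Q g] thomI[of g P Q] by simp
  show "eps T P P \<one>\<^bsub>S\<^esub> = tid T P" if "P \<in> ob T" for P by (simp add: S_one)
  show "eps T P R (g \<otimes>\<^bsub>S\<^esub> h) = tcomp T (eps T P Q g) (eps T Q R h)"
    if "g \<in> transporter_set S P Q" "h \<in> transporter_set S Q R" for P Q R g h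
    using that S_mult by (simp add: transporter_set_def)
  show "rho T \<phi> \<in> fusion_of_locality L S P Q" if "\<phi> \<in> thom T P Q" for P Q \<phi>
    using that
  proof (rule thomE)
    fix f assume f: "\<phi> = (f, P, Q)" "carries f P" "P \<in> \<Delta>" "Q \<in> \<Delta>" "pconj L f ` P \<subseteq> Q"
    then show ?thesis unfolding fusion_Delta[OF f(3)] using Delta_subgroups by auto
  qed
  show "rho T (tid T P) = (\<lambda>x\<in>P. x)" if "P \<in> ob T" for P
    using that carries_one[of P] by (auto intro: restrict_ext)
  show "rho T (tcomp T \<phi> \<psi>) = compose P (rho T \<psi>) (rho T \<phi>)"
    if "\<phi> \<in> thom T P Q" "\<psi> \<in> thom T Q R" for P Q R \<phi> \<psi>
  proof -
    note prems = that
    obtain f g where f: "\<phi> = (f, P, Q)" "carries f P" "pconj L f ` P \<subseteq> Q"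
      and g: "\<psi> = (g, Q, R)" "carries g Q" using \<open>\<phi> \<in> thom T P Q\<close> \<open>\<psi> \<in> thom T Q R\<close> by (meson thomE)
    show ?thesis using carries_comp_le(3)[OF f(2,3) g(2)] f g by (auto simp: compose_def intro!: restrict_ext)
  qed
  show "e = tid T P" if "e \<in> E_T T P" "\<phi> \<in> thom T P Q" "tcomp T e \<phi> = \<phi>" for P Q e \<phi>
  proof -
    note prems = that
    obtain f where f: "\<phi> = (f, P, Q)" "carries f P" "P \<in> \<Delta>" "f \<in> pcarrier L" using prems(2) by (rule thomE)
    obtain c where c: "e = (c, P, P)" "c \<in> pcentralizer L P" using \<open>e \<in> E_T T P\<close> E_T_loc[OF f(3)] by auto
    have "carries c P" "pconj L c ` P \<subseteq> P" "c \<in> pcarrier L" using c(2) f(3) Delta_carrier[OF f(3)] by (auto simp: pcentralizer_def carries_def)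
    then have d: "[c, f] \<in> pdom L" using carries_comp_le(1) f(2) by blast
    have "pprod L [c, f] = f" using \<open>tcomp T e \<phi> = \<phi>\<close> f(1) c(1) by simp
    then have "pprod L [f, pinv L f] = pprod L [c, f, pinv L f]"
      using prod_append[of "[]" "[c, f]" "[pinv L f]"] append_winv(1)[of "[c]" "[f]"] d by simp
    also have "\<dots> = c" using append_winv(2)[of "[c]" "[f]"] d prod_singleton[OF \<open>c \<in> pcarrier L\<close>] by simp
    finally have "c = pone" using dom_mult_winv[OF dom_singleton[OF f(4)]] by simp
    then show ?thesis using c by simp
  qed
  show "rho T ` thom T P Q = fusion_of_locality L S P Q" if "P \<in> ob T" "Q \<in> ob T" for P Q
  proof -
    have PQ: "P \<in> \<Delta>" "Q \<in> \<Delta>" using that by auto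
    have "thom T P Q = (\<lambda>f. (f, P, Q)) ` {f. carries f P \<and> pconj L f ` P \<subseteq> Q}"
      using PQ by (auto simp: thom_T_iff)
    then show ?thesis unfolding fusion_Delta[OF PQ(1)] using Delta_subgroups[OF PQ(2)] by (auto simp: image_image)
  qed
  show "rho T \<phi> = rho T \<psi> \<longleftrightarrow> (\<exists>e \<in> E_T T P. \<psi> = tcomp T e \<phi>)"
    if "\<phi> \<in> thom T P Q" "\<psi> \<in> thom T P Q" for P Q \<phi> \<psi>
  proof -
    note prems = that
    obtain f where f: "\<phi> = (f, P, Q)" "carries f P" "P \<in> \<Delta>" "f \<in> pcarrier L" "pconj L f ` P \<subseteq> Q" using prems(1) by (rule thomE)
    obtain g where g: "\<psi> = (g, P, Q)" "carries g P" "g \<in> pcarrier L" using prems(2) by (rule thomE)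
    have req: "rho T \<phi> = rho T \<psi> \<longleftrightarrow> (\<forall>x\<in>P. pconj L f x = pconj L g x)"
      using f g by (auto simp: restrict_def fun_eq_iff)
    show ?thesis unfolding req
    proof
      assume e: "\<forall>x\<in>P. pconj L f x = pconj L g x"
      then have im: "pconj L g ` P = pconj L f ` P" by (intro image_cong) auto
      have i: "carries (pinv L f) (pconj L g ` P)" using carries_inv[OF f(2)] im by simp
      note c = carries_comp[OF g(2) i]
      have fx: "pconj L (pprod L [g, pinv L f]) x = x" if "x \<in> P" for x
        using c(3)[OF that] e that conj_inverse(2)[OF f(4), of x] f(2) by (auto simp: carries_def)
      then have "pprod L [g, pinv L f] \<in> pcentralizer L P"
        using c(2) by (auto simp: pcentralizer_def carries_def)
      then have E: "(pprod L [g, pinv L f], P, P) \<in> E_T T P" using E_T_loc[OF f(3)] by blast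
      have "[g] @ [pinv L f] \<in> pdom L" using c(1) by simp
      from append_winv[OF this] have "[g, pinv L f, f] \<in> pdom L" "pprod L [g, pinv L f, f] = g"
        using inv_inv[OF f(4)] prod_singleton[OF g(3)] by auto
      then have "pprod L [pprod L [g, pinv L f], f] = g"
        using prod_append[of "[]" "[g, pinv L f]" "[f]"] by simp
      then have "\<psi> = tcomp T (pprod L [g, pinv L f], P, P) \<phi>" using f g by simp
      then show "\<exists>e \<in> E_T T P. \<psi> = tcomp T e \<phi>" using E by blast
    next
      assume "\<exists>e \<in> E_T T P. \<psi> = tcomp T e \<phi>"
      then obtain c where c: "c \<in> pcentralizer L P" "g = pprod L [c, f]"
        using E_T_loc[OF f(3)] f g by auto
      have ca: "carries c P" "pconj L c ` P \<subseteq> P" "\<forall>x\<in>P. pconj L c x = x"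
        using c(1) f(3) Delta_carrier[OF f(3)] by (auto simp: pcentralizer_def carries_def)
      show "\<forall>x\<in>P. pconj L f x = pconj L g x" using carries_comp_le(3)[OF ca(1,2) f(2)] ca(3) c(2) by simp
    qed
  qed
  show "e = tid T Q" if "e \<in> E_T T Q" "\<phi> \<in> thom T P Q" "tcomp T \<phi> e = \<phi>" for P Q e \<phi>
  proof -
    note prems = that
    obtain f where f: "\<phi> = (f, P, Q)" "carries f P" "Q \<in> \<Delta>" "pconj L f ` P \<subseteq> Q" "f \<in> pcarrier L" using prems(2) by (rule thomE)
    obtain c where c: "e = (c, Q, Q)" "c \<in> pcentralizer L Q" using \<open>e \<in> E_T T Q\<close> E_T_loc[OF f(3)] by auto
    have ca: "carries c Q" "c \<in> pcarrier L" using c(2) f(3) Delta_carrier[OF f(3)] by (auto simp: pcentralizer_def carries_def)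
    then have d: "[f, c] \<in> pdom L" using carries_comp_le(1)[OF f(2,4)] by blast
    have "pprod L [f, c] = f" using \<open>tcomp T \<phi> e = \<phi>\<close> f(1) c(1) by simp
    then have "pprod L [pinv L f, f] = pprod L [pinv L f, f, c]"
      using prod_append[of "[pinv L f]" "[f, c]" "[]"] winv_append(1)[of "[f]" "[c]"] d by simp
    also have "\<dots> = c" using winv_append(2)[of "[f]" "[c]"] d prod_singleton[OF ca(2)] by simp
    finally have "c = pone" using prod_inv[OF dom_singleton[OF f(5)]] by simp
    then show ?thesis using c by simp
  qed
  show "inj_on (eps T P Q) (transporter_set S P Q)" for P Q by (auto intro: inj_onI)
  show "rho T (eps T P Q g) = conj_map S g P" if "P \<in> ob T" "Q \<in> ob T" "g \<in> transporter_set S P Q" for P Q g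
    using that transporter_set_carries(4)[of P Q g] by (auto simp: conj_map_def intro!: restrict_ext)
  show "tcomp T (eps T P P g) \<phi> = tcomp T \<phi> (eps T Q Q (rho T \<phi> g))"
    if "\<phi> \<in> thom T P Q" "g \<in> P" for P Q \<phi> g
  proof -
    note prems = that
    obtain f where f: "\<phi> = (f, P, Q)" "carries f P" "f \<in> pcarrier L" using prems(1) by (rule thomE)
    have "g \<in> conj_dom L f" using f(2) that(2) by (auto simp: carries_def)
    then show ?thesis using conj_inverse(6)[OF f(3)] f(1) that(2) by simp
  qed
  show "sylow_subgroup p (Aut_T T (carrier S)) (eps T (carrier S) (carrier S) ` carrier S)" by (rule eps_S_sylow)
qed (rule T_extension)

lemma fst_iso_Aut:
  assumes P: "P \<in> \<Delta>"
  shows "group (induced_group L (pnormalizer L P))" "fst \<in> iso (Aut_T T P) (induced_group L (pnormalizer L P))"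
proof -
  note cA = Aut_T_loc_carrier[OF P]
  have bij: "bij_betw fst (carrier (Aut_T T P)) (carrier (induced_group L (pnormalizer L P)))"
    unfolding cA by (auto simp: bij_betw_def inj_on_def image_image)
  have m: "fst (x \<otimes>\<^bsub>Aut_T T P\<^esub> y) = fst x \<otimes>\<^bsub>induced_group L (pnormalizer L P)\<^esub> fst y"
    if "x \<in> carrier (Aut_T T P)" "y \<in> carrier (Aut_T T P)" for x y
    using that unfolding cA by (auto simp: Aut_T_mult_eq)
  show "group (induced_group L (pnormalizer L P))" "fst \<in> iso (Aut_T T P) (induced_group L (pnormalizer L P))"
    using group_transport[OF group_Aut_T_loc[OF P] bij m] by (auto simp: Aut_T_mult_eq)
qed

lemma fst_iso_E:
  assumes P: "P \<in> \<Delta>" and E: "group (subgrp (Aut_T T P) (E_T T P))"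
  shows "group (induced_group L (pcentralizer L P))"
    "fst \<in> iso (subgrp (Aut_T T P) (E_T T P)) (induced_group L (pcentralizer L P))"
proof -
  note cE = E_T_loc[OF P]
  have bij: "bij_betw fst (carrier (subgrp (Aut_T T P) (E_T T P))) (carrier (induced_group L (pcentralizer L P)))"
    by (auto simp: cE bij_betw_def inj_on_def image_image)
  have m: "fst (x \<otimes>\<^bsub>subgrp (Aut_T T P) (E_T T P)\<^esub> y) = fst x \<otimes>\<^bsub>induced_group L (pcentralizer L P)\<^esub> fst y"
    if "x \<in> carrier (subgrp (Aut_T T P) (E_T T P))" "y \<in> carrier (subgrp (Aut_T T P) (E_T T P))" for x y
    using that by (auto simp: cE Aut_T_mult_eq)
  show "group (induced_group L (pcentralizer L P))"
    "fst \<in> iso (subgrp (Aut_T T P) (E_T T P)) (induced_group L (pcentralizer L P))"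
    using group_transport[OF E bij m] by (auto simp: Aut_T_mult_eq)
qed

sublocale A: prime_transporter_system p S "fusion_of_locality L S" T
  using transporter_system_of_locality prime_p
  by (simp add: prime_transporter_system_def prime_transporter_system_axioms_def)

lemma group_E_loc: "P \<in> \<Delta> \<Longrightarrow> group (subgrp (Aut_T T P) (E_T T P))"
  using A.group_E_T by (simp add: plain_group_def)

lemma characteristic_p_normalizer_iff:
  assumes P: "P \<in> \<Delta>"
  shows "characteristic_p p (induced_group L (pnormalizer L P)) \<longleftrightarrow> characteristic_p p (Aut_T T P)"
  using iso_characteristic_p[OF prime_p fst_iso_Aut[OF P]]
    iso_characteristic_p[OF prime_p group_Aut_T_loc[OF P] group.iso_set_sym[OF group_Aut_T_loc[OF P] fst_iso_Aut(2)[OF P]]]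
  by blast

lemma objective_char_iff:
  "locality_objective_char p L \<Delta> S \<longleftrightarrow> (\<forall>P\<in>ob T. characteristic_p p (Aut_T T P))"
  using characteristic_p_normalizer_iff locality_axioms by (simp add: locality_objective_char_def)

lemma card_pcentralizer: "P \<in> \<Delta> \<Longrightarrow> card (pcentralizer L P) = card (E_T T P)"
  unfolding E_T_loc by (rule card_image[symmetric]) (simp add: inj_on_def)

lemma p_group_pcentralizer_iff:
  assumes P: "P \<in> \<Delta>"
  shows "finite_p_group p (induced_group L (pcentralizer L P)) \<longleftrightarrow>
    finite_p_group p (subgrp (Aut_T T P) (E_T T P))"
proof -
  have "finite (pcentralizer L P)"
    using finite_subset[OF _ finite_pcarrier] by (auto simp: pcentralizer_def)
  then show ?thesis
    using A.finite_p_group_E_T_iff[of P] P fst_iso_E(1)[OF P group_E_loc[OF P]] card_pcentralizer[OF P]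
    by (simp add: finite_p_group_def order_def)
qed

lemma pcentralizer_subset_iff: "P \<in> \<Delta> \<Longrightarrow> pcentralizer L P \<subseteq> P \<longleftrightarrow> E_T T P \<subseteq> eps T P P ` P"
  by (auto simp: E_T_loc)

text \<open>The isomorphism between \<open>E(P)\<close> and \<open>C\<^sub>L(P)\<close> maps the complement found in \<open>E(P)\<close> to a normal complement
  of \<open>C\<^sub>S(P)\<close>, which has to be \<open>O\<^sub>p\<^sub>'(C\<^sub>L(P))\<close>.\<close>

theorem pcentralizer_factorization:
  assumes P: "P \<in> \<Delta>" and fn: "P \<in> fully_normalized S (fusion_of_locality L S)"
    and q: "P \<in> quasicentric S (fusion_of_locality L S)"
  shows "pcentralizer L P = centralizer S P <#>\<^bsub>induced_group L (pcentralizer L P)\<^esub>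
      O_p' p (induced_group L (pcentralizer L P))"
proof -
  let ?C = "induced_group L (pcentralizer L P)" and ?E = "subgrp (Aut_T T P) (E_T T P)"
  have Pob: "P \<in> ob T" using P by simp
  interpret C: plain_group ?C using fst_iso_E(1)[OF P group_E_loc[OF P]] by (simp add: plain_group_def)
  note iso = fst_iso_E(2)[OF P group_E_loc[OF P]]
  interpret h: group_hom ?E ?C fst
    using iso group_E_loc[OF P] C.is_group by (simp add: group_hom_def group_hom_axioms_def iso_def)
  have fin: "finite (carrier ?C)"
    using finite_subset[OF _ finite_pcarrier] by (auto simp: pcentralizer_def)
  obtain K where K: "K \<lhd> ?E" "coprime p (card K)" "eps T P P ` centralizer S P <#>\<^bsub>?E\<^esub> K = E_T T P"
    using A.quasicentric_complement[OF Pob fn q] by blast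
  note syl = A.sylow_E_T[OF Pob fn]
  have sub: "subgroup (eps T P P ` centralizer S P) ?E" using syl by (simp add: sylow_subgroup_def)
  have im: "fst ` eps T P P ` centralizer S P = centralizer S P" by (simp add: image_image)
  have Cs: "subgroup (centralizer S P) ?C" using h.subgroup_img_is_subgroup[OF sub] unfolding im .
  have cC: "\<exists>n. card (centralizer S P) = p ^ n"
    using A.card_subgroup_S A.subgroup_centralizer Delta_carrier[OF P] by blast
  have KN: "fst ` K \<lhd> ?C" using iso_normal_subgroup[OF iso group_E_loc[OF P] C.is_group K(1)] .
  have Kc: "K \<subseteq> carrier ?E" using K(1) normal_imp_subgroup subgroup.subset by blast
  have "inj_on fst (carrier ?E)" using iso by (simp add: iso_def bij_betw_def)
  then have "card (fst ` K) = card K" using Kc card_image inj_on_subset by blast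
  then have cK: "coprime p (card (fst ` K))" using K(2) by simp
  have "fst ` (eps T P P ` centralizer S P <#>\<^bsub>?E\<^esub> K) = fst ` eps T P P ` centralizer S P <#>\<^bsub>?C\<^esub> fst ` K"
    using set_mult_hom[OF h.homh subgroup.subset[OF sub] Kc] .
  then have fac: "centralizer S P <#>\<^bsub>?C\<^esub> fst ` K = carrier ?C"
    unfolding K(3) im using E_T_loc[OF P] by (simp add: image_image)
  obtain n where "card (centralizer S P) = p ^ n" using cC by blast
  then have "O_p' p ?C = fst ` K" using C.O_p'_eq_complement[OF prime_p fin Cs _ KN cK fac] by blast
  then show ?thesis using fac by simp
qed

theorem normalizer_model:
  assumes P: "P \<in> \<Delta>" and fn: "P \<in> fully_normalized S (fusion_of_locality L S)"
    and ch: "characteristic_p p (Aut_T T P)"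
  shows "model p (subgrp S (normalizer S P)) (normalizer_fusion S (fusion_of_locality L S) P)
    (induced_group L (pnormalizer L P))"
  using A.Aut_T_model[OF _ fn ch fst_iso_Aut[OF P]] P by simp

end

section \<open>Comparison of localities and transporter systems\<close>

theorem proposition1:
  fixes p :: nat
    and S :: "'a monoid"
    and F :: "'a fusion"
    and L :: "'a pgrp"
    and \<Delta> :: "'a set set"
    and T :: "('a, 'm) transporter"
  assumes "Factorial_Ring.prime p"
    and "finite_p_group p S"
    and "fusion_system S F"
    and "locality_over p F L \<Delta> S"
    and "transporter_system p S F T"
  shows
    "(linking_system p S F (transporter_of_locality L \<Delta>) \<longleftrightarrow> linking_locality p L \<Delta> S) \<and>
     (locality_objective_char p L \<Delta> S \<longrightarrow>
        \<Delta> \<subseteq> subcentric S F \<and>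
        (\<forall>P \<in> \<Delta> \<inter> fully_normalized S F.
           model p (subgrp S (normalizer S P)) (normalizer_fusion S F P)
             (induced_group L (pnormalizer L P)))) \<and>
     (transporter_objective_char p S F T \<longrightarrow>
        ob T \<subseteq> subcentric S F \<and>
        (\<forall>P \<in> ob T \<inter> fully_normalized S F.
           isomorphic_to_model p (subgrp S (normalizer S P)) (normalizer_fusion S F P)
             (Aut_T T P))) \<and>
     (\<Delta> \<subseteq> quasicentric S F \<longrightarrow>
        (\<forall>P \<in> \<Delta> \<inter> fully_normalized S F.
           pcentralizer L P =
             centralizer S P <#>\<^bsub>induced_group L (pcentralizer L P)\<^esub>
               O_p' p (induced_group L (pcentralizer L P))) \<and>
        (locality_objective_char p L \<Delta> S \<longleftrightarrow>
           (\<forall>P \<in> \<Delta>. finite_p_group p (induced_group L (pcentralizer L P))))) \<and>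
     (ob T \<subseteq> quasicentric S F \<longrightarrow>
        (linking_system p S F T \<longleftrightarrow> Oliver_linking_system p S F T)) \<and>
     (Oliver_linking_system p S F T \<longrightarrow> linking_system p S F T) \<and>
     (\<Delta> \<subseteq> centric S F \<longrightarrow>
        (locality_objective_char p L \<Delta> S \<longleftrightarrow> Chermak_linking_system p L \<Delta> S) \<and>
        (Chermak_linking_system p L \<Delta> S \<longleftrightarrow> (\<forall>P \<in> \<Delta>. pcentralizer L P \<subseteq> P))) \<and>
     (\<Delta> = centric S F \<longrightarrow>
        (linking_locality p L \<Delta> S \<longleftrightarrow> Chermak_centric_linking_system p F L \<Delta> S)) \<and>
     (ob T = centric S F \<longrightarrow>
        (linking_system p S F T \<longleftrightarrow> BLO_centric_linking_system p S F T))"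
proof -
  let ?T = "transporter_of_locality L \<Delta>"
  have loc: "locality p L \<Delta> S" and F: "F = fusion_of_locality L S"
    using assms(4) by (simp_all add: locality_over_def)
  interpret L: prime_locality p L \<Delta> S
    using loc assms(1-3) unfolding F by (simp add: prime_locality_def prime_locality_axioms_def)
  interpret T: prime_transporter_system p S F T
    using assms(1,5) by (simp add: prime_transporter_system_def prime_transporter_system_axioms_def)
  note obL = L.objective_char_iff
  have obT: "transporter_objective_char p S F T \<longleftrightarrow> (\<forall>P\<in>ob T. characteristic_p p (Aut_T T P))"
    using assms(5) by (simp add: transporter_objective_char_def)
  have obLT: "transporter_objective_char p S F ?T \<longleftrightarrow> (\<forall>P\<in>ob ?T. characteristic_p p (Aut_T ?T P))"
    using L.transporter_system_of_locality unfolding F transporter_objective_char_def by blast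
  have a: "linking_system p S F ?T \<longleftrightarrow> linking_locality p L \<Delta> S"
    unfolding linking_system_def linking_locality_def obL obLT F[symmetric] by simp
  have b1: "locality_objective_char p L \<Delta> S \<Longrightarrow> \<Delta> \<subseteq> subcentric S F \<and>
      (\<forall>P \<in> \<Delta> \<inter> fully_normalized S F.
        model p (subgrp S (normalizer S P)) (normalizer_fusion S F P) (induced_group L (pnormalizer L P)))"
    unfolding obL F using L.A.objective_char_subcentric L.normalizer_model by simp
  have b2: "transporter_objective_char p S F T \<Longrightarrow> ob T \<subseteq> subcentric S F \<and>
      (\<forall>P \<in> ob T \<inter> fully_normalized S F.
        isomorphic_to_model p (subgrp S (normalizer S P)) (normalizer_fusion S F P) (Aut_T T P))"
    unfolding obT using T.objective_char_subcentric T.Aut_T_isomorphic_to_model by simp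
  have c1: "\<Delta> \<subseteq> quasicentric S F \<Longrightarrow>
      (\<forall>P \<in> \<Delta> \<inter> fully_normalized S F. pcentralizer L P =
        centralizer S P <#>\<^bsub>induced_group L (pcentralizer L P)\<^esub> O_p' p (induced_group L (pcentralizer L P)))"
    unfolding F using L.pcentralizer_factorization by blast
  have c2: "\<Delta> \<subseteq> quasicentric S F \<Longrightarrow> locality_objective_char p L \<Delta> S \<longleftrightarrow>
      (\<forall>P \<in> \<Delta>. finite_p_group p (induced_group L (pcentralizer L P)))"
    unfolding obL F using L.A.objective_char_iff_quasicentric L.p_group_pcentralizer_iff by simp
  have c3: "ob T \<subseteq> quasicentric S F \<Longrightarrow> linking_system p S F T \<longleftrightarrow> Oliver_linking_system p S F T"
    unfolding linking_system_def Oliver_linking_system_def obT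
    using T.objective_char_iff_quasicentric assms(5) by blast
  have c4: "Oliver_linking_system p S F T \<Longrightarrow> linking_system p S F T"
    unfolding linking_system_def Oliver_linking_system_def obT
    using T.E_T_p_group_imp_char_p T.finite_p_group_E_T_iff by blast
  have d1: "\<Delta> \<subseteq> centric S F \<Longrightarrow> locality_objective_char p L \<Delta> S \<longleftrightarrow> (\<forall>P \<in> \<Delta>. pcentralizer L P \<subseteq> P)"
    unfolding obL F using L.A.objective_char_iff_centric L.pcentralizer_subset_iff by simp
  have d2: "Chermak_linking_system p L \<Delta> S \<longleftrightarrow> (\<forall>P \<in> \<Delta>. pcentralizer L P \<subseteq> P)"
    using loc by (simp add: Chermak_linking_system_def)
  have d3: "linking_locality p L \<Delta> S \<longleftrightarrow> Chermak_centric_linking_system p F L \<Delta> S" if "\<Delta> = centric S F"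
  proof -
    have "centric_radical p S F \<subseteq> \<Delta>" using that by (simp add: centric_radical_def)
    then show ?thesis
      using d1 that assms(4)
      by (simp add: linking_locality_def Chermak_centric_linking_system_def F[symmetric])
  qed
  have d4: "linking_system p S F T \<longleftrightarrow> BLO_centric_linking_system p S F T" if "ob T = centric S F"
  proof -
    have "centric_radical p S F \<subseteq> ob T" using that by (simp add: centric_radical_def)
    then show ?thesis
      using T.objective_char_iff_centric T.E_T_eq_center_iff that assms(5)
      by (simp add: linking_system_def BLO_centric_linking_system_def obT)
  qed
  show ?thesis
    by (intro conjI[OF a conjI[OF impI[OF b1] conjI[OF impI[OF b2] conjI[OF impI[OF conjI[OF c1 c2]]
          conjI[OF impI[OF c3] conjI[OF impI[OF c4] conjI[OF impI[OF conjI[OF d1[folded d2] d2]]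
          conjI[OF impI[OF d3] impI[OF d4]]]]]]]]])
qed

end
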